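(* Let $p$ be an odd prime and let $C$ and $D$ be self-orthogonal codes of length $k$ over $\mathbb{F}_p$. Then $L_B(C)\cong L_B(D)$ as lattices if and only if $C\cong D$ as codes.
   Context: A code of length $k$ over $\mathbb{F}_p$ is a subspace of $\mathbb{F}_p^k$, with the standard dot product; $C^\perp$ is the dual code and $C$ is self-orthogonal if $C\subset C^\perp$. Codes $C,D$ are isomorphic if $f(C)=D$ for some $f$ in the group generated by coordinate permutations and sign changes of single coordinates. For $n\ge2$, $A_{n-1}=\{x\in\mathbb{Z}^n:\sum_ix_i=0\}$ with the standard inner product, $e_i$ the standard basis, $\alpha_i=e_i-e_{i+1}$, $\varepsilon_1=e_1-\frac1n\sum_je_j$, and $A_{n-1}^*/A_{n-1}=\langle\varepsilon_1+A_{n-1}\rangle\cong\mathbb{Z}/n$. Identify $\mathbb{F}_p^k$ with $(A_{p-1}^*/A_{p-1})^k$ via $a\mapsto(a_i\varepsilon_1+A_{p-1})_i$, let $\pi:(A_{p-1}^* )^k\to(A_{p-1}^*/A_{p-1})^k$ be the quotient map, and set $L_A(C)=\pi^{-1}(C)\subset\mathbb{R}^{pk}$. Let $\rho_\Delta=\frac12\sum_{1\le i<j\le p}(e_i-e_j)\in\mathbb{R}^p$ and $\chi_\Delta=\frac1p(\rho_\Delta,\dots,\rho_\Delta)\in\mathbb{R}^{pk}$. Construction B: $L_B(C)=\{x\in L_A(C):(x,\chi_\Delta)\in\mathbb{Z}\}$. *)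

theory Defs
  imports "HOL-Analysis.Analysis" "Berlekamp_Zassenhaus.Finite_Field"
begin

text \<open>
  The field with \<open>p\<close> elements is \<^typ>\<open>'p::prime_card mod_ring\<close> with \<open>p = CARD('p)\<close>.
  The coordinates of \<open>\<real>\<^sup>p\<close> are indexed by the same type \<open>'p\<close>; its linear order plays the
  role of the usual order on \<open>1, \<dots>, p\<close>.  The space \<open>\<real>\<^sup>p\<^sup>k\<close> is \<^typ>\<open>real ^ 'p ^ 'k\<close>, that is,
  \<open>k\<close>-tuples of vectors of \<open>\<real>\<^sup>p\<close>, whose library inner product is the standard one.
\<close>

subsection \<open>Codes\<close>

definition is_code :: "('a::field ^ 'k) set \<Rightarrow> bool" where
  "is_code C \<longleftrightarrow> vec.subspace C"

definition dual_code :: "('a::field ^ 'k) set \<Rightarrow> ('a ^ 'k) set" where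
  "dual_code C = {x. \<forall>c\<in>C. (\<Sum>i\<in>UNIV. x $ i * c $ i) = 0}"

definition self_orthogonal :: "('a::field ^ 'k) set \<Rightarrow> bool" where
  "self_orthogonal C \<longleftrightarrow> C \<subseteq> dual_code C"

definition permute_coords :: "('k \<Rightarrow> 'k) \<Rightarrow> 'a ^ 'k \<Rightarrow> 'a ^ 'k" where
  "permute_coords \<sigma> x = (\<chi> i. x $ \<sigma> i)"

definition flip_sign :: "'k \<Rightarrow> 'a::field ^ 'k \<Rightarrow> 'a ^ 'k" where
  "flip_sign j x = (\<chi> i. if i = j then - (x $ i) else x $ i)"

inductive_set code_group :: "('a::field ^ 'k \<Rightarrow> 'a ^ 'k) set" where
  one: "id \<in> code_group"
| perm: "bij \<sigma> \<Longrightarrow> permute_coords \<sigma> \<in> code_group"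
| flip: "flip_sign j \<in> code_group"
| comp: "f \<in> code_group \<Longrightarrow> g \<in> code_group \<Longrightarrow> f \<circ> g \<in> code_group"
| inv: "f \<in> code_group \<Longrightarrow> inv_into UNIV f \<in> code_group"

definition code_isomorphic :: "('a::field ^ 'k) set \<Rightarrow> ('a ^ 'k) set \<Rightarrow> bool" where
  "code_isomorphic C D \<longleftrightarrow> (\<exists>f\<in>code_group. f ` C = D)"

subsection \<open>Lattices\<close>

definition dual_lattice :: "'v::euclidean_space set \<Rightarrow> 'v set" where
  "dual_lattice L = {x \<in> span L. \<forall>y\<in>L. x \<bullet> y \<in> \<int>}"

definition lattice_isomorphic :: "'v::euclidean_space set \<Rightarrow> 'w::euclidean_space set \<Rightarrow> bool" where
  "lattice_isomorphic L M \<longleftrightarrow>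
    (\<exists>f. bij_betw f L M \<and> (\<forall>x\<in>L. \<forall>y\<in>L. f (x + y) = f x + f y)
                        \<and> (\<forall>x\<in>L. \<forall>y\<in>L. f x \<bullet> f y = x \<bullet> y))"

text \<open>With \<open>n = CARD('n)\<close> this is the root lattice of type \<open>A\<close> and rank \<open>n - 1\<close>.\<close>

definition A_lattice :: "(real ^ 'n) set" where
  "A_lattice = {x. (\<forall>i. x $ i \<in> \<int>) \<and> (\<Sum>i\<in>UNIV. x $ i) = 0}"

definition eps1 :: "real ^ 'n::{finite,linorder}" where
  "eps1 = axis (Min UNIV) 1 - (1 / real CARD('n)) *\<^sub>R (\<Sum>j\<in>UNIV. axis j 1)"

subsection \<open>Constructions A and B\<close>

definition A_coset :: "real ^ 'n \<Rightarrow> (real ^ 'n) set" where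
  "A_coset x = (\<lambda>y. x + y) ` A_lattice"

definition A_quot :: "real ^ 'n ^ 'k \<Rightarrow> (real ^ 'n) set ^ 'k" where
  "A_quot x = (\<chi> i. A_coset (x $ i))"

text \<open>
  \<^const>\<open>to_int_mod_ring\<close> picks the representative in \<open>{0..<p}\<close>; any other one gives the same
  coset, because \<open>p\<close> times \<^const>\<open>eps1\<close> lies in \<^const>\<open>A_lattice\<close>.
\<close>

definition code_embed ::
    "('p::{prime_card,linorder}) mod_ring ^ 'k \<Rightarrow> (real ^ 'p::{prime_card,linorder}) set ^ 'k" where
  "code_embed a = (\<chi> i. A_coset (real_of_int (to_int_mod_ring (a $ i)) *\<^sub>R eps1))"

definition L_A :: "(('p::{prime_card,linorder}) mod_ring ^ 'k) set
    \<Rightarrow> (real ^ 'p::{prime_card,linorder} ^ 'k) set" where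
  "L_A C = {x. (\<forall>i. x $ i \<in> dual_lattice A_lattice) \<and> A_quot x \<in> code_embed ` C}"

definition rho_Delta :: "real ^ 'p::{finite,linorder}" where
  "rho_Delta = (1 / 2) *\<^sub>R (\<Sum>(i, j)\<in>{(i, j). i < j}. axis i 1 - axis j 1)"

definition chi_Delta :: "real ^ 'p::{finite,linorder} ^ 'k" where
  "chi_Delta = (1 / real CARD('p)) *\<^sub>R (\<chi> i. rho_Delta)"

definition L_B :: "(('p::{prime_card,linorder}) mod_ring ^ 'k) set
    \<Rightarrow> (real ^ 'p::{prime_card,linorder} ^ 'k) set" where
  "L_B C = {x \<in> L_A C. x \<bullet> chi_Delta \<in> \<int>}"

end

theory Submission
  imports Defs
begin

text \<open>In coordinates, \<open>L_B C\<close> consists of the vectors \<open>x\<close> in a power of the dual root lattice whose glue word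
  \<open>word x\<close> lies in \<open>C\<close> and for which \<open>phi x\<close> is divisible by \<open>p\<close>. Isomorphic codes give isometric lattices
  because negating a coordinate of the code corresponds to negating and reversing a block. Conversely, an
  isometry \<open>W\<close> from \<open>L_B D\<close> to \<open>L_B C\<close> extends linearly, and the inner products of the images of the cyclic
  roots \<open>e_a - e_{a+1}\<close> with the cyclic roots are all congruent modulo the integers.

  If these products are integers, \<open>W\<close> maps root lattice blocks into the dual lattice. The words arising in this way
  form a self-orthogonal code whose words of minimal norm group the coordinates into classes of size at most four; \<open>W\<close>
  matches these classes, and on each class the codes have an explicit normal form, from which a signed
  permutation is read off.

  Otherwise \<open>p W r\<close> is, for every cyclic root \<open>r\<close>, an integer vector of norm \<open>2 p^2\<close> whose entries in each block
  are distinct modulo \<open>p\<close>. This bounds the length: it is at most \<open>2\<close> for \<open>p \<ge> 11\<close>, \<open>3\<close> for \<open>p = 7\<close>,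
  \<open>5\<close> for \<open>p = 5\<close>, and it is \<open>3\<close>, \<open>6\<close> or \<open>9\<close> for \<open>p = 3\<close>. The codes in question are classified directly,
  using that a proper subcode has fewer short vectors and that norm \<open>2\<close> vectors correspond to root words.\<close>

subsection \<open>Coordinates\<close>

text \<open>Why cyclic roots: a root e_a - e_b has word 0, but its \<open>phi\<close> is the
  difference of two positions, so it is never in \<open>L_B C\<close>, while its multiple by p is.
  All cyclic roots have \<open>phi\<close> congruent to -1 modulo p, also at the wrap-around. Hence
  the difference of any two of them lies in \<open>L_B\<close> of every code. Its image pairs
  integrally with roots, which makes all products congruent and leaves exactly two cases.

  In the integral case the words of the images of root vectors need not lie in C. They lie in C plus
  one line, so C has index 1 or p in the code that they generate together with C. For index p, a
  functional vanishing on C has to be preserved by the matching of classes; this is why the normal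
  forms of the classes carry a functional.

  In the other case, p integers distinct modulo p have squares summing to at least p (p^2 - 1) / 12.
  Since k such blocks share the norm 2 p^2, it follows that k <= 24 p / (p^2 - 1). Equality occurs
  for p = 5, k = 5 and p = 3, k = 9; there the entries of every block are exactly the balanced
  residues, and the code has at least k p words.\<close>

definition idx :: "'n::{finite,linorder} \<Rightarrow> nat" where
  "idx a = card {b. b < a}"

lemma idx_less_iff: "idx a < idx b \<longleftrightarrow> a < b"
proof -
  have m: "idx a < idx b" if "a < b" for a b :: 'a
  proof -
    have "{c. c < a} \<subset> {c. c < b}" using that by auto
    then show ?thesis unfolding idx_def by (intro psubset_card_mono) auto
  qed
  show ?thesis using m[of a b] m[of b a] by (metis less_asym less_linear)
qed

lemma inj_idx: "inj idx"
  by (rule injI) (metis idx_less_iff less_irrefl linorder_less_linear)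

lemma idx_less: "idx (a :: 'n::{finite,linorder}) < CARD('n)"
proof -
  have "{b. b < a} \<subset> UNIV" by auto
  then show ?thesis unfolding idx_def by (intro psubset_card_mono) auto
qed

lemma bij_idx: "bij_betw (idx :: 'n::{finite,linorder} \<Rightarrow> nat) UNIV {..<CARD('n)}"
proof -
  have "idx ` (UNIV :: 'n set) = {..<CARD('n)}"
    by (rule card_subset_eq) (auto simp: idx_less card_image inj_idx)
  then show ?thesis using inj_idx by (auto simp: bij_betw_def)
qed

lemma ex_idx: "m < CARD('n) \<Longrightarrow> \<exists>a::'n::{finite,linorder}. idx a = m"
  using bij_idx[where 'n='n] unfolding bij_betw_def by (metis imageE lessThan_iff)

lemma sum_idx: "(\<Sum>a\<in>UNIV. f (idx (a :: 'n::{finite,linorder}))) = (\<Sum>m<CARD('n). f m)"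
  by (rule sum.reindex_bij_betw[OF bij_idx])

lemma sum_idx_real:
  "(\<Sum>a\<in>UNIV. real (idx (a :: 'n::{finite,linorder}))) = real CARD('n) * (real CARD('n) - 1) / 2"
proof -
  have "(\<Sum>m<n. real m) = real n * (real n - 1) / 2" for n
    by (induction n) (auto simp: field_simps)
  then show ?thesis by (simp add: sum_idx[of real])
qed

text \<open>Cyclic successor. The roots e_a - e_(nxt a) of a block are the nodes of the affine
  diagram of type A: the simple roots and minus the highest root.\<close>

definition nxt :: "'n::{finite,linorder} \<Rightarrow> 'n" where
  "nxt a = (SOME b. idx b = (idx a + 1) mod CARD('n))"

lemma idx_nxt: "idx (nxt (a :: 'n::{finite,linorder})) = (idx a + 1) mod CARD('n)"
  unfolding nxt_def by (rule someI_ex) (simp add: ex_idx)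

lemma inj_nxt: "inj (nxt :: 'n::{finite,linorder} \<Rightarrow> 'n)"
proof (rule injI)
  fix a b :: 'n assume "nxt a = nxt b"
  then have "(idx a + 1) mod CARD('n) = (idx b + 1) mod CARD('n)" by (metis idx_nxt)
  then have "idx a = idx b"
    using idx_less[of a] idx_less[of b]
    by (cases "idx a + 1 = CARD('n)"; cases "idx b + 1 = CARD('n)") auto
  then show "a = b" by (rule injD[OF inj_idx])
qed

definition rev_idx :: "'n::{finite,linorder} \<Rightarrow> 'n" where
  "rev_idx a = (SOME b. idx b = CARD('n) - 1 - idx a)"

lemma idx_rev: "idx (rev_idx (a :: 'n::{finite,linorder})) = CARD('n) - 1 - idx a"
  unfolding rev_idx_def by (rule someI_ex) (simp add: ex_idx)

lemma rev_idx_rev_idx: "rev_idx (rev_idx a) = a"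
proof -
  have "idx (rev_idx (rev_idx a)) = idx a" using idx_less[of a] by (simp add: idx_rev)
  then show ?thesis by (rule injD[OF inj_idx])
qed

lemma bij_rev_idx: "bij rev_idx"
  by (rule o_bij[of rev_idx]) (auto simp: fun_eq_iff rev_idx_rev_idx)

lemma inner_blocks: "(x :: real ^ 'n ^ 'k) \<bullet> y = (\<Sum>i\<in>UNIV. \<Sum>a\<in>UNIV. x$i$a * y$i$a)"
  by (simp add: inner_vec_def)

lemma of_int_mod_ring_eq_iff:
  "(of_int m :: 'p::prime_card mod_ring) = of_int n \<longleftrightarrow> int CARD('p) dvd m - n"
proof -
  have "(of_int m :: 'p mod_ring) = of_int n \<longleftrightarrow> (of_int (m - n) :: 'p mod_ring) = 0" by simp
  also have "\<dots> \<longleftrightarrow> int CARD('p) dvd m - n"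
    by (simp only: of_int_eq_0_iff_char_dvd) simp
  finally show ?thesis .
qed

lemma of_int_mod_ring_eq_0_iff:
  "(of_int m :: 'p::prime_card mod_ring) = 0 \<longleftrightarrow> int CARD('p) dvd m"
  using of_int_mod_ring_eq_iff[of m 0] by simp

lemma to_int_mod_ring_bounds:
  "0 \<le> to_int_mod_ring (x :: 'p::prime_card mod_ring)" "to_int_mod_ring (x :: 'p mod_ring) < int CARD('p)"
  using range_to_int_mod_ring[where 'a='p] by auto

lemma of_int_to_int_mod_ring: "of_int (to_int_mod_ring (x :: 'p::prime_card mod_ring)) = x"
  by (simp add: of_int_of_int_mod_ring)

subsection \<open>Words of vectors in the dual of a power of the root lattice\<close>

text \<open>The power of the dual root lattice by coordinate conditions;
  \<open>dual_A_lattice\<close> identifies a single block with the dual in the sense of spans and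
  inner products.\<close>

definition A_dual :: "(real ^ 'n ^ 'k) set" where
  "A_dual = {x. \<forall>i. (\<Sum>a\<in>UNIV. x$i$a) = 0 \<and> (\<forall>a b. x$i$a - x$i$b \<in> \<int>)}"

text \<open>A block of glue s has entries n - s/p with n an integer, so p times any entry is
  congruent to -s; this explains the sign. On \<open>A_dual\<close> the product is an integer, and
  every coordinate of the block would give the same residue.\<close>

definition word :: "real ^ 'p::{prime_card,linorder} ^ 'k \<Rightarrow> 'p mod_ring ^ 'k" where
  "word x = (\<chi> i. - of_int \<lfloor>real CARD('p) * x$i$(Min UNIV)\<rfloor>)"

text \<open>Equals -p times the product with \<open>chi_Delta\<close> on blocks of sum zero, see
  \<open>inner_chi_Delta\<close>. Dropping the constant part of \<open>rho_Delta\<close> leaves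
  plain positions as weights.\<close>

definition phi :: "real ^ 'n::{finite,linorder} ^ 'k \<Rightarrow> real" where
  "phi x = (\<Sum>i\<in>UNIV. \<Sum>a\<in>UNIV. real (idx a) * x$i$a)"

text \<open>Normal form used throughout: a block of glue s is an integer vector of sum s minus its
  mean. For \<open>eps1\<close> the integer vector is the first unit vector and s = 1.
  \<open>A_dual_rep\<close> is the converse, with s taken in the range from 0 to p - 1.\<close>

lemma A_dualI:
  fixes x :: "real ^ 'p::{prime_card,linorder} ^ 'k"
  assumes x: "\<And>i a. x$i$a = of_int (n i a) - of_int (s i) / real CARD('p)"
    and n: "\<And>i. (\<Sum>a\<in>UNIV. n i a) = s i"
  shows "x \<in> A_dual" "word x = (\<chi> i. of_int (s i))"
proof -
  have "(\<Sum>a\<in>UNIV. x$i$a) = 0" for i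
    using n[of i] by (simp add: x sum_subtractf flip: of_int_sum)
  then show "x \<in> A_dual" by (auto simp: A_dual_def x)
  have "real CARD('p) * x$i$a = of_int (int CARD('p) * n i a - s i)" for i a
    by (simp add: x algebra_simps)
  then show "word x = (\<chi> i. of_int (s i))"
    by (simp only: word_def floor_of_int) (simp add: vec_eq_iff)
qed

lemma A_dual_rep:
  fixes x :: "real ^ 'p::{prime_card,linorder} ^ 'k"
  assumes "x \<in> A_dual"
  shows "\<exists>n. (\<forall>i a. x$i$a = of_int (n i a) - of_int (to_int_mod_ring (word x $ i)) / real CARD('p)) \<and>
    (\<forall>i. (\<Sum>a\<in>UNIV. n i a) = to_int_mod_ring (word x $ i))"
proof -
  define s where "s = (\<lambda>i. to_int_mod_ring (word x $ i))"
  let ?p = "real CARD('p)"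
  have sum0: "(\<Sum>a\<in>UNIV. x$i$a) = 0" and df: "x$i$a - x$i$b \<in> \<int>" for i a b
    using assms by (auto simp: A_dual_def)
  have px: "?p * x$i$a \<in> \<int>" for i a
  proof -
    have "(\<Sum>b\<in>UNIV. x$i$a - x$i$b) \<in> \<int>" by (intro Ints_sum df)
    then show ?thesis by (simp add: sum_subtractf sum0)
  qed
  have "\<exists>n. x$i$a = of_int n - of_int (s i) / ?p" for i a
  proof -
    obtain m where m: "?p * x$i$(Min UNIV) = of_int m" using px by (metis Ints_cases)
    have "(of_int (s i) :: 'p mod_ring) = of_int (- m)"
      by (simp add: s_def word_def of_int_to_int_mod_ring m)
    then obtain l where l: "s i + m = int CARD('p) * l"
      unfolding of_int_mod_ring_eq_iff by (auto elim!: dvdE)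
    obtain d where d: "x$i$a - x$i$(Min UNIV) = of_int d" using df by (metis Ints_cases)
    have "real_of_int (s i + m) = of_int (int CARD('p) * l)" by (simp only: l)
    then have "real_of_int (s i) + ?p * x$i$(Min UNIV) = ?p * of_int l" by (simp add: m)
    then have "of_int (s i) / ?p + x$i$(Min UNIV) = of_int l" by (simp add: field_simps)
    then have "x$i$a = of_int (d + l) - of_int (s i) / ?p" using d by simp
    then show ?thesis by blast
  qed
  then obtain n where n: "\<And>i a. x$i$a = of_int (n i a) - of_int (s i) / ?p" by metis
  have "(\<Sum>a\<in>UNIV. n i a) = s i" for i
  proof -
    have "(\<Sum>a\<in>UNIV. of_int (n i a) - of_int (s i) / ?p) = 0" using sum0[of i] by (simp add: n)
    then have "real_of_int (\<Sum>a\<in>UNIV. n i a) = of_int (s i)" by (simp add: sum_subtractf)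
    then show ?thesis by linarith
  qed
  with n show ?thesis unfolding s_def by blast
qed

text \<open>In each block the two mixed terms contribute -st/p each and the constant term
  contributes p times st/p^2, so a single -st/p survives.\<close>

lemma inner_rep:
  fixes x y :: "real ^ 'p::{prime_card,linorder} ^ 'k"
  assumes x: "\<And>i a. x$i$a = of_int (n i a) - of_int (s i) / real CARD('p)"
    and n: "\<And>i. (\<Sum>a\<in>UNIV. n i a) = s i"
    and y: "\<And>i a. y$i$a = of_int (m i a) - of_int (t i) / real CARD('p)"
    and m: "\<And>i. (\<Sum>a\<in>UNIV. m i a) = t i"
  shows "x \<bullet> y = (\<Sum>i\<in>UNIV. of_int (\<Sum>a\<in>UNIV. n i a * m i a) - of_int (s i * t i) / real CARD('p))"
proof -
  let ?p = "real CARD('p)"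
  have "(\<Sum>a\<in>UNIV. x$i$a * y$i$a) = of_int (\<Sum>a\<in>UNIV. n i a * m i a) - of_int (s i * t i) / ?p" for i
  proof -
    have "(\<Sum>a\<in>UNIV. x$i$a * y$i$a) = (\<Sum>a\<in>UNIV. of_int (n i a * m i a)
       - of_int (n i a) * (of_int (t i) / ?p) - of_int (m i a) * (of_int (s i) / ?p)
       + of_int (s i * t i) / (?p * ?p))"
      by (rule sum.cong) (auto simp: x y field_simps)
    also have "\<dots> = of_int (\<Sum>a\<in>UNIV. n i a * m i a) - of_int (\<Sum>a\<in>UNIV. n i a) * (of_int (t i) / ?p)
       - of_int (\<Sum>a\<in>UNIV. m i a) * (of_int (s i) / ?p) + of_int (s i * t i) / ?p"
      by (simp add: sum.distrib sum_subtractf sum_distrib_right sum_divide_distrib)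
    finally show ?thesis unfolding n m by (simp add: mult.commute)
  qed
  then show ?thesis by (simp only: inner_blocks)
qed

lemma A_dual_add: "x \<in> A_dual \<Longrightarrow> y \<in> A_dual \<Longrightarrow> x + y \<in> A_dual"
  unfolding A_dual_def by (auto simp: sum.distrib add_diff_add intro: Ints_add)

lemma A_dual_uminus: "x \<in> A_dual \<Longrightarrow> - x \<in> A_dual"
  unfolding A_dual_def by (auto simp: sum_negf)

lemma A_dual_0: "0 \<in> A_dual"
  by (auto simp: A_dual_def)

lemma A_dual_diff: "x \<in> A_dual \<Longrightarrow> y \<in> A_dual \<Longrightarrow> x - y \<in> A_dual"
  using A_dual_add[of x "- y"] A_dual_uminus[of y] by simp

lemma word_add:
  fixes x y :: "real ^ 'p::{prime_card,linorder} ^ 'k"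
  assumes "x \<in> A_dual" "y \<in> A_dual"
  shows "word (x + y) = word x + word y"
proof -
  obtain n where n: "\<And>i a. x$i$a = of_int (n i a) - of_int (to_int_mod_ring (word x $ i)) / real CARD('p)"
    "\<And>i. (\<Sum>a\<in>UNIV. n i a) = to_int_mod_ring (word x $ i)" using A_dual_rep[OF assms(1)] by blast
  obtain m where m: "\<And>i a. y$i$a = of_int (m i a) - of_int (to_int_mod_ring (word y $ i)) / real CARD('p)"
    "\<And>i. (\<Sum>a\<in>UNIV. m i a) = to_int_mod_ring (word y $ i)" using A_dual_rep[OF assms(2)] by blast
  have "word (x + y) = (\<chi> i. of_int (to_int_mod_ring (word x $ i) + to_int_mod_ring (word y $ i)))"
    by (rule A_dualI(2)[where n="\<lambda>i a. n i a + m i a"])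
       (simp_all add: n m sum.distrib add_divide_distrib)
  then show ?thesis by (simp add: of_int_to_int_mod_ring vec_eq_iff)
qed

lemma word_0: "word 0 = 0"
  by (simp add: word_def vec_eq_iff)

lemma word_uminus: "x \<in> A_dual \<Longrightarrow> word (- x) = - word x"
  using word_add[of x "- x"] A_dual_uminus[of x] word_0
  by (metis add.right_inverse minus_unique)

lemma word_diff: "x \<in> A_dual \<Longrightarrow> y \<in> A_dual \<Longrightarrow> word (x - y) = word x - word y"
  using word_add[of x "- y"] A_dual_uminus[of y] word_uminus[of y] by simp

lemma A_dual_of_nat: "x \<in> A_dual \<Longrightarrow> real n *\<^sub>R x \<in> A_dual \<and> word (real n *\<^sub>R x) = of_nat n *s word x"
  by (induction n) (auto simp: A_dual_0 word_0 scaleR_add_left A_dual_add word_add vec_eq_iff algebra_simps)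

lemma A_dual_of_int:
  "x \<in> A_dual \<Longrightarrow> of_int n *\<^sub>R x \<in> A_dual \<and> word (of_int n *\<^sub>R x) = of_int n *s word x"
proof (cases "n \<ge> 0")
  case True assume "x \<in> A_dual"
  with A_dual_of_nat[of x "nat n"] True show ?thesis by (simp add: of_nat_nat)
next
  case False assume x: "x \<in> A_dual"
  have "of_int n *\<^sub>R x = - (real (nat (- n)) *\<^sub>R x)" "of_int n *s word x = - (of_nat (nat (-n)) *s word x)"
    using False by (auto simp: of_nat_nat vec_eq_iff)
  with A_dual_of_nat[OF x, of "nat (- n)"] show ?thesis by (simp add: A_dual_uminus word_uminus)
qed

lemma phi_add: "phi (x + y) = phi x + phi y"
  by (simp add: phi_def sum.distrib algebra_simps)

lemma phi_scaleR: "phi (c *\<^sub>R x) = c * phi x"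
  by (simp add: phi_def sum_distrib_left algebra_simps)

lemma phi_uminus: "phi (- x) = - phi x"
  by (simp add: phi_def sum_negf)

lemma phi_diff: "phi (x - y) = phi x - phi y"
  using phi_add[of x "- y"] by (simp add: phi_uminus)

text \<open>Oddness enters through the positions: they sum to p h with p = 2h + 1, so the fractional
  parts s/p contribute the integer s h.\<close>

lemma phi_Ints:
  fixes x :: "real ^ 'p::{prime_card,linorder} ^ 'k"
  assumes "x \<in> A_dual" "odd CARD('p)"
  shows "phi x \<in> \<int>"
proof -
  obtain n where n: "\<And>i a. x$i$a = of_int (n i a) - of_int (to_int_mod_ring (word x $ i)) / real CARD('p)"
    "\<And>i. (\<Sum>a\<in>UNIV. n i a) = to_int_mod_ring (word x $ i)" using A_dual_rep[OF assms(1)] by blast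
  obtain h where h: "CARD('p) = 2 * h + 1" using assms(2) by (auto elim: oddE)
  have "(\<Sum>a\<in>UNIV. real (idx a) * x$i$a) \<in> \<int>" for i
  proof -
    have "(\<Sum>a\<in>UNIV. real (idx a) * x$i$a) = of_int (\<Sum>a\<in>UNIV. int (idx a) * n i a)
       - (\<Sum>a\<in>UNIV. real (idx (a::'p))) * (of_int (to_int_mod_ring (word x $ i)) / real CARD('p))"
      by (simp add: n algebra_simps sum_subtractf sum_distrib_right sum_divide_distrib)
    also have "\<dots> = of_int ((\<Sum>a\<in>UNIV. int (idx a) * n i a) - int h * to_int_mod_ring (word x $ i))"
      unfolding sum_idx_real using h by (simp add: field_simps)
    finally show ?thesis by (simp only: Ints_of_int)
  qed
  then show ?thesis unfolding phi_def by - (rule Ints_sum, blast)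
qed

text \<open>The fractional part of an inner product is minus the dot product of the words divided by
  p; this links lattice duality with code duality.\<close>

lemma inner_words:
  fixes x y :: "real ^ 'p::{prime_card,linorder} ^ 'k"
  assumes "x \<in> A_dual" "y \<in> A_dual"
  shows "\<exists>m. real CARD('p) * (x \<bullet> y) = of_int m \<and> of_int m = - (\<Sum>i\<in>UNIV. word x $ i * word y $ i)"
proof -
  obtain n where n: "\<And>i a. x$i$a = of_int (n i a) - of_int (to_int_mod_ring (word x $ i)) / real CARD('p)"
    "\<And>i. (\<Sum>a\<in>UNIV. n i a) = to_int_mod_ring (word x $ i)" using A_dual_rep[OF assms(1)] by blast
  obtain m where m: "\<And>i a. y$i$a = of_int (m i a) - of_int (to_int_mod_ring (word y $ i)) / real CARD('p)"
    "\<And>i. (\<Sum>a\<in>UNIV. m i a) = to_int_mod_ring (word y $ i)" using A_dual_rep[OF assms(2)] by blast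
  let ?M = "\<Sum>i\<in>UNIV. int CARD('p) * (\<Sum>a\<in>UNIV. n i a * m i a) - to_int_mod_ring (word x $ i) * to_int_mod_ring (word y $ i)"
  have "real CARD('p) * (x \<bullet> y) = of_int ?M"
    unfolding inner_rep[OF n m] by (simp add: sum_distrib_left algebra_simps sum_subtractf)
  moreover have "of_int ?M = - (\<Sum>i\<in>UNIV. word x $ i * word y $ i)"
    by (simp add: of_int_to_int_mod_ring sum_negf sum_subtractf)
  ultimately show ?thesis by blast
qed

lemma inner_Ints_iff:
  fixes x y :: "real ^ 'p::{prime_card,linorder} ^ 'k"
  assumes "x \<in> A_dual" "y \<in> A_dual"
  shows "x \<bullet> y \<in> \<int> \<longleftrightarrow> (\<Sum>i\<in>UNIV. word x $ i * word y $ i) = 0"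
proof -
  obtain m where m: "real CARD('p) * (x \<bullet> y) = of_int m"
    "of_int m = - (\<Sum>i\<in>UNIV. word x $ i * word y $ i)" using inner_words[OF assms] by blast
  have "(\<Sum>i\<in>UNIV. word x $ i * word y $ i) = 0 \<longleftrightarrow> (of_int m :: 'p mod_ring) = 0" using m by simp
  also have "\<dots> \<longleftrightarrow> int CARD('p) dvd m" by (rule of_int_mod_ring_eq_0_iff)
  also have "\<dots> \<longleftrightarrow> x \<bullet> y \<in> \<int>"
  proof
    assume "int CARD('p) dvd m"
    then obtain l where "m = int CARD('p) * l" by (auto elim: dvdE)
    then have "x \<bullet> y = of_int l" using m by simp
    then show "x \<bullet> y \<in> \<int>" by simp
  next
    assume "x \<bullet> y \<in> \<int>"
    then obtain l where "x \<bullet> y = of_int l" by (auto elim: Ints_cases)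
    then have "real_of_int m = of_int (int CARD('p) * l)" using m by simp
    then have "m = int CARD('p) * l" by (simp only: of_int_eq_iff)
    then show "int CARD('p) dvd m" by simp
  qed
  finally show ?thesis by simp
qed

subsection \<open>The lattices of constructions A and B in coordinates\<close>

lemma axis_diff_in_A_lattice: "axis a 1 - axis b 1 \<in> (A_lattice :: (real ^ 'n) set)"
  by (auto simp: A_lattice_def axis_def sum_subtractf sum.delta)

lemma span_A_lattice: "span A_lattice = {x :: real ^ 'n. (\<Sum>a\<in>UNIV. x$a) = 0}"
proof
  show "span A_lattice \<subseteq> {x :: real ^ 'n. (\<Sum>a\<in>UNIV. x$a) = 0}"
    by (rule span_minimal) (auto simp: A_lattice_def subspace_def sum.distrib simp flip: sum_distrib_left)
  show "{x :: real ^ 'n. (\<Sum>a\<in>UNIV. x$a) = 0} \<subseteq> span A_lattice"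
  proof
    fix x :: "real ^ 'n" assume "x \<in> {x. (\<Sum>a\<in>UNIV. x$a) = 0}"
    then have s: "(\<Sum>a\<in>UNIV. x$a) = 0" by simp
    fix b :: 'n
    have "x = (\<Sum>a\<in>UNIV. x$a *\<^sub>R (axis a 1 - axis undefined 1))"
    proof -
      have "(\<Sum>a\<in>UNIV. x$a *\<^sub>R (axis a 1 - axis undefined 1))
        = (\<Sum>a\<in>UNIV. x$a *\<^sub>R axis a 1) - (\<Sum>a\<in>UNIV. x$a) *\<^sub>R axis undefined 1"
        by (simp add: scaleR_diff_right sum_subtractf scaleR_sum_left)
      also have "\<dots> = x" using basis_expansion[of x] by (simp add: s scalar_mult_eq_scaleR)
      finally show ?thesis by simp
    qed
    also have "\<dots> \<in> span A_lattice"
      by (intro span_sum span_scale span_base axis_diff_in_A_lattice)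
    finally show "x \<in> span A_lattice" .
  qed
qed

lemma dual_A_lattice:
  "dual_lattice A_lattice = {x :: real ^ 'n. (\<Sum>a\<in>UNIV. x$a) = 0 \<and> (\<forall>a b. x$a - x$b \<in> \<int>)}"
proof -
  have "(\<forall>y\<in>A_lattice. x \<bullet> y \<in> \<int>) \<longleftrightarrow> (\<forall>a b. x$a - x$b \<in> \<int>)"
    if s: "(\<Sum>a\<in>UNIV. x$a) = 0" for x :: "real ^ 'n"
  proof
    assume "\<forall>y\<in>A_lattice. x \<bullet> y \<in> \<int>"
    then have "x \<bullet> (axis a 1 - axis b 1) \<in> \<int>" for a b using axis_diff_in_A_lattice by blast
    then show "\<forall>a b. x$a - x$b \<in> \<int>" by (simp add: inner_diff_right inner_axis)
  next
    assume d: "\<forall>a b. x$a - x$b \<in> \<int>"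
    show "\<forall>y\<in>A_lattice. x \<bullet> y \<in> \<int>"
    proof
      fix y :: "real ^ 'n" assume y: "y \<in> A_lattice"
      then have ys: "(\<Sum>a\<in>UNIV. y$a) = 0" and yi: "\<And>a. y$a \<in> \<int>" by (auto simp: A_lattice_def)
      have "x \<bullet> y = (\<Sum>a\<in>UNIV. (x$a - x$undefined) * y$a)"
        by (simp add: inner_vec_def left_diff_distrib sum_subtractf ys flip: sum_distrib_left)
      also have "\<dots> \<in> \<int>" using d yi by (intro Ints_sum Ints_mult) auto
      finally show "x \<bullet> y \<in> \<int>" .
    qed
  qed
  then show ?thesis unfolding dual_lattice_def span_A_lattice by blast
qed

lemma A_coset_eq_iff: "A_coset x = A_coset y \<longleftrightarrow> x - y \<in> A_lattice"
proof -
  have z: "0 \<in> (A_lattice :: (real ^ 'n) set)" by (simp add: A_lattice_def)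
  have a: "u + v \<in> A_lattice" if "u \<in> A_lattice" "v \<in> A_lattice" for u v :: "real ^ 'n"
    using that by (auto simp: A_lattice_def sum.distrib)
  have m: "- u \<in> A_lattice" if "u \<in> A_lattice" for u :: "real ^ 'n"
    using that by (auto simp: A_lattice_def sum_negf)
  show ?thesis
  proof
    assume "A_coset x = A_coset y"
    moreover have "x \<in> A_coset x" using z by (auto simp: A_coset_def intro!: image_eqI[of _ _ 0])
    ultimately obtain u where "u \<in> A_lattice" "x = y + u" by (auto simp: A_coset_def)
    then show "x - y \<in> A_lattice" by simp
  next
    assume xy: "x - y \<in> A_lattice"
    have "u \<in> A_coset y" if "u \<in> A_coset x" for u
    proof -
      from that obtain v where "v \<in> A_lattice" "u = x + v" by (auto simp: A_coset_def)
      then show ?thesis using a[OF xy, of v] by (auto simp: A_coset_def intro!: image_eqI[of _ _ "x - y + v"])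
    qed
    moreover have "u \<in> A_coset x" if "u \<in> A_coset y" for u
    proof -
      from that obtain v where "v \<in> A_lattice" "u = y + v" by (auto simp: A_coset_def)
      then show ?thesis using a[OF m[OF xy], of v]
        by (auto simp: A_coset_def intro!: image_eqI[of _ _ "- (x - y) + v"])
    qed
    ultimately show "A_coset x = A_coset y" by blast
  qed
qed

lemma sum_axis_nth: "(\<Sum>j\<in>UNIV. axis j (1::real)) $ (a::'n::finite) = 1"
  by (simp add: axis_def sum.delta)

lemma eps1_nth: "(eps1 :: real ^ 'n::{finite,linorder}) $ a = (if a = Min UNIV then 1 else 0) - 1 / real CARD('n)"
  unfolding eps1_def by (simp only: vector_minus_component vector_scaleR_component sum_axis_nth) (simp add: axis_def)

lemma L_A_eq:
  fixes C :: "('p::{prime_card,linorder} mod_ring ^ 'k) set"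
  shows "L_A C = {x \<in> A_dual. word x \<in> C}"
proof -
  have "A_quot x = code_embed c \<longleftrightarrow> word x = c" if x: "x \<in> A_dual"
    for x :: "real ^ 'p::{prime_card,linorder} ^ 'k" and c :: "'p mod_ring ^ 'k"
  proof -
    let ?p = "real CARD('p)"
    obtain n where n: "\<And>i a. x$i$a = of_int (n i a) - of_int (to_int_mod_ring (word x $ i)) / ?p"
      "\<And>i. (\<Sum>a\<in>UNIV. n i a) = to_int_mod_ring (word x $ i)" using A_dual_rep[OF x] by blast
    have "x$i - of_int (to_int_mod_ring (c $ i)) *\<^sub>R eps1 \<in> A_lattice \<longleftrightarrow> word x $ i = c $ i" for i
    proof -
      let ?s = "to_int_mod_ring (word x $ i)" and ?c = "to_int_mod_ring (c $ i)"
      let ?d = "x$i - of_int ?c *\<^sub>R eps1"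
      have d: "?d $ a = of_int (n i a - (if a = Min UNIV then ?c else 0)) - of_int (?s - ?c) / ?p" for a
        by (simp add: n(1) eps1_nth field_simps)
      show ?thesis
      proof
        assume "?d \<in> A_lattice"
        then have "?d $ (Min UNIV) \<in> \<int>" by (auto simp: A_lattice_def)
        then have "of_int (?s - ?c) / ?p \<in> \<int>" unfolding d by simp
        then obtain l where "of_int (?s - ?c) / ?p = of_int l" by (auto elim: Ints_cases)
        then have "real_of_int (?s - ?c) = of_int (int CARD('p) * l)" by (simp add: field_simps)
        then have "?s - ?c = int CARD('p) * l" by (simp only: of_int_eq_iff)
        then have "(of_int ?s :: 'p mod_ring) = of_int ?c" by (simp add: of_int_mod_ring_eq_iff)
        then show "word x $ i = c $ i" by (simp add: of_int_to_int_mod_ring)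
      next
        assume "word x $ i = c $ i"
        then have e: "?s = ?c" by simp
        have "(\<Sum>a\<in>UNIV. ?d $ a) = 0"
          unfolding d e using n(2)[of i]
          by (simp add: sum_subtractf sum.delta e flip: of_int_sum)
        moreover have "?d $ a \<in> \<int>" for a unfolding d e by simp
        ultimately show "?d \<in> A_lattice" by (simp add: A_lattice_def)
      qed
    qed
    then show ?thesis by (simp add: A_quot_def code_embed_def vec_eq_iff A_coset_eq_iff)
  qed
  then show ?thesis unfolding L_A_def dual_A_lattice A_dual_def[symmetric]
    by (auto simp: A_dual_def image_iff)
qed

text \<open>Coordinate \<open>a\<close> occurs with sign + once for every larger index and with sign
  - once for every smaller one.\<close>

lemma rho_Delta_nth:
  "(rho_Delta :: real ^ 'p::{finite,linorder}) $ a = (real CARD('p) - 1) / 2 - real (idx a)"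
proof -
  let ?P = "{(i, j). i < j} :: ('p \<times> 'p) set"
  have c1: "card {b. a < b} = CARD('p) - 1 - idx a"
  proof -
    have "UNIV = {b. b < a} \<union> {a} \<union> {b. a < b}" by auto
    then have "CARD('p) = card ({b. b < a} \<union> {a} \<union> {b. a < b})" by simp
    also have "\<dots> = idx a + 1 + card {b. a < b}"
      by (subst card_Un_disjoint; (subst card_Un_disjoint)?) (auto simp: idx_def)
    finally show ?thesis by simp
  qed
  have "(\<Sum>(i, j)\<in>?P. axis i 1 - axis j (1::real)) $ a = (\<Sum>z\<in>?P. (if fst z = a then 1 else 0) - (if snd z = a then 1 else 0))"
    by (auto simp: axis_def sum_component split_def intro!: sum.cong)
  also have "\<dots> = real (card {z\<in>?P. fst z = a}) - real (card {z\<in>?P. snd z = a})"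
    by (simp add: sum_subtractf sum.If_cases Int_def)
  also have "{z\<in>?P. fst z = a} = Pair a ` {b. a < b}" by auto
  also have "{z\<in>?P. snd z = a} = (\<lambda>b. (b, a)) ` {b. b < a}" by auto
  finally have "(\<Sum>(i, j)\<in>?P. axis i 1 - axis j (1::real)) $ a = real (CARD('p) - 1 - idx a) - real (idx a)"
    by (simp add: card_image inj_on_def c1 idx_def)
  then show ?thesis unfolding rho_Delta_def using idx_less[of a]
    by (simp add: of_nat_diff field_simps)
qed

lemma inner_chi_Delta:
  fixes x :: "real ^ 'p::{finite,linorder} ^ 'k"
  assumes "\<And>i. (\<Sum>a\<in>UNIV. x$i$a) = 0"
  shows "x \<bullet> chi_Delta = - phi x / real CARD('p)"
proof -
  define q r where "q = 1 / real CARD('p)" and "r = (real CARD('p) - 1) / 2"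
  have "x \<bullet> chi_Delta = (\<Sum>i\<in>UNIV. \<Sum>a\<in>UNIV. x$i$a * (q * (r - real (idx a))))"
    by (simp add: inner_blocks chi_Delta_def rho_Delta_nth q_def r_def)
  also have "\<dots> = (\<Sum>i\<in>UNIV. (\<Sum>a\<in>UNIV. x$i$a) * (q * r) - (\<Sum>a\<in>UNIV. real (idx a) * x$i$a) * q)"
    unfolding sum_distrib_right sum_subtractf[symmetric] by (intro sum.cong refl) (simp add: algebra_simps)
  also have "\<dots> = - phi x / real CARD('p)"
    by (simp add: assms phi_def sum_negf sum_divide_distrib q_def)
  finally show ?thesis .
qed

lemma L_B_eq:
  fixes C :: "('p::{prime_card,linorder} mod_ring ^ 'k) set"
  shows "L_B C = {x \<in> A_dual. word x \<in> C \<and> phi x / real CARD('p) \<in> \<int>}"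
proof -
  have "x \<bullet> chi_Delta \<in> \<int> \<longleftrightarrow> phi x / real CARD('p) \<in> \<int>" if "x \<in> A_dual" for x :: "real ^ 'p::{prime_card,linorder} ^ 'k"
    using that inner_chi_Delta[of x] by (auto simp: A_dual_def)
  then show ?thesis unfolding L_B_def L_A_eq by auto
qed

type_synonym ('n, 'k) blocks = "((real, 'n) vec, 'k) vec"

subsection \<open>Isomorphic codes give isometric lattices\<close>

lemma bij_permute_coords: "bij \<sigma> \<Longrightarrow> bij (permute_coords \<sigma>)"
  by (rule o_bij[of "permute_coords (inv_into UNIV \<sigma>)"])
    (auto simp: fun_eq_iff permute_coords_def vec_eq_iff bij_is_inj bij_is_surj surj_f_inv_f)

lemma bij_flip_sign: "bij (flip_sign j)"
  by (rule o_bij[of "flip_sign j"]) (auto simp: fun_eq_iff flip_sign_def vec_eq_iff)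

lemma code_group_signed_permutation:
  fixes s :: "'k::finite \<Rightarrow> 'a::field"
  assumes "bij \<sigma>" and s: "\<And>i. s i = 1 \<or> s i = -1"
  shows "(\<lambda>x. \<chi> i. s i * x $ \<sigma> i) \<in> (code_group :: ('a ^ 'k \<Rightarrow> 'a ^ 'k) set)"
proof -
  have flips: "(\<lambda>x. \<chi> i. if i \<in> F then s i * x $ i else x $ i) \<in> (code_group :: ('a ^ 'k \<Rightarrow> 'a ^ 'k) set)"
    if "finite F" for F
    using that
  proof (induction F)
    case empty
    have "(\<lambda>x. \<chi> i. if i \<in> {} then s i * x $ i else x $ i) = (id :: 'a ^ 'k \<Rightarrow> 'a ^ 'k)"
      by (simp add: fun_eq_iff vec_eq_iff)
    then show ?case by (simp add: code_group.one)
  next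
    case (insert j F)
    let ?f = "\<lambda>x :: 'a ^ 'k. \<chi> i. if i \<in> F then s i * x $ i else x $ i"
    let ?g = "\<lambda>x :: 'a ^ 'k. \<chi> i. if i \<in> insert j F then s i * x $ i else x $ i"
    show ?case
    proof (cases "s j = 1")
      case True
      then have "?g = ?f" using insert(2) by (auto simp: fun_eq_iff vec_eq_iff)
      then show ?thesis using insert by simp
    next
      case False
      then have "s j = -1" using s by blast
      then have "?g = flip_sign j \<circ> ?f" using insert(2) by (auto simp: fun_eq_iff vec_eq_iff flip_sign_def)
      then show ?thesis by (simp only: code_group.comp[OF code_group.flip insert.IH])
    qed
  qed
  have "(\<lambda>x. \<chi> i. s i * x $ \<sigma> i) = (\<lambda>x :: 'a ^ 'k. \<chi> i. if i \<in> UNIV then s i * x $ i else x $ i) \<circ> permute_coords \<sigma>"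
    by (auto simp: fun_eq_iff permute_coords_def)
  then show ?thesis using code_group.comp[OF flips[of UNIV] code_group.perm[OF assms(1)]] by simp
qed

lemma L_B_image:
  fixes G :: "('p::{prime_card,linorder}, 'k::finite) blocks \<Rightarrow> ('p, 'k) blocks"
  assumes "bij G" "inj f"
    and "\<And>x. G x \<in> A_dual \<longleftrightarrow> x \<in> A_dual"
    and "\<And>x. x \<in> A_dual \<Longrightarrow> word (G x) = f (word x) \<and> phi (G x) = phi x"
  shows "G ` L_B C = L_B (f ` C)"
proof -
  have "y \<in> G ` L_B C \<longleftrightarrow> y \<in> L_B (f ` C)" for y
  proof -
    obtain x where x: "y = G x" using \<open>bij G\<close> by (metis bij_pointE)
    have "y \<in> G ` L_B C \<longleftrightarrow> x \<in> L_B C" using \<open>bij G\<close> by (auto simp: x bij_def inj_image_mem_iff)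
    also have "\<dots> \<longleftrightarrow> y \<in> L_B (f ` C)"
      using assms(3)[of x] assms(4)[of x] \<open>inj f\<close> by (auto simp: L_B_eq x inj_eq)
    finally show ?thesis .
  qed
  then show ?thesis by blast
qed

text \<open>Negating one block reverses the sign of its contribution to \<open>phi\<close>, which
  would destroy divisibility of the total. Reversing the order of the coordinates reverses it once
  more because the block sum is zero, and it leaves the word alone.\<close>

definition flip_block :: "'k::finite \<Rightarrow> ('n::{finite,linorder}, 'k::finite) blocks \<Rightarrow> ('n, 'k) blocks" where
  "flip_block j x = (\<chi> i a. if i = j then - x$i$(rev_idx a) else x$i$a)"

lemma flip_block_flip_block: "flip_block j (flip_block j x) = x"
  by (simp add: flip_block_def vec_eq_iff rev_idx_rev_idx)

lemma sum_rev_idx: "(\<Sum>a\<in>UNIV. f (rev_idx a)) = (\<Sum>a\<in>UNIV. f a)"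
  by (rule sum.reindex_bij_betw[OF bij_rev_idx])

lemma flip_block_A_dual: "x \<in> A_dual \<Longrightarrow> flip_block j x \<in> A_dual"
proof -
  assume "x \<in> A_dual"
  then have x: "(\<Sum>a\<in>UNIV. x$i$a) = 0" "x$i$a - x$i$b \<in> \<int>" for i a b by (auto simp: A_dual_def)
  have "(\<Sum>a\<in>UNIV. flip_block j x $i$a) = 0" for i
    using x(1)[of i] sum_rev_idx[of "\<lambda>a. x$i$a"]
    by (cases "i = j") (simp_all add: flip_block_def sum_negf)
  moreover have "flip_block j x $i$a - flip_block j x$i$b \<in> \<int>" for i a b
    using x(2)[of i a b] x(2)[of i "rev_idx b" "rev_idx a"] by (auto simp: flip_block_def)
  ultimately show ?thesis by (simp add: A_dual_def)
qed

text \<open>The isometry is required to serve all codes at once: in the cases of compositions and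
  inverses the induction hypothesis is applied to image codes.\<close>

lemma code_group_isometry:
  fixes f :: "'p::{prime_card,linorder} mod_ring ^ 'k \<Rightarrow> 'p mod_ring ^ 'k"
  assumes "f \<in> code_group"
  shows "bij f \<and> (\<exists>G. bij G \<and> (\<forall>x y. G (x + y) = G x + G y) \<and> (\<forall>x y. G x \<bullet> G y = x \<bullet> y) \<and>
    (\<forall>C. G ` L_B C = L_B (f ` C)))"
  using assms
proof induction
  case one
  show ?case by (intro conjI exI[of _ id] bij_id) auto
next
  case (perm \<sigma>)
  let ?G = "permute_coords \<sigma> :: ('p, 'k) blocks \<Rightarrow> _"
  have "?G x \<in> A_dual \<longleftrightarrow> x \<in> A_dual" for x
    unfolding A_dual_def permute_coords_def using perm by simp (metis bij_pointE)
  moreover have "word (?G x) = permute_coords \<sigma> (word x)" for x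
    by (simp add: word_def permute_coords_def)
  moreover have "phi (?G x) = phi x" for x
    unfolding phi_def permute_coords_def using perm
      sum.reindex_bij_betw[of \<sigma> UNIV UNIV "\<lambda>i. \<Sum>a\<in>UNIV. real (idx a) * x$i$a"] by simp
  ultimately have "?G ` L_B C = L_B (permute_coords \<sigma> ` C)" for C
    by (intro L_B_image bij_permute_coords[OF perm] bij_is_inj[OF bij_permute_coords[OF perm]]) auto
  moreover have "?G x \<bullet> ?G y = x \<bullet> y" for x y
    unfolding inner_blocks permute_coords_def using perm
      sum.reindex_bij_betw[of \<sigma> UNIV UNIV "\<lambda>i. \<Sum>a\<in>UNIV. x$i$a * y$i$a"] by simp
  moreover have "?G (x + y) = ?G x + ?G y" for x y by (simp add: permute_coords_def vec_eq_iff)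
  ultimately show ?case by (intro conjI exI[of _ ?G] bij_permute_coords[OF perm]) auto
next
  case (flip j)
  have b: "bij (flip_sign j :: 'p mod_ring ^ 'k \<Rightarrow> _)" by (rule bij_flip_sign)
  let ?G = "flip_block j :: ('p, 'k) blocks \<Rightarrow> _"
  have bG: "bij ?G" by (rule o_bij[of ?G]) (auto simp: fun_eq_iff flip_block_flip_block)
  have d: "?G x \<in> A_dual \<longleftrightarrow> x \<in> A_dual" for x
    using flip_block_A_dual[of x j] flip_block_A_dual[of "?G x" j] by (auto simp: flip_block_flip_block)
  have "word (?G x) = flip_sign j (word x)" if x: "x \<in> A_dual" for x
  proof -
    let ?s = "\<lambda>i. to_int_mod_ring (word x $ i)"
    obtain n where n: "\<And>i a. x$i$a = of_int (n i a) - of_int (?s i) / real CARD('p)"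
      "\<And>i. (\<Sum>a\<in>UNIV. n i a) = ?s i" using A_dual_rep[OF x] by blast
    have "word (?G x) = (\<chi> i. of_int (if i = j then - ?s i else ?s i))"
      by (rule A_dualI(2)[where n="\<lambda>i a. if i = j then - n i (rev_idx a) else n i a"])
        (auto simp: flip_block_def n sum_negf sum_rev_idx[of "n j"])
    then show ?thesis by (simp add: flip_sign_def vec_eq_iff of_int_to_int_mod_ring)
  qed
  moreover have "phi (?G x) = phi x" if x: "x \<in> A_dual" for x
  proof -
    have "(\<Sum>a\<in>UNIV. real (idx a) * - x$j$(rev_idx a)) = (\<Sum>a\<in>UNIV. real (idx a) * x$j$a)"
    proof -
      have "(\<Sum>a\<in>UNIV. real (idx a) * - x$j$(rev_idx a)) = (\<Sum>a\<in>UNIV. real (idx (rev_idx a)) * - x$j$a)"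
        using sum_rev_idx[of "\<lambda>a. real (idx (rev_idx a)) * - x$j$a"] by (simp add: rev_idx_rev_idx)
      also have "\<dots> = (\<Sum>a\<in>UNIV. real (idx a) * x$j$a - (real CARD('p) - 1) * x$j$a)"
      proof (intro sum.cong refl)
        fix a :: 'p
        have "real (idx (rev_idx a)) = real CARD('p) - 1 - real (idx a)"
          unfolding idx_rev using idx_less[of a] by (simp add: of_nat_diff)
        then show "real (idx (rev_idx a)) * - x$j$a = real (idx a) * x$j$a - (real CARD('p) - 1) * x$j$a"
          by (simp only:) (simp add: algebra_simps)
      qed
      also have "\<dots> = (\<Sum>a\<in>UNIV. real (idx a) * x$j$a)"
        using x by (simp add: sum_subtractf A_dual_def flip: sum_distrib_left)
      finally show ?thesis .
    qed
    then have "(\<Sum>a\<in>UNIV. real (idx a) * ?G x $i$a) = (\<Sum>a\<in>UNIV. real (idx a) * x$i$a)" for i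
      by (cases "i = j") (simp_all add: flip_block_def)
    then show ?thesis by (simp add: phi_def)
  qed
  ultimately have "?G ` L_B C = L_B (flip_sign j ` C)" for C
    using d b bG by (intro L_B_image) (auto simp: bij_is_inj)
  moreover have "?G x \<bullet> ?G y = x \<bullet> y" for x y
  proof -
    have "(\<Sum>a\<in>UNIV. ?G x$i$a * ?G y$i$a) = (\<Sum>a\<in>UNIV. x$i$a * y$i$a)" for i
      using sum_rev_idx[of "\<lambda>a. x$j$a * y$j$a"] by (cases "i = j") (simp_all add: flip_block_def)
    then show ?thesis by (simp add: inner_blocks)
  qed
  moreover have "?G (x + y) = ?G x + ?G y" for x y by (simp add: flip_block_def vec_eq_iff)
  ultimately show ?case using b bG by blast
next
  case (comp f g)
  obtain G where G: "bij G" "\<forall>x y. G (x + y) = G x + G y" "\<forall>x y. G x \<bullet> G y = x \<bullet> y"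
    "\<forall>C. G ` L_B C = L_B (f ` C)" using comp.IH(1) by blast
  obtain H where H: "bij H" "\<forall>x y. H (x + y) = H x + H y" "\<forall>x y. H x \<bullet> H y = x \<bullet> y"
    "\<forall>C. H ` L_B C = L_B (g ` C)" using comp.IH(2) by blast
  have "(G \<circ> H) ` L_B C = L_B ((f \<circ> g) ` C)" for C by (simp only: image_comp[symmetric] G H)
  moreover have "bij (f \<circ> g)" using comp.IH by (intro bij_comp) blast+
  moreover have "bij (G \<circ> H)" using G(1) H(1) by (intro bij_comp)
  moreover have "\<forall>x y. (G \<circ> H) (x + y) = (G \<circ> H) x + (G \<circ> H) y" using G(2) H(2) by simp
  moreover have "\<forall>x y. (G \<circ> H) x \<bullet> (G \<circ> H) y = x \<bullet> y" using G(3) H(3) by simp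
  ultimately show ?case by blast
next
  case (inv f)
  obtain G where G: "bij G" "\<forall>x y. G (x + y) = G x + G y" "\<forall>x y. G x \<bullet> G y = x \<bullet> y"
    "\<forall>C. G ` L_B C = L_B (f ` C)" and f: "bij f" using inv.IH by blast
  let ?H = "inv_into UNIV G"
  have GH: "G (?H x) = x" for x using G(1) by (simp add: bij_is_surj surj_f_inv_f)
  have HG: "?H (G x) = x" for x using G(1) by (simp add: bij_is_inj)
  have "?H (x + y) = ?H x + ?H y" for x y
    using G(2) GH HG by metis
  moreover have "?H x \<bullet> ?H y = x \<bullet> y" for x y using G(3) GH by metis
  moreover have "?H ` L_B C = L_B (inv_into UNIV f ` C)" for C
  proof -
    have "G ` L_B (inv_into UNIV f ` C) = L_B C"
      using f G(4) by (metis bij_is_surj image_f_inv_f)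
    then have "?H ` L_B C = ?H ` G ` L_B (inv_into UNIV f ` C)" by simp
    also have "\<dots> = L_B (inv_into UNIV f ` C)" by (simp add: image_image HG)
    finally show ?thesis .
  qed
  ultimately show ?case using G(1) f by (intro conjI exI[of _ ?H]) (auto simp: bij_imp_bij_inv)
qed

lemma code_isomorphic_imp_lattice_isomorphic:
  fixes C D :: "('p::{prime_card,linorder} mod_ring ^ 'k) set"
  assumes "code_isomorphic C D"
  shows "lattice_isomorphic (L_B C) (L_B D)"
proof -
  obtain f where f: "f \<in> code_group" "f ` C = D" using assms by (auto simp: code_isomorphic_def)
  obtain G where G: "bij G" "\<forall>x y. G (x + y) = G x + G y" "\<forall>x y. G x \<bullet> G y = x \<bullet> y"
    "\<forall>C. G ` L_B C = L_B (f ` C)" using code_group_isometry[OF f(1)] by blast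
  have "bij_betw G (L_B C) (L_B D)"
    using G f(2) by (auto simp: bij_betw_def intro: inj_on_subset[OF bij_is_inj])
  then show ?thesis using G unfolding lattice_isomorphic_def by blast
qed

lemma code_isomorphic_sym: "code_isomorphic C D \<Longrightarrow> code_isomorphic D C"
proof -
  assume "code_isomorphic C D"
  then obtain f where f: "f \<in> code_group" "f ` C = D" by (auto simp: code_isomorphic_def)
  have "bij f" using f(1)
  proof induction
    case (comp f g)
    then show ?case by (intro bij_comp)
  qed (simp_all only: bij_id bij_imp_bij_inv bij_permute_coords bij_flip_sign)
  then have "inv_into UNIV f ` D = C" using f(2) by (auto simp: image_image bij_is_inj)
  then show ?thesis using code_group.inv[OF f(1)] by (auto simp: code_isomorphic_def)
qed

subsection \<open>Linear extension of lattice isometries\<close>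

text \<open>Linearity follows from inner products. The linear extension \<open>g\<close> from a
  basis of L preserves products with basis vectors and hence on the span (\<open>half\<close>,
  applied twice); then f x - g x has norm zero for every x in L.\<close>

lemma isometry_extends:
  fixes f :: "'v::euclidean_space \<Rightarrow> 'w::euclidean_space"
  assumes f: "\<And>x y. x \<in> L \<Longrightarrow> y \<in> L \<Longrightarrow> f x \<bullet> f y = x \<bullet> y"
  obtains g where "linear g" "\<And>x. x \<in> L \<Longrightarrow> g x = f x"
    "\<And>x y. x \<in> span L \<Longrightarrow> y \<in> span L \<Longrightarrow> g x \<bullet> g y = x \<bullet> y"
proof -
  obtain B where B: "B \<subseteq> L" "independent B" "L \<subseteq> span B"
    using maximal_independent_subset[of L] by blast
  obtain g where g: "linear g" "\<forall>x\<in>B. g x = f x" using linear_independent_extend[OF B(2)] by blast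
  have half: "u \<bullet> g y = x \<bullet> y" if u: "\<And>b. b \<in> B \<Longrightarrow> u \<bullet> g b = x \<bullet> b" and y: "y \<in> span B" for u x y
    using y
  proof (induction rule: span_induct_alt)
    case base then show ?case using g(1) by (simp add: linear_0)
  next
    case (step c b y)
    then show ?case using u[of b] g(1) by (simp add: linear_add linear_scale inner_add_right)
  qed
  have gg: "g x \<bullet> g y = x \<bullet> y" if "x \<in> span B" "y \<in> span B" for x y
  proof (rule half[OF _ that(2)])
    fix b assume b: "b \<in> B"
    have "g b \<bullet> g x = b \<bullet> x"
      by (rule half[OF _ that(1)]) (use B(1) b f g(2) in \<open>auto simp: subset_iff\<close>)
    then show "g x \<bullet> g b = x \<bullet> b" by (simp add: inner_commute)
  qed
  have gf: "g x = f x" if x: "x \<in> L" for x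
  proof -
    have xs: "x \<in> span B" using x B by blast
    have "f x \<bullet> g x = x \<bullet> x" by (rule half[OF _ xs]) (use B(1) x f g(2) in \<open>auto simp: subset_iff\<close>)
    then have "(f x - g x) \<bullet> (f x - g x) = 0"
      using gg[OF xs xs] f[OF x x] by (simp add: inner_diff_left inner_diff_right inner_commute)
    then show ?thesis by simp
  qed
  have "span L \<subseteq> span B" using B(3) by (simp add: span_minimal)
  then show ?thesis using that[OF g(1) gf] gg by blast
qed

subsection \<open>Roots and minimal vectors\<close>

definition V0 :: "('n::finite, 'k::finite) blocks set" where
  "V0 = {x. \<forall>i. (\<Sum>a\<in>UNIV. x$i$a) = 0}"

lemma subspace_V0: "subspace V0"
  by (auto simp: V0_def subspace_def sum.distrib simp flip: sum_distrib_left)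

lemma A_dual_V0: "x \<in> A_dual \<Longrightarrow> x \<in> V0"
  by (auto simp: A_dual_def V0_def)

text \<open>Orthogonal projection of a unit vector of block \<open>i\<close> to \<open>V0\<close>.
  Products with it read off coordinates (\<open>inner_ebar\<close>), and its word is a unit word.
  The p projections of one block sum to zero and form a tight frame, see
  \<open>sum_inner_ebar\<close>.\<close>

definition ebar :: "'k::finite \<Rightarrow> 'n::finite \<Rightarrow> ('n, 'k) blocks" where
  "ebar i a = (\<chi> j b. if j = i then (if b = a then 1 else 0) - 1 / real CARD('n) else 0)"

abbreviation rootv :: "'k::finite \<Rightarrow> 'n::finite \<Rightarrow> 'n \<Rightarrow> ('n, 'k) blocks" where
  "rootv i a b \<equiv> ebar i a - ebar i b"

lemma ebar_nth: "ebar i a $ j $ b = (if j = i then (if b = a then 1 else 0) - 1 / real CARD('n) else 0)"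
  for i :: "'k::finite" and a :: "'n::finite"
  by (simp add: ebar_def)

lemma root_nth: "rootv i a b $ j $ c = (if j = i then (if c = a then 1 else 0) - (if c = b then 1 else 0) else 0)"
  by (simp add: ebar_nth)

lemma inner_ebar: "x \<in> V0 \<Longrightarrow> x \<bullet> ebar i a = x$i$a"
proof -
  assume x: "x \<in> V0"
  have "x \<bullet> ebar i a = (\<Sum>j\<in>UNIV. if j = i then (\<Sum>b\<in>UNIV. x$j$b * ((if b = a then 1 else 0) - 1 / real CARD('a))) else 0)"
    unfolding inner_blocks ebar_nth by (intro sum.cong) auto
  also have "\<dots> = (\<Sum>b\<in>UNIV. x$i$b * ((if b = a then 1 else 0) - 1 / real CARD('a)))" by simp
  also have "\<dots> = x$i$a - (\<Sum>b\<in>UNIV. x$i$b) / real CARD('a)"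
    by (simp add: right_diff_distrib sum_subtractf if_distrib[of "\<lambda>u. _ * u"] sum_divide_distrib cong: if_cong)
  finally show ?thesis using x by (simp add: V0_def)
qed

lemma ebar_A_dual:
  "ebar i a \<in> A_dual" "word (ebar i a) = axis i 1" for i :: "'k::finite" and a :: "'p::{prime_card,linorder}"
proof -
  have *: "ebar i a $ j $ b = of_int (if j = i \<and> b = a then 1 else 0) - of_int (if j = i then 1 else 0) / real CARD('p)" for j b
    by (simp add: ebar_nth)
  have **: "(\<Sum>b\<in>UNIV. if j = i \<and> b = a then 1 else 0) = (if j = i then 1 else (0::int))" for j
    by (cases "j = i") auto
  show "ebar i a \<in> A_dual" by (rule A_dualI(1)[OF * **])
  show "word (ebar i a) = axis i 1"
    by (subst A_dualI(2)[OF * **]) (simp add: vec_eq_iff axis_def)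
qed

lemma root_A_dual:
  "rootv i a b \<in> A_dual" "word (rootv i a b) = 0" for i :: "'k::finite" and a b :: "'p::{prime_card,linorder}"
  by (simp_all add: A_dual_diff ebar_A_dual word_diff)

lemma phi_root: "phi (rootv i a b) = real (idx a) - real (idx b)"
proof -
  have "phi (rootv i a b) = (\<Sum>j\<in>UNIV. if j = i then (\<Sum>c\<in>UNIV. real (idx c) * ((if c = a then 1 else 0) - (if c = b then 1 else 0))) else 0)"
    unfolding phi_def root_nth by (intro sum.cong) auto
  also have "\<dots> = (\<Sum>c\<in>UNIV. real (idx c) * ((if c = a then 1 else 0) - (if c = b then 1 else 0)))" by simp
  also have "\<dots> = real (idx a) - real (idx b)"
    by (simp add: right_diff_distrib sum_subtractf if_distrib[of "\<lambda>u. _ * u"] cong: if_cong)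
  finally show ?thesis .
qed

text \<open>Along consecutive positions the value is -1; the wrap-around root gives p - 1, which is
  the same residue.\<close>

lemma phi_root_nxt:
  "\<exists>m. phi (rootv i a (nxt a)) = real CARD('n) * of_int m - 1" for a :: "'n::{finite,linorder}"
proof (cases "idx a + 1 = CARD('n)")
  case True
  then have "idx (nxt a) = 0" by (simp add: idx_nxt)
  then have "phi (rootv i a (nxt a)) = real CARD('n) * of_int 1 - 1" using True by (simp add: phi_root flip: True)
  then show ?thesis by blast
next
  case False
  then have "idx (nxt a) = idx a + 1" using idx_less[of a] by (simp add: idx_nxt)
  then have "phi (rootv i a (nxt a)) = real CARD('n) * of_int 0 - 1" by (simp add: phi_root)
  then show ?thesis by blast
qed

lemma V0_expand: "x \<in> V0 \<Longrightarrow> x = (\<Sum>i\<in>UNIV. \<Sum>a\<in>UNIV. x$i$a *\<^sub>R ebar i a)"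
proof -
  assume x: "x \<in> V0"
  have "(\<Sum>i\<in>UNIV. \<Sum>a\<in>UNIV. x$i$a *\<^sub>R ebar i a) $ j $ b = x $ j $ b" for j b
  proof -
    have "(\<Sum>i\<in>UNIV. \<Sum>a\<in>UNIV. x$i$a *\<^sub>R ebar i a) $ j $ b
      = (\<Sum>i\<in>UNIV. if i = j then \<Sum>a\<in>UNIV. x$j$a * ((if b = a then 1 else 0) - 1 / real CARD('a)) else 0)"
      unfolding sum_component by (intro sum.cong refl) (auto simp: ebar_nth)
    also have "\<dots> = x$j$b - (\<Sum>a\<in>UNIV. x$j$a) / real CARD('a)"
      by (simp add: right_diff_distrib sum_subtractf if_distrib[of "\<lambda>u. _ * u"] sum_divide_distrib cong: if_cong)
    finally show ?thesis using x by (simp add: V0_def)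
  qed
  then show ?thesis by (simp add: vec_eq_iff)
qed

lemma ebar_root_sum: "ebar i a = (1 / real CARD('n)) *\<^sub>R (\<Sum>b\<in>UNIV. rootv i a b)" for a :: "'n::finite" and i :: "'k::finite"
proof -
  have "(\<Sum>b\<in>UNIV. ebar i b) = (0 :: ('n, 'k) blocks)"
  proof -
    have "(\<Sum>b\<in>UNIV. ebar i b) $ j $ c = (0 :: real)" for j :: 'k and c :: 'n
      by (cases "j = i") (simp_all add: ebar_nth sum_subtractf)
    then show ?thesis by (simp add: vec_eq_iff)
  qed
  then show ?thesis by (simp add: sum_subtractf sum_constant_scaleR del: sum_constant)
qed

text \<open>These three facts hold whatever the code is. They are the substitute for the root
  lattice, which the lattice of construction B does not contain.\<close>

lemma root_in_L_B:
  fixes C :: "('p::{prime_card,linorder} mod_ring ^ 'k) set"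
  assumes "0 \<in> C"
  shows "real CARD('p) *\<^sub>R rootv i a b \<in> L_B C" "rootv i a (nxt a) - rootv j b (nxt b) \<in> L_B C"
    "rootv i a (nxt a) \<notin> L_B C"
proof -
  show "real CARD('p) *\<^sub>R rootv i a b \<in> L_B C"
    using A_dual_of_nat[OF root_A_dual(1), of "CARD('p)" i a b] assms
    by (auto simp: L_B_eq root_A_dual phi_scaleR phi_root)
  obtain m where m: "phi (rootv i a (nxt a)) = real CARD('p) * of_int m - 1" using phi_root_nxt by blast
  obtain n where n: "phi (rootv j b (nxt b)) = real CARD('p) * of_int n - 1" using phi_root_nxt by blast
  have "phi (rootv i a (nxt a) - rootv j b (nxt b)) = real CARD('p) * of_int (m - n)"
    unfolding phi_diff[of "rootv i a (nxt a)" "rootv j b (nxt b)"] m n by (simp add: algebra_simps)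
  then show "rootv i a (nxt a) - rootv j b (nxt b) \<in> L_B C"
    using assms by (simp add: L_B_eq A_dual_diff root_A_dual word_diff)
  show "rootv i a (nxt a) \<notin> L_B C"
  proof
    assume "rootv i a (nxt a) \<in> L_B C"
    then have "(real CARD('p) * of_int m - 1) / real CARD('p) \<in> \<int>" by (simp add: L_B_eq m)
    then obtain l where "(real CARD('p) * of_int m - 1) / real CARD('p) = of_int l" by (auto elim: Ints_cases)
    then have "real_of_int (int CARD('p) * (m - l)) = of_int 1" by (simp add: field_simps)
    then have "int CARD('p) * (m - l) = 1" by (simp only: of_int_eq_iff)
    then have "CARD('p) = 1" by (metis dvd_triv_left int_dvd_int_iff nat_dvd_1_iff_1 of_nat_1)
    then show False using prime_card[where 'a='p] by simp
  qed
qed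

lemma span_L_B:
  fixes C :: "('p::{prime_card,linorder} mod_ring ^ 'k) set"
  assumes "0 \<in> C"
  shows "span (L_B C) = V0"
proof
  show "span (L_B C) \<subseteq> V0"
    by (rule span_minimal) (auto simp: L_B_eq A_dual_V0 subspace_V0)
  have "rootv i a b \<in> span (L_B C)" for i a b
  proof -
    have "(1 / real CARD('p)) *\<^sub>R (real CARD('p) *\<^sub>R rootv i a b) \<in> span (L_B C)"
      by (intro span_scale span_base root_in_L_B assms)
    then show ?thesis by simp
  qed
  then have "ebar i a \<in> span (L_B C)" for i a
    by (subst ebar_root_sum) (intro span_scale span_sum)
  then show "V0 \<subseteq> span (L_B C)"
    by (metis (no_types, lifting) V0_expand span_scale span_sum subsetI)
qed

lemma exists_L_B_word:
  fixes c :: "'p::{prime_card,linorder} mod_ring ^ 'k"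
  assumes "odd CARD('p)"
  obtains x where "x \<in> A_dual" "word x = c" "phi x / real CARD('p) \<in> \<int>"
proof -
  define y where "y = (\<Sum>i\<in>UNIV. of_int (to_int_mod_ring (c $ i)) *\<^sub>R ebar i (Min UNIV :: 'p))"
  have s: "(\<Sum>i\<in>F. of_int (to_int_mod_ring (c $ i)) *\<^sub>R ebar i (Min UNIV :: 'p)) \<in> A_dual \<and>
     word (\<Sum>i\<in>F. of_int (to_int_mod_ring (c $ i)) *\<^sub>R ebar i (Min UNIV :: 'p)) = (\<Sum>i\<in>F. c $ i *s axis i 1)"
    if "finite F" for F
    using that
    by (induction F) (auto simp: A_dual_0 word_0 A_dual_add word_add A_dual_of_int ebar_A_dual of_int_to_int_mod_ring)
  have y: "y \<in> A_dual" "word y = c" using s[of UNIV] basis_expansion[of c] by (auto simp: y_def)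
  obtain m where m: "phi y = of_int m" using phi_Ints[OF y(1) assms] by (auto elim: Ints_cases)
  let ?r = "rootv (undefined :: 'k) (undefined :: 'p) (nxt undefined)"
  obtain l where l: "phi ?r = real CARD('p) * of_int l - 1" using phi_root_nxt by blast
  \<comment> \<open>The root has word 0 and \<open>phi\<close> congruent to -1, so adding it m times
    cancels \<open>phi y\<close> = m modulo p without changing the word.\<close>
  define x where "x = y + of_int m *\<^sub>R ?r"
  have "phi x = real CARD('p) * of_int (l * m)" unfolding x_def phi_add phi_scaleR m l by (simp add: algebra_simps)
  then have "phi x / real CARD('p) \<in> \<int>" by simp
  moreover have "x \<in> A_dual" "word x = c"
    using A_dual_of_int[OF root_A_dual(1)[of "undefined :: 'k" "undefined :: 'p" "nxt undefined"], of m]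
      root_A_dual(2)[of "undefined :: 'k" "undefined :: 'p" "nxt undefined"] y
    by (auto simp: x_def A_dual_add word_add)
  ultimately show ?thesis using that by blast
qed

text \<open>s (p - s) / p is the minimal norm of the coset of s \<open>eps1\<close> modulo the root
  lattice; \<open>gap\<close> is p times this number.\<close>

definition gap :: "'p::prime_card mod_ring \<Rightarrow> int" where
  "gap c = to_int_mod_ring c * (int CARD('p) - to_int_mod_ring c)"

lemma to_int_mod_ring_eq_0_iff: "to_int_mod_ring (c :: 'p::prime_card mod_ring) = 0 \<longleftrightarrow> c = 0"
proof
  assume "to_int_mod_ring c = 0"
  then have "of_int (to_int_mod_ring c) = (0 :: 'p mod_ring)" by simp
  then show "c = 0" by (simp only: of_int_to_int_mod_ring)
qed simp

lemma gap_nonneg: "gap (c :: 'p::prime_card mod_ring) \<ge> 0"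
  unfolding gap_def using to_int_mod_ring_bounds[of c] by simp

lemma gap_ge: "c \<noteq> 0 \<Longrightarrow> gap (c :: 'p::prime_card mod_ring) \<ge> int CARD('p) - 1"
proof -
  assume "c \<noteq> 0"
  then have "to_int_mod_ring c \<noteq> 0" using to_int_mod_ring_eq_0_iff[of c] by blast
  then have "1 \<le> to_int_mod_ring c" "to_int_mod_ring c < int CARD('p)"
    using to_int_mod_ring_bounds[of c] by linarith+
  then have "0 \<le> (to_int_mod_ring c - 1) * (int CARD('p) - 1 - to_int_mod_ring c)" by (intro mult_nonneg_nonneg) auto
  then show ?thesis unfolding gap_def by (simp add: algebra_simps)
qed

text \<open>With the integer parts n, replacing n^2 by n would give exactly the sum of the gaps. The
  excess n (n - 1) is nonnegative and even, and \<open>t\<close> collects the halves.\<close>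

lemma norm_gap:
  fixes x :: "('p::{prime_card,linorder}, 'k::finite) blocks"
  assumes "x \<in> A_dual"
  obtains t :: int where "t \<ge> 0" "real CARD('p) * (x \<bullet> x) = of_int ((\<Sum>i\<in>UNIV. gap (word x $ i)) + 2 * int CARD('p) * t)"
proof -
  let ?s = "\<lambda>i. to_int_mod_ring (word x $ i)"
  obtain n where n: "\<And>i a. x$i$a = of_int (n i a) - of_int (?s i) / real CARD('p)"
    "\<And>i. (\<Sum>a\<in>UNIV. n i a) = ?s i" using A_dual_rep[OF assms] by blast
  define t where "t = (\<Sum>i\<in>UNIV. \<Sum>a\<in>UNIV. n i a * (n i a - 1) div 2)"
  have nn: "n i a * (n i a - 1) \<ge> 0" for i a
    by (cases "n i a \<ge> 1") (auto intro: mult_nonneg_nonneg mult_nonpos_nonpos)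
  have ev: "2 * (n i a * (n i a - 1) div 2) = n i a * n i a - n i a" for i a
  proof -
    have "even (n i a * (n i a - 1))" by auto
    then show ?thesis by (simp add: algebra_simps)
  qed
  have t0: "t \<ge> 0" unfolding t_def by (intro sum_nonneg) (use nn in \<open>simp add: pos_imp_zdiv_nonneg_iff\<close>)
  have "2 * t = (\<Sum>i\<in>UNIV. \<Sum>a\<in>UNIV. n i a * n i a - n i a)"
    by (simp add: t_def sum_distrib_left ev)
  also have "\<dots> = (\<Sum>i\<in>UNIV. (\<Sum>a\<in>UNIV. n i a * n i a) - ?s i)" by (simp add: sum_subtractf n(2))
  finally have t2: "2 * t = (\<Sum>i\<in>UNIV. (\<Sum>a\<in>UNIV. n i a * n i a) - ?s i)" .
  have "real CARD('p) * (x \<bullet> x) = of_int (\<Sum>i\<in>UNIV. int CARD('p) * (\<Sum>a\<in>UNIV. n i a * n i a) - ?s i * ?s i)"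
    unfolding inner_rep[OF n n] by (simp add: sum_distrib_left algebra_simps sum_subtractf)
  also have "(\<Sum>i\<in>UNIV. int CARD('p) * (\<Sum>a\<in>UNIV. n i a * n i a) - ?s i * ?s i)
     = (\<Sum>i\<in>UNIV. gap (word x $ i) + int CARD('p) * ((\<Sum>a\<in>UNIV. n i a * n i a) - ?s i))"
    by (intro sum.cong refl) (simp add: gap_def algebra_simps)
  also have "\<dots> = (\<Sum>i\<in>UNIV. gap (word x $ i)) + int CARD('p) * (2 * t)"
    unfolding t2 by (simp add: sum.distrib sum_distrib_left)
  finally show ?thesis using t0 by (intro that[of t]) (simp_all add: algebra_simps)
qed

text \<open>The words whose coset has minimal norm 2.\<close>

definition root_word :: "'p::prime_card mod_ring ^ 'k \<Rightarrow> bool" where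
  "root_word c \<longleftrightarrow> (\<Sum>i\<in>UNIV. gap (c $ i)) = 2 * int CARD('p)"

text \<open>By \<open>norm_gap\<close>, 2p is the sum of the gaps plus 2pt. A nonzero entry makes
  the first summand positive, so t = 0 and the vector is minimal in its coset.\<close>

lemma norm2_word:
  fixes x :: "('p::{prime_card,linorder}, 'k::finite) blocks"
  assumes "x \<in> A_dual" "x \<bullet> x = 2" "word x \<noteq> 0"
  shows "root_word (word x)"
proof -
  obtain t where t: "t \<ge> 0" "real CARD('p) * (x \<bullet> x) = of_int ((\<Sum>i\<in>UNIV. gap (word x $ i)) + 2 * int CARD('p) * t)"
    using norm_gap[OF assms(1)] by blast
  then have "real_of_int (2 * int CARD('p)) = of_int ((\<Sum>i\<in>UNIV. gap (word x $ i)) + 2 * int CARD('p) * t)"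
    using assms(2) by simp
  then have e: "2 * int CARD('p) = (\<Sum>i\<in>UNIV. gap (word x $ i)) + 2 * int CARD('p) * t"
    by (simp only: of_int_eq_iff)
  have p: "int CARD('p) > 1" using prime_card[where 'a='p] prime_gt_1_nat by simp
  obtain i where i: "word x $ i \<noteq> 0" using assms(3) by (auto simp: vec_eq_iff)
  have "0 < gap (word x $ i)" using gap_ge[OF i] p by simp
  also have "\<dots> \<le> (\<Sum>i\<in>UNIV. gap (word x $ i))" by (rule member_le_sum) (auto simp: gap_nonneg)
  finally have "2 * int CARD('p) * t < 2 * int CARD('p) * 1" using e by linarith
  then have "t < 1" using p by (subst (asm) mult_less_cancel_left_pos) auto
  then have "t = 0" using t(1) by simp
  then show ?thesis using e by (simp add: root_word_def)
qed

lemma norm2_word_0: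
  fixes x :: "('p::{prime_card,linorder}, 'k::finite) blocks"
  assumes x: "x \<in> A_dual" "x \<bullet> x = 2" "word x = 0"
  shows "\<exists>i a b. a \<noteq> b \<and> x = rootv i a b"
proof -
  obtain n where n0: "\<And>i a. x$i$a = of_int (n i a) - of_int (to_int_mod_ring (word x $ i)) / real CARD('p)"
    "\<And>i. (\<Sum>a\<in>UNIV. n i a) = to_int_mod_ring (word x $ i)" using A_dual_rep[OF x(1)] by blast
  have n: "\<And>i a. x$i$a = of_int (n i a)" "\<And>i. (\<Sum>a\<in>UNIV. n i a) = 0" using n0 by (simp_all add: x(3))
  have "real_of_int (\<Sum>i\<in>UNIV. \<Sum>a\<in>UNIV. n i a * n i a) = 2" using x(2) by (simp add: inner_blocks n)
  then have sq: "(\<Sum>i\<in>UNIV. \<Sum>a\<in>UNIV. n i a * n i a) = 2" by linarith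
  have "\<exists>i a. n i a \<noteq> 0"
  proof (rule ccontr)
    assume "\<not> ?thesis" then show False using sq by simp
  qed
  then obtain i c where c: "n i c \<noteq> 0" by blast
  have "\<exists>a. n i a > 0"
  proof (rule ccontr)
    assume "\<not> ?thesis"
    then have "\<forall>a\<in>UNIV. - n i a = 0" using n(2)[of i] sum_nonneg_eq_0_iff[of UNIV "\<lambda>a. - n i a"]
      by (auto simp: not_less sum_negf)
    then show False using c by simp
  qed
  then obtain a where a: "n i a > 0" by blast
  have "\<exists>b. n i b < 0"
  proof (rule ccontr)
    assume "\<not> ?thesis"
    then have "\<forall>a\<in>UNIV. n i a = 0" using n(2)[of i] sum_nonneg_eq_0_iff[of UNIV "n i"] by (auto simp: not_less)
    then show False using c by simp
  qed
  then obtain b where b: "n i b < 0" by blast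
  have ab: "a \<noteq> b" using a b by auto
  have S: "(\<Sum>z\<in>UNIV. n (fst z) (snd z) * n (fst z) (snd z)) = 2"
    using sq by (simp add: sum.cartesian_product split_def)
  have one: "n i a * n i a \<ge> 1" "n i b * n i b \<ge> 1"
    using a b by (auto simp: int_one_le_iff_zero_less zero_less_mult_iff)
  have pair: "(\<Sum>z\<in>{(i,a),(i,b)}. n (fst z) (snd z) * n (fst z) (snd z)) = n i a * n i a + n i b * n i b"
    using ab by simp
  have rest: "(\<Sum>z\<in>UNIV. n (fst z) (snd z) * n (fst z) (snd z))
    = (n i a * n i a + n i b * n i b) + (\<Sum>z\<in>UNIV - {(i,a),(i,b)}. n (fst z) (snd z) * n (fst z) (snd z))"
    by (subst sum.subset_diff[of "{(i,a),(i,b)}"]) (auto simp only: pair finite subset_UNIV add.commute)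
  have nonneg: "(\<Sum>z\<in>UNIV - {(i,a),(i,b)}. n (fst z) (snd z) * n (fst z) (snd z)) \<ge> 0"
    by (intro sum_nonneg) simp
  have r0: "(\<Sum>z\<in>UNIV - {(i,a),(i,b)}. n (fst z) (snd z) * n (fst z) (snd z)) = 0"
    and sa: "n i a * n i a = 1" and sb: "n i b * n i b = 1"
    using S rest one nonneg by linarith+
  have "n j d = 0" if "(j, d) \<noteq> (i, a)" "(j, d) \<noteq> (i, b)" for j d
  proof -
    have "\<forall>z\<in>UNIV - {(i,a),(i,b)}. n (fst z) (snd z) * n (fst z) (snd z) = 0"
      using r0 by (subst (asm) sum_nonneg_eq_0_iff) auto
    then have "n (fst (j,d)) (snd (j,d)) * n (fst (j,d)) (snd (j,d)) = 0" using that by blast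
    then show ?thesis by simp
  qed
  moreover have "n i a = 1" using sa a by (auto simp: zmult_eq_1_iff)
  moreover have "n i b = -1" using sb b by (auto simp: zmult_eq_1_iff)
  ultimately have "x $ j $ d = rootv i a b $ j $ d" for j d
    using ab by (auto simp: n(1) ebar_nth)
  then have "x = rootv i a b" by (simp add: vec_eq_iff)
  then show ?thesis using ab by blast
qed

text \<open>The fundamental weights: ones on the first s positions of a block, minus the mean.
  Entries 0 and 1 satisfy n^2 = n, so no excess over the gap occurs.\<close>

lemma minimal_vector:
  fixes c :: "'p::{prime_card,linorder} mod_ring ^ 'k"
  obtains x where "x \<in> A_dual" "word x = c" "real CARD('p) * (x \<bullet> x) = of_int (\<Sum>i\<in>UNIV. gap (c $ i))"
proof -
  let ?s = "\<lambda>i. to_int_mod_ring (c $ i)"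
  define n :: "'k \<Rightarrow> 'p \<Rightarrow> int" where "n = (\<lambda>i a. if int (idx a) < ?s i then 1 else 0)"
  define x :: "('p, 'k) blocks" where "x = (\<chi> i a. of_int (n i a) - of_int (?s i) / real CARD('p))"
  have x: "x$i$a = of_int (n i a) - of_int (?s i) / real CARD('p)" for i a by (simp add: x_def)
  have sn: "(\<Sum>a\<in>UNIV. n i a) = ?s i" for i
  proof -
    have "(\<Sum>a\<in>UNIV. n i a) = (\<Sum>m<CARD('p). if int m < ?s i then 1 else 0)"
      unfolding n_def by (rule sum_idx[of "\<lambda>m. if int m < ?s i then 1 else 0"])
    also have "\<dots> = int (card {m \<in> {..<CARD('p)}. int m < ?s i})" by (simp add: sum.If_cases Int_def)
    also have "{m \<in> {..<CARD('p)}. int m < ?s i} = {..<nat (?s i)}"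
      using to_int_mod_ring_bounds[of "c $ i"] by auto
    finally show ?thesis using to_int_mod_ring_bounds[of "c $ i"] by simp
  qed
  have nn: "(\<Sum>a\<in>UNIV. n i a * n i a) = ?s i" for i
  proof -
    have "(\<Sum>a\<in>UNIV. n i a * n i a) = (\<Sum>a\<in>UNIV. n i a)" by (intro sum.cong) (auto simp: n_def)
    then show ?thesis by (simp add: sn)
  qed
  have "real CARD('p) * (x \<bullet> x) = of_int (\<Sum>i\<in>UNIV. gap (c $ i))"
    unfolding inner_rep[OF x sn x sn] nn by (simp add: gap_def sum_distrib_left algebra_simps)
  moreover have "x \<in> A_dual" by (rule A_dualI(1)[OF x sn])
  moreover have "word x = c" by (subst A_dualI(2)[OF x sn]) (simp add: of_int_to_int_mod_ring)
  ultimately show ?thesis using that by blast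
qed

text \<open>A rotation keeps word and norm but shifts \<open>phi\<close> by minus the glue of the
  block modulo p. It serves to move a short vector into the sublattice on which p divides
  \<open>phi\<close>.\<close>

definition rotate_block :: "'k::finite \<Rightarrow> ('n::{finite,linorder}, 'k) blocks \<Rightarrow> ('n, 'k) blocks" where
  "rotate_block j x = (\<chi> i a. if i = j then x$i$(nxt a) else x$i$a)"

lemma sum_nxt: "(\<Sum>a\<in>UNIV. f (nxt a)) = (\<Sum>a\<in>UNIV. f (a :: 'n::{finite,linorder}))"
  by (rule sum.reindex_bij_betw) (simp add: bij_betw_def inj_nxt finite_UNIV_inj_surj)

lemma rotate_block_props:
  fixes x :: "('p::{prime_card,linorder}, 'k::finite) blocks"
  assumes x: "x \<in> A_dual"
  shows "rotate_block j x \<in> A_dual" "word (rotate_block j x) = word x" "rotate_block j x \<bullet> rotate_block j x = x \<bullet> x"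
    "\<exists>l. phi (rotate_block j x) = phi x - of_int (to_int_mod_ring (word x $ j)) + real CARD('p) * of_int l"
proof -
  let ?s = "\<lambda>i. to_int_mod_ring (word x $ i)" and ?p = "real CARD('p)"
  obtain n where n: "\<And>i a. x$i$a = of_int (n i a) - of_int (?s i) / real CARD('p)"
    "\<And>i. (\<Sum>a\<in>UNIV. n i a) = ?s i" using A_dual_rep[OF x] by blast
  define m where "m = (\<lambda>i a. if i = j then n i (nxt a) else n i a)"
  have m: "rotate_block j x$i$a = of_int (m i a) - of_int (?s i) / real CARD('p)" for i a
    by (auto simp: rotate_block_def m_def n)
  have sm: "(\<Sum>a\<in>UNIV. m i a) = ?s i" for i
    using sum_nxt[of "n j"] by (cases "i = j") (simp_all add: m_def n(2))
  show "rotate_block j x \<in> A_dual" by (rule A_dualI(1)[OF m sm])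
  show "word (rotate_block j x) = word x" by (subst A_dualI(2)[OF m sm]) (simp add: of_int_to_int_mod_ring)
  have "(\<Sum>a\<in>UNIV. rotate_block j x$i$a * rotate_block j x$i$a) = (\<Sum>a\<in>UNIV. x$i$a * x$i$a)" for i
    using sum_nxt[of "\<lambda>a. x$j$a * x$j$a"] by (cases "i = j") (simp_all add: rotate_block_def)
  then show "rotate_block j x \<bullet> rotate_block j x = x \<bullet> x" by (simp add: inner_blocks)
  have ia: "real (idx a) = real (idx (nxt a)) - 1 + (if idx (nxt a) = 0 then ?p else 0)" for a :: 'p
  proof (cases "idx a + 1 = CARD('p)")
    case True
    then have "idx (nxt a) = 0" by (simp add: idx_nxt)
    then show ?thesis by (simp flip: True)
  next
    case False
    then have "idx (nxt a) = idx a + 1" using idx_less[of a] by (simp add: idx_nxt)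
    then show ?thesis by simp
  qed
  obtain z :: 'p where z: "idx z = 0" using ex_idx[of 0] by auto
  have z': "idx (a :: 'p) = 0 \<longleftrightarrow> a = z" for a using z inj_idx by (metis injD)
  have "(\<Sum>a\<in>UNIV. real (idx a) * x$j$(nxt a)) = (\<Sum>a\<in>UNIV. real (idx a) * x$j$a) + ?p * x$j$z"
  proof -
    have "(\<Sum>a\<in>UNIV. real (idx a) * x$j$(nxt a))
      = (\<Sum>a\<in>UNIV. (real (idx (nxt a)) - 1 + (if idx (nxt a) = 0 then ?p else 0)) * x$j$(nxt a))"
      by (intro sum.cong refl) (metis ia)
    also have "\<dots> = (\<Sum>a\<in>UNIV. (real (idx a) - 1 + (if idx a = 0 then ?p else 0)) * x$j$a)"
      by (rule sum_nxt[of "\<lambda>a. (real (idx a) - 1 + (if idx a = 0 then ?p else 0)) * x$j$a"])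
    also have "\<dots> = (\<Sum>a\<in>UNIV. real (idx a) * x$j$a) - (\<Sum>a\<in>UNIV. x$j$a) + (\<Sum>a\<in>UNIV. if a = z then ?p * x$j$a else 0)"
      unfolding sum_subtractf[symmetric] sum.distrib[symmetric] by (intro sum.cong refl) (auto simp: z' algebra_simps)
    also have "\<dots> = (\<Sum>a\<in>UNIV. real (idx a) * x$j$a) + ?p * x$j$z" using x by (simp add: A_dual_def)
    finally show ?thesis .
  qed
  then have "(\<Sum>a\<in>UNIV. real (idx a) * rotate_block j x $i$a) = (\<Sum>a\<in>UNIV. real (idx a) * x$i$a) + (if i = j then ?p * x$j$z else 0)" for i
    by (cases "i = j") (simp_all add: rotate_block_def)
  then have "phi (rotate_block j x) = phi x + ?p * x$j$z" by (simp add: phi_def sum.distrib)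
  also have "?p * x$j$z = - of_int (?s j) + ?p * of_int (n j z)" by (simp add: n(1) algebra_simps)
  finally show "\<exists>l. phi (rotate_block j x) = phi x - of_int (?s j) + ?p * of_int l"
    by (metis add.assoc diff_conv_add_uminus)
qed

lemma rotate_into_L_B:
  fixes x :: "('p::{prime_card,linorder}, 'k::finite) blocks"
  assumes x: "x \<in> A_dual" "word x $ j \<noteq> 0" and odd: "odd CARD('p)"
  obtains y where "y \<in> A_dual" "word y = word x" "y \<bullet> y = x \<bullet> x" "phi y / real CARD('p) \<in> \<int>"
proof -
  let ?s = "to_int_mod_ring (word x $ j)"
  have it: "\<exists>y\<in>A_dual. word y = word x \<and> y \<bullet> y = x \<bullet> x \<and> (\<exists>l. phi y = phi x - real m * of_int ?s + real CARD('p) * of_int l)" for m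
  proof (induction m)
    case 0
    then show ?case using x by (intro bexI[of _ x]) (auto intro: exI[of _ 0])
  next
    case (Suc m)
    then obtain y l where y: "y \<in> A_dual" "word y = word x" "y \<bullet> y = x \<bullet> x"
      "phi y = phi x - real m * of_int ?s + real CARD('p) * of_int l" by blast
    obtain l' where l': "phi (rotate_block j y) = phi y - of_int ?s + real CARD('p) * of_int l'"
      using rotate_block_props(4)[OF y(1), of j] y(2) by auto
    have "phi (rotate_block j y) = phi x - real (Suc m) * of_int ?s + real CARD('p) * of_int (l + l')"
      unfolding l' y(4) by (simp add: algebra_simps)
    then show ?case using rotate_block_props[OF y(1), of j] y by (intro bexI[of _ "rotate_block j y"] conjI exI[of _ "l + l'"]) simp_all
  qed
  obtain q where q: "phi x = of_int q" using phi_Ints[OF x(1) odd] by (auto elim: Ints_cases)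
  \<comment> \<open>The glue s of block \<open>j\<close> is invertible modulo p, so some number m of
    rotations satisfies m s congruent to \<open>phi x\<close>.\<close>
  have "coprime ?s (int CARD('p))"
  proof -
    have "\<not> int CARD('p) dvd ?s"
      using of_int_mod_ring_eq_0_iff[of ?s, where 'p='p] x(2) by (simp add: of_int_to_int_mod_ring)
    then show ?thesis using prime_card_int[where 'a='p] by (simp add: prime_imp_coprime coprime_commute)
  qed
  then obtain u where "[?s * u = q] (mod int CARD('p))"
    by (metis cong_solve_coprime_int cong_scalar_right mult.assoc mult_1)
  then have "[?s * (u mod int CARD('p)) = q] (mod int CARD('p))"
    by (metis cong_def mod_mult_right_eq)
  then obtain v where v: "?s * (u mod int CARD('p)) = q + int CARD('p) * v"
    by (metis cong_iff_lin cong_sym)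
  define m where "m = nat (u mod int CARD('p))"
  have "int m = u mod int CARD('p)" unfolding m_def by simp
  then have mv: "int m * ?s = q + int CARD('p) * v" using v by (simp add: mult.commute)
  obtain y l where y: "y \<in> A_dual" "word y = word x" "y \<bullet> y = x \<bullet> x"
    "phi y = phi x - real m * of_int ?s + real CARD('p) * of_int l" using it[of m] by blast
  have "phi y = of_int (q - int m * ?s + int CARD('p) * l)" unfolding y(4) q by simp
  also have "\<dots> = real CARD('p) * of_int (l - v)" unfolding mv by (simp add: algebra_simps)
  finally have "phi y / real CARD('p) \<in> \<int>" by simp
  then show ?thesis using that y by blast
qed

text \<open>A norm 2 vector of word 0 is a root e_a - e_b, and 0 < |idx a - idx b| < p excludes it.
  Conversely the minimal vector of a root word can be rotated until p divides \<open>phi\<close>. So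
  the existence of root words is visible in the lattice.\<close>

lemma L_B_has_root_iff:
  fixes C :: "('p::{prime_card,linorder} mod_ring ^ 'k) set"
  assumes odd: "odd CARD('p)"
  shows "(\<exists>x\<in>L_B C. x \<bullet> x = 2) \<longleftrightarrow> (\<exists>c\<in>C. root_word c)"
proof
  assume "\<exists>x\<in>L_B C. x \<bullet> x = 2"
  then obtain x where x: "x \<in> A_dual" "word x \<in> C" "phi x / real CARD('p) \<in> \<int>" "x \<bullet> x = 2"
    by (auto simp: L_B_eq)
  show "\<exists>c\<in>C. root_word c"
  proof (cases "word x = 0")
    case True
    obtain i a b where ab: "a \<noteq> b" "x = rootv i a b"
      using norm2_word_0[OF x(1,4) True] by (elim exE conjE)
    obtain l where "(real (idx a) - real (idx b)) / real CARD('p) = of_int l"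
      using x(3) by (auto simp: ab(2) phi_root elim: Ints_cases)
    then have "real_of_int (int (idx a) - int (idx b)) = of_int (int CARD('p) * l)" by (simp add: field_simps)
    then have e: "int (idx a) - int (idx b) = int CARD('p) * l" by (simp only: of_int_eq_iff)
    have "idx a \<noteq> idx b" using ab(1) inj_idx by (metis injD)
    moreover have "\<bar>int (idx a) - int (idx b)\<bar> < int CARD('p)" using idx_less[of a] idx_less[of b] by auto
    ultimately show ?thesis using e dvd_imp_le_int[of "int (idx a) - int (idx b)" "int CARD('p)"]
      by (cases "l = 0") auto
  next
    case False
    then show ?thesis using norm2_word[OF x(1,4)] x(2) by blast
  qed
next
  assume "\<exists>c\<in>C. root_word c"
  then obtain c where c: "c \<in> C" "root_word c" by blast
  have p: "CARD('p) > 0" by simp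
  obtain x where x: "x \<in> A_dual" "word x = c" "real CARD('p) * (x \<bullet> x) = of_int (\<Sum>i\<in>UNIV. gap (c $ i))"
    using minimal_vector by blast
  have "real CARD('p) * (x \<bullet> x) = of_int (2 * int CARD('p))" using x(3) c(2) by (simp only: root_word_def)
  then have x2: "x \<bullet> x = 2" using p by simp
  have "c \<noteq> 0" using c(2) p by (auto simp: root_word_def gap_def)
  then obtain j where "word x $ j \<noteq> 0" using x(2) by (auto simp: vec_eq_iff)
  then obtain y where "y \<in> A_dual" "word y = word x" "y \<bullet> y = x \<bullet> x" "phi y / real CARD('p) \<in> \<int>"
    using rotate_into_L_B[OF x(1) _ odd] by blast
  then show "\<exists>x\<in>L_B C. x \<bullet> x = 2" using x x2 c(1) by (intro bexI[of _ y]) (auto simp: L_B_eq)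
qed

subsection \<open>Comparing lattices by counting short vectors\<close>

lemma finite_vec_components: "finite S \<Longrightarrow> finite {v :: 'a ^ 'n. \<forall>i. v $ i \<in> S}"
proof -
  assume "finite S"
  then have "finite (vec_lambda ` (PiE (UNIV :: 'n set) (\<lambda>_. S)))" by (intro finite_imageI finite_PiE) auto
  moreover have "{v :: 'a ^ 'n. \<forall>i. v $ i \<in> S} \<subseteq> vec_lambda ` (PiE (UNIV :: 'n set) (\<lambda>_. S))"
    by (auto intro!: image_eqI[of _ _ "vec_nth _"] simp: vec_lambda_eta)
  ultimately show ?thesis by (rule rev_finite_subset)
qed

lemma finite_A_dual_bounded: "finite {x :: ('p::{prime_card,linorder}, 'k::finite) blocks. x \<in> A_dual \<and> x \<bullet> x \<le> r}"
proof -
  define M where "M = \<lceil>real CARD('p) * (r + 1)\<rceil>"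
  define S where "S = (\<lambda>m. real_of_int m / real CARD('p)) ` {-M..M}"
  have fin: "finite {v :: ('p, 'k) blocks. \<forall>i. v $ i \<in> {w. \<forall>a. w $ a \<in> S}}"
    by (intro finite_vec_components) (simp add: S_def)
  have "x $ i $ a \<in> S" if x: "x \<in> A_dual" "x \<bullet> x \<le> r" for x :: "('p, 'k) blocks" and i a
  proof -
    obtain n where n: "\<And>i a. x$i$a = of_int (n i a) - of_int (to_int_mod_ring (word x $ i)) / real CARD('p)"
      using A_dual_rep[OF x(1)] by blast
    define m where "m = int CARD('p) * n i a - to_int_mod_ring (word x $ i)"
    have m: "x $ i $ a = of_int m / real CARD('p)" by (simp add: n m_def field_simps)
    have "(x$i$a)\<^sup>2 \<le> (\<Sum>a\<in>UNIV. x$i$a * x$i$a)"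
      by (simp add: power2_eq_square) (rule member_le_sum, auto)
    also have "\<dots> \<le> x \<bullet> x" unfolding inner_blocks
      by (rule member_le_sum[of i UNIV "\<lambda>i. \<Sum>a\<in>UNIV. x$i$a * x$i$a"]) (auto intro: sum_nonneg)
    finally have sq: "(x$i$a)\<^sup>2 \<le> r" using x(2) by simp
    \<comment> \<open>A bound without square roots: (r + 1)^2 exceeds r for nonnegative r.\<close>
    have "\<bar>x$i$a\<bar> \<le> r + 1"
    proof (rule ccontr)
      assume "\<not> ?thesis"
      then have h: "\<bar>x$i$a\<bar> > r + 1" by simp
      have "0 \<le> r" using sq by (meson order_trans zero_le_power2)
      then have "(r + 1) * (r + 1) \<le> \<bar>x$i$a\<bar> * \<bar>x$i$a\<bar>" using h by (intro mult_mono) auto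
      then have "(r + 1) * (r + 1) \<le> r" using sq by (simp add: power2_eq_square)
      moreover have "(r + 1) * (r + 1) = r * r + 2 * r + 1" by (simp add: algebra_simps)
      moreover have "0 \<le> r * r" by simp
      ultimately show False using \<open>0 \<le> r\<close> by linarith
    qed
    then have "\<bar>real_of_int m\<bar> \<le> real CARD('p) * (r + 1)" by (simp add: m field_simps)
    then have "m \<in> {-M..M}" unfolding M_def by (auto simp: abs_le_iff) linarith+
    then show ?thesis unfolding S_def m by blast
  qed
  then show ?thesis by (intro finite_subset[OF _ fin]) auto
qed

text \<open>Take a vector whose word lies in D but not in C. The vectors of at most its norm form
  finite sets, strictly nested for the two lattices, and an isometry would have to preserve their
  number.\<close>

lemma proper_subcode_not_isomorphic:
  fixes C D :: "('p::{prime_card,linorder} mod_ring ^ 'k) set"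
  assumes odd: "odd CARD('p)" and CD: "C \<subset> D"
  shows "\<not> lattice_isomorphic (L_B C) (L_B D)" "\<not> lattice_isomorphic (L_B D) (L_B C)"
proof -
  obtain c where c: "c \<in> D" "c \<notin> C" using CD by blast
  obtain x where x: "x \<in> A_dual" "word x = c" "phi x / real CARD('p) \<in> \<int>"
    using exists_L_B_word[OF odd] by blast
  define S where "S = (\<lambda>E :: ('p mod_ring ^ 'k) set. {y \<in> L_B E. y \<bullet> y \<le> x \<bullet> x})"
  have fin: "finite (S E)" for E
    by (rule finite_subset[OF _ finite_A_dual_bounded[of "x \<bullet> x"]]) (auto simp: S_def L_B_eq)
  have "S C \<subset> S D" using CD x c by (auto simp: S_def L_B_eq)
  then have less: "card (S C) < card (S D)" using fin by (intro psubset_card_mono)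
  have eq: "card (S E) = card (S F)" if iso: "lattice_isomorphic (L_B E) (L_B F)" for E F
  proof -
    obtain f where f: "bij_betw f (L_B E) (L_B F)" "\<forall>x\<in>L_B E. \<forall>y\<in>L_B E. f x \<bullet> f y = x \<bullet> y"
      using iso unfolding lattice_isomorphic_def by blast
    have "f ` S E = S F"
    proof
      show "f ` S E \<subseteq> S F" using f by (auto simp: S_def bij_betw_def)
      show "S F \<subseteq> f ` S E"
      proof
        fix y assume y: "y \<in> S F"
        then obtain z where z: "z \<in> L_B E" "y = f z" using f(1) by (auto simp: S_def bij_betw_def)
        then show "y \<in> f ` S E" using y f(2) by (auto simp: S_def)
      qed
    qed
    moreover have "inj_on f (S E)" using f(1) by (auto simp: bij_betw_def S_def inj_on_def)
    ultimately show ?thesis by (metis card_image)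
  qed
  show "\<not> lattice_isomorphic (L_B C) (L_B D)" "\<not> lattice_isomorphic (L_B D) (L_B C)"
    using eq less by fastforce+
qed

subsection \<open>Root words\<close>

lemma card_p_cases:
  assumes "odd CARD('p::prime_card)"
  shows "CARD('p) = 3 \<or> CARD('p) = 5 \<or> CARD('p) \<ge> 7"
proof -
  have "prime CARD('p)" by (rule prime_card)
  then have "CARD('p) \<ge> 2" by (rule prime_ge_2_nat)
  then show ?thesis using assms by (cases "CARD('p) = 2 \<or> CARD('p) = 4 \<or> CARD('p) = 6") auto
qed

lemma mod_ring_cases_3:
  assumes "CARD('p::prime_card) = 3"
  shows "(c :: 'p mod_ring) = 0 \<or> c = 1 \<or> c = -1"
proof -
  have "to_int_mod_ring c < 3" using to_int_mod_ring_bounds[of c] assms by simp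
  then have "to_int_mod_ring c = 0 \<or> to_int_mod_ring c = 1 \<or> to_int_mod_ring c = 2"
    using to_int_mod_ring_bounds(1)[of c] by presburger
  then have "c = of_int 0 \<or> c = of_int 1 \<or> c = of_int 2" using of_int_to_int_mod_ring[of c] by metis
  moreover have "(of_int 2 :: 'p mod_ring) = of_int (-1)" unfolding of_int_mod_ring_eq_iff assms by simp
  ultimately show ?thesis by auto
qed

lemma mod_ring_cases_5:
  assumes "CARD('p::prime_card) = 5"
  shows "(c :: 'p mod_ring) = 0 \<or> c = 1 \<or> c = -1 \<or> c = 2 \<or> c = -2"
proof -
  have "to_int_mod_ring c < 5" using to_int_mod_ring_bounds[of c] assms by simp
  then have "to_int_mod_ring c = 0 \<or> to_int_mod_ring c = 1 \<or> to_int_mod_ring c = 2 \<or>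
    to_int_mod_ring c = 3 \<or> to_int_mod_ring c = 4"
    using to_int_mod_ring_bounds(1)[of c] by presburger
  then have "c = of_int 0 \<or> c = of_int 1 \<or> c = of_int 2 \<or> c = of_int 3 \<or> c = of_int 4"
    using of_int_to_int_mod_ring[of c] by metis
  moreover have "(of_int 4 :: 'p mod_ring) = of_int (-1)" "(of_int 3 :: 'p mod_ring) = of_int (-2)"
    unfolding of_int_mod_ring_eq_iff assms by simp_all
  ultimately show ?thesis by auto
qed

lemma three_eq_0: "CARD('p::prime_card) = 3 \<Longrightarrow> (3 :: 'p mod_ring) = 0"
  using of_int_mod_ring_eq_0_iff[of 3, where 'p='p] by simp

lemma five_eq_0: "CARD('p::prime_card) = 5 \<Longrightarrow> (5 :: 'p mod_ring) = 0"
  using of_int_mod_ring_eq_0_iff[of 5, where 'p='p] by simp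

lemma two_neq_0: "odd CARD('p::prime_card) \<Longrightarrow> (2 :: 'p mod_ring) \<noteq> 0"
proof
  assume o: "odd CARD('p)" and "(2 :: 'p mod_ring) = 0"
  then have "int CARD('p) dvd 2" using of_int_mod_ring_eq_0_iff[of 2, where 'p='p] by simp
  then have "CARD('p) dvd 2" by (metis int_dvd_int_iff of_nat_numeral)
  then have "CARD('p) \<le> 2" by (rule dvd_imp_le) simp
  moreover have "CARD('p) \<ge> 2" by (rule prime_ge_2_nat[OF prime_card])
  ultimately show False using o by simp
qed

text \<open>For 2 <= s <= p - 2 the product s (p - s) is smallest at the ends, where it is 2 (p -
  2).\<close>

lemma gap_small:
  fixes c :: "'p::prime_card mod_ring"
  assumes "c \<noteq> 0" "c \<noteq> 1" "c \<noteq> -1"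
  shows "gap c \<ge> 2 * int CARD('p) - 4"
proof -
  let ?s = "to_int_mod_ring c"
  have "?s \<noteq> 0" using assms(1) to_int_mod_ring_eq_0_iff[of c] by blast
  moreover have "?s \<noteq> 1" using assms(2) of_int_to_int_mod_ring[of c] by auto
  moreover have "?s \<noteq> int CARD('p) - 1"
  proof
    assume "?s = int CARD('p) - 1"
    then have "c = of_int (int CARD('p) - 1)" using of_int_to_int_mod_ring[of c] by simp
    also have "\<dots> = of_int (-1)" unfolding of_int_mod_ring_eq_iff by simp
    finally show False using assms(3) by simp
  qed
  ultimately have "2 \<le> ?s" "?s \<le> int CARD('p) - 2" using to_int_mod_ring_bounds[of c] by linarith+
  then have "0 \<le> (?s - 2) * (int CARD('p) - 2 - ?s)" by (intro mult_nonneg_nonneg) auto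
  then show ?thesis unfolding gap_def by (simp add: algebra_simps)
qed

lemma gap_uminus: "gap (- c) = gap (c :: 'p::prime_card mod_ring)"
proof (cases "c = 0")
  case False
  let ?s = "to_int_mod_ring c"
  have "?s \<noteq> 0" using False to_int_mod_ring_eq_0_iff[of c] by blast
  then have b: "0 < ?s" "?s < int CARD('p)" using to_int_mod_ring_bounds[of c] by linarith+
  have "- c = of_int (- ?s)" using of_int_to_int_mod_ring[of c] by simp
  also have "\<dots> = of_int (int CARD('p) - ?s)" unfolding of_int_mod_ring_eq_iff by simp
  finally have "- c = of_int (int CARD('p) - ?s)" .
  then have "to_int_mod_ring (- c) = int CARD('p) - ?s"
    using b by (simp only: of_int_of_int_mod_ring) (simp add: to_int_mod_ring_of_int_mod_ring)
  then show ?thesis by (simp add: gap_def)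
qed simp

lemma gap_numeral: "0 \<le> n \<Longrightarrow> n < int CARD('p) \<Longrightarrow> gap (of_int n :: 'p::prime_card mod_ring) = n * (int CARD('p) - n)"
  unfolding gap_def by (simp only: of_int_of_int_mod_ring) (simp add: to_int_mod_ring_of_int_mod_ring)

lemma gap_1: "gap (1 :: 'p::prime_card mod_ring) = int CARD('p) - 1" "gap (-1 :: 'p mod_ring) = int CARD('p) - 1"
  using gap_numeral[of 1, where 'p='p] prime_gt_1_nat[OF prime_card[where 'a='p]] by (simp_all add: gap_uminus)

definition supp :: "'a::zero ^ 'k \<Rightarrow> 'k set" where
  "supp c = {i. c $ i \<noteq> 0}"

lemma sum_gap_supp: "(\<Sum>i\<in>UNIV. gap (c $ i)) = (\<Sum>i\<in>supp c. gap (c $ i))"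
  by (rule sum.mono_neutral_right) (auto simp: supp_def gap_def)

text \<open>Every nonzero entry costs at least p - 1 out of 2p. For p = 3 this means three entries
  of gap 2. For larger p at most two entries fit; a single one would force p to divide s^2, two
  entries both different from 1 and -1 cost too much, and with one entry equal to 1 or -1 the other
  has gap p + 1 >= 2p - 4, so p = 5. In particular there are no root words for p >= 7.\<close>

lemma root_word_shape:
  fixes w :: "'p::prime_card mod_ring ^ 'k"
  assumes odd: "odd CARD('p)" and w: "root_word w"
  shows "(CARD('p) = 3 \<and> card (supp w) = 3) \<or>
    (CARD('p) = 5 \<and> (\<exists>i j. i \<noteq> j \<and> supp w = {i, j} \<and> (w $ i = 1 \<or> w $ i = -1) \<and> (w $ j = 2 \<or> w $ j = -2)))"
proof -
  let ?p = "int CARD('p)"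
  have s: "(\<Sum>i\<in>supp w. gap (w $ i)) = 2 * ?p" using w by (simp add: root_word_def sum_gap_supp)
  have ge: "?p - 1 \<le> gap (w $ i)" if "i \<in> supp w" for i using that gap_ge by (simp add: supp_def)
  have le: "int (card (supp w)) * (?p - 1) \<le> 2 * ?p"
    using sum_bounded_below[of "supp w" "?p - 1" "\<lambda>i. gap (w $ i)"] ge s by simp
  have p0: "prime CARD('p)" by (rule prime_card)
  consider "CARD('p) = 3" | "CARD('p) \<ge> 5" using card_p_cases[OF odd] by linarith
  then show ?thesis
  proof cases
    case 1
    have "gap (w $ i) = 2" if "i \<in> supp w" for i
      using that mod_ring_cases_3[OF 1, of "w $ i"] gap_1[where 'p='p] 1 by (auto simp: supp_def)
    then have "int (card (supp w)) * 2 = 6" using s 1 by simp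
    then show ?thesis using 1 by simp
  next
    case 2
    have c2: "card (supp w) \<le> 2"
    proof (rule ccontr)
      assume "\<not> ?thesis"
      then have "3 * (?p - 1) \<le> int (card (supp w)) * (?p - 1)" using 2 by (intro mult_right_mono) auto
      then have "3 * (?p - 1) \<le> 2 * ?p" using le by (rule order_trans)
      moreover have "?p \<ge> 5" using 2 by simp
      ultimately show False by presburger
    qed
    have "card (supp w) \<noteq> 0" using s 2 by (auto simp: card_eq_0_iff)
    moreover have "card (supp w) \<noteq> 1"
    proof
      assume "card (supp w) = 1"
      then obtain i where i: "supp w = {i}" by (auto simp: card_1_singleton_iff)
      then have "to_int_mod_ring (w $ i) * (?p - to_int_mod_ring (w $ i)) = 2 * ?p" using s by (simp add: gap_def)
      then have "to_int_mod_ring (w $ i) * to_int_mod_ring (w $ i) = ?p * (to_int_mod_ring (w $ i) - 2)"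
        by (simp add: algebra_simps)
      then have "?p dvd to_int_mod_ring (w $ i) * to_int_mod_ring (w $ i)" by simp
      then have "?p dvd to_int_mod_ring (w $ i)" using p0 by (simp add: prime_dvd_mult_iff)
      then have "(of_int (to_int_mod_ring (w $ i)) :: 'p mod_ring) = 0" by (simp only: of_int_mod_ring_eq_0_iff)
      then have "w $ i = 0" by (simp only: of_int_to_int_mod_ring)
      then show False using i by (auto simp: supp_def)
    qed
    ultimately have "card (supp w) = 2" using c2 by linarith
    then obtain i j where ij: "i \<noteq> j" "supp w = {i, j}" by (auto simp: card_2_iff)
    have nz: "w $ i \<noteq> 0" "w $ j \<noteq> 0" using ij(2) by (auto simp: supp_def)
    have sg: "gap (w $ i) + gap (w $ j) = 2 * ?p" using s ij by simp
    have *: "CARD('p) = 5 \<and> (b = 2 \<or> b = -2)"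
      if "gap a + gap b = 2 * ?p" "a = 1 \<or> a = -1" "b \<noteq> 0" for a b :: "'p mod_ring"
    proof -
      have "gap b = ?p + 1" using that(1,2) gap_1[where 'p='p] by auto
      then have b: "b \<noteq> 1" "b \<noteq> -1" using gap_1[where 'p='p] by auto
      then have "2 * ?p - 4 \<le> ?p + 1" using gap_small[OF that(3) b] \<open>gap b = ?p + 1\<close> by simp
      then have 5: "CARD('p) = 5" using card_p_cases[OF odd] 2 by linarith
      then show ?thesis using mod_ring_cases_5[OF 5, of b] that(3) b by auto
    qed
    consider "w $ i = 1 \<or> w $ i = -1" | "w $ j = 1 \<or> w $ j = -1"
      | "w $ i \<noteq> 1" "w $ i \<noteq> -1" "w $ j \<noteq> 1" "w $ j \<noteq> -1" by blast
    then show ?thesis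
    proof cases
      case 1
      have "CARD('p) = 5 \<and> (w $ j = 2 \<or> w $ j = -2)" by (rule *[OF sg 1 nz(2)])
      then show ?thesis using ij 1
        by - (rule disjI2, rule conjI, simp, rule exI[of _ i], rule exI[of _ j], simp)
    next
      case 2
      have "gap (w $ j) + gap (w $ i) = 2 * ?p" using sg by simp
      then have "CARD('p) = 5 \<and> (w $ i = 2 \<or> w $ i = -2)" by (rule *[OF _ 2 nz(1)])
      moreover have "supp w = {j, i}" using ij(2) by blast
      ultimately show ?thesis using ij(1) 2
        by - (rule disjI2, rule conjI, simp, rule exI[of _ j], rule exI[of _ i], simp)
    next
      case 3
      have "2 * (2 * ?p - 4) \<le> 2 * ?p" using gap_small[OF nz(1) 3(1,2)] gap_small[OF nz(2) 3(3,4)] sg by presburger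
      moreover have "?p \<ge> 5" using \<open>CARD('p) \<ge> 5\<close> by simp
      ultimately show ?thesis by presburger
    qed
  qed
qed

lemma root_word_3: "CARD('p::prime_card) = 3 \<Longrightarrow> root_word (w :: 'p mod_ring ^ 'k) \<longleftrightarrow> card (supp w) = 3"
proof -
  assume 3: "CARD('p) = 3"
  have "gap (w $ i) = 2" if "i \<in> supp w" for i
    using that mod_ring_cases_3[OF 3, of "w $ i"] gap_1[where 'p='p] 3 by (auto simp: supp_def)
  then show ?thesis using 3 by (auto simp: root_word_def sum_gap_supp)
qed

section \<open>Overlaps of root words in a self-orthogonal code\<close>

lemma sum_supp: "supp c \<subseteq> T \<Longrightarrow> (\<Sum>i\<in>UNIV. c $ i * d i) = (\<Sum>i\<in>T. c $ i * d i)" for c :: "'a::semiring_0 ^ 'k"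
proof (rule sum.mono_neutral_right)
  assume s: "supp c \<subseteq> T"
  show "\<forall>i\<in>UNIV - T. c $ i * d i = 0"
  proof
    fix i assume "i \<in> UNIV - T"
    then have "c $ i = 0" using s by (auto simp: supp_def)
    then show "c $ i * d i = 0" by simp
  qed
qed auto

text \<open>One word suffices and no transitive closure is taken: in a self-orthogonal code the
  relation is transitive by \<open>root_rel_trans\<close>.\<close>

definition root_rel :: "('p::prime_card mod_ring ^ 'k) set \<Rightarrow> 'k \<Rightarrow> 'k \<Rightarrow> bool" where
  "root_rel G i j \<longleftrightarrow> i = j \<or> (\<exists>w\<in>G. root_word w \<and> i \<in> supp w \<and> j \<in> supp w)"

lemma root_rel_refl: "root_rel G i i" by (simp add: root_rel_def)

lemma root_rel_sym: "root_rel G i j \<Longrightarrow> root_rel G j i" by (auto simp: root_rel_def)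

lemma code_closed:
  assumes "is_code C"
  shows "0 \<in> C" "x \<in> C \<Longrightarrow> y \<in> C \<Longrightarrow> x + y \<in> C" "x \<in> C \<Longrightarrow> y \<in> C \<Longrightarrow> x - y \<in> C" "x \<in> C \<Longrightarrow> a *s x \<in> C"
    "x \<in> C \<Longrightarrow> - x \<in> C"
  using assms unfolding is_code_def
  by (auto intro: vec.subspace_0 vec.subspace_add vec.subspace_diff vec.subspace_scale vec.subspace_neg)

lemma self_orthogonalD:
  "self_orthogonal C \<Longrightarrow> x \<in> C \<Longrightarrow> y \<in> C \<Longrightarrow> (\<Sum>i\<in>UNIV. x $ i * y $ i) = 0"
  by (auto simp: self_orthogonal_def dual_code_def)

text \<open>A single common coordinate would contribute a nonzero product to the vanishing dot
  product. So two ternary root words that meet in different supports share exactly two coordinates,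
  with opposite products there.\<close>

lemma overlap_3:
  fixes w w' :: "'p::prime_card mod_ring ^ 'k"
  assumes p: "CARD('p) = 3" and w: "card (supp w) = 3" "card (supp w') = 3"
    and orth: "(\<Sum>i\<in>UNIV. w $ i * w' $ i) = 0" and j: "j \<in> supp w" "j \<in> supp w'"
    and i: "i \<in> supp w" "i \<notin> supp w'"
  obtains m l where "supp w = {i, j, m}" "supp w' = {j, m, l}" "distinct [i, j, m, l]"
    "w $ j * w' $ j + w $ m * w' $ m = 0"
proof -
  have ij: "i \<noteq> j" using i j by auto
  have fin: "finite (supp w)" "finite (supp w')" by simp_all
  have "card (supp w - {i, j}) = 1" using w(1) i(1) j(1) ij by (simp add: card_Diff_subset)
  then obtain m where m: "supp w - {i, j} = {m}" by (auto simp: card_1_singleton_iff)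
  have sw: "supp w = {i, j, m}" and mij: "m \<noteq> i" "m \<noteq> j" using m i(1) j(1) by auto
  have o: "w $ j * w' $ j + w $ m * w' $ m = 0"
    using orth sum_supp[of w "{i, j, m}" "\<lambda>i. w' $ i"] sw ij mij i(2) by (auto simp: supp_def)
  have "w $ j * w' $ j \<noteq> 0" using j by (simp add: supp_def)
  then have "m \<in> supp w'" using o by (auto simp: supp_def)
  then have "card (supp w' - {j, m}) = 1" using w(2) j(2) mij by (simp add: card_Diff_subset)
  then obtain l where l: "supp w' - {j, m} = {l}" by (auto simp: card_1_singleton_iff)
  have sw': "supp w' = {j, m, l}" and "l \<noteq> j" "l \<noteq> m" using l j(2) \<open>m \<in> supp w'\<close> by auto
  moreover have "l \<noteq> i" using i(2) sw' by auto
  ultimately show ?thesis using that[OF sw sw'] o ij mij by auto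
qed

text \<open>For p = 3, w - (w_j w'_j) w' vanishes at \<open>j\<close> since squares of nonzero
  elements are 1. At the other common coordinate the products have opposite signs, so the entry
  doubles instead of cancelling; the result is a root word through \<open>i\<close> and
  \<open>l\<close>. For p = 5 orthogonality forces root words that meet to have equal
  supports.\<close>

lemma root_rel_trans:
  fixes G :: "('p::prime_card mod_ring ^ 'k) set"
  assumes G: "is_code G" "self_orthogonal G" and odd: "odd CARD('p)"
    and ij: "root_rel G i j" and jl: "root_rel G j l"
  shows "root_rel G i l"
proof (cases "i = j \<or> j = l \<or> i = l")
  case False
  then obtain w w' where w: "w \<in> G" "root_word w" "i \<in> supp w" "j \<in> supp w"
    and w': "w' \<in> G" "root_word w'" "j \<in> supp w'" "l \<in> supp w'"
    using ij jl by (auto simp: root_rel_def)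
  have orth: "(\<Sum>i\<in>UNIV. w $ i * w' $ i) = 0" using self_orthogonalD[OF G(2) w(1) w'(1)] .
  show ?thesis
  proof (cases "i \<in> supp w' \<or> l \<in> supp w")
    case True
    then show ?thesis using w w' by (auto simp: root_rel_def)
  next
    case no: False
    show ?thesis
    proof (cases "CARD('p) = 3")
      case 3: True
      obtain m l' where m: "supp w = {i, j, m}" "supp w' = {j, m, l'}" "distinct [i, j, m, l']"
        "w $ j * w' $ j + w $ m * w' $ m = 0"
        using overlap_3[OF 3 _ _ orth w(4) w'(3) w(3)] w(2) w'(2) no by (auto simp: root_word_3[OF 3])
      have l': "l' = l" using m w'(4) no False by auto
      define u where "u = w - (w $ j * w' $ j) *s w'"
      have uG: "u \<in> G" unfolding u_def by (intro code_closed[OF G(1)] w w')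
      have sq: "c * c = 1" if "c \<noteq> 0" for c :: "'p mod_ring" using mod_ring_cases_3[OF 3, of c] that by auto
      have nz: "w $ i \<noteq> 0" "w $ j \<noteq> 0" "w $ m \<noteq> 0" "w' $ j \<noteq> 0" "w' $ m \<noteq> 0" "w' $ l \<noteq> 0"
        using w w' m l' by (auto simp: supp_def)
      have z: "w' $ i = 0" "w $ l = 0" using no by (auto simp: supp_def)
      have "u $ j = w $ j * (1 - w' $ j * w' $ j)" by (simp add: u_def algebra_simps)
      then have uj: "u $ j = 0" using sq[OF nz(4)] by simp
      have "u $ m = w $ m + w $ m * (w' $ m * w' $ m)"
        using m(4) by (simp add: u_def algebra_simps add_eq_0_iff)
      then have um: "u $ m \<noteq> 0" using sq[OF nz(5)] nz(3) two_neq_0[OF odd] by (simp flip: mult_2)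
      have ui: "u $ i \<noteq> 0" using z nz by (simp add: u_def)
      have ul: "u $ l \<noteq> 0" using z nz by (simp add: u_def)
      have "u $ t = 0" if "t \<notin> {i, j, m, l}" for t
      proof -
        have "t \<notin> supp w" "t \<notin> supp w'" using that m l' by auto
        then show ?thesis by (simp add: u_def supp_def)
      qed
      then have "supp u = {i, m, l}" using uj um ui ul by (auto simp: supp_def)
      then have "card (supp u) = 3" using m(3) l' by simp
      then show ?thesis using uG ui ul by (auto simp: root_rel_def root_word_3[OF 3] supp_def)
    next
      case n3: False
      then have "card (supp w) = 2"
        using root_word_shape[OF odd w(2)] by auto
      then have sw: "supp w = {i, j}" using w False by (auto simp: card_2_iff doubleton_eq_iff)
      have "w $ i * w' $ i + w $ j * w' $ j = 0"
        using orth sum_supp[of w "{i, j}" "\<lambda>i. w' $ i"] sw False by simp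
      then show ?thesis using no w w' by (auto simp: supp_def)
    qed
  qed
next
  case True
  then show ?thesis using ij jl root_rel_refl by blast
qed

subsection \<open>Pairs of codes with isometric lattices\<close>

lemma A_dual_iff: "x \<in> A_dual \<longleftrightarrow> x \<in> V0 \<and> (\<forall>i a b. x \<bullet> rootv i a b \<in> \<int>)"
  by (auto simp: A_dual_def V0_def inner_diff_right inner_ebar)

lemma A_dual_sum: "(\<And>i. i \<in> F \<Longrightarrow> f i \<in> A_dual) \<Longrightarrow> (\<Sum>i\<in>F. f i) \<in> A_dual"
  by (induction F rule: infinite_finite_induct) (auto simp: A_dual_0 A_dual_add)

lemma ebar_V0: "ebar i a \<in> V0" for i :: "'k::finite" and a :: "'n::finite"
proof -
  have "(\<Sum>b\<in>UNIV. (if b = a then 1 else 0) - 1 / real CARD('n)) = 0"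
    by (simp add: sum_subtractf)
  then have "(\<Sum>b\<in>UNIV. ebar i a $ j $ b) = 0" for j by (cases "j = i") (simp_all add: ebar_nth)
  then show ?thesis by (simp add: V0_def)
qed

lemma root_V0: "rootv i a b \<in> V0"
  by (simp add: ebar_V0 subspace_V0 subspace_diff)

lemma funpow_nxt: "idx ((nxt ^^ n) (a :: 'n::{finite,linorder})) = (idx a + n) mod CARD('n)"
  by (induction n) (auto simp: idx_nxt idx_less mod_Suc_eq)

lemma nxt_induct:
  assumes "P (a :: 'n::{finite,linorder})" "\<And>b. P b \<Longrightarrow> P (nxt b)"
  shows "P b"
proof -
  have P: "P ((nxt ^^ n) a)" for n by (induction n) (auto simp: assms)
  have "idx ((nxt ^^ (CARD('n) - idx a + idx b)) a) = idx b"
    unfolding funpow_nxt using idx_less[of a] idx_less[of b] by simp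
  then have "(nxt ^^ (CARD('n) - idx a + idx b)) a = b" by (rule injD[OF inj_idx])
  then show ?thesis using P by metis
qed

lemma word_0_expand:
  fixes x :: "('p::{prime_card,linorder}, 'k::finite) blocks"
  assumes "x \<in> A_dual" "word x = 0"
  obtains n :: "'k \<Rightarrow> 'p \<Rightarrow> int" where "x = (\<Sum>i\<in>UNIV. \<Sum>a\<in>UNIV. of_int (n i a) *\<^sub>R rootv i a undefined)"
proof -
  obtain n where n0: "\<And>i a. x$i$a = of_int (n i a) - of_int (to_int_mod_ring (word x $ i)) / real CARD('p)"
    "\<And>i. (\<Sum>a\<in>UNIV. n i a) = to_int_mod_ring (word x $ i)" using A_dual_rep[OF assms(1)] by blast
  have n: "\<And>i a. x$i$a = of_int (n i a)" "\<And>i. (\<Sum>a\<in>UNIV. n i a) = 0" using n0 by (simp_all add: assms(2))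
  have "x = (\<Sum>i\<in>UNIV. \<Sum>a\<in>UNIV. of_int (n i a) *\<^sub>R ebar i a)"
    using V0_expand[OF A_dual_V0[OF assms(1)]] by (simp add: n(1))
  also have "\<dots> = (\<Sum>i\<in>UNIV. (\<Sum>a\<in>UNIV. of_int (n i a) *\<^sub>R ebar i a) - of_int (\<Sum>a\<in>UNIV. n i a) *\<^sub>R ebar i undefined)"
    by (simp add: n(2))
  also have "\<dots> = (\<Sum>i\<in>UNIV. \<Sum>a\<in>UNIV. of_int (n i a) *\<^sub>R rootv i a undefined)"
    by (intro sum.cong refl) (simp add: scaleR_diff_right sum_subtractf scaleR_sum_left)
  finally show ?thesis by (rule that)
qed

text \<open>\<open>W\<close> runs from the space of D to the space of C. Both maps are linear on all
  blocks but controlled only on \<open>V0\<close>, the common span of the two lattices. The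
  assumptions are symmetric (\<open>swap\<close>), so each result also holds with the codes
  exchanged.\<close>

locale frame_pair =
  fixes C D :: "('p::{prime_card,linorder} mod_ring ^ 'k::finite) set"
    and W W' :: "('p, 'k) blocks \<Rightarrow> ('p, 'k) blocks"
  assumes odd: "odd CARD('p)"
    and C: "is_code C" "self_orthogonal C" and D: "is_code D" "self_orthogonal D"
    and lin: "linear W" "linear W'"
    and V0: "x \<in> V0 \<Longrightarrow> W x \<in> V0" "x \<in> V0 \<Longrightarrow> W' x \<in> V0"
    and inverse: "x \<in> V0 \<Longrightarrow> W' (W x) = x" "x \<in> V0 \<Longrightarrow> W (W' x) = x"
    and inner: "x \<in> V0 \<Longrightarrow> y \<in> V0 \<Longrightarrow> W x \<bullet> W y = x \<bullet> y"
    and L_B: "x \<in> L_B D \<Longrightarrow> W x \<in> L_B C" "x \<in> L_B C \<Longrightarrow> W' x \<in> L_B D"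
begin

lemma inner': "x \<in> V0 \<Longrightarrow> y \<in> V0 \<Longrightarrow> W' x \<bullet> W' y = x \<bullet> y"
  using inner[of "W' x" "W' y"] V0 inverse by simp

lemma adjoint: "x \<in> V0 \<Longrightarrow> y \<in> V0 \<Longrightarrow> W x \<bullet> y = x \<bullet> W' y"
  using inner[of x "W' y"] V0 inverse by simp

lemma swap: "frame_pair D C W' W"
  by (rule frame_pair.intro) (assumption | rule odd C D lin V0 inverse inner' L_B)+

lemmas linear_simps' = linear_add[OF lin(1)] linear_diff[OF lin(1)] linear_scale[OF lin(1)] linear_0[OF lin(1)] linear_neg[OF lin(1)]
  linear_add[OF lin(2)] linear_diff[OF lin(2)] linear_scale[OF lin(2)] linear_0[OF lin(2)] linear_neg[OF lin(2)]

lemma L_B_dual: "x \<in> L_B C \<Longrightarrow> x \<in> A_dual" "x \<in> L_B C \<Longrightarrow> x \<in> V0" "x \<in> L_B D \<Longrightarrow> x \<in> A_dual" "x \<in> L_B D \<Longrightarrow> x \<in> V0"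
  by (auto simp: L_B_eq A_dual_V0)

text \<open>The image of a difference of cyclic roots lies in \<open>A_dual\<close> and so pairs
  integrally with every root. This permits changing the left root; the adjoint \<open>W'\<close>
  permits changing the right one.\<close>

lemma inner_root_const:
  "W (rootv j a (nxt a)) \<bullet> rootv i b (nxt b) - W (rootv j' a' (nxt a')) \<bullet> rootv i' b' (nxt b') \<in> \<int>"
proof -
  let ?r = "\<lambda>j a. rootv j a (nxt a)"
  have "W (?r j a - ?r j' a') \<in> A_dual"
    by (intro L_B_dual L_B root_in_L_B code_closed D)
  then have 1: "W (?r j a) \<bullet> ?r i b - W (?r j' a') \<bullet> ?r i b \<in> \<int>"
    unfolding A_dual_iff linear_diff[OF lin(1), of "?r j a" "?r j' a'"] inner_diff_left[symmetric] by blast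
  have "W' (?r i b - ?r i' b') \<in> A_dual"
    by (intro L_B_dual L_B root_in_L_B code_closed C)
  then have "?r j' a' \<bullet> W' (?r i b - ?r i' b') \<in> \<int>"
    unfolding A_dual_iff inner_commute[of "?r j' a'"] by blast
  then have 2: "W (?r j' a') \<bullet> ?r i b - W (?r j' a') \<bullet> ?r i' b' \<in> \<int>"
    using adjoint[OF root_V0 subspace_diff[OF subspace_V0 root_V0 root_V0], of j' a' "nxt a'" i b "nxt b" i' b' "nxt b'"]
    by (simp only: inner_diff_right[symmetric])
  show ?thesis using Ints_add[OF 1 2] by simp
qed

end

locale integral_frame_pair = frame_pair +
  assumes W_root: "W (rootv j a b) \<in> A_dual"
begin

lemma W'_root: "W' (rootv j a b) \<in> A_dual"
proof -
  have "W' (rootv j a b) \<bullet> rootv i c d \<in> \<int>" for i c d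
  proof -
    have "W (rootv i c d) \<bullet> rootv j a b \<in> \<int>" using W_root A_dual_iff by blast
    moreover have "W (rootv i c d) \<bullet> rootv j a b = W' (rootv j a b) \<bullet> rootv i c d"
      unfolding adjoint[OF root_V0 root_V0] by (rule inner_commute)
    ultimately show ?thesis by simp
  qed
  then show ?thesis unfolding A_dual_iff using V0 root_V0 by blast
qed

lemma swap_integral: "integral_frame_pair D C W' W"
  using swap W'_root by (simp add: integral_frame_pair_def integral_frame_pair_axioms_def)

lemma W_A:
  assumes "x \<in> A_dual" "word x = 0"
  shows "W x \<in> A_dual"
proof -
  obtain n where n: "x = (\<Sum>i\<in>UNIV. \<Sum>a\<in>UNIV. of_int (n i a) *\<^sub>R rootv i a undefined)"
    using word_0_expand[OF assms] by blast
  show ?thesis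
    unfolding n linear_sum[OF lin(1)] linear_scale[OF lin(1)]
    using A_dual_of_int[OF W_root] by (intro A_dual_sum) blast
qed

text \<open>The glue code, in the coordinates of C, of the lattice Q generated by the root lattice
  and its image under \<open>W\<close>. It need not be contained in C.\<close>

definition Gam :: "('a mod_ring ^ 'b) set" where
  "Gam = {word (W x) | x. x \<in> A_dual \<and> word x = 0}"

lemma Gam_code: "is_code Gam"
proof -
  have 0: "0 \<in> Gam" unfolding Gam_def using A_dual_0 word_0 by (force simp: linear_simps')
  have add: "u + v \<in> Gam" if uv: "u \<in> Gam" "v \<in> Gam" for u v
  proof -
    obtain x y where x: "u = word (W x)" "x \<in> A_dual" "word x = 0" and y: "v = word (W y)" "y \<in> A_dual" "word y = 0"
      using uv by (auto simp: Gam_def)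
    then have "u + v = word (W (x + y))" by (simp add: linear_simps' word_add W_A)
    then show ?thesis unfolding Gam_def using x y A_dual_add[of x y] word_add[of x y] by force
  qed
  have scale: "c *s u \<in> Gam" if u: "u \<in> Gam" for c u
  proof -
    obtain x where x: "u = word (W x)" "x \<in> A_dual" "word x = 0" using u by (auto simp: Gam_def)
    let ?n = "to_int_mod_ring c"
    have "c *s u = word (W (of_int ?n *\<^sub>R x))"
      using A_dual_of_int[OF W_A[OF x(2,3)], of ?n] x by (simp add: linear_simps' of_int_to_int_mod_ring)
    then show ?thesis unfolding Gam_def using A_dual_of_int[OF x(2), of ?n] x(3) by force
  qed
  show ?thesis unfolding is_code_def vec.subspace_def using 0 add scale by blast
qed

lemma Gam_orthogonal: "self_orthogonal Gam"
proof -
  have "(\<Sum>i\<in>UNIV. u $ i * v $ i) = 0" if uv: "u \<in> Gam" "v \<in> Gam" for u v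
  proof -
    obtain x y where x: "u = word (W x)" "x \<in> A_dual" "word x = 0" and y: "v = word (W y)" "y \<in> A_dual" "word y = 0"
      using uv by (auto simp: Gam_def)
    have "x \<bullet> y \<in> \<int>" using inner_Ints_iff[OF x(2) y(2)] x(3) by simp
    then have "W x \<bullet> W y \<in> \<int>" using inner x y by (simp add: A_dual_V0)
    then show ?thesis using inner_Ints_iff[OF W_A W_A] x y by simp
  qed
  then show ?thesis by (auto simp: self_orthogonal_def dual_code_def)
qed

text \<open>Every word of C is the word of some z in \<open>L_B C\<close>. Its image under
  \<open>W'\<close> lies in \<open>A_dual\<close> and so pairs integrally with the root
  lattice.\<close>

lemma C_orthogonal_Gam: "c \<in> C \<Longrightarrow> w \<in> Gam \<Longrightarrow> (\<Sum>i\<in>UNIV. c $ i * w $ i) = 0"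
proof -
  assume c: "c \<in> C" and w: "w \<in> Gam"
  obtain x where x: "w = word (W x)" "x \<in> A_dual" "word x = 0" using w by (auto simp: Gam_def)
  obtain z where z: "z \<in> A_dual" "word z = c" "phi z / real CARD('a) \<in> \<int>" using exists_L_B_word[OF odd] by blast
  then have zC: "z \<in> L_B C" using c by (simp add: L_B_eq)
  have "W' z \<bullet> x \<in> \<int>" using inner_Ints_iff[OF L_B_dual(3)[OF L_B(2)[OF zC]] x(2)] x(3) by simp
  then have "z \<bullet> W x \<in> \<int>" using adjoint[of x z] x z by (simp add: A_dual_V0 inner_commute)
  then show ?thesis using inner_Ints_iff[OF z(1) W_A[OF x(2,3)]] z x by simp
qed

text \<open>A vector with word in \<open>Gam\<close> is \<open>W x\<close> plus a vector n of the
  root lattice, and \<open>W'\<close> sends it to x + \<open>W' n\<close>. So Q is carried onto the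
  corresponding lattice for the exchanged pair.\<close>

lemma W_Q: "y \<in> A_dual \<Longrightarrow> word y \<in> Gam \<Longrightarrow> W' y \<in> A_dual \<and> word (W' y) \<in> {word (W' x) | x. x \<in> A_dual \<and> word x = 0}"
proof -
  interpret sw: integral_frame_pair D C W' W by (rule swap_integral)
  assume y: "y \<in> A_dual" "word y \<in> Gam"
  then obtain x where x: "word y = word (W x)" "x \<in> A_dual" "word x = 0" by (auto simp: Gam_def)
  define n where "n = y - W x"
  have n: "n \<in> A_dual" "word n = 0" using x y W_A[OF x(2,3)] by (auto simp: n_def A_dual_diff word_diff)
  have "W' y = x + W' n" using inverse(1)[OF A_dual_V0[OF x(2)]] by (simp add: n_def linear_simps')
  then show ?thesis using x n sw.W_A[OF n] by (auto simp: A_dual_add word_add)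
qed

text \<open>The dual statement to \<open>W_Q\<close>: the vectors whose words are orthogonal to
  \<open>Gam\<close> form the dual of Q, and \<open>W'\<close> carries duals to duals.\<close>

lemma W_Q_dual:
  assumes x: "x \<in> A_dual" and orth: "\<And>w. w \<in> Gam \<Longrightarrow> (\<Sum>i\<in>UNIV. word x $ i * w $ i) = 0"
  shows "W' x \<in> A_dual"
    "w \<in> {word (W' x) | x. x \<in> A_dual \<and> word x = 0} \<Longrightarrow> (\<Sum>i\<in>UNIV. word (W' x) $ i * w $ i) = 0"
proof -
  interpret sw: integral_frame_pair D C W' W by (rule swap_integral)
  have "W' x \<bullet> rootv i a b \<in> \<int>" for i a b
  proof -
    have "word (W (rootv i a b)) \<in> Gam" unfolding Gam_def using root_A_dual by blast
    then have "x \<bullet> W (rootv i a b) \<in> \<int>" using inner_Ints_iff[OF x W_root] orth by blast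
    then show ?thesis using adjoint[OF root_V0 A_dual_V0[OF x], of i a b] by (simp add: inner_commute)
  qed
  then show d: "W' x \<in> A_dual" unfolding A_dual_iff using V0 A_dual_V0[OF x] by blast
  assume "w \<in> {word (W' x) | x. x \<in> A_dual \<and> word x = 0}"
  then obtain n where n: "w = word (W' n)" "n \<in> A_dual" "word n = 0" by blast
  have "x \<bullet> n \<in> \<int>" using inner_Ints_iff[OF x n(2)] n(3) by simp
  then have "W' x \<bullet> W' n \<in> \<int>" using inner' x n by (simp add: A_dual_V0)
  then show "(\<Sum>i\<in>UNIV. word (W' x) $ i * w $ i) = 0"
    using inner_Ints_iff[OF d sw.W_A[OF n(2,3)]] n by simp
qed

end

subsection \<open>Classes of coordinates linked by root words\<close>

lemma sum_dot_supp: "supp w \<subseteq> T \<Longrightarrow> (\<Sum>i\<in>UNIV. s $ i * w $ i) = (\<Sum>i\<in>T. s $ i * w $ i)" for w :: "'a::comm_semiring_0 ^ 'k"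
  using sum_supp[of w T "\<lambda>i. s $ i"] by (simp add: mult.commute)

lemma square_one_cancel:
  fixes x y :: "'a::comm_ring_1"
  assumes "x * x = 1"
  shows "x * (x * y) = y" "x * y * x = y"
proof -
  show "x * (x * y) = y" using assms by (simp only: mult.assoc[symmetric] mult_1)
  then show "x * y * x = y" by (simp only: mult.commute)
qed

text \<open>Orthogonality makes a class the support of a root word of length two. A word orthogonal
  to G is then proportional to \<open>w\<close> on the class, because both satisfy the same single
  equation. Scaling \<open>w\<close> so that s takes the value 1 on it makes the factor equal to the
  value of s on the class.\<close>

lemma class_form_2:
  fixes G :: "('p::prime_card mod_ring ^ 'k) set"
  assumes G: "is_code G" "self_orthogonal G" and p: "CARD('p) = 5"
    and w0: "w0 \<in> G" "root_word w0" "i \<in> supp w0" and T: "T = {j. root_rel G i j}"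
    and w1: "w1 \<in> G" "root_word w1" "supp w1 \<subseteq> T" "(\<Sum>i\<in>UNIV. s $ i * w1 $ i) \<noteq> 0"
  obtains w i0 i1 e0 e1 where "w \<in> G" "i0 \<noteq> i1" "T = {i0, i1}" "e0 \<in> {1, -1}" "e1 \<in> {1, -1}"
    "supp w = T" "w $ i0 = e0" "w $ i1 = 2 * e1"
    "\<forall>c. (\<forall>g\<in>G. (\<Sum>i\<in>UNIV. c $ i * g $ i) = 0) \<longrightarrow>
      c $ i0 = e0 * (\<Sum>i\<in>T. s $ i * c $ i) \<and> c $ i1 = 2 * e1 * (\<Sum>i\<in>T. s $ i * c $ i)"
proof -
  have odd: "odd CARD('p)" by (simp add: p)
  have shape: "\<exists>a b. a \<noteq> b \<and> supp w = {a, b} \<and> (w $ a = 1 \<or> w $ a = -1) \<and> (w $ b = 2 \<or> w $ b = -2)"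
    if "root_word w" for w :: "'p mod_ring ^ 'k" using root_word_shape[OF odd that] p by simp
  have same: "supp w' = supp w" if w: "w \<in> G" "root_word w" "w' \<in> G" "root_word w'" "j \<in> supp w" "j \<in> supp w'" for w w' j
  proof -
    obtain a b where a: "a \<noteq> b" "supp w = {a, b}" using shape[OF w(2)] by blast
    obtain a' b' where a': "a' \<noteq> b'" "supp w' = {a', b'}" using shape[OF w(4)] by blast
    have "w $ a * w' $ a + w $ b * w' $ b = 0"
      using self_orthogonalD[OF G(2) w(1,3)] sum_supp[of w "{a, b}" "\<lambda>i. w' $ i"] a by simp
    then have "a \<in> supp w' \<longleftrightarrow> b \<in> supp w'" using a(2) by (auto simp: supp_def)
    then have "{a, b} \<subseteq> {a', b'}" using a a' w(5,6) by auto
    then show ?thesis using a a' by auto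
  qed
  have Tw: "T = supp w0"
  proof
    show "T \<subseteq> supp w0" unfolding T root_rel_def using same[OF w0(1,2)] w0(3) by blast
    show "supp w0 \<subseteq> T" unfolding T root_rel_def using w0 by blast
  qed
  have sw1: "supp w1 = T"
  proof -
    obtain a b where "supp w1 = {a, b}" using shape[OF w1(2)] by blast
    then show ?thesis using same[OF w0(1,2) w1(1,2), of a] w1(3) Tw by auto
  qed
  obtain a b where ab: "a \<noteq> b" "T = {a, b}" "w1 $ a = 1 \<or> w1 $ a = -1" "w1 $ b = 2 \<or> w1 $ b = -2"
    using shape[OF w1(2)] sw1 by blast
  let ?t = "\<Sum>i\<in>UNIV. s $ i * w1 $ i"
  define w where "w = inverse ?t *s w1"
  have wG: "w \<in> G" unfolding w_def by (intro code_closed G w1)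
  have sw: "supp w = T" using w1(4) sw1 by (auto simp: w_def supp_def)
  have sv: "(\<Sum>i\<in>T. s $ i * w $ i) = 1"
  proof -
    have "(\<Sum>i\<in>UNIV. s $ i * w $ i) = inverse ?t * ?t"
      by (simp add: w_def sum_distrib_left mult.left_commute)
    also have "\<dots> = 1" using w1(4) by (rule left_inverse)
    finally show ?thesis using sum_dot_supp[of w T s] sw by simp
  qed
  have inv: "inverse ?t = 1 \<or> inverse ?t = -1 \<or> inverse ?t = 2 \<or> inverse ?t = -2"
    using mod_ring_cases_5[OF p, of "inverse ?t"] w1(4) by auto
  have "(4 :: 'p mod_ring) + 1 = 0" using five_eq_0[OF p] by simp
  then have four: "(4 :: 'p mod_ring) = -1" by (simp only: eq_neg_iff_add_eq_0)
  \<comment> \<open>Since 4 = -1, scaling by 2 or -2 turns entries 1, -1 into 2, -2 and conversely.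
    So the scaled word still has one entry of each kind, possibly with the two coordinates
    exchanged.\<close>
  obtain i0 i1 e0 e1 where i: "i0 \<noteq> i1" "T = {i0, i1}" "e0 \<in> {1, -1}" "e1 \<in> {1, -1}" "w $ i0 = e0" "w $ i1 = 2 * e1"
  proof (cases "inverse ?t = 1 \<or> inverse ?t = -1")
    case True
    then have "w $ a \<in> {1, -1}" "w $ b = 2 * 1 \<or> w $ b = 2 * -1" using ab by (auto simp: w_def)
    then show ?thesis using that[OF ab(1,2)] by (metis insertCI)
  next
    case False
    then have "w $ b \<in> {1, -1}" "w $ a = 2 * 1 \<or> w $ a = 2 * -1" using ab inv four by (auto simp: w_def)
    moreover have "b \<noteq> a" "T = {b, a}" using ab by auto
    ultimately show ?thesis using that by (metis insertCI)
  qed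
  have "c $ i0 = e0 * (\<Sum>i\<in>T. s $ i * c $ i) \<and> c $ i1 = 2 * e1 * (\<Sum>i\<in>T. s $ i * c $ i)"
    if c: "\<And>g. g \<in> G \<Longrightarrow> (\<Sum>i\<in>UNIV. c $ i * g $ i) = 0" for c
  proof -
    have "(\<Sum>i\<in>UNIV. c $ i * w $ i) = 0" using c wG by blast
    then have o: "c $ i0 * e0 + c $ i1 * (2 * e1) = 0"
      using sum_dot_supp[of w T c] sw i by simp
    define X where "X = e0 * c $ i0"
    have ee: "e0 * e0 = 1" "e1 * e1 = 1" using i by auto
    have c0: "c $ i0 = X * w $ i0" using square_one_cancel(2)[OF ee(1)] by (simp only: X_def i(5))
    have "c $ i1 = X * w $ i1"
    proof -
      have "2 * (e1 * c $ i1) = - X" using o by (simp add: X_def add_eq_0_iff2 algebra_simps)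
      then have "2 * (2 * (e1 * c $ i1)) = 2 * - X" by (rule arg_cong)
      then have "4 * (e1 * c $ i1) = - (2 * X)" by simp
      then have "e1 * c $ i1 = 2 * X" by (simp add: four)
      then have "e1 * (e1 * c $ i1) = e1 * (2 * X)" by (rule arg_cong)
      then have "c $ i1 = e1 * (2 * X)" by (simp only: square_one_cancel(1)[OF ee(2)])
      then show ?thesis by (simp add: i(6) algebra_simps)
    qed
    then have "(\<Sum>i\<in>T. s $ i * c $ i) = X * (\<Sum>i\<in>T. s $ i * w $ i)" using c0 i by (simp add: algebra_simps)
    then have "(\<Sum>i\<in>T. s $ i * c $ i) = X" using sv by simp
    then show ?thesis using c0 \<open>c $ i1 = X * w $ i1\<close> i by (simp add: mult.commute)
  qed
  then show ?thesis using that[OF wG i(1,2,3,4) sw i(5,6)] by blast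
qed

lemma class_3_cases:
  fixes G :: "('p::prime_card mod_ring ^ 'k) set"
  assumes G: "is_code G" "self_orthogonal G" and p: "CARD('p) = 3"
    and w: "w \<in> G" "card (supp w) = 3" "i \<in> supp w" and T: "T = {j. root_rel G i j}"
  shows "T = supp w \<or> (\<exists>w'\<in>G. card (supp w') = 3 \<and> supp w \<inter> supp w' \<noteq> {} \<and> supp w \<noteq> supp w')"
proof (rule disjCI)
  assume no: "\<not> (\<exists>w'\<in>G. card (supp w') = 3 \<and> supp w \<inter> supp w' \<noteq> {} \<and> supp w \<noteq> supp w')"
  show "T = supp w"
  proof
    show "T \<subseteq> supp w" unfolding T root_rel_def root_word_3[OF p] using no w(3) by blast
    show "supp w \<subseteq> T" unfolding T root_rel_def root_word_3[OF p] using w by blast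
  qed
qed

text \<open>In the labels w_t c_t orthogonality says that the three labels sum to zero. The
  coefficients s_t w_t of the functional sum to 1, so two of them agree and the third exceeds them
  by 1; modulo the sum of the labels the functional is the label of that third coordinate.\<close>

lemma class_form_3:
  fixes G :: "('p::prime_card mod_ring ^ 'k) set"
  assumes G: "is_code G" "self_orthogonal G" and p: "CARD('p) = 3"
    and w0: "w0 \<in> G" "card (supp w0) = 3" and T: "T = supp w0"
    and w1: "w1 \<in> G" "card (supp w1) = 3" "supp w1 \<subseteq> T" "(\<Sum>i\<in>UNIV. s $ i * w1 $ i) \<noteq> 0"
  obtains w i0 i1 i2 where "w \<in> G" "distinct [i0, i1, i2]" "T = {i0, i1, i2}" "supp w = T"
    "\<forall>c. (\<forall>g\<in>G. (\<Sum>i\<in>UNIV. c $ i * g $ i) = 0) \<longrightarrow>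
      w $ i0 * c $ i0 = (\<Sum>i\<in>T. s $ i * c $ i) \<and> w $ i0 * c $ i0 + w $ i1 * c $ i1 + w $ i2 * c $ i2 = 0"
proof -
  let ?t = "\<Sum>i\<in>UNIV. s $ i * w1 $ i"
  have three: "(3 :: 'p mod_ring) = 0" by (rule three_eq_0[OF p])
  have t: "?t = 1 \<or> ?t = -1" using mod_ring_cases_3[OF p, of ?t] w1(4) by blast
  have s1: "supp w1 = T" using w1(2,3) w0(2) T by (intro card_subset_eq) auto
  define w where "w = ?t *s w1"
  have wG: "w \<in> G" unfolding w_def by (intro code_closed G w1)
  have sw: "supp w = T" using w1(4) s1 by (auto simp: w_def supp_def)
  have "(\<Sum>i\<in>UNIV. s $ i * w $ i) = ?t * ?t" by (simp add: w_def sum_distrib_left mult.left_commute)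
  also have "\<dots> = 1" using t by auto
  finally have sv: "(\<Sum>i\<in>T. s $ i * w $ i) = 1" using sum_dot_supp[of w T s] sw by simp
  obtain a b c where abc: "T = {a, b, c}" "distinct [a, b, c]"
    using w0(2) T by (auto simp: card_3_iff)
  have sq: "w $ i * w $ i = 1" if "i \<in> T" for i
    using mod_ring_cases_3[OF p, of "w $ i"] that sw by (auto simp: supp_def)
  have sum1: "s $ a * w $ a + s $ b * w $ b + s $ c * w $ c = 1" using sv abc by (simp add: add.assoc)
  have "\<exists>i0 i1 i2. T = {i0, i1, i2} \<and> distinct [i0, i1, i2] \<and> s $ i1 * w $ i1 = s $ i2 * w $ i2 \<and> s $ i0 * w $ i0 = s $ i1 * w $ i1 + 1"
  proof -
    \<comment> \<open>1 - 2x = 1 + x modulo 3. Three pairwise different elements would sum to 0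
      rather than 1, so two of the coefficients coincide.\<close>
    have *: "z = x + 1" if "x + x + z = 1" for x z :: "'p mod_ring"
    proof -
      have "z = 1 - 2 * x" using that by (simp add: algebra_simps)
      also have "\<dots> = 1 + x - 3 * x" by (simp add: algebra_simps)
      finally show ?thesis using three by simp
    qed
    let ?A = "s $ a * w $ a" and ?B = "s $ b * w $ b" and ?C = "s $ c * w $ c"
    have "?A = ?B \<or> ?B = ?C \<or> ?A = ?C"
      using mod_ring_cases_3[OF p, of ?A] mod_ring_cases_3[OF p, of ?B] mod_ring_cases_3[OF p, of ?C] sum1 by auto
    then consider "?A = ?B" | "?B = ?C" | "?A = ?C" by blast
    then show ?thesis
    proof cases
      case 1
      then have "?C = ?A + 1" using *[of ?A ?C] sum1 by simp
      moreover have "T = {c, a, b}" "distinct [c, a, b]" using abc by auto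
      ultimately show ?thesis using 1 by (metis (no_types))
    next
      case 2
      then have "?A = ?B + 1" using *[of ?B ?A] sum1 by (simp add: algebra_simps)
      moreover have "T = {a, b, c}" "distinct [a, b, c]" using abc by auto
      ultimately show ?thesis using 2 by (metis (no_types))
    next
      case 3
      then have "?B = ?A + 1" using *[of ?A ?B] sum1 by (simp add: algebra_simps)
      moreover have "T = {b, a, c}" "distinct [b, a, c]" using abc by auto
      ultimately show ?thesis using 3 by (metis (no_types))
    qed
  qed
  then obtain i0 i1 i2 where i: "T = {i0, i1, i2}" "distinct [i0, i1, i2]" "s $ i1 * w $ i1 = s $ i2 * w $ i2"
    "s $ i0 * w $ i0 = s $ i1 * w $ i1 + 1" by blast
  have "w $ i0 * c $ i0 = (\<Sum>i\<in>T. s $ i * c $ i) \<and> w $ i0 * c $ i0 + w $ i1 * c $ i1 + w $ i2 * c $ i2 = 0"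
    if c: "\<And>g. g \<in> G \<Longrightarrow> (\<Sum>i\<in>UNIV. c $ i * g $ i) = 0" for c
  proof -
    have "(\<Sum>i\<in>UNIV. c $ i * w $ i) = 0" using c wG by blast
    then have o: "w $ i0 * c $ i0 + w $ i1 * c $ i1 + w $ i2 * c $ i2 = 0"
      using sum_dot_supp[of w T c] sw i(1,2) by (simp add: mult.commute add.assoc)
    have "s $ j * c $ j = (s $ j * w $ j) * (w $ j * c $ j)" if "j \<in> T" for j
      using square_one_cancel(1)[OF sq[OF that], of "c $ j"] by (simp only: mult.assoc)
    then have "(\<Sum>i\<in>T. s $ i * c $ i) = (\<Sum>j\<in>T. (s $ j * w $ j) * (w $ j * c $ j))" by (intro sum.cong) auto
    also have "\<dots> = (s $ i0 * w $ i0) * (w $ i0 * c $ i0) + ((s $ i1 * w $ i1) * (w $ i1 * c $ i1) + (s $ i2 * w $ i2) * (w $ i2 * c $ i2))"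
      using i(1,2) by simp
    also have "\<dots> = (s $ i2 * w $ i2) * (w $ i0 * c $ i0 + w $ i1 * c $ i1 + w $ i2 * c $ i2) + w $ i0 * c $ i0"
      unfolding i(4) unfolding i(3) by (simp add: algebra_simps)
    finally show ?thesis using o by simp
  qed
  then show ?thesis using that[OF wG i(2,1) sw] by blast
qed

text \<open>At the two common coordinates the products of the entries have opposite signs, so w + w'
  and w - w' each cancel exactly one of them. Thus two overlapping triples generate a tetracode, in
  which all of these words are triples on the same four coordinates.\<close>

lemma tetrad_combination:
  fixes G :: "('p::prime_card mod_ring ^ 'k) set"
  assumes G: "is_code G" "self_orthogonal G" and p: "CARD('p) = 3"
    and w: "w \<in> G" "card (supp w) = 3" and w': "w' \<in> G" "card (supp w') = 3"
    and ov: "supp w \<inter> supp w' \<noteq> {}" "supp w \<noteq> supp w'" and e: "e \<in> {1, -1}"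
  shows "card (supp (w + e *s w')) = 3" "supp (w + e *s w') \<inter> supp w \<noteq> {}" "supp (w + e *s w') \<noteq> supp w"
    "supp (w + e *s w') \<union> supp w = supp w \<union> supp w'"
proof -
  have odd: "odd CARD('p)" by (simp add: p)
  have "\<not> supp w \<subseteq> supp w'" using ov(2) w(2) w'(2) card_subset_eq[of "supp w'" "supp w"] by auto
  then obtain i where i: "i \<in> supp w" "i \<notin> supp w'" by blast
  obtain j where j: "j \<in> supp w" "j \<in> supp w'" using ov(1) by blast
  obtain m l where m: "supp w = {i, j, m}" "supp w' = {j, m, l}" "distinct [i, j, m, l]" "w $ j * w' $ j + w $ m * w' $ m = 0"
    using overlap_3[OF p w(2) w'(2) self_orthogonalD[OF G(2) w(1) w'(1)] j i] by blast
  have nz: "w $ i \<noteq> 0" "w $ j \<noteq> 0" "w $ m \<noteq> 0" "w' $ j \<noteq> 0" "w' $ m \<noteq> 0" "w' $ l \<noteq> 0"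
    using m(1,2) by (auto simp: supp_def)
  have z: "w' $ i = 0" "w $ l = 0" using m by (auto simp: supp_def)
  let ?u = "w + e *s w'"
  have out: "?u $ t = 0" if "t \<notin> {i, j, m, l}" for t
  proof -
    have "t \<notin> supp w" "t \<notin> supp w'" using that m(1,2) by auto
    then show ?thesis by (simp add: supp_def)
  qed
  have ui: "?u $ i \<noteq> 0" "?u $ l \<noteq> 0" using nz z e by auto
  have jm: "(?u $ j = 0 \<and> ?u $ m \<noteq> 0) \<or> (?u $ j \<noteq> 0 \<and> ?u $ m = 0)"
  proof -
    have pm: "c = 1 \<or> c = -1" if "c \<noteq> 0" for c :: "'p mod_ring" using mod_ring_cases_3[OF p, of c] that by blast
    have two: "(1::'p mod_ring) + 1 \<noteq> 0" "(-1::'p mod_ring) - 1 \<noteq> 0"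
      using two_neq_0[OF odd] by (simp_all add: algebra_simps)
    show ?thesis using pm[OF nz(2)] pm[OF nz(3)] pm[OF nz(4)] pm[OF nz(5)] e m(4) two by auto
  qed
  then have su: "supp ?u = {i, m, l} \<or> supp ?u = {i, j, l}" using ui out by (auto simp: supp_def)
  then show "card (supp ?u) = 3" "supp ?u \<inter> supp w \<noteq> {}" "supp ?u \<noteq> supp w" "supp ?u \<union> supp w = supp w \<union> supp w'"
    using m(1,2,3) by auto
qed

text \<open>The tetracode is self-dual, so a word orthogonal to G restricts on the class to a
  combination of the two basis words. The basis is chosen with s vanishing on \<open>u\<close> and
  equal to 1 on \<open>v\<close>, so the value of s is the coefficient of \<open>v\<close>.\<close>

lemma class_form_4:
  fixes G :: "('p::prime_card mod_ring ^ 'k) set"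
  assumes G: "is_code G" "self_orthogonal G" and p: "CARD('p) = 3"
    and w: "w \<in> G" "card (supp w) = 3" "i \<in> supp w" and w': "w' \<in> G" "card (supp w') = 3"
    and ov: "supp w \<inter> supp w' \<noteq> {}" "supp w \<noteq> supp w'" and T: "T = {j. root_rel G i j}"
    and w1: "w1 \<in> G" "card (supp w1) = 3" "supp w1 \<subseteq> T" "(\<Sum>i\<in>UNIV. s $ i * w1 $ i) \<noteq> 0"
  obtains u v i0 i1 i2 i3 e0 e1 e2 e3 where "distinct [i0, i1, i2, i3]" "T = {i0, i1, i2, i3}"
    "supp u = {i0, i1, i2}" "supp v = {i1, i2, i3}"
    "u $ i0 = e0" "u $ i1 = e1" "u $ i2 = e2" "v $ i1 = e1" "v $ i2 = - e2" "v $ i3 = e3"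
    "u \<in> G" "v \<in> G" "e0 \<in> {1, -1}" "e1 \<in> {1, -1}" "e2 \<in> {1, -1}" "e3 \<in> {1, -1}"
    "\<forall>c. (\<forall>g\<in>G. (\<Sum>i\<in>UNIV. c $ i * g $ i) = 0) \<longrightarrow>
      e3 * c $ i3 = (\<Sum>i\<in>T. s $ i * c $ i) \<and> (\<forall>i\<in>T. c $ i = (e0 * c $ i0) * u $ i + (e3 * c $ i3) * v $ i)"
proof -
  have odd: "odd CARD('p)" by (simp add: p)
  have three: "(3 :: 'p mod_ring) = 0" by (rule three_eq_0[OF p])
  have pm: "c = 1 \<or> c = -1" if "c \<noteq> 0" for c :: "'p mod_ring" using mod_ring_cases_3[OF p, of c] that by blast
  define Tet where "Tet = (\<lambda>u v. u \<in> G \<and> v \<in> G \<and> card (supp u) = 3 \<and> card (supp v) = 3 \<and> supp u \<inter> supp v \<noteq> {} \<and>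
    supp u \<noteq> supp v \<and> supp u \<union> supp v = supp w \<union> supp w')"
  \<comment> \<open>Coordinates of a tetracode with basis \<open>u\<close>, \<open>v\<close>.\<close>
  have form: "\<exists>i0 i1 i2 i3 e0 e1 e2 e3. distinct [i0, i1, i2, i3] \<and> supp w \<union> supp w' = {i0, i1, i2, i3} \<and>
      supp u = {i0, i1, i2} \<and> supp v = {i1, i2, i3} \<and>
      e0 \<in> {1, -1} \<and> e1 \<in> {1, -1} \<and> e2 \<in> {1, -1} \<and> e3 \<in> {1, -1} \<and>
      u $ i0 = e0 \<and> u $ i1 = e1 \<and> u $ i2 = e2 \<and> v $ i1 = e1 \<and> v $ i2 = - e2 \<and> v $ i3 = e3 \<and>
      (\<forall>c. (\<forall>g\<in>G. (\<Sum>i\<in>UNIV. c $ i * g $ i) = 0) \<longrightarrow>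
        (\<forall>i\<in>supp w \<union> supp w'. c $ i = (e0 * c $ i0) * u $ i + (e3 * c $ i3) * v $ i))"
    if tet: "Tet u v" for u v
  proof -
    have u: "u \<in> G" "card (supp u) = 3" and v: "v \<in> G" "card (supp v) = 3" and uv: "supp u \<inter> supp v \<noteq> {}" "supp u \<noteq> supp v"
      "supp u \<union> supp v = supp w \<union> supp w'" using tet by (auto simp: Tet_def)
    have "\<not> supp u \<subseteq> supp v" using uv(2) u(2) v(2) card_subset_eq[of "supp v" "supp u"] by auto
    then obtain a where a: "a \<in> supp u" "a \<notin> supp v" by blast
    obtain j where j: "j \<in> supp u" "j \<in> supp v" using uv(1) by blast
    obtain m l where m: "supp u = {a, j, m}" "supp v = {j, m, l}" "distinct [a, j, m, l]" "u $ j * v $ j + u $ m * v $ m = 0"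
      using overlap_3[OF p u(2) v(2) self_orthogonalD[OF G(2) u(1) v(1)] j a] by blast
    have nz: "u $ a \<noteq> 0" "u $ j \<noteq> 0" "u $ m \<noteq> 0" "v $ j \<noteq> 0" "v $ m \<noteq> 0" "v $ l \<noteq> 0"
      using m(1,2) by (auto simp: supp_def)
    have "\<exists>i1 i2. supp u = {a, i1, i2} \<and> supp v = {i1, i2, l} \<and> distinct [a, i1, i2, l] \<and> v $ i1 = u $ i1 \<and> v $ i2 = - u $ i2"
    proof (cases "v $ j = u $ j")
      case True
      then have "v $ m = - u $ m" using m(4) pm[OF nz(2)] pm[OF nz(3)] pm[OF nz(5)] two_neq_0[OF odd] by auto
      then show ?thesis using True m(1-3) by - (rule exI[of _ j], rule exI[of _ m], simp)
    next
      case False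
      then have "v $ j = - u $ j" using pm[OF nz(2)] pm[OF nz(4)] by auto
      moreover have "v $ m = u $ m" using m(4) calculation pm[OF nz(2)] pm[OF nz(3)] pm[OF nz(5)] two_neq_0[OF odd] by auto
      moreover have "supp u = {a, m, j}" "supp v = {m, j, l}" "distinct [a, m, j, l]" using m(1-3) by auto
      ultimately show ?thesis by - (rule exI[of _ m], rule exI[of _ j], simp)
    qed
    then obtain i1 i2 where i: "supp u = {a, i1, i2}" "supp v = {i1, i2, l}" "distinct [a, i1, i2, l]"
      "v $ i1 = u $ i1" "v $ i2 = - u $ i2" by (elim exE conjE)
    have nz': "u $ a \<noteq> 0" "u $ i1 \<noteq> 0" "u $ i2 \<noteq> 0" "v $ l \<noteq> 0" using i(1,2) by (auto simp: supp_def)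
    have z: "u $ l = 0" "v $ a = 0" using i by (auto simp: supp_def)
    have sq: "x * x = 1" if "x \<noteq> 0" for x :: "'p mod_ring" using pm[OF that] by auto
    have main: "\<forall>t\<in>supp w \<union> supp w'. c $ t = (u $ a * c $ a) * u $ t + (v $ l * c $ l) * v $ t"
      if c: "\<forall>g\<in>G. (\<Sum>i\<in>UNIV. c $ i * g $ i) = 0" for c
    proof -
      have o: "c $ a * u $ a + c $ i1 * u $ i1 + c $ i2 * u $ i2 = 0"
        using bspec[OF c u(1)] sum_dot_supp[of u "{a, i1, i2}" c] i(1,3) by (simp add: add.assoc)
      have o': "c $ i1 * u $ i1 - c $ i2 * u $ i2 + c $ l * v $ l = 0"
        using bspec[OF c v(1)] sum_dot_supp[of v "{i1, i2, l}" c] i(2-5) by (simp add: algebra_simps)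
      define X B E Y where "X = u $ a * c $ a" and "B = u $ i1 * c $ i1" and "E = u $ i2 * c $ i2" and "Y = v $ l * c $ l"
      have o1: "X + B + E = 0" using o by (simp add: X_def B_def E_def mult.commute)
      have o2: "B - E + Y = 0" using o' by (simp add: Y_def B_def E_def mult.commute)
      \<comment> \<open>The two orthogonality relations determine the middle labels from the outer
        ones up to a multiple of 3.\<close>
      have B: "B = X + Y"
      proof -
        have "B - (X + Y) = 3 * B - (X + B + E) - (B - E + Y)" by (simp add: algebra_simps)
        then show ?thesis using o1 o2 three by simp
      qed
      have E: "E = X - Y"
      proof -
        have "E - (X - Y) = 3 * E - (X + B + E) + (B - E + Y)" by (simp add: algebra_simps)
        then show ?thesis using o1 o2 three by simp
      qed
      have "c $ a = X * u $ a" using square_one_cancel(2)[OF sq[OF nz'(1)]] by (simp only: X_def)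
      moreover have "c $ l = Y * v $ l" using square_one_cancel(2)[OF sq[OF nz'(4)]] by (simp only: Y_def)
      moreover have "c $ i1 = B * u $ i1" using square_one_cancel(2)[OF sq[OF nz'(2)]] by (simp only: B_def)
      moreover have "c $ i2 = E * u $ i2" using square_one_cancel(2)[OF sq[OF nz'(3)]] by (simp only: E_def)
      ultimately have "\<forall>t\<in>{a, i1, i2, l}. c $ t = X * u $ t + Y * v $ t"
        using z i(4,5) B E by (simp add: algebra_simps)
      moreover have "supp w \<union> supp w' = {a, i1, i2, l}" using uv(3) i by auto
      ultimately show ?thesis by (simp add: X_def Y_def)
    qed
    have e: "u $ a \<in> {1, -1}" "u $ i1 \<in> {1, -1}" "u $ i2 \<in> {1, -1}" "v $ l \<in> {1, -1}" using pm nz' by auto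
    have U: "supp w \<union> supp w' = {a, i1, i2, l}" using uv(3) i(1,2) by auto
    show ?thesis
      by (rule exI[of _ a], rule exI[of _ i1], rule exI[of _ i2], rule exI[of _ l], rule exI[of _ "u $ a"],
          rule exI[of _ "u $ i1"], rule exI[of _ "u $ i2"], rule exI[of _ "v $ l"], intro conjI allI impI)
        (rule refl U e i | rule main, assumption)+
  qed
  have tet0: "Tet w w'" using w w' ov by (auto simp: Tet_def)
  have combo: "Tet (u + e *s v) u" if "Tet u v" "e \<in> {1, -1}" for u v e
  proof -
    have uv: "u \<in> G" "card (supp u) = 3" "v \<in> G" "card (supp v) = 3" "supp u \<inter> supp v \<noteq> {}" "supp u \<noteq> supp v"
      "supp u \<union> supp v = supp w \<union> supp w'" using that(1) by (auto simp: Tet_def)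
    show ?thesis unfolding Tet_def
      using tetrad_combination[OF G p uv(1-6) that(2)] uv code_closed[OF G(1)] by auto
  qed
  have sym: "Tet v u" if "Tet u v" for u v using that by (auto simp: Tet_def)
  have TU: "T = supp w \<union> supp w'"
  proof
    show "supp w \<union> supp w' \<subseteq> T"
    proof
      fix t assume t: "t \<in> supp w \<union> supp w'"
      obtain j where j: "j \<in> supp w" "j \<in> supp w'" using ov(1) by blast
      have ij: "root_rel G i j" using w j by (auto simp: root_rel_def root_word_3[OF p])
      have "root_rel G i t"
      proof (cases "t \<in> supp w")
        case True then show ?thesis using w by (auto simp: root_rel_def root_word_3[OF p])
      next
        case False
        then have "root_rel G j t" using t w' j by (auto simp: root_rel_def root_word_3[OF p])
        then show ?thesis using root_rel_trans[OF G odd ij] by blast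
      qed
      then show "t \<in> T" by (simp add: T)
    qed
    \<comment> \<open>The class is not larger than the tetrad: a root word of G through
      \<open>i\<close> restricts to a nonzero tetracode word and so has three coordinates in the
      tetrad, which is its whole support.\<close>
    show "T \<subseteq> supp w \<union> supp w'"
    proof
      fix t assume "t \<in> T"
      then have "t = i \<or> (\<exists>x\<in>G. card (supp x) = 3 \<and> i \<in> supp x \<and> t \<in> supp x)"
        by (auto simp: T root_rel_def root_word_3[OF p])
      then show "t \<in> supp w \<union> supp w'"
      proof
        assume "\<exists>x\<in>G. card (supp x) = 3 \<and> i \<in> supp x \<and> t \<in> supp x"
        then obtain x where x: "x \<in> G" "card (supp x) = 3" "i \<in> supp x" "t \<in> supp x" by blast
        obtain i0 i1 i2 i3 e0 e1 e2 e3 where f: "distinct [i0, i1, i2, i3]" "supp w \<union> supp w' = {i0, i1, i2, i3}"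
          "supp w = {i0, i1, i2}" "supp w' = {i1, i2, i3}"
          "e0 \<in> {1, -1}" "e1 \<in> {1, -1}" "e2 \<in> {1, -1}" "e3 \<in> {1, -1}"
          "w $ i0 = e0" "w $ i1 = e1" "w $ i2 = e2" "w' $ i1 = e1" "w' $ i2 = - e2" "w' $ i3 = e3"
          "\<forall>c. (\<forall>g\<in>G. (\<Sum>i\<in>UNIV. c $ i * g $ i) = 0) \<longrightarrow>
            (\<forall>i\<in>supp w \<union> supp w'. c $ i = (e0 * c $ i0) * w $ i + (e3 * c $ i3) * w' $ i)"
          using form[OF tet0] by (elim exE conjE)
        have xo: "\<forall>g\<in>G. (\<Sum>i\<in>UNIV. x $ i * g $ i) = 0" using self_orthogonalD[OF G(2) x(1)] by blast
        define X Y where "X = e0 * x $ i0" and "Y = e3 * x $ i3"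
        have xv: "x $ t = X * w $ t + Y * w' $ t" if "t \<in> {i0, i1, i2, i3}" for t
          using f(15) xo that f(2) unfolding X_def Y_def by blast
        have z: "w $ i3 = 0" "w' $ i0 = 0" using f(1,3,4) by (auto simp: supp_def)
        have vals: "x $ i0 = X * e0" "x $ i1 = (X + Y) * e1" "x $ i2 = (X - Y) * e2" "x $ i3 = Y * e3"
          using xv[of i0] xv[of i1] xv[of i2] xv[of i3] by (simp_all add: z f(9-14) distrib_right left_diff_distrib)
        have ne: "e0 \<noteq> 0" "e1 \<noteq> 0" "e2 \<noteq> 0" "e3 \<noteq> 0" using f(5-8) by auto
        have "X \<noteq> 0 \<or> Y \<noteq> 0" using x(3) w(3) f(3) vals by (auto simp: supp_def)
        have sub: "3 \<le> card (supp x \<inter> {i0, i1, i2, i3})"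
        proof -
          have "{i0, i1, i2} \<subseteq> supp x \<or> {i1, i2, i3} \<subseteq> supp x \<or> {i0, i1, i3} \<subseteq> supp x \<or> {i0, i2, i3} \<subseteq> supp x"
          proof -
            have "X \<noteq> 0 \<and> X + Y \<noteq> 0 \<and> X - Y \<noteq> 0 \<or> X + Y \<noteq> 0 \<and> X - Y \<noteq> 0 \<and> Y \<noteq> 0 \<or>
              X \<noteq> 0 \<and> X + Y \<noteq> 0 \<and> Y \<noteq> 0 \<or> X \<noteq> 0 \<and> X - Y \<noteq> 0 \<and> Y \<noteq> 0"
            proof (cases "X = 0 \<or> Y = 0")
              case True then show ?thesis using \<open>X \<noteq> 0 \<or> Y \<noteq> 0\<close> by auto
            next
              case False
              then have "Y = X \<or> Y = - X" using pm[of X] pm[of Y] by auto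
              moreover have "X + X \<noteq> 0" using False two_neq_0[OF odd] by (simp flip: mult_2)
              ultimately show ?thesis using False by auto
            qed
            then show ?thesis using vals ne by (simp add: supp_def)
          qed
          then obtain S where S: "S \<subseteq> supp x \<inter> {i0, i1, i2, i3}" "card S = 3"
          proof (elim disjE)
            assume "{i0, i1, i2} \<subseteq> supp x" then show ?thesis using that[of "{i0, i1, i2}"] f(1) by auto
          next
            assume "{i1, i2, i3} \<subseteq> supp x" then show ?thesis using that[of "{i1, i2, i3}"] f(1) by auto
          next
            assume "{i0, i1, i3} \<subseteq> supp x" then show ?thesis using that[of "{i0, i1, i3}"] f(1) by auto
          next
            assume "{i0, i2, i3} \<subseteq> supp x" then show ?thesis using that[of "{i0, i2, i3}"] f(1) by auto
          qed
          then show ?thesis using card_mono[OF _ S(1)] by simp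
        qed
        have "supp x \<inter> {i0, i1, i2, i3} = supp x" using sub x(2) by (intro card_seteq) auto
        then show ?thesis using x(4) f(2) by auto
      qed (use w in auto)
    qed
  qed
  \<comment> \<open>A basis adapted to the functional \<open>s\<close>.\<close>
  have dot_add: "(\<Sum>i\<in>UNIV. s $ i * (u + e *s v) $ i) = (\<Sum>i\<in>UNIV. s $ i * u $ i) + e * (\<Sum>i\<in>UNIV. s $ i * v $ i)"
    for u v e by (simp add: sum.distrib sum_distrib_left algebra_simps)
  obtain i0 i1 i2 i3 e0 e1 e2 e3 where f0: "\<forall>c. (\<forall>g\<in>G. (\<Sum>i\<in>UNIV. c $ i * g $ i) = 0) \<longrightarrow>
        (\<forall>i\<in>supp w \<union> supp w'. c $ i = (e0 * c $ i0) * w $ i + (e3 * c $ i3) * w' $ i)"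
    using form[OF tet0] by (elim exE conjE)
  have nz0: "(\<Sum>i\<in>UNIV. s $ i * w $ i) \<noteq> 0 \<or> (\<Sum>i\<in>UNIV. s $ i * w' $ i) \<noteq> 0"
  proof (rule ccontr)
    assume no: "\<not> ?thesis"
    have o1: "\<forall>g\<in>G. (\<Sum>i\<in>UNIV. w1 $ i * g $ i) = 0" using self_orthogonalD[OF G(2) w1(1)] by blast
    define x y where "x = e0 * w1 $ i0" and "y = e3 * w1 $ i3"
    have w1_eq: "w1 $ t = x * w $ t + y * w' $ t" for t
    proof (cases "t \<in> T")
      case True then show ?thesis using f0 o1 TU unfolding x_def y_def by blast
    next
      case False
      then have "t \<notin> supp w1" "t \<notin> supp w" "t \<notin> supp w'" using w1(3) TU by auto
      then show ?thesis by (simp add: supp_def)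
    qed
    have "(\<Sum>i\<in>UNIV. s $ i * w1 $ i) = (\<Sum>i\<in>UNIV. x * (s $ i * w $ i) + y * (s $ i * w' $ i))"
      by (intro sum.cong refl) (simp add: w1_eq algebra_simps)
    also have "\<dots> = x * (\<Sum>i\<in>UNIV. s $ i * w $ i) + y * (\<Sum>i\<in>UNIV. s $ i * w' $ i)"
      by (simp add: sum.distrib sum_distrib_left)
    finally show False using w1(4) no by simp
  qed
  then have "\<exists>u v. Tet u v \<and> (\<Sum>i\<in>UNIV. s $ i * u $ i) = 0 \<and> (\<Sum>i\<in>UNIV. s $ i * v $ i) \<noteq> 0"
  proof (cases "(\<Sum>i\<in>UNIV. s $ i * w $ i) = 0 \<or> (\<Sum>i\<in>UNIV. s $ i * w' $ i) = 0")
    case True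
    then show ?thesis using tet0 sym[OF tet0] nz0 by blast
  next
    case False
    let ?A = "\<Sum>i\<in>UNIV. s $ i * w $ i" and ?B = "\<Sum>i\<in>UNIV. s $ i * w' $ i"
    have AB: "?A \<noteq> 0" "?B \<noteq> 0" using False by auto
    \<comment> \<open>The sign is chosen so that s vanishes on w + e w': the squares of A and B are
      1.\<close>
    have e: "- (?A * ?B) \<in> {1, -1}" using pm[OF AB(1)] pm[OF AB(2)] by auto
    have "?A + (- (?A * ?B)) * ?B = 0" using pm[OF AB(1)] pm[OF AB(2)] by auto
    then have "(\<Sum>i\<in>UNIV. s $ i * (w + (- (?A * ?B)) *s w') $ i) = 0" by (simp only: dot_add)
    then show ?thesis using combo[OF tet0 e] AB(1)
      by - (rule exI[of _ "w + (- (?A * ?B)) *s w'"], rule exI[of _ w], intro conjI)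
  qed
  then obtain u v0 where uv0: "Tet u v0" "(\<Sum>i\<in>UNIV. s $ i * u $ i) = 0" "(\<Sum>i\<in>UNIV. s $ i * v0 $ i) \<noteq> 0" by blast
  let ?t = "\<Sum>i\<in>UNIV. s $ i * v0 $ i"
  define v where "v = ?t *s v0"
  have t: "?t = 1 \<or> ?t = -1" using pm[OF uv0(3)] .
  have "supp v = supp v0" using uv0(3) by (auto simp: v_def supp_def)
  then have tuv: "Tet u v" using uv0(1) code_closed(4)[OF G(1)] by (auto simp: Tet_def v_def)
  have "(\<Sum>i\<in>UNIV. s $ i * v $ i) = ?t * ?t" by (simp add: v_def sum_distrib_left mult.left_commute)
  also have "\<dots> = 1" using t by auto
  finally have sv: "(\<Sum>i\<in>UNIV. s $ i * v $ i) = 1" .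
  obtain i0 i1 i2 i3 e0 e1 e2 e3 where f: "distinct [i0, i1, i2, i3]" "supp w \<union> supp w' = {i0, i1, i2, i3}"
      "supp u = {i0, i1, i2}" "supp v = {i1, i2, i3}"
      "e0 \<in> {1, -1}" "e1 \<in> {1, -1}" "e2 \<in> {1, -1}" "e3 \<in> {1, -1}"
      "u $ i0 = e0" "u $ i1 = e1" "u $ i2 = e2" "v $ i1 = e1" "v $ i2 = - e2" "v $ i3 = e3"
      "\<forall>c. (\<forall>g\<in>G. (\<Sum>i\<in>UNIV. c $ i * g $ i) = 0) \<longrightarrow>
        (\<forall>i\<in>supp w \<union> supp w'. c $ i = (e0 * c $ i0) * u $ i + (e3 * c $ i3) * v $ i)"
    using form[OF tuv] by (elim exE conjE)
  have uvG: "u \<in> G" "v \<in> G" and uvT: "supp u \<subseteq> T" "supp v \<subseteq> T" using tuv TU by (auto simp: Tet_def)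
  have fin: "e3 * c $ i3 = (\<Sum>i\<in>T. s $ i * c $ i) \<and> (\<forall>i\<in>T. c $ i = (e0 * c $ i0) * u $ i + (e3 * c $ i3) * v $ i)"
    if c: "\<And>g. g \<in> G \<Longrightarrow> (\<Sum>i\<in>UNIV. c $ i * g $ i) = 0" for c
  proof -
    define x y where "x = e0 * c $ i0" and "y = e3 * c $ i3"
    have cT: "\<forall>i\<in>T. c $ i = x * u $ i + y * v $ i" using f(15) c TU unfolding x_def y_def by blast
    have "(\<Sum>i\<in>T. s $ i * c $ i) = (\<Sum>i\<in>T. x * (s $ i * u $ i) + y * (s $ i * v $ i))"
    proof (intro sum.cong refl)
      fix t assume "t \<in> T"
      then have ct: "c $ t = x * u $ t + y * v $ t" using cT by blast
      show "s $ t * c $ t = x * (s $ t * u $ t) + y * (s $ t * v $ t)" unfolding ct by (simp add: algebra_simps)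
    qed
    also have "\<dots> = x * (\<Sum>i\<in>T. s $ i * u $ i) + y * (\<Sum>i\<in>T. s $ i * v $ i)"
      by (simp add: sum.distrib sum_distrib_left)
    also have "\<dots> = y" using sum_dot_supp[OF uvT(1), of s] sum_dot_supp[OF uvT(2), of s] uv0(2) sv by simp
    finally have "y = (\<Sum>i\<in>T. s $ i * c $ i)" by simp
    then show ?thesis using cT unfolding x_def y_def by (rule conjI)
  qed
  have "T = {i0, i1, i2, i3}" using TU f(2) by simp
  moreover have "\<forall>c. (\<forall>g\<in>G. (\<Sum>i\<in>UNIV. c $ i * g $ i) = 0) \<longrightarrow>
      e3 * c $ i3 = (\<Sum>i\<in>T. s $ i * c $ i) \<and> (\<forall>i\<in>T. c $ i = (e0 * c $ i0) * u $ i + (e3 * c $ i3) * v $ i)"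
    using fin by blast
  ultimately show ?thesis by - (rule that[OF f(1) _ f(3,4) f(9-14) uvG f(5-8)])
qed

subsection \<open>Matching the classes of the two codes\<close>

definition res :: "'k set \<Rightarrow> 'a::zero ^ 'k \<Rightarrow> 'a ^ 'k" where
  "res T x = (\<chi> i. if i \<in> T then x $ i else 0)"

lemma res_nth: "res T x $ i = (if i \<in> T then x $ i else 0)"
  by (simp add: res_def)

lemma res_A_dual: "x \<in> A_dual \<Longrightarrow> res T x \<in> A_dual"
  by (auto simp: A_dual_def res_nth)

lemma res_V0: "x \<in> V0 \<Longrightarrow> res T x \<in> V0"
  by (auto simp: V0_def res_nth)

lemma word_res: "word (res T x) = res T (word x)"
  by (simp add: word_def res_def vec_eq_iff)

lemma supp_res: "supp (res T x) \<subseteq> T"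
  by (auto simp: supp_def res_nth)

lemma res_split: "x = res T x + res (- T) x" for x :: "'a::monoid_add ^ 'k"
  by (simp add: res_def vec_eq_iff)

lemma inner_disjoint_supp: "supp x \<inter> supp y = {} \<Longrightarrow> x \<bullet> y = 0" for x y :: "('n::finite, 'k::finite) blocks"
proof -
  assume d: "supp x \<inter> supp y = {}"
  have "x $ i \<bullet> y $ i = 0" for i
  proof -
    have "x $ i = 0 \<or> y $ i = 0" using d by (auto simp: supp_def)
    then show ?thesis by auto
  qed
  then show ?thesis by (subst inner_vec_def) simp
qed

text \<open>A nonzero block with zero glue could be deleted without changing the word. The remaining
  vector would have norm below 2, the minimal norm of its coset.\<close>

lemma supp_norm2:
  fixes x :: "('p::{prime_card,linorder}, 'k::finite) blocks"
  assumes x: "x \<in> A_dual" "x \<bullet> x = 2" "word x \<noteq> 0"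
  shows "supp x \<subseteq> supp (word x)"
proof
  fix i assume i: "i \<in> supp x"
  show "i \<in> supp (word x)"
  proof (rule ccontr)
    assume "i \<notin> supp (word x)"
    then have wi: "word x $ i = 0" by (simp add: supp_def)
    let ?y = "res (- {i}) x" and ?z = "res {i} x"
    have "res (- {i}) (word x) $ t = word x $ t" for t using wi by (simp add: res_nth)
    then have wy: "word ?y = word x" unfolding word_res by (simp add: vec_eq_iff)
    have yz: "?y \<bullet> ?z = 0" by (rule inner_disjoint_supp) (auto simp: supp_def res_nth)
    have "x = ?z + ?y" using res_split[of x "{i}"] by simp
    then have "x \<bullet> x = (?z + ?y) \<bullet> (?z + ?y)" by (rule arg_cong2[where f=inner]) fact
    then have "x \<bullet> x = ?z \<bullet> ?z + ?y \<bullet> ?y" using yz by (simp add: inner_add inner_commute)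
    then have 1: "?z \<bullet> ?z + ?y \<bullet> ?y = 2" using x(2) by simp
    obtain t where t: "t \<ge> 0" "real CARD('p) * (?y \<bullet> ?y) = of_int ((\<Sum>i\<in>UNIV. gap (word ?y $ i)) + 2 * int CARD('p) * t)"
      using norm_gap[OF res_A_dual[OF x(1)]] by blast
    have "(\<Sum>i\<in>UNIV. gap (word ?y $ i)) = 2 * int CARD('p)"
      using norm2_word[OF x] by (simp add: wy root_word_def)
    then have "real CARD('p) * (?y \<bullet> ?y) \<ge> real CARD('p) * 2" using t by simp
    then have "?y \<bullet> ?y \<ge> 2" by simp
    then have "?z \<bullet> ?z \<le> 0" using 1 by simp
    then have "?z \<bullet> ?z = 0" using inner_ge_zero[of ?z] by (rule antisym)
    then have "?z = 0" by (simp only: inner_eq_zero_iff)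
    then have "?z $ i = 0" by simp
    then show False using i by (simp add: res_nth supp_def)
  qed
qed

lemma ebar_norm: "ebar i a \<bullet> ebar i a = 1 - 1 / real CARD('n)" for i :: "'k::finite" and a :: "'n::finite"
  by (simp add: inner_ebar ebar_V0 ebar_nth)

lemma root_norm: "a \<noteq> b \<Longrightarrow> rootv i a b \<bullet> rootv i a b = 2"
  by (simp add: inner_diff_right inner_ebar root_V0 ebar_nth)

lemma root_inner: "rootv i a b \<bullet> rootv i c d
    = (if a = c then 1 else 0) - (if b = c then 1 else 0) - (if a = d then 1 else 0) + (if b = d then 1 else 0)"
  by (simp add: inner_diff_right inner_ebar root_V0 ebar_nth)

lemma exists_root_nonorthogonal:
  fixes x :: "('n::finite, 'k::finite) blocks"
  assumes "x \<in> V0" "i \<in> supp x"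
  obtains a b where "x \<bullet> rootv i a b \<noteq> 0"
proof -
  have "\<exists>a b. x $ i $ a \<noteq> x $ i $ b"
  proof (rule ccontr)
    assume "\<not> ?thesis"
    then have c: "x $ i $ a = x $ i $ undefined" for a by blast
    have "0 = (\<Sum>a\<in>UNIV. x $ i $ a)" using assms(1) by (simp add: V0_def)
    also have "\<dots> = (\<Sum>a\<in>(UNIV :: 'n set). x $ i $ undefined)" by (intro sum.cong refl) (rule c)
    finally have "x $ i $ undefined = 0" by simp
    then have "x $ i $ a = 0" for a using c[of a] by simp
    then have "x $ i = 0" by (simp add: vec_eq_iff)
    then show False using assms(2) by (simp add: supp_def)
  qed
  then obtain a b where "x $ i $ a \<noteq> x $ i $ b" by blast
  then have "x \<bullet> rootv i a b \<noteq> 0" using assms(1) by (simp add: inner_diff_right inner_ebar)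
  then show ?thesis by (rule that)
qed

lemma sum_inner_ebar: "x \<in> V0 \<Longrightarrow> (\<Sum>i\<in>UNIV. \<Sum>a\<in>UNIV. (x \<bullet> ebar i a)\<^sup>2) = x \<bullet> x"
  by (simp add: inner_ebar inner_blocks[of x x] power2_eq_square)

section \<open>Correspondence between the classes of the two codes\<close>

context integral_frame_pair
begin

sublocale sw: integral_frame_pair D C W' W
  by (rule swap_integral)

lemma sw_Gam: "sw.Gam = {word (W' x) | x. x \<in> A_dual \<and> word x = 0}"
  by (rule sw.Gam_def)

lemma word_W_root: "word (W (rootv j a b)) \<in> Gam"
  unfolding Gam_def using root_A_dual by blast

lemma root_support:
  assumes q: "q \<in> A_dual" "q \<bullet> q = 2" "word q \<in> Gam" and i: "i \<in> supp q" "i' \<in> supp q"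
  shows "root_rel Gam i i'"
proof (cases "word q = 0")
  case True
  obtain l a b where "q = rootv l a b" using norm2_word_0[OF q(1,2) True] by (elim exE conjE)
  then have "supp q \<subseteq> {l}" by (auto simp: supp_def vec_eq_iff ebar_nth)
  then show ?thesis using i by (auto simp: root_rel_def)
next
  case False
  then show ?thesis using supp_norm2[OF q(1,2) False] norm2_word[OF q(1,2) False] q(3) i
    unfolding root_rel_def by blast
qed

lemma roots_rel:
  assumes q: "q \<in> A_dual" "q \<bullet> q = 2" "word q \<in> Gam" and q': "q' \<in> A_dual" "q' \<bullet> q' = 2" "word q' \<in> Gam"
    and nz: "q \<bullet> q' \<noteq> 0" and i: "i \<in> supp q" "i' \<in> supp q'"
  shows "root_rel Gam i i'"
proof -
  obtain m where m: "m \<in> supp q" "m \<in> supp q'" using nz inner_disjoint_supp by blast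
  show ?thesis using root_rel_trans[OF Gam_code Gam_orthogonal odd root_support[OF q i(1) m(1)] root_support[OF q' m(2) i(2)]] .
qed

text \<open>The first argument is a block of the space of D, the second a block of the space of C in
  which the image of the first has a nonzero component.\<close>

definition link :: "'b \<Rightarrow> 'b \<Rightarrow> bool" where
  "link j i \<longleftrightarrow> (\<exists>a. i \<in> supp (W (ebar j a)))"

lemma W_root_norm: "a \<noteq> b \<Longrightarrow> W (rootv j a b) \<bullet> W (rootv j a b) = 2"
  using inner[OF root_V0 root_V0] root_norm by metis

lemma link_root:
  assumes "link j i"
  obtains a b where "a \<noteq> b" "i \<in> supp (W (rootv j a b))"
proof -
  obtain a where a: "i \<in> supp (W (ebar j a))" using assms by (auto simp: link_def)
  have "W (ebar j a) = (1 / real CARD('a)) *\<^sub>R (\<Sum>b\<in>UNIV. W (rootv j a b))"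
    using ebar_root_sum[of j a] linear_scale[OF lin(1)] linear_sum[OF lin(1), of "\<lambda>b. rootv j a b" UNIV] by metis
  then have "W (ebar j a) $ i = (1 / real CARD('a)) *\<^sub>R (\<Sum>b\<in>UNIV. W (rootv j a b) $ i)" by simp
  then obtain b where b: "W (rootv j a b) $ i \<noteq> 0"
    using a by (auto simp: supp_def) (metis (no_types, lifting) sum.neutral)
  moreover have "a \<noteq> b" using b by (auto simp: linear_0[OF lin(1)])
  ultimately show ?thesis by (intro that[of a b]) (auto simp: supp_def)
qed

text \<open>The image of a root has norm 2 and word in \<open>Gam\<close>, so its support lies in
  one class, and images of nonorthogonal roots share a coordinate. Orthogonal roots e_a - e_b and
  e_c - e_d of a block are connected through e_b - e_c, so the image of an irreducible root system
  stays in one class.\<close>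

lemma link_unique:
  assumes "link j i" "link j i'"
  shows "root_rel Gam i i'"
proof -
  obtain a b where ab: "a \<noteq> b" "i \<in> supp (W (rootv j a b))" using link_root[OF assms(1)] by blast
  obtain c d where cd: "c \<noteq> d" "i' \<in> supp (W (rootv j c d))" using link_root[OF assms(2)] by blast
  have rel: "root_rel Gam l l'" if "a \<noteq> b" "c \<noteq> d" "rootv j a b \<bullet> rootv j c d \<noteq> 0"
    "l \<in> supp (W (rootv j a b))" "l' \<in> supp (W (rootv j c d))" for a b c d l l'
    by (rule roots_rel[OF W_root W_root_norm[OF that(1)] word_W_root W_root W_root_norm[OF that(2)] word_W_root _ that(4,5)])
      (use that(3) inner[OF root_V0 root_V0] in simp)
  show ?thesis
  proof (cases "rootv j a b \<bullet> rootv j c d = 0")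
    case False
    then show ?thesis using rel ab cd by blast
  next
    case True
    have dist: "a \<noteq> c" "b \<noteq> c" "a \<noteq> d" "b \<noteq> d" using True ab(1) cd(1) unfolding root_inner by (auto split: if_splits)
    have "W (rootv j b c) \<noteq> 0" using W_root_norm[OF dist(2), of j] by auto
    then obtain m where m: "m \<in> supp (W (rootv j b c))" by (auto simp: supp_def vec_eq_iff)
    have 1: "root_rel Gam i m"
      by (rule rel[OF ab(1) dist(2) _ ab(2) m]) (use dist ab cd in \<open>simp add: root_inner\<close>)
    have 2: "root_rel Gam m i'"
      by (rule rel[OF dist(2) cd(1) _ m cd(2)]) (use dist ab cd in \<open>simp add: root_inner\<close>)
    show ?thesis by (rule root_rel_trans[OF Gam_code Gam_orthogonal odd 1 2])
  qed
qed

lemma W_Q': "y \<in> A_dual \<Longrightarrow> word y \<in> sw.Gam \<Longrightarrow> W y \<in> A_dual \<and> word (W y) \<in> Gam"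
  using sw.W_Q[of y] unfolding Gam_def .

text \<open>A root word joining \<open>j\<close> and \<open>j'\<close> has a minimal vector of norm
  2. Its image again has norm 2 and word in \<open>Gam\<close>, hence lies in one class, and it
  meets what is linked to \<open>j\<close> as well as what is linked to \<open>j'\<close>.\<close>

lemma link_class:
  assumes jj: "root_rel sw.Gam j j'" and l: "link j i" "link j' i'"
  shows "root_rel Gam i i'"
proof (cases "j = j'")
  case True
  then show ?thesis using link_unique l by blast
next
  case False
  then obtain w where w: "w \<in> sw.Gam" "root_word w" "j \<in> supp w" "j' \<in> supp w"
    using jj by (auto simp: root_rel_def)
  obtain q where q: "q \<in> A_dual" "word q = w" "real CARD('a) * (q \<bullet> q) = of_int (\<Sum>i\<in>UNIV. gap (w $ i))"
    using minimal_vector by blast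
  have "real CARD('a) * (q \<bullet> q) = of_int (2 * int CARD('a))" using q(3) w(2) by (simp only: root_word_def)
  then have q2: "q \<bullet> q = 2" by simp
  have "t \<in> supp q" if "t \<in> supp (word q)" for t
  proof (rule ccontr)
    assume "t \<notin> supp q"
    then have "word q $ t = 0" by (simp add: supp_def word_def)
    then show False using that by (simp add: supp_def)
  qed
  then have jq: "j \<in> supp q" "j' \<in> supp q" using w(3,4) q(2) by auto
  have Wq: "W q \<in> A_dual" "W q \<bullet> W q = 2" "word (W q) \<in> Gam"
    using W_Q'[OF q(1)] q(2) w(1) inner[OF A_dual_V0[OF q(1)] A_dual_V0[OF q(1)]] q2 by auto
  have key: "\<exists>m\<in>supp (W q). root_rel Gam l m" if lj: "link j l" and jq: "j \<in> supp q" for j l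
  proof -
    obtain a b where nz: "q \<bullet> rootv j a b \<noteq> 0" using exists_root_nonorthogonal[OF A_dual_V0[OF q(1)] jq] by blast
    then have ab: "a \<noteq> b" by auto
    have "W q \<bullet> W (rootv j a b) \<noteq> 0" using nz inner[OF A_dual_V0[OF q(1)] root_V0] by simp
    then obtain m where m: "m \<in> supp (W q)" "m \<in> supp (W (rootv j a b))" using inner_disjoint_supp by blast
    have "W (rootv j a b) $ m \<noteq> 0" using m(2) by (simp add: supp_def)
    then have "W (ebar j a) $ m \<noteq> 0 \<or> W (ebar j b) $ m \<noteq> 0" by (auto simp: linear_diff[OF lin(1)])
    then have "link j m" by (auto simp: link_def supp_def)
    then show ?thesis using link_unique[OF lj] m(1) by blast
  qed
  obtain m where m: "m \<in> supp (W q)" "root_rel Gam i m" using key[OF l(1) jq(1)] by blast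
  obtain m' where m': "m' \<in> supp (W q)" "root_rel Gam i' m'" using key[OF l(2) jq(2)] by blast
  have "root_rel Gam m m'" by (rule root_support[OF Wq m(1) m'(1)])
  then show ?thesis
    using root_rel_trans[OF Gam_code Gam_orthogonal odd] m(2) root_rel_sym[OF m'(2)] by blast
qed

end

context integral_frame_pair
begin

lemma link_inner: "link j i \<longleftrightarrow> (\<exists>a b. W (ebar j a) \<bullet> ebar i b \<noteq> 0)"
  unfolding link_def supp_def by (simp add: inner_ebar V0 ebar_V0 vec_eq_iff)

end

context integral_frame_pair
begin

lemma link_sym: "sw.link i j \<longleftrightarrow> link j i"
  unfolding link_inner sw.link_inner using adjoint[OF ebar_V0 ebar_V0] by (metis inner_commute)

lemma link_ex: "\<exists>i. link j i"
proof -
  have p: "real CARD('a) > 1" using prime_gt_1_nat[OF prime_card[where 'a='a]] by simp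
  have "W (ebar j undefined) \<bullet> W (ebar j undefined) > 0"
    using inner[OF ebar_V0 ebar_V0, of j undefined j undefined] ebar_norm[of j "undefined :: 'a"] p by simp
  then have "W (ebar j undefined) \<noteq> 0" by auto
  then show ?thesis unfolding link_def supp_def by (auto simp: vec_eq_iff)
qed

definition cls :: "'b \<Rightarrow> 'b set" where "cls i = {i'. root_rel Gam i i'}"

text \<open>The coordinates of D that correspond to the class of \<open>i\<close>; by
  \<open>partner_eq\<close> they are a whole class of the exchanged pair.\<close>

definition partner :: "'b \<Rightarrow> 'b set" where "partner i = {j. \<exists>i'\<in>cls i. link j i'}"

lemma cls_eq: "root_rel Gam i i' \<Longrightarrow> cls i = cls i'"
  unfolding cls_def using root_rel_trans[OF Gam_code Gam_orthogonal odd] root_rel_sym by blast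

end

context integral_frame_pair
begin

lemma partner_eq: "j \<in> partner i \<Longrightarrow> partner i = sw.cls j"
proof -
  assume "j \<in> partner i"
  then obtain i1 where i1: "root_rel Gam i i1" "link j i1" by (auto simp: partner_def cls_def)
  have "j' \<in> sw.cls j" if "j' \<in> partner i" for j'
  proof -
    obtain i2 where i2: "root_rel Gam i i2" "link j' i2" using \<open>j' \<in> partner i\<close> by (auto simp: partner_def cls_def)
    have "root_rel Gam i1 i2" using cls_eq[OF i1(1)] i2(1) by (auto simp: cls_def)
    then have "root_rel sw.Gam j j'" by (rule sw.link_class) (simp_all add: link_sym i1 i2)
    then show ?thesis by (simp add: sw.cls_def)
  qed
  moreover have "j' \<in> partner i" if "j' \<in> sw.cls j" for j'
  proof -
    obtain i2 where i2: "link j' i2" using link_ex by blast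
    have "root_rel Gam i1 i2" using that link_class[OF _ i1(2) i2] by (simp add: sw.cls_def)
    then have "i2 \<in> cls i" using cls_eq[OF i1(1)] by (auto simp: cls_def)
    then show ?thesis using i2 by (auto simp: partner_def)
  qed
  ultimately show ?thesis by blast
qed

lemma partner_nonempty: "\<exists>j. j \<in> partner i"
  using sw.link_ex[of i] root_rel_refl[of Gam i] by (auto simp: partner_def cls_def link_sym)

lemma partner_cong: "i' \<in> cls i \<Longrightarrow> partner i' = partner i"
  unfolding partner_def using cls_eq[of i i'] by (auto simp: cls_def)

lemma link_in: "j \<in> partner i \<Longrightarrow> link j i' \<Longrightarrow> i' \<in> cls i"
proof -
  assume "j \<in> partner i" and l: "link j i'"
  then obtain i1 where i1: "root_rel Gam i i1" "link j i1" by (auto simp: partner_def cls_def)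
  have "root_rel Gam i1 i'" by (rule link_unique[OF i1(2) l])
  then show ?thesis using cls_eq[OF i1(1)] by (simp add: cls_def)
qed

lemma W_ebar_in: "j \<in> partner i \<Longrightarrow> supp (W (ebar j a)) \<subseteq> cls i"
  using link_in unfolding link_def by blast

lemma W_ebar_out: "j \<notin> partner i \<Longrightarrow> supp (W (ebar j a)) \<inter> cls i = {}"
  unfolding partner_def link_def by blast

text \<open>Double counting of the squared products of images of the projected unit vectors on one
  side with those on the other. By Parseval each block of the class contributes p - 1 along its
  rows, and each block of the partner contributes p - 1 along its columns.\<close>

lemma card_partner: "card (partner i) = card (cls i)"
proof -
  let ?T = "cls i" and ?T' = "partner i"
  let ?f = "\<lambda>i' b j a. (W (ebar j a) \<bullet> ebar i' b)\<^sup>2"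
  have z1: "?f i' b j a = 0" if "i' \<in> ?T" "j \<notin> ?T'" for i' b j a
  proof -
    have "i' \<notin> supp (W (ebar j a))" using W_ebar_out[OF that(2), of a] that(1) by blast
    then show ?thesis by (simp add: inner_ebar V0 ebar_V0 supp_def)
  qed
  have z2: "?f i' b j a = 0" if "i' \<notin> ?T" "j \<in> ?T'" for i' b j a
  proof -
    have "i' \<notin> supp (W (ebar j a))" using W_ebar_in[OF that(2), of a] that(1) by blast
    then show ?thesis by (simp add: inner_ebar V0 ebar_V0 supp_def)
  qed
  have "(\<Sum>i'\<in>?T. \<Sum>b\<in>UNIV. \<Sum>j\<in>UNIV. \<Sum>a\<in>UNIV. ?f i' b j a) = real (card ?T) * (real CARD('a) - 1)"
  proof -
    have "(\<Sum>j\<in>UNIV. \<Sum>a\<in>UNIV. ?f i' b j a) = 1 - 1 / real CARD('a)" for i' b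
    proof -
      have "(\<Sum>j\<in>UNIV. \<Sum>a\<in>UNIV. ?f i' b j a) = (\<Sum>j\<in>UNIV. \<Sum>a\<in>UNIV. (W' (ebar i' b) \<bullet> ebar j a)\<^sup>2)"
        unfolding adjoint[OF ebar_V0 ebar_V0]
        by (intro sum.cong refl arg_cong[where f="\<lambda>u. u\<^sup>2"]) (rule inner_commute)
      also have "\<dots> = W' (ebar i' b) \<bullet> W' (ebar i' b)" by (rule sum_inner_ebar) (simp add: V0 ebar_V0)
      finally show ?thesis by (simp add: inner' ebar_V0 ebar_norm)
    qed
    then show ?thesis by (simp only:) (simp add: field_simps)
  qed
  moreover have "(\<Sum>j\<in>?T'. \<Sum>a\<in>UNIV. \<Sum>i'\<in>UNIV. \<Sum>b\<in>UNIV. ?f i' b j a) = real (card ?T') * (real CARD('a) - 1)"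
  proof -
    have "(\<Sum>i'\<in>UNIV. \<Sum>b\<in>UNIV. ?f i' b j a) = 1 - 1 / real CARD('a)" for j a
      by (subst sum_inner_ebar) (simp_all add: V0 ebar_V0 inner ebar_norm)
    then show ?thesis by (simp only:) (simp add: field_simps)
  qed
  moreover have "(\<Sum>i'\<in>?T. \<Sum>b\<in>UNIV. \<Sum>j\<in>UNIV. \<Sum>a\<in>UNIV. ?f i' b j a) = (\<Sum>i'\<in>?T. \<Sum>b\<in>UNIV. \<Sum>j\<in>?T'. \<Sum>a\<in>UNIV. ?f i' b j a)"
    by (intro sum.cong refl sum.mono_neutral_right) (auto simp: z1)
  moreover have "(\<Sum>j\<in>?T'. \<Sum>a\<in>UNIV. \<Sum>i'\<in>UNIV. \<Sum>b\<in>UNIV. ?f i' b j a) = (\<Sum>j\<in>?T'. \<Sum>a\<in>UNIV. \<Sum>i'\<in>?T. \<Sum>b\<in>UNIV. ?f i' b j a)"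
    by (intro sum.cong refl sum.mono_neutral_right) (auto simp: z2)
  moreover have "(\<Sum>i'\<in>?T. \<Sum>b\<in>UNIV. \<Sum>j\<in>?T'. \<Sum>a\<in>UNIV. ?f i' b j a) = (\<Sum>j\<in>?T'. \<Sum>a\<in>UNIV. \<Sum>i'\<in>?T. \<Sum>b\<in>UNIV. ?f i' b j a)"
  proof -
    have "(\<Sum>i'\<in>?T. \<Sum>b\<in>UNIV. \<Sum>j\<in>?T'. \<Sum>a\<in>UNIV. ?f i' b j a) = (\<Sum>i'\<in>?T. \<Sum>j\<in>?T'. \<Sum>b\<in>UNIV. \<Sum>a\<in>UNIV. ?f i' b j a)"
      by (rule sum.cong[OF refl], rule sum.swap)
    also have "\<dots> = (\<Sum>j\<in>?T'. \<Sum>i'\<in>?T. \<Sum>b\<in>UNIV. \<Sum>a\<in>UNIV. ?f i' b j a)" by (rule sum.swap)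
    also have "\<dots> = (\<Sum>j\<in>?T'. \<Sum>i'\<in>?T. \<Sum>a\<in>UNIV. \<Sum>b\<in>UNIV. ?f i' b j a)"
      by (rule sum.cong[OF refl], rule sum.cong[OF refl], rule sum.swap)
    also have "\<dots> = (\<Sum>j\<in>?T'. \<Sum>a\<in>UNIV. \<Sum>i'\<in>?T. \<Sum>b\<in>UNIV. ?f i' b j a)"
      by (rule sum.cong[OF refl], rule sum.swap)
    finally show ?thesis .
  qed
  ultimately have "real (card ?T') * (real CARD('a) - 1) = real (card ?T) * (real CARD('a) - 1)" by linarith
  moreover have "real CARD('a) > 1" using prime_gt_1_nat[OF prime_card[where 'a='a]] by simp
  ultimately show ?thesis by simp
qed

text \<open>\<open>W'\<close> is block diagonal for the classes: coordinates outside the partner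
  pair with nothing in the class, and coordinates inside it pair with nothing outside the
  class.\<close>

lemma W'_res: "x \<in> V0 \<Longrightarrow> W' (res (cls i) x) = res (partner i) (W' x)"
proof -
  assume x: "x \<in> V0"
  have a: "W' y $ j = 0" if y: "y \<in> V0" "\<And>a. supp y \<inter> supp (W (ebar j a)) = {}" for y j
  proof -
    have "W' y $ j $ a = 0" for a
    proof -
      have "W' y $ j $ a = W' y \<bullet> ebar j a" using inner_ebar[of "W' y"] V0 y by simp
      also have "\<dots> = y \<bullet> W (ebar j a)" using adjoint[OF ebar_V0 y(1)] by (simp add: inner_commute)
      also have "\<dots> = 0" by (rule inner_disjoint_supp[OF y(2)])
      finally show ?thesis .
    qed
    then show ?thesis by (simp add: vec_eq_iff)
  qed
  have in0: "W' (res (cls i) x) $ j = 0" if "j \<notin> partner i" for j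
    by (rule a[OF res_V0[OF x]]) (use W_ebar_out[OF that] supp_res[of "cls i" x] in blast)
  have out0: "W' (res (- cls i) x) $ j = 0" if "j \<in> partner i" for j
    by (rule a[OF res_V0[OF x]]) (use W_ebar_in[OF that] supp_res[of "- cls i" x] in blast)
  have "W' x = W' (res (cls i) x) + W' (res (- cls i) x)"
    using res_split[of x "cls i"] linear_add[OF lin(2), of "res (cls i) x" "res (- cls i) x"] by simp
  then have e: "W' x $ j = W' (res (cls i) x) $ j + W' (res (- cls i) x) $ j" for j by simp
  have "W' (res (cls i) x) $ j = res (partner i) (W' x) $ j" for j
    using in0[of j] out0[of j] e[of j] by (cases "j \<in> partner i") (simp_all add: res_nth)
  then show ?thesis by (simp add: vec_eq_iff)
qed

end

text \<open>Additive maps to the field with three elements and with the same kernel agree up to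
  sign, since 1 and -1 are the only nonzero scalars. The domain is merely closed under differences;
  \<open>y\<close> below is the negative of \<open>x0\<close> written with differences.\<close>

lemma additive_mod_3_proportional:
  fixes f g :: "'v::group_add \<Rightarrow> 'p::prime_card mod_ring"
  assumes p: "CARD('p) = 3" and S: "\<And>x y. x \<in> S \<Longrightarrow> y \<in> S \<Longrightarrow> x - y \<in> S"
    and f: "\<And>x y. x \<in> S \<Longrightarrow> y \<in> S \<Longrightarrow> f (x - y) = f x - f y"
    and g: "\<And>x y. x \<in> S \<Longrightarrow> y \<in> S \<Longrightarrow> g (x - y) = g x - g y"
    and ker: "\<And>x. x \<in> S \<Longrightarrow> f x = 0 \<longleftrightarrow> g x = 0"
  shows "(\<forall>x\<in>S. g x = f x) \<or> (\<forall>x\<in>S. g x = - f x)"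
proof (cases "\<forall>x\<in>S. f x = 0")
  case True
  then show ?thesis using ker by auto
next
  case False
  then obtain x0 where x0: "x0 \<in> S" "f x0 \<noteq> 0" by blast
  have g0: "g x0 \<noteq> 0" using ker x0 by blast
  have pm: "c = 1 \<or> c = -1" if "c \<noteq> 0" for c :: "'p mod_ring" using mod_ring_cases_3[OF p, of c] that by blast
  define y where "y = (x0 - x0) - x0"
  have z: "x0 - x0 \<in> S" by (rule S[OF x0(1) x0(1)])
  have m: "f y = - f x0" "g y = - g x0" "y \<in> S"
    unfolding y_def f[OF z x0(1)] g[OF z x0(1)] f[OF x0(1) x0(1)] g[OF x0(1) x0(1)] using S[OF z x0(1)] by simp_all
  have *: "f x = 0 \<and> g x = 0 \<or> f x = f x0 \<and> g x = g x0 \<or> f x = - f x0 \<and> g x = - g x0" if x: "x \<in> S" for x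
  proof -
    consider "f x = 0" | "f x = f x0" | "f x = - f x0"
      using mod_ring_cases_3[OF p, of "f x"] pm[OF x0(2)] by fastforce
    then show ?thesis
    proof cases
      case 1 then show ?thesis using ker[OF x] by simp
    next
      case 2
      then have "f (x - x0) = 0" using f[OF x x0(1)] by simp
      then have "g (x - x0) = 0" using ker[OF S[OF x x0(1)]] by simp
      then show ?thesis using 2 g[OF x x0(1)] by simp
    next
      case 3
      have "f (x - y) = 0" using f[OF x m(3)] m(1) 3 by simp
      then have "g (x - y) = 0" using ker[OF S[OF x m(3)]] by simp
      then have "g x = g y" using g[OF x m(3)] by simp
      then show ?thesis using 3 m(2) by simp
    qed
  qed
  have "g x0 = f x0 \<or> g x0 = - f x0" using pm[OF x0(2)] pm[OF g0] by auto
  then show ?thesis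
  proof
    assume e: "g x0 = f x0"
    have "g x = f x" if "x \<in> S" for x using *[OF that] unfolding e by (elim disjE conjE) simp_all
    then show ?thesis by blast
  next
    assume e: "g x0 = - f x0"
    have "g x = - f x" if "x \<in> S" for x using *[OF that] unfolding e by (elim disjE conjE) simp_all
    then show ?thesis by blast
  qed
qed

section \<open>Signed bijections on a single class\<close>

context integral_frame_pair
begin

text \<open>The dual of the lattice Q whose glue code is \<open>Gam\<close>. It contains
  \<open>L_B C\<close>, and each of its vectors has a word in both frames, before and after
  \<open>W'\<close>.\<close>

definition Qd :: "('a, 'b) blocks set" where
  "Qd = {x \<in> A_dual. \<forall>w\<in>Gam. (\<Sum>i\<in>UNIV. word x $ i * w $ i) = 0}"

end

context integral_frame_pair
begin

lemma QdD: "x \<in> Qd \<Longrightarrow> x \<in> A_dual" "x \<in> Qd \<Longrightarrow> w \<in> Gam \<Longrightarrow> (\<Sum>i\<in>UNIV. word x $ i * w $ i) = 0"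
  by (auto simp: Qd_def)

lemma W'_Qd: "x \<in> Qd \<Longrightarrow> W' x \<in> sw.Qd"
  using W_Q_dual[of x] unfolding sw.Qd_def sw_Gam Qd_def by blast

lemma Qd_diff: "x \<in> Qd \<Longrightarrow> y \<in> Qd \<Longrightarrow> x - y \<in> Qd"
  by (auto simp: Qd_def A_dual_diff word_diff left_diff_distrib sum_subtractf)

lemma L_B_Qd: "x \<in> L_B C \<Longrightarrow> x \<in> Qd"
  using C_orthogonal_Gam by (auto simp: Qd_def L_B_eq)

lemma Gam_self_orth: "u \<in> Gam \<Longrightarrow> v \<in> Gam \<Longrightarrow> (\<Sum>i\<in>UNIV. u $ i * v $ i) = 0"
  using self_orthogonalD[OF Gam_orthogonal] .

lemma partner_partner: "j \<in> partner i \<Longrightarrow> sw.partner j = cls i"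
proof -
  assume j: "j \<in> partner i"
  have "sw.partner j = {t. \<exists>j'\<in>partner i. link j' t}"
    unfolding sw.partner_def partner_eq[OF j] link_sym ..
  also have "\<dots> = cls i"
  proof
    show "{t. \<exists>j'\<in>partner i. link j' t} \<subseteq> cls i" using link_in by blast
    show "cls i \<subseteq> {t. \<exists>j'\<in>partner i. link j' t}"
    proof
      fix t assume t: "t \<in> cls i"
      obtain j' where "link j' t" using sw.link_ex[of t] link_sym by blast
      then show "t \<in> {t. \<exists>j'\<in>partner i. link j' t}" using t by (auto simp: partner_def)
    qed
  qed
  finally show ?thesis .
qed

end

context integral_frame_pair
begin

text \<open>All labels on the triple agree exactly if the restricted word is a multiple of
  \<open>w\<close>, hence lies in \<open>Gam\<close>. \<open>W'\<close> respects this and the class,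
  so the restricted image word lies in \<open>sw.Gam\<close>. There it is orthogonal to
  \<open>w'\<close> and to itself, which forces equal labels.\<close>

lemma kernel_transfer:
  assumes p: "CARD('a) = 3" and x: "x \<in> Qd"
    and w: "w \<in> Gam" "supp w = cls i" "cls i = {i0, i1, i2}" "distinct [i0, i1, i2]"
    and w': "w' \<in> sw.Gam" "supp w' = partner i" "partner i = {j0, j1, j2}" "distinct [j0, j1, j2]"
    and eq: "w $ i1 * word x $ i1 = w $ i0 * word x $ i0"
  shows "w' $ j1 * word (W' x) $ j1 = w' $ j0 * word (W' x) $ j0"
proof -
  let ?c = "word x" and ?d = "word (W' x)"
  have three: "(3 :: 'a mod_ring) = 0" by (rule three_eq_0[OF p])
  have sq: "u $ t * u $ t = 1" if "t \<in> supp u" for u :: "'a mod_ring ^ 'b" and t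
    using mod_ring_cases_3[OF p, of "u $ t"] that by (auto simp: supp_def)
  have x0: "x \<in> A_dual" using x by (rule QdD)
  define X where "X = w $ i0 * ?c $ i0"
  have o: "w $ i0 * ?c $ i0 + w $ i1 * ?c $ i1 + w $ i2 * ?c $ i2 = 0"
    using QdD(2)[OF x w(1)] sum_dot_supp[of w "{i0, i1, i2}" ?c] w(2-4) by (simp add: mult.commute add.assoc)
  have c2: "w $ i2 * ?c $ i2 = X"
  proof -
    have "w $ i2 * ?c $ i2 = X - 3 * X" using o eq by (simp add: X_def eq_neg_iff_add_eq_0 algebra_simps)
    then show ?thesis using three by simp
  qed
  have "res (cls i) ?c $ t = (X *s w) $ t" for t
  proof (cases "t \<in> cls i")
    case True
    then have "w $ t * ?c $ t = X" using w(3) c2 eq X_def by auto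
    then have "w $ t * (w $ t * ?c $ t) = w $ t * X" by (rule arg_cong)
    then have "?c $ t = w $ t * X" using square_one_cancel(1)[OF sq[of t w]] True w(2) by simp
    then show ?thesis using True by (simp add: res_nth mult.commute)
  next
    case False
    then show ?thesis using w(2) by (auto simp: res_nth supp_def)
  qed
  then have "res (cls i) ?c = X *s w" by (simp add: vec_eq_iff)
  then have "word (res (cls i) x) \<in> Gam" using code_closed(4)[OF Gam_code w(1)] by (simp add: word_res)
  then have "word (W' (res (cls i) x)) \<in> sw.Gam" using W_Q[OF res_A_dual[OF x0]] unfolding sw_Gam by blast
  then have r: "res (partner i) ?d \<in> sw.Gam" by (simp add: W'_res[OF A_dual_V0[OF x0]] word_res)
  define D0 D1 D2 where "D0 = w' $ j0 * ?d $ j0" and "D1 = w' $ j1 * ?d $ j1" and "D2 = w' $ j2 * ?d $ j2"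
  have j: "j0 \<in> supp w'" "j1 \<in> supp w'" "j2 \<in> supp w'" using w' by auto
  have "(\<Sum>t\<in>UNIV. res (partner i) ?d $ t * w' $ t) = 0" by (rule sw.Gam_self_orth[OF r w'(1)])
  then have "D0 + D1 + D2 = 0"
    using sum_dot_supp[of w' "{j0, j1, j2}" "res (partner i) ?d"] w'(2-4)
    by (simp add: D0_def D1_def D2_def res_nth mult.commute add.assoc)
  then have D2: "D2 = - D0 - D1" by (simp add: eq_neg_iff_add_eq_0 algebra_simps)
  have dd: "?d $ t * ?d $ t = (w' $ t * ?d $ t) * (w' $ t * ?d $ t)" if "t \<in> supp w'" for t
  proof -
    have "(w' $ t * ?d $ t) * (w' $ t * ?d $ t) = (w' $ t * w' $ t) * (?d $ t * ?d $ t)" by (simp only: mult_ac)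
    then show ?thesis using sq[OF that] by simp
  qed
  have "(\<Sum>t\<in>UNIV. res (partner i) ?d $ t * res (partner i) ?d $ t) = 0" by (rule sw.Gam_self_orth[OF r r])
  then have "(\<Sum>t\<in>{j0, j1, j2}. res (partner i) ?d $ t * res (partner i) ?d $ t) = 0"
    using sum_supp[of "res (partner i) ?d" "{j0, j1, j2}" "\<lambda>t. res (partner i) ?d $ t"] supp_res[of "partner i" ?d] w'(3) by simp
  then have "?d $ j0 * ?d $ j0 + ?d $ j1 * ?d $ j1 + ?d $ j2 * ?d $ j2 = 0"
    using w'(3,4) by (simp add: res_nth add.assoc)
  then have "D0 * D0 + D1 * D1 + D2 * D2 = 0" by (simp only: dd[OF j(1)] dd[OF j(2)] dd[OF j(3)] D0_def D1_def D2_def)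
  \<comment> \<open>With D2 = - D0 - D1 the sum of the three squares is -(D0 - D1)^2 modulo
    3.\<close>
  moreover have "D0 * D0 + D1 * D1 + D2 * D2 = 3 * (D0 * D1) + 3 * (D0 * D0) - (D0 - D1) * (D0 - D1) + 3 * (D1 * D1) - 3 * (D0 * D1)"
  proof -
    have "D0 * D0 + D1 * D1 + D2 * D2 + (D0 - D1) * (D0 - D1) = 3 * (D0 * D0) + 3 * (D1 * D1)"
      unfolding D2 by (simp add: algebra_simps)
    then show ?thesis by (simp add: algebra_simps)
  qed
  ultimately have "(D0 - D1) * (D0 - D1) = 0" using three by simp
  then show ?thesis by (simp add: D0_def D1_def)
qed

text \<open>On the class of \<open>i\<close> the transported word of \<open>W' x\<close> agrees with
  the word of x modulo \<open>Gam\<close>, and on a class with several coordinates the functional v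
  takes on it the value that v' takes on the original. The second condition is what fixes the choice
  modulo \<open>Gam\<close> when \<open>Gam\<close> is not contained in C.\<close>

definition matches :: "'b \<Rightarrow> 'a mod_ring ^ 'b \<Rightarrow> 'a mod_ring ^ 'b \<Rightarrow> ('b \<Rightarrow> 'b) \<Rightarrow> ('b \<Rightarrow> 'a mod_ring) \<Rightarrow> bool" where
  "matches i v v' \<sigma> s \<longleftrightarrow> bij_betw \<sigma> (cls i) (partner i) \<and> (\<forall>t\<in>cls i. s t = 1 \<or> s t = -1) \<and>
    (\<forall>x\<in>Qd. res (cls i) (\<chi> t. word x $ t - s t * word (W' x) $ \<sigma> t) \<in> Gam \<and>
      (card (cls i) > 1 \<longrightarrow> (\<Sum>t\<in>cls i. v $ t * (s t * word (W' x) $ \<sigma> t)) = (\<Sum>j\<in>partner i. v' $ j * word (W' x) $ j)))"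

lemma matchesI:
  assumes "bij_betw \<sigma> (cls i) (partner i)" "\<And>t. t \<in> cls i \<Longrightarrow> s t = 1 \<or> s t = -1"
    and "\<And>x. x \<in> Qd \<Longrightarrow> \<exists>g\<in>Gam. supp g \<subseteq> cls i \<and> (\<forall>t\<in>cls i. s t * word (W' x) $ \<sigma> t = word x $ t - g $ t) \<and>
      (\<Sum>t\<in>cls i. v $ t * g $ t) = (\<Sum>t\<in>cls i. v $ t * word x $ t) - (\<Sum>j\<in>partner i. v' $ j * word (W' x) $ j)"
  shows "matches i v v' \<sigma> s"
  unfolding matches_def
proof (intro conjI ballI impI)
  fix x assume "x \<in> Qd"
  then obtain g where g: "g \<in> Gam" "supp g \<subseteq> cls i" "\<forall>t\<in>cls i. s t * word (W' x) $ \<sigma> t = word x $ t - g $ t"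
    "(\<Sum>t\<in>cls i. v $ t * g $ t) = (\<Sum>t\<in>cls i. v $ t * word x $ t) - (\<Sum>j\<in>partner i. v' $ j * word (W' x) $ j)"
    using assms(3) by blast
  have "res (cls i) (\<chi> t. word x $ t - s t * word (W' x) $ \<sigma> t) $ t = g $ t" for t
  proof (cases "t \<in> cls i")
    case True then show ?thesis using g(3) by (simp add: res_nth)
  next
    case False then show ?thesis using g(2) by (auto simp: res_nth supp_def)
  qed
  then have "res (cls i) (\<chi> t. word x $ t - s t * word (W' x) $ \<sigma> t) = g" by (simp add: vec_eq_iff)
  then show "res (cls i) (\<chi> t. word x $ t - s t * word (W' x) $ \<sigma> t) \<in> Gam" using g(1) by simp
  have "(\<Sum>t\<in>cls i. v $ t * (s t * word (W' x) $ \<sigma> t)) = (\<Sum>t\<in>cls i. v $ t * word x $ t - v $ t * g $ t)"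
    by (intro sum.cong refl) (use g(3) in \<open>simp add: right_diff_distrib\<close>)
  then show "(\<Sum>t\<in>cls i. v $ t * (s t * word (W' x) $ \<sigma> t)) = (\<Sum>j\<in>partner i. v' $ j * word (W' x) $ j)"
    by (simp add: sum_subtractf g(4))
qed (use assms in auto)

text \<open>No root word passes through the partner \<open>j\<close>, so images of roots of block
  \<open>i\<close> have zero glue at \<open>j\<close>. Hence the image of a projected unit vector of
  block \<open>j\<close> lies in \<open>A_dual\<close>, is supported on block \<open>i\<close> and
  has norm 1 - 1/p, so its only glue entry has gap p - 1 and is 1 or -1. Products with it compare
  the two words.\<close>

lemma match_1:
  assumes "card (cls i) = 1"
  shows "\<exists>\<sigma> s. matches i v v' \<sigma> s"
proof -
  have "i \<in> cls i" using root_rel_refl[of Gam i] by (simp add: cls_def)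
  then have i: "cls i = {i}" using assms by (auto simp: card_1_singleton_iff)
  obtain j where j: "partner i = {j}" using assms card_partner[of i] by (auto simp: card_1_singleton_iff)
  have jp: "j \<in> partner i" using j by simp
  let ?E = "W (ebar j (undefined :: 'a))"
  have EV: "?E \<in> V0" by (intro V0 ebar_V0)
  have E0: "?E $ t = 0" if "t \<noteq> i" for t using W_ebar_in[OF jp] i that by (auto simp: supp_def)
  have W'0: "word (W' (rootv i a b)) $ j = 0" for a b
  proof (rule ccontr)
    assume nz: "word (W' (rootv i a b)) $ j \<noteq> 0"
    then have ab: "a \<noteq> b" by (auto simp: linear_0[OF lin(2)] word_0)
    have ww: "word (W' (rootv i a b)) \<noteq> 0" using nz by auto
    have rw: "root_word (word (W' (rootv i a b)))"
      by (rule norm2_word[OF W'_root sw.W_root_norm[OF ab] ww])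
    have "card (supp (word (W' (rootv i a b)))) \<noteq> 1" using root_word_shape[OF odd rw] by auto
    then have "supp (word (W' (rootv i a b))) \<noteq> {j}" by auto
    then obtain l where l: "l \<in> supp (word (W' (rootv i a b)))" "l \<noteq> j" using nz by (auto simp: supp_def)
    have "root_rel sw.Gam j l" unfolding root_rel_def
      using rw l nz sw.word_W_root[of i a b] by (auto simp: supp_def)
    then have "l \<in> partner i" using partner_eq[OF jp] by (simp add: sw.cls_def)
    then show False using j l by simp
  qed
  have "?E \<bullet> rootv t a b \<in> \<int>" for t a b
  proof (cases "t = i")
    case False
    then show ?thesis using E0[of t] by (simp add: inner_diff_right inner_ebar EV)
  next
    case True
    have "?E \<bullet> rootv i a b = ebar j undefined \<bullet> W' (rootv i a b)" by (rule adjoint[OF ebar_V0 root_V0])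
    moreover have "ebar j (undefined :: 'a) \<bullet> W' (rootv i a b) \<in> \<int>"
    proof -
      have "(\<Sum>t\<in>UNIV. word (ebar j (undefined :: 'a)) $ t * word (W' (rootv i a b)) $ t) = word (W' (rootv i a b)) $ j"
        unfolding ebar_A_dual(2) by (subst sum.remove[of _ j]) (auto simp: axis_def)
      then show ?thesis using inner_Ints_iff[OF ebar_A_dual(1) W'_root, of j undefined i a b] W'0 by simp
    qed
    ultimately show ?thesis using True by simp
  qed
  then have EA: "?E \<in> A_dual" unfolding A_dual_iff using EV by blast
  have wE: "word ?E $ t = 0" if "t \<noteq> i" for t using E0[OF that] by (simp add: word_def)
  have "word ?E $ i = 1 \<or> word ?E $ i = -1"
  proof (rule ccontr)
    assume no: "\<not> ?thesis"
    obtain t where t: "t \<ge> 0" "real CARD('a) * (?E \<bullet> ?E) = of_int ((\<Sum>l\<in>UNIV. gap (word ?E $ l)) + 2 * int CARD('a) * t)"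
      using norm_gap[OF EA] by blast
    have "?E \<bullet> ?E = 1 - 1 / real CARD('a)" using inner[OF ebar_V0 ebar_V0] ebar_norm by metis
    then have "real CARD('a) * (?E \<bullet> ?E) = real CARD('a) - 1" by (simp add: field_simps)
    then have "real_of_int (int CARD('a) - 1) = of_int ((\<Sum>l\<in>UNIV. gap (word ?E $ l)) + 2 * int CARD('a) * t)" using t(2) by simp
    then have e: "int CARD('a) - 1 = (\<Sum>l\<in>UNIV. gap (word ?E $ l)) + 2 * int CARD('a) * t" by (simp only: of_int_eq_iff)
    have g: "(\<Sum>l\<in>UNIV. gap (word ?E $ l)) = gap (word ?E $ i)"
      by (subst sum.remove[of _ i]) (auto simp: wE gap_def intro!: sum.neutral)
    have p: "CARD('a) \<ge> 3" using card_p_cases[where 'p='a] odd by linarith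
    show False
    proof (cases "word ?E $ i = 0")
      case True
      then have q: "int CARD('a) - 1 = 2 * int CARD('a) * t" using e g by (simp add: gap_def)
      show False
      proof (cases "t = 0")
        case True then show False using q p by simp
      next
        case False
        then have "2 * int CARD('a) * 1 \<le> 2 * int CARD('a) * t" using t(1) by (intro mult_left_mono) auto
        then show False unfolding q[symmetric] by simp
      qed
    next
      case False
      then have "2 * int CARD('a) - 4 \<le> gap (word ?E $ i)" using gap_small no by blast
      moreover have "0 \<le> 2 * int CARD('a) * t" using t(1) by simp
      ultimately have "2 * int CARD('a) - 4 \<le> int CARD('a) - 1" using e g by presburger
      then have p3: "CARD('a) = 3" using p card_p_cases[where 'p='a] odd by linarith
      then show False using mod_ring_cases_3[OF p3, of "word ?E $ i"] no False by blast
    qed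
  qed
  then have s: "word ?E $ i = 1 \<or> word ?E $ i = -1" .
  let ?s = "word ?E $ i"
  have cd: "?s * word (W' x) $ j = word x $ i" if x: "x \<in> Qd" for x
  proof -
    have xA: "x \<in> A_dual" using x by (rule QdD)
    have W'A: "W' x \<in> A_dual" using W'_Qd[OF x] by (simp add: sw.Qd_def)
    obtain m where m: "real CARD('a) * (?E \<bullet> x) = of_int m" "of_int m = - (\<Sum>t\<in>UNIV. word ?E $ t * word x $ t)"
      using inner_words[OF EA xA] by blast
    obtain m' where m': "real CARD('a) * (ebar j (undefined :: 'a) \<bullet> W' x) = of_int m'"
      "of_int m' = - (\<Sum>t\<in>UNIV. word (ebar j (undefined :: 'a)) $ t * word (W' x) $ t)"
      using inner_words[OF ebar_A_dual(1) W'A] by blast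
    have "m = m'" using m(1) m'(1) adjoint[OF ebar_V0 A_dual_V0[OF xA], of j undefined] by simp
    moreover have "(\<Sum>t\<in>UNIV. word ?E $ t * word x $ t) = ?s * word x $ i"
      by (subst sum.remove[of _ i]) (auto simp: wE intro!: sum.neutral)
    moreover have "(\<Sum>t\<in>UNIV. word (ebar j (undefined :: 'a)) $ t * word (W' x) $ t) = word (W' x) $ j"
      unfolding ebar_A_dual(2) by (subst sum.remove[of _ j]) (auto simp: axis_def)
    ultimately have "word (W' x) $ j = ?s * word x $ i" using m(2) m'(2) by simp
    then show ?thesis using s by (elim disjE) simp_all
  qed
  have "matches i v v' (\<lambda>_. j) (\<lambda>_. ?s)"
    unfolding matches_def
  proof (intro conjI ballI impI)
    show "bij_betw (\<lambda>_. j) (cls i) (partner i)" by (simp add: i j bij_betw_def)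
    fix x assume x: "x \<in> Qd"
    have "res (cls i) (\<chi> t. word x $ t - ?s * word (W' x) $ j) $ t = 0" for t using cd[OF x] i by (simp add: res_nth)
    then have "res (cls i) (\<chi> t. word x $ t - ?s * word (W' x) $ j) = 0" by (simp add: vec_eq_iff)
    then show "res (cls i) (\<chi> t. word x $ t - ?s * word (W' x) $ j) \<in> Gam" using code_closed(1)[OF Gam_code] by simp
  qed (use s assms in auto)
  then show ?thesis by blast
qed

end

context integral_frame_pair
begin

text \<open>Both words are multiples of the normal form words, with factors y and y' given by the
  functionals. The signed bijection takes one normal form to the other, and the difference (y - y')
  w lies in \<open>Gam\<close> and changes v by exactly y - y'.\<close>

lemma match_2:
  assumes p: "CARD('a) = 5"
    and w1: "w1 \<in> Gam" "root_word w1" "supp w1 \<subseteq> cls i" "(\<Sum>t\<in>UNIV. v $ t * w1 $ t) \<noteq> 0"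
    and w1': "w1' \<in> sw.Gam" "root_word w1'" "supp w1' \<subseteq> partner i" "(\<Sum>t\<in>UNIV. v' $ t * w1' $ t) \<noteq> 0"
  shows "\<exists>\<sigma> s. matches i v v' \<sigma> s"
proof -
  have ne: "supp w \<noteq> {}" if "root_word w" for w :: "'a mod_ring ^ 'b"
    using root_word_shape[OF odd that] p by auto
  obtain t where t: "t \<in> supp w1" using ne[OF w1(2)] by blast
  have Tt: "cls i = {l. root_rel Gam t l}" using cls_eq[of i t] t w1(3) by (auto simp: cls_def)
  obtain t' where t': "t' \<in> supp w1'" using ne[OF w1'(2)] by blast
  have Tt': "partner i = {l. root_rel sw.Gam t' l}" using partner_eq[of t' i] t' w1'(3) by (auto simp: sw.cls_def)
  obtain w i0 i1 e0 e1 where f: "w \<in> Gam" "i0 \<noteq> i1" "cls i = {i0, i1}" "e0 \<in> {1, -1}" "e1 \<in> {1, -1}"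
    "supp w = cls i" "w $ i0 = e0" "w $ i1 = 2 * e1"
    and fc: "\<forall>c. (\<forall>g\<in>Gam. (\<Sum>i\<in>UNIV. c $ i * g $ i) = 0) \<longrightarrow>
      c $ i0 = e0 * (\<Sum>i\<in>cls i. v $ i * c $ i) \<and> c $ i1 = 2 * e1 * (\<Sum>i\<in>cls i. v $ i * c $ i)"
    by (rule class_form_2[OF Gam_code Gam_orthogonal p w1(1,2) t Tt w1], rule that)
  obtain w' j0 j1 d0 d1 where f': "w' \<in> sw.Gam" "j0 \<noteq> j1" "partner i = {j0, j1}" "d0 \<in> {1, -1}" "d1 \<in> {1, -1}"
    "supp w' = partner i" "w' $ j0 = d0" "w' $ j1 = 2 * d1"
    and fc': "\<forall>c. (\<forall>g\<in>sw.Gam. (\<Sum>i\<in>UNIV. c $ i * g $ i) = 0) \<longrightarrow>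
      c $ j0 = d0 * (\<Sum>j\<in>partner i. v' $ j * c $ j) \<and> c $ j1 = 2 * d1 * (\<Sum>j\<in>partner i. v' $ j * c $ j)"
    by (rule class_form_2[OF sw.Gam_code sw.Gam_orthogonal p w1'(1,2) t' Tt' w1'], rule that)
  have vw: "(\<Sum>l\<in>cls i. v $ l * w $ l) = 1"
  proof -
    have "e0 = e0 * (\<Sum>l\<in>cls i. v $ l * w $ l)" using spec[OF fc, of w] Gam_self_orth[OF f(1)] f(7) by auto
    then show ?thesis using f(4) by auto
  qed
  have dd: "d0 * d0 = 1" "d1 * d1 = 1" using f' by auto
  have "matches i v v' (\<lambda>l. if l = i0 then j0 else j1) (\<lambda>l. if l = i0 then e0 * d0 else e1 * d1)"
  proof (rule matchesI)
    show "bij_betw (\<lambda>l. if l = i0 then j0 else j1) (cls i) (partner i)"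
      unfolding f(3) f'(3) using f(2) f'(2) by (auto simp: bij_betw_def inj_on_def)
    show "(if l = i0 then e0 * d0 else e1 * d1) = 1 \<or> (if l = i0 then e0 * d0 else e1 * d1) = -1" for l
      using f(4,5) f'(4,5) by auto
    fix x assume x: "x \<in> Qd"
    let ?c = "word x" and ?d = "word (W' x)"
    define y y' where "y = (\<Sum>l\<in>cls i. v $ l * ?c $ l)" and "y' = (\<Sum>j\<in>partner i. v' $ j * ?d $ j)"
    have c: "?c $ i0 = e0 * y" "?c $ i1 = 2 * e1 * y" using spec[OF fc, of ?c] QdD(2)[OF x] by (auto simp: y_def)
    have d: "?d $ j0 = d0 * y'" "?d $ j1 = 2 * d1 * y'" using spec[OF fc', of ?d] sw.QdD(2)[OF W'_Qd[OF x]] by (auto simp: y'_def)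
    have F0: "e0 * d0 * ?d $ j0 = e0 * y'" unfolding d by (simp only: mult.assoc square_one_cancel(1)[OF dd(1)])
    have F1: "e1 * d1 * ?d $ j1 = 2 * e1 * y'"
    proof -
      have "e1 * d1 * ?d $ j1 = 2 * (e1 * (d1 * (d1 * y')))" unfolding d by (simp only: mult_ac)
      then show ?thesis by (simp only: square_one_cancel(1)[OF dd(2)] mult.assoc)
    qed
    let ?g = "(y - y') *s w"
    have "?g \<in> Gam" by (rule code_closed(4)[OF Gam_code f(1)])
    moreover have "supp ?g \<subseteq> cls i" using f(6) by (auto simp: supp_def)
    moreover have "\<forall>l\<in>cls i. (if l = i0 then e0 * d0 else e1 * d1) * ?d $ (if l = i0 then j0 else j1) = ?c $ l - ?g $ l"
    proof -
      have "e0 * d0 * ?d $ j0 = ?c $ i0 - ?g $ i0" unfolding F0 c by (simp add: f(7) algebra_simps)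
      moreover have "e1 * d1 * ?d $ j1 = ?c $ i1 - ?g $ i1" unfolding F1 c by (simp add: f(8) algebra_simps)
      ultimately show ?thesis unfolding f(3) using f(2) by simp
    qed
    moreover have "(\<Sum>l\<in>cls i. v $ l * ?g $ l) = y - y'"
    proof -
      have "(\<Sum>l\<in>cls i. v $ l * ?g $ l) = (y - y') * (\<Sum>l\<in>cls i. v $ l * w $ l)"
        unfolding sum_distrib_left by (intro sum.cong refl) (simp only: vector_smult_component mult_ac)
      then show ?thesis using vw by simp
    qed
    ultimately show "\<exists>g\<in>Gam. supp g \<subseteq> cls i \<and>
       (\<forall>l\<in>cls i. (if l = i0 then e0 * d0 else e1 * d1) * ?d $ (if l = i0 then j0 else j1) = ?c $ l - g $ l) \<and>
       (\<Sum>l\<in>cls i. v $ l * g $ l) = (\<Sum>l\<in>cls i. v $ l * ?c $ l) - (\<Sum>j\<in>partner i. v' $ j * ?d $ j)"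
      unfolding y_def[symmetric] y'_def[symmetric] by blast
  qed
  then show ?thesis by blast
qed

text \<open>Labels of sum zero on a triple are determined by the first label, which is the
  functional, and by the difference of two labels, which is unaffected by \<open>Gam\<close>. By
  \<open>kernel_transfer\<close> this difference has the same kernel in both frames, so the two
  versions agree up to a sign.\<close>

lemma match_3:
  assumes p: "CARD('a) = 3"
    and w1: "w1 \<in> Gam" "card (supp w1) = 3" "cls i = supp w1" "(\<Sum>t\<in>UNIV. v $ t * w1 $ t) \<noteq> 0"
    and w1': "w1' \<in> sw.Gam" "card (supp w1') = 3" "partner i = supp w1'" "(\<Sum>t\<in>UNIV. v' $ t * w1' $ t) \<noteq> 0"
  shows "\<exists>\<sigma> s. matches i v v' \<sigma> s"
proof -
  have three: "(3 :: 'a mod_ring) = 0" by (rule three_eq_0[OF p])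
  have pm: "u $ t = 1 \<or> u $ t = -1" if "t \<in> supp u" for u :: "'a mod_ring ^ 'b" and t
    using mod_ring_cases_3[OF p, of "u $ t"] that by (auto simp: supp_def)
  have sq: "u $ t * u $ t = 1" if "t \<in> supp u" for u :: "'a mod_ring ^ 'b" and t using pm[OF that] by auto
  obtain w i0 i1 i2 where f: "w \<in> Gam" "distinct [i0, i1, i2]" "cls i = {i0, i1, i2}" "supp w = cls i"
    and fc: "\<forall>c. (\<forall>g\<in>Gam. (\<Sum>i\<in>UNIV. c $ i * g $ i) = 0) \<longrightarrow>
      w $ i0 * c $ i0 = (\<Sum>i\<in>cls i. v $ i * c $ i) \<and> w $ i0 * c $ i0 + w $ i1 * c $ i1 + w $ i2 * c $ i2 = 0"
    by (rule class_form_3[OF Gam_code Gam_orthogonal p w1(1,2,3) w1(1,2) equalityD2[OF w1(3)] w1(4)], rule that)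
  obtain w' j0 k1 k2 where f': "w' \<in> sw.Gam" "distinct [j0, k1, k2]" "partner i = {j0, k1, k2}" "supp w' = partner i"
    and fc0: "\<forall>c. (\<forall>g\<in>sw.Gam. (\<Sum>i\<in>UNIV. c $ i * g $ i) = 0) \<longrightarrow>
      w' $ j0 * c $ j0 = (\<Sum>j\<in>partner i. v' $ j * c $ j) \<and> w' $ j0 * c $ j0 + w' $ k1 * c $ k1 + w' $ k2 * c $ k2 = 0"
    by (rule class_form_3[OF sw.Gam_code sw.Gam_orthogonal p w1'(1,2,3) w1'(1,2) equalityD2[OF w1'(3)] w1'(4)], rule that)
  let ?b = "\<lambda>x. w $ i1 * word x $ i1 - w $ i0 * word x $ i0"
  let ?b' = "\<lambda>x. w' $ k1 * word (W' x) $ k1 - w' $ j0 * word (W' x) $ j0"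
  have jp: "j0 \<in> partner i" using f'(3) by simp
  have "(\<forall>x\<in>Qd. ?b' x = ?b x) \<or> (\<forall>x\<in>Qd. ?b' x = - ?b x)"
  proof (rule additive_mod_3_proportional[OF p Qd_diff])
    fix x y assume xy: "x \<in> Qd" "y \<in> Qd"
    show "?b (x - y) = ?b x - ?b y"
      unfolding word_diff[OF QdD(1)[OF xy(1)] QdD(1)[OF xy(2)]] by (simp add: algebra_simps)
    have "word (W' (x - y)) = word (W' x) - word (W' y)"
      unfolding linear_diff[OF lin(2)] by (rule word_diff[OF sw.QdD(1)[OF W'_Qd[OF xy(1)]] sw.QdD(1)[OF W'_Qd[OF xy(2)]]])
    then show "?b' (x - y) = ?b' x - ?b' y" by (simp only:) (simp add: algebra_simps)
  next
    fix x assume x: "x \<in> Qd"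
    have "?b' x = 0" if "?b x = 0"
      using kernel_transfer[OF p x f(1,4,3,2) f'(1,4,3,2)] that by simp
    moreover have "?b x = 0" if z: "?b' x = 0"
    proof -
      have c: "sw.cls j0 = partner i" using partner_eq[OF jp] by simp
      have q: "sw.partner j0 = cls i" by (rule partner_partner[OF jp])
      have "w $ i1 * word (W (W' x)) $ i1 = w $ i0 * word (W (W' x)) $ i0"
        by (rule sw.kernel_transfer[OF p W'_Qd[OF x] f'(1) _ _ f'(2) f(1) _ _ f(2)])
          (use z c q f f' in simp_all)
      then show ?thesis using inverse(2)[OF A_dual_V0[OF QdD(1)[OF x]]] by simp
    qed
    ultimately show "?b x = 0 \<longleftrightarrow> ?b' x = 0" by blast
  qed
  \<comment> \<open>Exchanging \<open>k1\<close> and \<open>k2\<close> changes the sign of \<open>?b'\<close>.\<close>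
  then have "\<exists>j1 j2. distinct [j0, j1, j2] \<and> partner i = {j0, j1, j2} \<and>
    (\<forall>x\<in>Qd. w' $ j0 * word (W' x) $ j0 + w' $ j1 * word (W' x) $ j1 + w' $ j2 * word (W' x) $ j2 = 0 \<and>
      w' $ j1 * word (W' x) $ j1 - w' $ j0 * word (W' x) $ j0 = ?b x)"
  proof
    assume a: "\<forall>x\<in>Qd. ?b' x = ?b x"
    have "\<forall>x\<in>Qd. w' $ j0 * word (W' x) $ j0 + w' $ k1 * word (W' x) $ k1 + w' $ k2 * word (W' x) $ k2 = 0"
      using fc0 sw.QdD(2)[OF W'_Qd] by blast
    then show ?thesis using a f'(2,3) by (intro exI[of _ k1] exI[of _ k2]) simp
  next
    assume a: "\<forall>x\<in>Qd. ?b' x = - ?b x"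
    have s: "\<forall>x\<in>Qd. w' $ j0 * word (W' x) $ j0 + w' $ k1 * word (W' x) $ k1 + w' $ k2 * word (W' x) $ k2 = 0"
      using fc0 sw.QdD(2)[OF W'_Qd] by blast
    have "w' $ j0 * word (W' x) $ j0 + w' $ k2 * word (W' x) $ k2 + w' $ k1 * word (W' x) $ k1 = 0 \<and>
        w' $ k2 * word (W' x) $ k2 - w' $ j0 * word (W' x) $ j0 = ?b x" if x: "x \<in> Qd" for x
    proof -
      define D0 D1 D2 where "D0 = w' $ j0 * word (W' x) $ j0" and "D1 = w' $ k1 * word (W' x) $ k1" and "D2 = w' $ k2 * word (W' x) $ k2"
      have 1: "D0 + D1 + D2 = 0" using bspec[OF s x] by (simp only: D0_def D1_def D2_def)
      have 2: "D1 - D0 = - ?b x" using bspec[OF a x] by (simp only: D0_def D1_def)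
      have "D2 - D0 = (D0 + D1 + D2) - (D1 - D0) - 3 * D0" by (simp add: algebra_simps)
      then have "D2 - D0 = ?b x" unfolding 1 2 using three by simp
      moreover have "D0 + D2 + D1 = 0" using 1 by (simp add: algebra_simps)
      ultimately show ?thesis by (simp only: D0_def D1_def D2_def)
    qed
    moreover have "distinct [j0, k2, k1]" "partner i = {j0, k2, k1}" using f'(2,3) by auto
    ultimately show ?thesis by (intro exI[of _ k2] exI[of _ k1]) simp
  qed
  then obtain j1 j2 where j: "distinct [j0, j1, j2]" "partner i = {j0, j1, j2}"
    and js: "\<And>x. x \<in> Qd \<Longrightarrow> w' $ j0 * word (W' x) $ j0 + w' $ j1 * word (W' x) $ j1 + w' $ j2 * word (W' x) $ j2 = 0"
    and jb: "\<And>x. x \<in> Qd \<Longrightarrow> w' $ j1 * word (W' x) $ j1 - w' $ j0 * word (W' x) $ j0 = ?b x"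
    by (elim exE conjE) (metis (no_types, lifting))
  have vw: "(\<Sum>l\<in>cls i. v $ l * w $ l) = 1"
  proof -
    have "w $ i0 * w $ i0 = (\<Sum>l\<in>cls i. v $ l * w $ l)" using spec[OF fc, of w] Gam_self_orth[OF f(1)] by auto
    then show ?thesis using sq[of i0 w] f(3,4) by simp
  qed
  let ?\<sigma> = "\<lambda>l. if l = i0 then j0 else if l = i1 then j1 else j2"
  let ?s = "\<lambda>l. w $ l * w' $ ?\<sigma> l"
  have "matches i v v' ?\<sigma> ?s"
  proof (rule matchesI)
    show "bij_betw ?\<sigma> (cls i) (partner i)"
      unfolding f(3) j(2) using f(2) j(1) by (auto simp: bij_betw_def inj_on_def)
    show "?s l = 1 \<or> ?s l = -1" if l: "l \<in> cls i" for l
    proof -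
      have "l \<in> supp w" using l f(4) by simp
      moreover have "?\<sigma> l \<in> supp w'" using f'(4) j(2) by simp
      ultimately show ?thesis using pm[of l w] pm[of "?\<sigma> l" w'] by auto
    qed
    fix x assume x: "x \<in> Qd"
    let ?c = "word x" and ?d = "word (W' x)"
    define X B E D0 D1 D2 where "X = w $ i0 * ?c $ i0" and "B = w $ i1 * ?c $ i1" and "E = w $ i2 * ?c $ i2"
      and "D0 = w' $ j0 * ?d $ j0" and "D1 = w' $ j1 * ?d $ j1" and "D2 = w' $ j2 * ?d $ j2"
    have y: "X = (\<Sum>l\<in>cls i. v $ l * ?c $ l)" and cs: "X + B + E = 0"
      using spec[OF fc, of ?c] QdD(2)[OF x] by (auto simp: X_def B_def E_def)
    have y': "D0 = (\<Sum>j\<in>partner i. v' $ j * ?d $ j)" using spec[OF fc0, of ?d] sw.QdD(2)[OF W'_Qd[OF x]] by (auto simp: D0_def)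
    have ds: "D0 + D1 + D2 = 0" using js[OF x] by (simp only: D0_def D1_def D2_def)
    have db: "D1 - D0 = B - X" using jb[OF x] by (simp only: D0_def D1_def B_def X_def)
    have D1: "D1 = B - (X - D0)" using db by (simp add: algebra_simps)
    have D2: "D2 = E - (X - D0)"
    proof -
      have "D2 - (E - (X - D0)) = (D0 + D1 + D2) - (X + B + E) - (D1 - D0 - (B - X)) + 3 * (X - D0)" by (simp add: algebra_simps)
      then show ?thesis unfolding ds cs db using three by simp
    qed
    let ?g = "(X - D0) *s w"
    have s0: "w $ l * (w $ l * ?c $ l - (X - D0)) = ?c $ l - ?g $ l" if "l \<in> cls i" for l
      using square_one_cancel(1)[OF sq[of l w], of "?c $ l"] that f(4) by (simp add: right_diff_distrib mult.commute)
    have F: "?s l * ?d $ ?\<sigma> l = ?c $ l - ?g $ l" if l: "l \<in> cls i" for l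
    proof -
      have "w' $ ?\<sigma> l * ?d $ ?\<sigma> l = w $ l * ?c $ l - (X - D0)"
        using l f(2,3) D1 D2 by (auto simp: X_def B_def E_def D0_def D1_def D2_def)
      then have "w $ l * (w' $ ?\<sigma> l * ?d $ ?\<sigma> l) = ?c $ l - ?g $ l" using s0[OF l] by (simp only:)
      then show ?thesis by (simp only: mult.assoc)
    qed
    have "?g \<in> Gam" by (rule code_closed(4)[OF Gam_code f(1)])
    moreover have "supp ?g \<subseteq> cls i" using f(4) by (auto simp: supp_def)
    moreover have "(\<Sum>l\<in>cls i. v $ l * ?g $ l) = X - D0"
    proof -
      have "(\<Sum>l\<in>cls i. v $ l * ?g $ l) = (X - D0) * (\<Sum>l\<in>cls i. v $ l * w $ l)"
        unfolding sum_distrib_left by (intro sum.cong refl) (simp only: vector_smult_component mult_ac)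
      then show ?thesis using vw by simp
    qed
    ultimately show "\<exists>g\<in>Gam. supp g \<subseteq> cls i \<and> (\<forall>l\<in>cls i. ?s l * ?d $ ?\<sigma> l = ?c $ l - g $ l) \<and>
       (\<Sum>l\<in>cls i. v $ l * g $ l) = (\<Sum>l\<in>cls i. v $ l * ?c $ l) - (\<Sum>j\<in>partner i. v' $ j * ?d $ j)"
      using F unfolding y[symmetric] y'[symmetric] by blast
  qed
  then show ?thesis by blast
qed

end

lemma separating_functional:
  fixes C :: "('a::field ^ 'k) set"
  assumes C: "is_code C" and c0: "c0 \<notin> C"
  obtains v where "\<And>c. c \<in> C \<Longrightarrow> (\<Sum>i\<in>UNIV. v $ i * c $ i) = 0" "(\<Sum>i\<in>UNIV. v $ i * c0 $ i) = 1"
proof -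
  obtain B where B: "B \<subseteq> C" "vec.independent B" "C \<subseteq> vec.span B" by (rule vec.maximal_independent_subset)
  have "vec.span B \<subseteq> C" using B(1) C by (simp add: is_code_def vec.span_minimal)
  then have "c0 \<notin> vec.span B" using c0 by blast
  then have ind: "vec.independent (insert c0 B)" using B(2) by (rule vec.independent_insertI)
  obtain l :: 'k where "True" by blast
  obtain g :: "'a ^ 'k \<Rightarrow> 'a ^ 'k" where g: "Vector_Spaces.linear (*s) (*s) g"
    "\<forall>x\<in>insert c0 B. g x = (if x = c0 then axis l 1 else 0)"
    using vec.linear_independent_extend[OF ind, of "\<lambda>x. if x = c0 then axis l 1 else 0"] by blast
  define v :: "'a ^ 'k" where "v = (\<chi> i. g (axis i 1) $ l)"
  have rep: "g x $ l = (\<Sum>i\<in>UNIV. v $ i * x $ i)" for x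
  proof -
    have "g x = g (\<Sum>i\<in>UNIV. x $ i *s axis i 1)" by (simp only: basis_expansion)
    also have "\<dots> = (\<Sum>i\<in>UNIV. x $ i *s g (axis i 1))"
      by (simp add: vec.linear_sum[OF g(1)] vec.linear_scale[OF g(1)])
    finally show ?thesis by (simp add: v_def mult.commute)
  qed
  have "g c = 0" if "c \<in> C" for c
  proof -
    have "c \<in> vec.span B" using that B(3) by blast
    then show ?thesis
    proof (induction rule: vec.span_induct_alt)
      case base show ?case by (rule vec.linear_0[OF g(1)])
    next
      case (step a x y)
      have "x \<noteq> c0" using step(1) B(1) c0 by blast
      then have "g x = 0" using g(2) step(1) by simp
      then show ?case using step by (simp add: vec.linear_add[OF g(1)] vec.linear_scale[OF g(1)])
    qed
  qed
  moreover have "g c0 $ l = 1" using g(2) by (simp add: axis_def)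
  ultimately show ?thesis using that[of v] rep by (metis zero_index)
qed

context integral_frame_pair
begin

text \<open>The restricted words lie in a tetracode contained in \<open>Gam\<close>, so only the
  functional has to be respected: the adapted bases are identified, and the correction is a
  combination of the basis words \<open>a\<close> and \<open>b\<close>.\<close>

lemma match_4:
  assumes p: "CARD('a) = 3"
    and w: "w \<in> Gam" "card (supp w) = 3" "t \<in> supp w" and u: "u \<in> Gam" "card (supp u) = 3" "supp w \<inter> supp u \<noteq> {}" "supp w \<noteq> supp u"
    and T: "cls i = {l. root_rel Gam t l}"
    and w1: "w1 \<in> Gam" "card (supp w1) = 3" "supp w1 \<subseteq> cls i" "(\<Sum>t\<in>UNIV. v $ t * w1 $ t) \<noteq> 0"
    and w': "w' \<in> sw.Gam" "card (supp w') = 3" "t' \<in> supp w'" and u': "u' \<in> sw.Gam" "card (supp u') = 3" "supp w' \<inter> supp u' \<noteq> {}" "supp w' \<noteq> supp u'"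
    and T': "partner i = {l. root_rel sw.Gam t' l}"
    and w1': "w1' \<in> sw.Gam" "card (supp w1') = 3" "supp w1' \<subseteq> partner i" "(\<Sum>t\<in>UNIV. v' $ t * w1' $ t) \<noteq> 0"
  shows "\<exists>\<sigma> s. matches i v v' \<sigma> s"
proof -
  obtain a b i0 i1 i2 i3 e0 e1 e2 e3 where f: "distinct [i0, i1, i2, i3]" "cls i = {i0, i1, i2, i3}"
    "supp a = {i0, i1, i2}" "supp b = {i1, i2, i3}"
    "a $ i0 = e0" "a $ i1 = e1" "a $ i2 = e2" "b $ i1 = e1" "b $ i2 = - e2" "b $ i3 = e3"
    "a \<in> Gam" "b \<in> Gam" "e0 \<in> {1, -1}" "e1 \<in> {1, -1}" "e2 \<in> {1, -1}" "e3 \<in> {1, -1}"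
    and fc: "\<forall>c. (\<forall>g\<in>Gam. (\<Sum>i\<in>UNIV. c $ i * g $ i) = 0) \<longrightarrow>
      e3 * c $ i3 = (\<Sum>i\<in>cls i. v $ i * c $ i) \<and> (\<forall>i\<in>cls i. c $ i = (e0 * c $ i0) * a $ i + (e3 * c $ i3) * b $ i)"
    by (rule class_form_4[OF Gam_code Gam_orthogonal p w u T w1], rule that)
  obtain a' b' j0 j1 j2 j3 d0 d1 d2 d3 where f': "distinct [j0, j1, j2, j3]" "partner i = {j0, j1, j2, j3}"
    "supp a' = {j0, j1, j2}" "supp b' = {j1, j2, j3}"
    "a' $ j0 = d0" "a' $ j1 = d1" "a' $ j2 = d2" "b' $ j1 = d1" "b' $ j2 = - d2" "b' $ j3 = d3"
    "a' \<in> sw.Gam" "b' \<in> sw.Gam" "d0 \<in> {1, -1}" "d1 \<in> {1, -1}" "d2 \<in> {1, -1}" "d3 \<in> {1, -1}"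
    and fc': "\<forall>c. (\<forall>g\<in>sw.Gam. (\<Sum>i\<in>UNIV. c $ i * g $ i) = 0) \<longrightarrow>
      d3 * c $ j3 = (\<Sum>j\<in>partner i. v' $ j * c $ j) \<and> (\<forall>i\<in>partner i. c $ i = (d0 * c $ j0) * a' $ i + (d3 * c $ j3) * b' $ i)"
    by (rule class_form_4[OF sw.Gam_code sw.Gam_orthogonal p w' u' T' w1'], rule that)
  have z: "a $ i3 = 0" "b $ i0 = 0" using f(1,3,4) by (auto simp: supp_def)
  have z': "a' $ j3 = 0" "b' $ j0 = 0" using f'(1,3,4) by (auto simp: supp_def)
  have va: "(\<Sum>l\<in>cls i. v $ l * a $ l) = 0"
    using spec[OF fc, of a] Gam_self_orth[OF f(11)] z by auto
  have vb: "(\<Sum>l\<in>cls i. v $ l * b $ l) = 1"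
  proof -
    have "e3 * e3 = (\<Sum>l\<in>cls i. v $ l * b $ l)" using spec[OF fc, of b] Gam_self_orth[OF f(12)] f(10) by auto
    then show ?thesis using f(16) by auto
  qed
  have dd: "d0 * d0 = 1" "d1 * d1 = 1" "d2 * d2 = 1" "d3 * d3 = 1" using f'(13,14,15,16) by auto
  let ?\<sigma> = "\<lambda>l. if l = i0 then j0 else if l = i1 then j1 else if l = i2 then j2 else j3"
  let ?s = "\<lambda>l. if l = i0 then e0 * d0 else if l = i1 then e1 * d1 else if l = i2 then e2 * d2 else e3 * d3"
  have "matches i v v' ?\<sigma> ?s"
  proof (rule matchesI)
    show "bij_betw ?\<sigma> (cls i) (partner i)"
      unfolding f(2) f'(2) using f(1) f'(1) by (auto simp: bij_betw_def inj_on_def)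
    have pm: "x * y = 1 \<or> x * y = -1" if "x \<in> {1, -1}" "y \<in> {1, -1}" for x y :: "'a mod_ring" using that by auto
    show "?s l = 1 \<or> ?s l = -1" for l
      using pm[OF f(13) f'(13)] pm[OF f(14) f'(14)] pm[OF f(15) f'(15)] pm[OF f(16) f'(16)] by simp
    fix x assume x: "x \<in> Qd"
    let ?c = "word x" and ?d = "word (W' x)"
    define X Y X' Y' where "X = e0 * ?c $ i0" and "Y = e3 * ?c $ i3" and "X' = d0 * ?d $ j0" and "Y' = d3 * ?d $ j3"
    have fx: "Y = (\<Sum>l\<in>cls i. v $ l * ?c $ l) \<and> (\<forall>l\<in>cls i. ?c $ l = X * a $ l + Y * b $ l)"
      unfolding X_def Y_def using mp[OF spec[OF fc, of ?c]] QdD(2)[OF x] by blast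
    have fx': "Y' = (\<Sum>j\<in>partner i. v' $ j * ?d $ j) \<and> (\<forall>l\<in>partner i. ?d $ l = X' * a' $ l + Y' * b' $ l)"
      unfolding X'_def Y'_def using mp[OF spec[OF fc', of ?d]] sw.QdD(2)[OF W'_Qd[OF x]] by blast
    have d: "?d $ j0 = d0 * X'" "?d $ j1 = d1 * (X' + Y')" "?d $ j2 = d2 * (X' - Y')" "?d $ j3 = d3 * Y'"
    proof -
      have "j0 \<in> partner i" "j1 \<in> partner i" "j2 \<in> partner i" "j3 \<in> partner i" using f'(2) by auto
      then have "?d $ j0 = X' * a' $ j0 + Y' * b' $ j0" "?d $ j1 = X' * a' $ j1 + Y' * b' $ j1"
        "?d $ j2 = X' * a' $ j2 + Y' * b' $ j2" "?d $ j3 = X' * a' $ j3 + Y' * b' $ j3" using fx' by blast+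
      then show "?d $ j0 = d0 * X'" "?d $ j1 = d1 * (X' + Y')" "?d $ j2 = d2 * (X' - Y')" "?d $ j3 = d3 * Y'"
        unfolding z' f'(5,6,7,8,9,10) by (simp_all add: algebra_simps)
    qed
    let ?g = "(X - X') *s a + (Y - Y') *s b"
    have gl: "?c $ l - ?g $ l = X' * a $ l + Y' * b $ l" if "l \<in> cls i" for l
    proof -
      have "?c $ l = X * a $ l + Y * b $ l" using fx that by blast
      then show ?thesis by (simp only:) (simp add: algebra_simps)
    qed
    have ii: "i0 \<in> cls i" "i1 \<in> cls i" "i2 \<in> cls i" "i3 \<in> cls i" using f(2) by auto
    have F0: "e0 * d0 * ?d $ j0 = ?c $ i0 - ?g $ i0"
      unfolding gl[OF ii(1)] d z f(5,6,7,8,9,10) by (simp only: mult.assoc square_one_cancel(1)[OF dd(1)]) (simp add: mult.commute)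
    have F1: "e1 * d1 * ?d $ j1 = ?c $ i1 - ?g $ i1"
      unfolding gl[OF ii(2)] d z f(5,6,7,8,9,10) by (simp only: mult.assoc square_one_cancel(1)[OF dd(2)]) (simp add: algebra_simps)
    have F2: "e2 * d2 * ?d $ j2 = ?c $ i2 - ?g $ i2"
      unfolding gl[OF ii(3)] d z f(5,6,7,8,9,10) by (simp only: mult.assoc square_one_cancel(1)[OF dd(3)]) (simp add: algebra_simps)
    have F3: "e3 * d3 * ?d $ j3 = ?c $ i3 - ?g $ i3"
      unfolding gl[OF ii(4)] d z f(5,6,7,8,9,10) by (simp only: mult.assoc square_one_cancel(1)[OF dd(4)]) (simp add: mult.commute)
    have "?g \<in> Gam" by (intro code_closed[OF Gam_code] f(11,12))
    moreover have "supp ?g \<subseteq> cls i"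
    proof
      fix l assume "l \<in> supp ?g"
      then have "l \<in> supp a \<or> l \<in> supp b" by (auto simp: supp_def)
      then show "l \<in> cls i" using f(2,3,4) by auto
    qed
    moreover have "\<forall>l\<in>cls i. ?s l * ?d $ ?\<sigma> l = ?c $ l - ?g $ l"
      unfolding f(2) using f(1) F0 F1 F2 F3 by simp
    moreover have "(\<Sum>l\<in>cls i. v $ l * ?g $ l) = (\<Sum>l\<in>cls i. v $ l * ?c $ l) - (\<Sum>j\<in>partner i. v' $ j * ?d $ j)"
    proof -
      have "(\<Sum>l\<in>cls i. v $ l * ?g $ l) = (X - X') * (\<Sum>l\<in>cls i. v $ l * a $ l) + (Y - Y') * (\<Sum>l\<in>cls i. v $ l * b $ l)"
        unfolding sum_distrib_left sum.distrib[symmetric] by (intro sum.cong refl) (simp add: algebra_simps)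
      also have "\<dots> = Y - Y'" by (simp add: va vb)
      finally show ?thesis using conjunct1[OF fx] conjunct1[OF fx'] by simp
    qed
    ultimately show "\<exists>g\<in>Gam. supp g \<subseteq> cls i \<and> (\<forall>l\<in>cls i. ?s l * ?d $ ?\<sigma> l = ?c $ l - g $ l) \<and>
       (\<Sum>l\<in>cls i. v $ l * g $ l) = (\<Sum>l\<in>cls i. v $ l * ?c $ l) - (\<Sum>j\<in>partner i. v' $ j * ?d $ j)"
      by - (rule bexI[of _ ?g], intro conjI)
  qed
  then show ?thesis by blast
qed

text \<open>A class and its partner have the same size, so for p = 3 both are triples or both are
  tetrads.\<close>

lemma exists_match:
  assumes "card (cls i) > 1 \<Longrightarrow> \<exists>w\<in>Gam. root_word w \<and> supp w \<subseteq> cls i \<and> (\<Sum>t\<in>UNIV. v $ t * w $ t) \<noteq> 0"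
    and "card (cls i) > 1 \<Longrightarrow> \<exists>w\<in>sw.Gam. root_word w \<and> supp w \<subseteq> partner i \<and> (\<Sum>t\<in>UNIV. v' $ t * w $ t) \<noteq> 0"
  shows "\<exists>\<sigma> s. matches i v v' \<sigma> s"
proof (cases "card (cls i) > 1")
  case False
  have "i \<in> cls i" using root_rel_refl[of Gam i] by (simp add: cls_def)
  then have "card (cls i) \<noteq> 0" by auto
  then have "card (cls i) = 1" using False by linarith
  then show ?thesis by (rule match_1)
next
  case True
  obtain w where w: "w \<in> Gam" "root_word w" "supp w \<subseteq> cls i" "(\<Sum>t\<in>UNIV. v $ t * w $ t) \<noteq> 0" using assms(1)[OF True] by blast
  obtain w' where w': "w' \<in> sw.Gam" "root_word w'" "supp w' \<subseteq> partner i" "(\<Sum>t\<in>UNIV. v' $ t * w' $ t) \<noteq> 0" using assms(2)[OF True] by blast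
  show ?thesis
  proof (cases "CARD('a) = 3")
    case False
    then have "CARD('a) = 5" using root_word_shape[OF odd w(2)] by blast
    then show ?thesis using match_2 w w' by blast
  next
    case 3: True
    have c: "card (supp w) = 3" "card (supp w') = 3" using w(2) w'(2) root_word_3[OF 3] by blast+
    obtain t where t: "t \<in> supp w" using c(1) by fastforce
    obtain t' where t': "t' \<in> supp w'" using c(2) by fastforce
    have T: "cls i = {l. root_rel Gam t l}" using cls_eq[of i t] t w(3) by (auto simp: cls_def)
    have T': "partner i = {l. root_rel sw.Gam t' l}" using partner_eq[of t' i] t' w'(3) by (auto simp: sw.cls_def)
    have big: "card (cls i) \<ge> 4" if u: "u \<in> Gam" "card (supp u) = 3" "supp w \<inter> supp u \<noteq> {}" "supp w \<noteq> supp u" for u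
    proof -
      obtain s where s: "s \<in> supp w" "s \<in> supp u" using u(3) by blast
      have "supp u \<subseteq> cls i"
      proof
        fix l assume "l \<in> supp u"
        then have "root_rel Gam s l" using u s root_word_3[OF 3] by (auto simp: root_rel_def)
        moreover have "cls i = cls s" using cls_eq[of i s] s w(3) by (auto simp: cls_def)
        ultimately show "l \<in> cls i" by (simp add: cls_def)
      qed
      then have "card (supp w \<union> supp u) \<le> card (cls i)" using w(3) by (intro card_mono) auto
      moreover have "supp w \<subset> supp w \<union> supp u"
        using u c(1) card_subset_eq[of "supp w" "supp u"] by auto
      then have "card (supp w) < card (supp w \<union> supp u)" by (intro psubset_card_mono) auto
      ultimately show ?thesis using c(1) by simp
    qed
    have big': "card (partner i) \<ge> 4" if u: "u \<in> sw.Gam" "card (supp u) = 3" "supp w' \<inter> supp u \<noteq> {}" "supp w' \<noteq> supp u" for u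
    proof -
      obtain s where s: "s \<in> supp w'" "s \<in> supp u" using u(3) by blast
      have "supp u \<subseteq> partner i"
      proof
        fix l assume "l \<in> supp u"
        then have "root_rel sw.Gam s l" using u s root_word_3[OF 3] by (auto simp: root_rel_def)
        moreover have "partner i = sw.cls s" using partner_eq[of s i] s w'(3) by auto
        ultimately show "l \<in> partner i" by (simp add: sw.cls_def)
      qed
      then have "card (supp w' \<union> supp u) \<le> card (partner i)" using w'(3) by (intro card_mono) auto
      moreover have "supp w' \<subset> supp w' \<union> supp u"
        using u c(2) card_subset_eq[of "supp w'" "supp u"] by auto
      then have "card (supp w') < card (supp w' \<union> supp u)" by (intro psubset_card_mono) auto
      ultimately show ?thesis using c(2) by simp
    qed
    consider "cls i = supp w" | u where "u \<in> Gam" "card (supp u) = 3" "supp w \<inter> supp u \<noteq> {}" "supp w \<noteq> supp u"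
      using class_3_cases[OF Gam_code Gam_orthogonal 3 w(1) c(1) t T] by blast
    then show ?thesis
    proof cases
      case 1
      then have "card (partner i) = 3" using card_partner[of i] c(1) by simp
      then have "partner i = supp w'" using w'(3) c(2) card_subset_eq[of "partner i" "supp w'"] by simp
      then show ?thesis using match_3[OF 3 w(1) c(1) 1 w(4) w'(1) c(2) _ w'(4)] by blast
    next
      case 2
      have "partner i \<noteq> supp w'" using big[OF 2] card_partner[of i] c(2) by auto
      then obtain u' where u': "u' \<in> sw.Gam" "card (supp u') = 3" "supp w' \<inter> supp u' \<noteq> {}" "supp w' \<noteq> supp u'"
        using class_3_cases[OF sw.Gam_code sw.Gam_orthogonal 3 w'(1) c(2) t' T'] by blast
      show ?thesis
        by (rule match_4[OF 3 w(1) c(1) t 2 T w(1) c(1) w(3,4) w'(1) c(2) t' u' T' w'(1) c(2) w'(3,4)])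
    qed
  qed
qed

end

lemma sum_diff_dot: "(\<Sum>i\<in>UNIV. v $ i * (x - y) $ i) = (\<Sum>i\<in>UNIV. v $ i * x $ i) - (\<Sum>i\<in>UNIV. v $ i * y $ i)"
  for v :: "'a::comm_ring_1 ^ 'k"
  by (simp add: right_diff_distrib sum_subtractf)

lemma nxt_neq: "CARD('n) > 1 \<Longrightarrow> (a :: 'n::{finite,linorder}) \<noteq> nxt a"
proof
  assume c: "CARD('n) > 1" and "a = nxt a"
  then have "idx a = (idx a + 1) mod CARD('n)" by (metis idx_nxt)
  then show False using idx_less[of a] c by (cases "idx a + 1 = CARD('n)") auto
qed

lemma supp_word: "supp (word x) \<subseteq> supp x"
  by (auto simp: supp_def word_def)

section \<open>From matched classes to a signed permutation of all coordinates\<close>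

context integral_frame_pair
begin

lemma Gam_subset:
  assumes S: "is_code S" and r: "\<And>j a. word (W (rootv j a (nxt a))) \<in> S"
  shows "Gam \<subseteq> S"
proof
  fix w assume "w \<in> Gam"
  then obtain x where x: "w = word (W x)" "x \<in> A_dual" "word x = 0" by (auto simp: Gam_def)
  define P where "P = (\<lambda>y. y \<in> A_dual \<and> word y \<in> S)"
  have P0: "P 0" using code_closed(1)[OF S] by (simp add: P_def A_dual_0 word_0)
  have Padd: "P (y + z)" if "P y" "P z" for y z
    using that code_closed(2)[OF S] by (simp add: P_def A_dual_add word_add)
  have Pscale: "P (of_int n *\<^sub>R y)" if "P y" for n y
    using that A_dual_of_int[of y n] code_closed(4)[OF S] by (simp add: P_def)
  have Psum: "P (\<Sum>i\<in>F. f i)" if "\<And>i. P (f i)" for F and f :: "'i \<Rightarrow> ('a, 'b) blocks"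
    by (induction F rule: infinite_finite_induct) (use P0 Padd that in auto)
  have Proot: "P (W (rootv j a b))" for j a b
  proof (rule nxt_induct[of "\<lambda>b. P (W (rootv j a b))" a b])
    show "P (W (rootv j a a))" using P0 by (simp add: linear_0[OF lin(1)])
    fix b assume b: "P (W (rootv j a b))"
    have "W (rootv j a (nxt b)) = W (rootv j a b) + W (rootv j b (nxt b))"
      unfolding linear_add[OF lin(1), symmetric] by simp
    moreover have "P (W (rootv j b (nxt b)))" using W_root r by (simp add: P_def)
    ultimately show "P (W (rootv j a (nxt b)))" using Padd[OF b] by simp
  qed
  obtain n where n: "x = (\<Sum>i\<in>UNIV. \<Sum>a\<in>UNIV. of_int (n i a) *\<^sub>R rootv i a undefined)"
    using word_0_expand[OF x(2,3)] by blast
  have "P (W x)"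
    unfolding n linear_sum[OF lin(1)] linear_scale[OF lin(1)] by (intro Psum Pscale Proot)
  then show "w \<in> S" by (simp add: P_def x(1))
qed

lemma word_W_root_diff: "word (W (rootv j a (nxt a))) - word (W (rootv j' a' (nxt a'))) \<in> C"
proof -
  have "W (rootv j a (nxt a) - rootv j' a' (nxt a')) \<in> L_B C"
    by (intro L_B root_in_L_B code_closed D)
  then have "word (W (rootv j a (nxt a) - rootv j' a' (nxt a'))) \<in> C" by (simp add: L_B_eq)
  then show ?thesis
    unfolding linear_diff[OF lin(1), of "rootv j a (nxt a)" "rootv j' a' (nxt a')"] word_diff[OF W_root W_root] .
qed

text \<open>If the word of \<open>W r\<close> lies in C, then \<open>W r\<close> can miss
  \<open>L_B C\<close> only through \<open>phi\<close>, and it does, since r is not in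
  \<open>L_B D\<close>. Adding m times a cyclic root r' repairs this. Applying \<open>W'\<close>
  shows that m times the word of \<open>W' r'\<close> lies in D, and m is invertible.\<close>

lemma word_W_root_in_C:
  assumes "word (W (rootv j a (nxt a))) \<in> C"
  shows "word (W' (rootv i b (nxt b))) \<in> D"
proof -
  let ?r = "rootv j a (nxt a)" and ?r' = "rootv i b (nxt b)"
  obtain m where m: "phi (W ?r) = of_int m" using phi_Ints[OF W_root odd, of j a "nxt a"] by (auto elim: Ints_cases)
  obtain l where l: "phi ?r' = real CARD('a) * of_int l - 1" using phi_root_nxt by blast
  have "(of_int m :: 'a mod_ring) \<noteq> 0"
  proof
    assume "(of_int m :: 'a mod_ring) = 0"
    then obtain q where "m = int CARD('a) * q" by (auto simp: of_int_mod_ring_eq_0_iff elim: dvdE)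
    then have "phi (W ?r) / real CARD('a) = of_int q" by (simp add: m)
    then have "W ?r \<in> L_B C" using assms W_root by (simp add: L_B_eq)
    then have "W' (W ?r) \<in> L_B D" by (rule L_B)
    then show False using root_in_L_B(3)[OF code_closed(1)[OF D(1)]] inverse(1)[OF root_V0, of j a "nxt a"] by simp
  qed
  define y where "y = W ?r + of_int m *\<^sub>R ?r'"
  have "phi y = real CARD('a) * of_int (m * l)" unfolding y_def phi_add phi_scaleR m l by (simp add: algebra_simps)
  moreover have "y \<in> A_dual" "word y = word (W ?r)"
    using A_dual_of_int[OF root_A_dual(1)[of i b "nxt b"], of m] root_A_dual(2)[of i b "nxt b"] W_root[of j a "nxt a"]
    by (auto simp: y_def A_dual_add word_add)
  ultimately have "y \<in> L_B C" using assms by (simp add: L_B_eq)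
  then have "W' y \<in> L_B D" by (rule L_B)
  moreover have "W' y = ?r + of_int m *\<^sub>R W' ?r'"
    unfolding y_def linear_add[OF lin(2)] linear_scale[OF lin(2)] inverse(1)[OF root_V0] ..
  moreover have "word (?r + of_int m *\<^sub>R W' ?r') = of_int m *s word (W' ?r')"
    using A_dual_of_int[OF W'_root[of i b "nxt b"], of m] root_A_dual[of j a "nxt a"] by (simp add: word_add)
  ultimately have "of_int m *s word (W' ?r') \<in> D" by (simp add: L_B_eq)
  then have "inverse (of_int m) *s (of_int m *s word (W' ?r')) \<in> D" by (rule code_closed(4)[OF D(1)])
  then show ?thesis using \<open>(of_int m :: 'a mod_ring) \<noteq> 0\<close> by simp
qed

lemma root_word_in_class:
  assumes j: "j \<in> partner i" and nz: "(\<Sum>t\<in>UNIV. v $ t * word (W (rootv j a (nxt a))) $ t) \<noteq> 0"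
  shows "\<exists>w\<in>Gam. root_word w \<and> supp w \<subseteq> cls i \<and> (\<Sum>t\<in>UNIV. v $ t * w $ t) \<noteq> 0"
proof -
  let ?w = "word (W (rootv j a (nxt a)))"
  have w0: "?w \<noteq> 0" using nz by auto
  have p: "CARD('a) > 1" using prime_gt_1_nat[OF prime_card[where 'a='a]] .
  have "root_word ?w" by (rule norm2_word[OF W_root W_root_norm[OF nxt_neq[OF p]] w0])
  moreover have "supp ?w \<subseteq> cls i"
  proof
    fix t assume "t \<in> supp ?w"
    then have "t \<in> supp (W (rootv j a (nxt a)))" using supp_word by blast
    then have "W (ebar j a) $ t \<noteq> 0 \<or> W (ebar j (nxt a)) $ t \<noteq> 0" by (auto simp: supp_def linear_diff[OF lin(1)])
    then show "t \<in> cls i" using W_ebar_in[OF j] by (auto simp: supp_def)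
  qed
  ultimately show ?thesis using word_W_root nz by blast
qed

definition rep :: "'b \<Rightarrow> 'b" where "rep i = (SOME t. t \<in> cls i)"

lemma rep_in: "rep i \<in> cls i"
  unfolding rep_def by (rule someI[of _ i]) (simp add: cls_def root_rel_refl)

lemma rep_cls: "cls (rep i) = cls i"
  using cls_eq[of i "rep i"] rep_in[of i] by (simp add: cls_def)

lemma rep_cong: "cls i = cls i' \<Longrightarrow> rep i = rep i'"
  by (simp add: rep_def)

lemma cls_mem_eq: "t \<in> cls i \<Longrightarrow> cls t = cls i"
  using cls_eq[of i t] by (simp add: cls_def)

lemma self_in_cls: "i \<in> cls i"
  by (simp add: cls_def root_rel_refl)

text \<open>One matching is chosen per class, at its representative. Distinct classes have disjoint
  partners, so the pieces form a permutation, and the corrections in \<open>Gam\<close> add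
  up.\<close>

lemma global_match:
  assumes ex: "\<And>i. \<exists>\<sigma> s. matches i (V i) (V' i) \<sigma> s"
  shows "\<exists>\<sigma> s. bij \<sigma> \<and> (\<forall>t. s t = 1 \<or> s t = -1) \<and>
    (\<forall>x\<in>Qd. (\<chi> t. word x $ t - s t * word (W' x) $ \<sigma> t) \<in> Gam) \<and>
    (\<forall>x\<in>Qd. \<forall>r\<in>range rep. card (cls r) > 1 \<longrightarrow>
      (\<Sum>t\<in>cls r. V r $ t * (s t * word (W' x) $ \<sigma> t)) = (\<Sum>j\<in>partner r. V' r $ j * word (W' x) $ j))"
proof -
  have "\<forall>i. \<exists>q. matches i (V i) (V' i) (fst q) (snd q)" using ex by simp
  then obtain q where q: "\<And>i. matches i (V i) (V' i) (fst (q i)) (snd (q i))" by metis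
  define \<sigma> where "\<sigma> = (\<lambda>t. fst (q (rep t)) t)"
  define s where "s = (\<lambda>t. snd (q (rep t)) t)"
  have eq: "\<sigma> t = fst (q r) t" "s t = snd (q r) t" if t: "t \<in> cls r" and r: "r \<in> range rep" for t r
  proof -
    obtain i where i: "r = rep i" using r by blast
    have "cls t = cls i" using cls_mem_eq[OF t] rep_cls i by simp
    then show "\<sigma> t = fst (q r) t" "s t = snd (q r) t" using rep_cong[of t i] i by (simp_all add: \<sigma>_def s_def)
  qed
  have bijr: "bij_betw \<sigma> (cls r) (partner r)" if "r \<in> range rep" for r
  proof -
    have "bij_betw (fst (q r)) (cls r) (partner r)" using q[of r] by (simp add: matches_def)
    then show ?thesis using bij_betw_cong[of "cls r" \<sigma> "fst (q r)"] eq that by blast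
  qed
  have \<sigma>p: "\<sigma> t \<in> partner t" for t
  proof -
    have "\<sigma> t \<in> partner (rep t)" using bij_betwE[OF bijr[of "rep t"]] self_in_cls[of t] rep_cls[of t] by auto
    then show ?thesis using partner_cong[OF rep_in] by simp
  qed
  have "inj \<sigma>"
  proof (rule injI)
    fix t t' assume e: "\<sigma> t = \<sigma> t'"
    have "cls t = cls t'" using partner_partner[OF \<sigma>p[of t]] partner_partner[OF \<sigma>p[of t']] e by simp
    then have "t \<in> cls (rep t)" "t' \<in> cls (rep t)" using self_in_cls rep_cls by auto
    moreover have "inj_on \<sigma> (cls (rep t))" using bijr[of "rep t"] by (simp add: bij_betw_def)
    ultimately show "t = t'" using e by (simp add: inj_on_def)
  qed
  then have bij: "bij \<sigma>" by (simp add: bij_def finite_UNIV_inj_surj)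
  have sgn: "s t = 1 \<or> s t = -1" for t
  proof -
    have "t \<in> cls (rep t)" using self_in_cls rep_cls by auto
    then show ?thesis using q[of "rep t"] by (simp add: matches_def s_def)
  qed
  have gam: "(\<chi> t. word x $ t - s t * word (W' x) $ \<sigma> t) \<in> Gam" if x: "x \<in> Qd" for x
  proof -
    let ?y = "\<chi> t. word x $ t - s t * word (W' x) $ \<sigma> t"
    have each: "res (cls r) ?y \<in> Gam" if r: "r \<in> range rep" for r
    proof -
      have "res (cls r) ?y = res (cls r) (\<chi> t. word x $ t - snd (q r) t * word (W' x) $ fst (q r) t)"
        by (simp add: res_def vec_eq_iff eq[OF _ r])
      then show ?thesis using q[of r] x by (simp add: matches_def)
    qed
    have "(\<Sum>r\<in>range rep. res (cls r) ?y) \<in> Gam"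
      using each Gam_code unfolding is_code_def by (intro vec.subspace_sum) auto
    moreover have "(\<Sum>r\<in>range rep. res (cls r) ?y) $ t = ?y $ t" for t
    proof -
      have iff: "t \<in> cls r \<longleftrightarrow> r = rep t" if r: "r \<in> range rep" for r
      proof
        assume "t \<in> cls r"
        obtain i where i: "r = rep i" using r by blast
        have "cls t = cls i" using cls_mem_eq[OF \<open>t \<in> cls r\<close>] rep_cls i by simp
        then show "r = rep t" unfolding i by (intro rep_cong) simp
      next
        assume "r = rep t" then show "t \<in> cls r" using self_in_cls rep_cls by auto
      qed
      have "(\<Sum>r\<in>range rep. res (cls r) ?y) $ t = (\<Sum>r\<in>range rep. if r = rep t then ?y $ t else 0)"
        unfolding sum_component by (intro sum.cong refl) (simp add: res_nth iff)
      also have "\<dots> = ?y $ t" by simp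
      finally show ?thesis .
    qed
    ultimately show ?thesis by (metis (no_types, lifting) vec_eq_iff)
  qed
  have sums: "(\<Sum>t\<in>cls r. V r $ t * (s t * word (W' x) $ \<sigma> t)) = (\<Sum>j\<in>partner r. V' r $ j * word (W' x) $ j)"
    if x: "x \<in> Qd" and r: "r \<in> range rep" and c: "card (cls r) > 1" for x r
  proof -
    have "(\<Sum>t\<in>cls r. V r $ t * (s t * word (W' x) $ \<sigma> t)) = (\<Sum>t\<in>cls r. V r $ t * (snd (q r) t * word (W' x) $ fst (q r) t))"
      by (intro sum.cong refl) (simp add: eq[OF _ r])
    also have "\<dots> = (\<Sum>j\<in>partner r. V' r $ j * word (W' x) $ j)" using q[of r] x c by (simp add: matches_def)
    finally show ?thesis .
  qed
  show ?thesis
    by (rule exI[of _ \<sigma>], rule exI[of _ s], intro conjI allI ballI impI) (rule bij sgn gam sums; assumption)+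
qed

lemma sum_classes: "(\<Sum>t\<in>UNIV. f t) = (\<Sum>r\<in>range rep. \<Sum>t\<in>cls r. f t)" "(\<Sum>j\<in>UNIV. g j) = (\<Sum>r\<in>range rep. \<Sum>j\<in>partner r. g j)"
proof -
  have d: "r = r'" if rr: "cls r = cls r'" and r: "r \<in> range rep" "r' \<in> range rep" for r r'
  proof -
    obtain i i' where i: "r = rep i" "r' = rep i'" using r by blast
    have "cls i = cls i'" using rr unfolding i rep_cls .
    then show ?thesis unfolding i by (rule rep_cong)
  qed
  have "(\<Union>r\<in>range rep. cls r) = UNIV"
  proof -
    have "t \<in> cls (rep t)" for t using self_in_cls rep_cls by auto
    then show ?thesis by blast
  qed
  moreover have "\<forall>r\<in>range rep. \<forall>r'\<in>range rep. r \<noteq> r' \<longrightarrow> cls r \<inter> cls r' = {}"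
  proof (intro ballI impI)
    fix r r' assume r: "r \<in> range rep" "r' \<in> range rep" "r \<noteq> r'"
    show "cls r \<inter> cls r' = {}"
    proof (rule ccontr)
      assume "cls r \<inter> cls r' \<noteq> {}"
      then obtain t where "t \<in> cls r" "t \<in> cls r'" by blast
      then have "cls r = cls r'" using cls_mem_eq by blast
      then show False using d r by blast
    qed
  qed
  ultimately show "(\<Sum>t\<in>UNIV. f t) = (\<Sum>r\<in>range rep. \<Sum>t\<in>cls r. f t)"
    using sum.UNION_disjoint[of "range rep" cls f] by simp
  have "(\<Union>r\<in>range rep. partner r) = UNIV"
  proof -
    have "\<exists>r\<in>range rep. j \<in> partner r" for j
    proof -
      obtain i where "link j i" using link_ex by blast
      then have "j \<in> partner i" using self_in_cls by (auto simp: partner_def)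
      then show ?thesis using partner_cong[OF rep_in, of i] by auto
    qed
    then show ?thesis by blast
  qed
  moreover have "\<forall>r\<in>range rep. \<forall>r'\<in>range rep. r \<noteq> r' \<longrightarrow> partner r \<inter> partner r' = {}"
  proof (intro ballI impI)
    fix r r' assume r: "r \<in> range rep" "r' \<in> range rep" "r \<noteq> r'"
    show "partner r \<inter> partner r' = {}"
    proof (rule ccontr)
      assume "partner r \<inter> partner r' \<noteq> {}"
      then obtain j where "j \<in> partner r" "j \<in> partner r'" by blast
      then have "cls r = cls r'" using partner_partner by blast
      then show False using d r by blast
    qed
  qed
  ultimately show "(\<Sum>j\<in>UNIV. g j) = (\<Sum>r\<in>range rep. \<Sum>j\<in>partner r. g j)"
    using sum.UNION_disjoint[of "range rep" partner g] by simp
qed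

end

context integral_frame_pair
begin

lemma lift_D:
  assumes "d \<in> D"
  obtains x where "x \<in> L_B C" "x \<in> Qd" "word x \<in> C" "word (W' x) = d"
proof -
  obtain y where y: "y \<in> A_dual" "word y = d" "phi y / real CARD('a) \<in> \<int>" using exists_L_B_word[OF odd] by blast
  then have yD: "y \<in> L_B D" using assms by (simp add: L_B_eq)
  have "W y \<in> L_B C" by (rule L_B(1)[OF yD])
  moreover have "W' (W y) = y" by (rule inverse(1)[OF A_dual_V0[OF y(1)]])
  ultimately show ?thesis using that[of "W y"] L_B_Qd y(2) by (simp add: L_B_eq)
qed

lemma exists_root_word_in_class:
  assumes "card (cls i) > 1"
  shows "\<exists>w\<in>Gam. root_word w \<and> supp w \<subseteq> cls i \<and> i \<in> supp w"
proof -
  have "\<exists>t\<in>cls i. t \<noteq> i"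
  proof (rule ccontr)
    assume "\<not> ?thesis"
    then have "cls i \<subseteq> {i}" by blast
    then have "card (cls i) \<le> 1" by (metis card_mono finite.emptyI finite_insert is_singletonI is_singleton_altdef)
    then show False using assms by simp
  qed
  then obtain w where "w \<in> Gam" "root_word w" "i \<in> supp w" by (auto simp: cls_def root_rel_def)
  moreover have "supp w \<subseteq> cls i" using calculation by (auto simp: cls_def root_rel_def)
  ultimately show ?thesis by blast
qed

end

context integral_frame_pair
begin

text \<open>If the word c0 of one cyclic root image lies in C, then \<open>Gam\<close> is contained
  in C and agreement modulo \<open>Gam\<close> is enough. Otherwise \<open>Gam\<close> lies in C
  plus the line of c0, and a transported word is known only up to a multiple of c0; a functional
  with kernel containing C and value 1 at c0 shows that this multiple is zero.\<close>

theorem signed_permutation_into_C: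
  "\<exists>\<sigma> s. bij \<sigma> \<and> (\<forall>t. s t = 1 \<or> s t = -1) \<and> (\<forall>d\<in>D. (\<chi> t. s t * d $ \<sigma> t) \<in> C)"
proof -
  let ?r = "rootv (undefined :: 'b) (undefined :: 'a) (nxt undefined)"
  let ?c0 = "word (W ?r)"
  show ?thesis
  proof (cases "?c0 \<in> C")
    case True
    have "word (W (rootv j a (nxt a))) \<in> C" for j a
      using code_closed(2)[OF C(1) word_W_root_diff[of j a undefined undefined] True] by simp
    then have GC: "Gam \<subseteq> C" by (rule Gam_subset[OF C(1)])
    have axis_dot: "(\<Sum>t\<in>UNIV. axis l 1 $ t * w $ t) = w $ l" for l and w :: "'a mod_ring ^ 'b"
      by (subst sum.remove[of _ l]) (auto simp: axis_def)
    \<comment> \<open>Coordinate functionals are taken: a class with several coordinates has a root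
      word through any given coordinate, on which that coordinate does not vanish.\<close>
    define j where "j = (\<lambda>i. SOME j. j \<in> partner i)"
    have j: "j i \<in> partner i" for i unfolding j_def using partner_nonempty by (rule someI_ex)
    have "\<exists>\<sigma> s. matches i (axis i 1) (axis (j i) 1) \<sigma> s" for i
    proof (rule exists_match)
      assume c: "card (cls i) > 1"
      show "\<exists>w\<in>Gam. root_word w \<and> supp w \<subseteq> cls i \<and> (\<Sum>t\<in>UNIV. axis i 1 $ t * w $ t) \<noteq> 0"
        using exists_root_word_in_class[OF c] unfolding axis_dot supp_def by blast
      have "card (sw.cls (j i)) > 1" using c card_partner[of i] partner_eq[OF j] by simp
      then show "\<exists>w\<in>sw.Gam. root_word w \<and> supp w \<subseteq> partner i \<and> (\<Sum>t\<in>UNIV. axis (j i) 1 $ t * w $ t) \<noteq> 0"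
        using sw.exists_root_word_in_class[of "j i"] unfolding axis_dot partner_eq[OF j] supp_def by blast
    qed
    then have "\<exists>\<sigma> s. bij \<sigma> \<and> (\<forall>t. s t = 1 \<or> s t = -1) \<and>
      (\<forall>x\<in>Qd. (\<chi> t. word x $ t - s t * word (W' x) $ \<sigma> t) \<in> Gam) \<and>
      (\<forall>x\<in>Qd. \<forall>r\<in>range rep. card (cls r) > 1 \<longrightarrow>
        (\<Sum>t\<in>cls r. axis r 1 $ t * (s t * word (W' x) $ \<sigma> t)) = (\<Sum>k\<in>partner r. axis (j r) 1 $ k * word (W' x) $ k))"
      by (rule global_match)
    then obtain \<sigma> s where g: "bij \<sigma>" "\<forall>t. s t = 1 \<or> s t = -1"
      "\<forall>x\<in>Qd. (\<chi> t. word x $ t - s t * word (W' x) $ \<sigma> t) \<in> Gam"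
      by (elim exE conjE)
    have "(\<chi> t. s t * d $ \<sigma> t) \<in> C" if d: "d \<in> D" for d
    proof -
      obtain x where x: "x \<in> Qd" "word x \<in> C" "word (W' x) = d" using lift_D[OF d] by blast
      have "(\<chi> t. word x $ t - s t * d $ \<sigma> t) \<in> C" using bspec[OF g(3) x(1)] GC x(3) by auto
      then have "word x - (\<chi> t. word x $ t - s t * d $ \<sigma> t) \<in> C" using code_closed(3)[OF C(1) x(2)] by blast
      moreover have "word x - (\<chi> t. word x $ t - s t * d $ \<sigma> t) = (\<chi> t. s t * d $ \<sigma> t)" by (simp add: vec_eq_iff)
      ultimately show ?thesis by simp
    qed
    then show ?thesis using g(1,2) by blast
  next
    case False
    let ?c0' = "word (W' ?r)"
    have c0': "?c0' \<notin> D" using False sw.word_W_root_in_C by blast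
    obtain v where v: "\<And>c. c \<in> C \<Longrightarrow> (\<Sum>i\<in>UNIV. v $ i * c $ i) = 0" "(\<Sum>i\<in>UNIV. v $ i * ?c0 $ i) = 1"
      using separating_functional[OF C(1) False] by blast
    obtain v' where v': "\<And>c. c \<in> D \<Longrightarrow> (\<Sum>i\<in>UNIV. v' $ i * c $ i) = 0" "(\<Sum>i\<in>UNIV. v' $ i * ?c0' $ i) = 1"
      using separating_functional[OF D(1) c0'] by blast
    have vr: "(\<Sum>t\<in>UNIV. v $ t * word (W (rootv j a (nxt a))) $ t) = 1" for j a
      using v(1)[OF word_W_root_diff[of j a undefined undefined]] v(2) unfolding sum_diff_dot by simp
    have vr': "(\<Sum>t\<in>UNIV. v' $ t * word (W' (rootv j a (nxt a))) $ t) = 1" for j a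
      using v'(1)[OF sw.word_W_root_diff[of j a undefined undefined]] v'(2) unfolding sum_diff_dot by simp
    have rw: "\<exists>w\<in>Gam. root_word w \<and> supp w \<subseteq> cls i \<and> (\<Sum>t\<in>UNIV. v $ t * w $ t) \<noteq> 0" for i
    proof -
      obtain j where "j \<in> partner i" using partner_nonempty by blast
      then show ?thesis by (rule root_word_in_class[where a=undefined]) (simp add: vr)
    qed
    have rw': "\<exists>w\<in>sw.Gam. root_word w \<and> supp w \<subseteq> partner i \<and> (\<Sum>t\<in>UNIV. v' $ t * w $ t) \<noteq> 0" for i
    proof -
      obtain j where j: "j \<in> partner i" using partner_nonempty by blast
      then have "i \<in> sw.partner j" using partner_partner[OF j] self_in_cls by simp
      then have "\<exists>w\<in>sw.Gam. root_word w \<and> supp w \<subseteq> sw.cls j \<and> (\<Sum>t\<in>UNIV. v' $ t * w $ t) \<noteq> 0"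
        by (rule sw.root_word_in_class[where a=undefined]) (simp add: vr')
      then show ?thesis using partner_eq[OF j] by simp
    qed
    have card1: "card (cls i) > 1" for i
    proof -
      obtain w where w: "w \<in> Gam" "root_word w" "supp w \<subseteq> cls i" using rw by blast
      have "card (supp w) \<ge> 2" using root_word_shape[OF odd w(2)] by auto
      then show ?thesis using card_mono[OF _ w(3)] by simp
    qed
    have "\<exists>\<sigma> s. matches i v v' \<sigma> s" for i
      by (rule exists_match[OF rw rw'])
    then have "\<exists>\<sigma> s. bij \<sigma> \<and> (\<forall>t. s t = 1 \<or> s t = -1) \<and>
      (\<forall>x\<in>Qd. (\<chi> t. word x $ t - s t * word (W' x) $ \<sigma> t) \<in> Gam) \<and>
      (\<forall>x\<in>Qd. \<forall>r\<in>range rep. card (cls r) > 1 \<longrightarrow>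
        (\<Sum>t\<in>cls r. v $ t * (s t * word (W' x) $ \<sigma> t)) = (\<Sum>j\<in>partner r. v' $ j * word (W' x) $ j))"
      by (rule global_match)
    then obtain \<sigma> s where g: "bij \<sigma>" "\<forall>t. s t = 1 \<or> s t = -1"
      "\<forall>x\<in>Qd. (\<chi> t. word x $ t - s t * word (W' x) $ \<sigma> t) \<in> Gam"
      and g4: "\<forall>x\<in>Qd. \<forall>r\<in>range rep. card (cls r) > 1 \<longrightarrow>
        (\<Sum>t\<in>cls r. v $ t * (s t * word (W' x) $ \<sigma> t)) = (\<Sum>j\<in>partner r. v' $ j * word (W' x) $ j)"
      by (elim exE conjE)
    \<comment> \<open>Images of cyclic roots have words congruent to c0 modulo C, so
      \<open>Gam\<close> is contained in this code.\<close>
    define S where "S = {c + a *s ?c0 | c a. c \<in> C}"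
    have Scode: "is_code S"
    proof -
      have "0 \<in> S" unfolding S_def using code_closed(1)[OF C(1)] by (auto intro!: exI[of _ 0])
      moreover have "x + y \<in> S" if xy: "x \<in> S" "y \<in> S" for x y
      proof -
        obtain c a c' a' where "x = c + a *s ?c0" "y = c' + a' *s ?c0" "c \<in> C" "c' \<in> C" using xy by (auto simp: S_def)
        moreover from this have "x + y = (c + c') + (a + a') *s ?c0" by (simp add: vec_eq_iff algebra_simps)
        ultimately show ?thesis unfolding S_def using code_closed(2)[OF C(1)] by blast
      qed
      moreover have "b *s x \<in> S" if x: "x \<in> S" for b x
      proof -
        obtain c a where "x = c + a *s ?c0" "c \<in> C" using x by (auto simp: S_def)
        moreover from this have "b *s x = b *s c + (b * a) *s ?c0" by (simp add: vec_eq_iff algebra_simps)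
        ultimately show ?thesis unfolding S_def using code_closed(4)[OF C(1)] by blast
      qed
      ultimately show ?thesis unfolding is_code_def vec.subspace_def by blast
    qed
    have "word (W (rootv j a (nxt a))) \<in> S" for j a
    proof -
      have "word (W (rootv j a (nxt a))) = (word (W (rootv j a (nxt a))) - ?c0) + 1 *s ?c0" by simp
      then show ?thesis unfolding S_def using word_W_root_diff[of j a undefined undefined] by blast
    qed
    then have GS: "Gam \<subseteq> S" by (rule Gam_subset[OF Scode])
    have "(\<chi> t. s t * d $ \<sigma> t) \<in> C" if d: "d \<in> D" for d
    proof -
      obtain x where x: "x \<in> Qd" "word x \<in> C" "word (W' x) = d" using lift_D[OF d] by blast
      let ?f = "\<chi> t. s t * d $ \<sigma> t"
      have "(\<chi> t. word x $ t - s t * d $ \<sigma> t) \<in> S" using bspec[OF g(3) x(1)] GS x(3) by auto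
      then obtain c a where c: "c \<in> C" "(\<chi> t. word x $ t - s t * d $ \<sigma> t) = c + a *s ?c0" by (auto simp: S_def)
      have "?f = word x - (\<chi> t. word x $ t - s t * d $ \<sigma> t)" by (simp add: vec_eq_iff)
      then have f: "?f = (word x - c) - a *s ?c0" unfolding c(2) by (simp add: algebra_simps)
      have xc: "word x - c \<in> C" by (rule code_closed(3)[OF C(1) x(2) c(1)])
      \<comment> \<open>The functional is evaluated twice: from the decomposition modulo C it is -a,
        and summed over the classes it is the value of v' at d, which is zero.\<close>
      have "(\<Sum>t\<in>UNIV. v $ t * ?f $ t) = - a"
      proof -
        have "(\<Sum>t\<in>UNIV. v $ t * (a *s ?c0) $ t) = a * (\<Sum>t\<in>UNIV. v $ t * ?c0 $ t)"
          unfolding sum_distrib_left by (intro sum.cong refl) (simp only: vector_smult_component mult_ac)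
        then show ?thesis unfolding f sum_diff_dot[of v "word x - c"] v(1)[OF xc] v(2) by simp
      qed
      moreover have "(\<Sum>t\<in>UNIV. v $ t * ?f $ t) = 0"
      proof -
        have "(\<Sum>t\<in>UNIV. v $ t * ?f $ t) = (\<Sum>r\<in>range rep. \<Sum>t\<in>cls r. v $ t * (s t * word (W' x) $ \<sigma> t))"
          unfolding sum_classes(1)[of "\<lambda>t. v $ t * ?f $ t"] x(3) by simp
        also have "\<dots> = (\<Sum>r\<in>range rep. \<Sum>j\<in>partner r. v' $ j * word (W' x) $ j)"
          by (rule sum.cong[OF refl]) (rule mp[OF bspec[OF bspec[OF g4 x(1)]] card1])
        also have "\<dots> = (\<Sum>j\<in>UNIV. v' $ j * d $ j)" unfolding x(3) by (rule sum_classes(2)[symmetric])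
        also have "\<dots> = 0" by (rule v'(1)[OF d])
        finally show ?thesis .
      qed
      ultimately have "a = 0" by simp
      then show ?thesis using f xc by simp
    qed
    then show ?thesis using g(1,2) by blast
  qed
qed

end

subsection \<open>Isomorphisms between explicit codes\<close>

lemma fibre_bijection:
  fixes f g :: "'k::finite \<Rightarrow> 'l"
  assumes "\<And>x. card {i. f i = x} = card {i. g i = x}"
  obtains \<sigma> where "bij \<sigma>" "\<forall>i. g (\<sigma> i) = f i"
proof -
  have "\<exists>h. bij_betw h {i. f i = x} {i. g i = x}" for x
    by (rule finite_same_card_bij) (use assms in auto)
  then obtain h where h: "\<And>x. bij_betw (h x) {i. f i = x} {i. g i = x}" by metis
  define \<sigma> where "\<sigma> i = h (f i) i" for i
  have g: "g (\<sigma> i) = f i" for i using bij_betwE[OF h[of "f i"]] by (auto simp: \<sigma>_def)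
  have "inj \<sigma>"
  proof (rule injI)
    fix i j assume e: "\<sigma> i = \<sigma> j"
    then have "f i = f j" using g by metis
    then show "i = j" using e h[of "f i"] by (auto simp: \<sigma>_def bij_betw_def inj_on_def)
  qed
  then show ?thesis using that[of \<sigma>] g by (simp add: bij_def finite_UNIV_inj_surj)
qed

lemma iso_span:
  fixes A B :: "('a::field ^ 'k) set"
  assumes "bij \<sigma>" "\<And>i. s i = 1 \<or> s i = -1" "(\<lambda>x. \<chi> i. s i * x $ \<sigma> i) ` B = A"
  shows "code_isomorphic (vec.span A) (vec.span B)"
proof -
  let ?f = "\<lambda>x :: 'a ^ 'k. \<chi> i. s i * x $ \<sigma> i"
  have lin: "Vector_Spaces.linear (*s) (*s) ?f"
    by unfold_locales (simp_all add: vec_eq_iff algebra_simps)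
  have "?f ` vec.span B = vec.span (?f ` B)" using vec.linear_span_image[OF lin, of B] by simp
  then have "?f ` vec.span B = vec.span A" by (simp only: assms(3))
  then have "code_isomorphic (vec.span B) (vec.span A)"
    unfolding code_isomorphic_def by (rule bexI[OF _ code_group_signed_permutation[OF assms(1,2)]])
  then show ?thesis by (rule code_isomorphic_sym)
qed

text \<open>Elements with equal squares differ by a sign, so a line is determined up to isomorphism
  by how often each square occurs among the entries of a spanning word.\<close>

lemma iso_span_single:
  fixes w z :: "'a::field ^ 'k"
  assumes "\<And>x. card {i. w $ i * w $ i = x} = card {i. z $ i * z $ i = x}"
  shows "code_isomorphic (vec.span {w}) (vec.span {z})"
proof -
  obtain \<sigma> where s: "bij \<sigma>" "\<forall>i. z $ \<sigma> i * z $ \<sigma> i = w $ i * w $ i"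
    by (rule fibre_bijection[of "\<lambda>i. w $ i * w $ i" "\<lambda>i. z $ i * z $ i", OF assms], rule that)
  define e :: "'k \<Rightarrow> 'a" where "e i = (if w $ i = z $ \<sigma> i then 1 else -1)" for i
  have "w $ i = e i * z $ \<sigma> i" for i
    using spec[OF s(2), of i] square_eq_iff[of "z $ \<sigma> i" "w $ i"] by (auto simp: e_def)
  then have "(\<chi> i. e i * z $ \<sigma> i) = w" by (simp add: vec_eq_iff)
  then have im: "(\<lambda>x. \<chi> i. e i * x $ \<sigma> i) ` {z} = {w}" by simp
  show ?thesis by (rule iso_span[OF s(1) _ im]) (simp add: e_def)
qed

lemma list_permutation:
  fixes xs ys :: "'k::finite list"
  assumes "distinct xs" "distinct ys" "length xs = length ys"
  obtains \<sigma> where "bij \<sigma>" "\<forall>n<length xs. \<sigma> (xs ! n) = ys ! n" "\<forall>i. i \<notin> set xs \<longrightarrow> \<sigma> i \<notin> set ys"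
proof -
  have c: "card (- set xs) = card (- set ys)"
    using assms distinct_card[OF assms(1)] distinct_card[OF assms(2)] by (simp add: Compl_eq_Diff_UNIV card_Diff_subset)
  obtain h where h: "bij_betw h (- set xs) (- set ys)"
    using finite_same_card_bij[OF _ _ c] by auto
  define k where "k x = ys ! (THE n. n < length xs \<and> xs ! n = x)" for x
  have k: "k (xs ! n) = ys ! n" if "n < length xs" for n
  proof -
    have "(THE m. m < length xs \<and> xs ! m = xs ! n) = n"
      by (rule the_equality) (use that assms(1) in \<open>auto simp: nth_eq_iff_index_eq\<close>)
    then show ?thesis by (simp add: k_def)
  qed
  define \<sigma> where "\<sigma> x = (if x \<in> set xs then k x else h x)" for x
  have in1: "\<sigma> x \<in> set ys" if "x \<in> set xs" for x
    using that k assms(3) by (auto simp: \<sigma>_def in_set_conv_nth)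
  have out1: "\<sigma> x \<notin> set ys" if "x \<notin> set xs" for x
    using that bij_betwE[OF h] by (auto simp: \<sigma>_def)
  have "inj \<sigma>"
  proof (rule injI)
    fix x y assume e: "\<sigma> x = \<sigma> y"
    show "x = y"
    proof (cases "x \<in> set xs")
      case True
      then have "y \<in> set xs" using in1[OF True] out1[of y] e by auto
      obtain m n where mn: "m < length xs" "x = xs ! m" "n < length xs" "y = xs ! n"
        using True \<open>y \<in> set xs\<close> by (auto simp: in_set_conv_nth)
      then have "ys ! m = ys ! n" using e k True \<open>y \<in> set xs\<close> by (auto simp: \<sigma>_def)
      then have "m = n" using mn assms by (simp add: nth_eq_iff_index_eq)
      then show ?thesis using mn by simp
    next
      case False
      then have "y \<notin> set xs" using out1[OF False] in1[of y] e by auto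
      then show ?thesis using e False h by (auto simp: \<sigma>_def bij_betw_def inj_on_def)
    qed
  qed
  then have "bij \<sigma>" by (simp add: bij_def finite_UNIV_inj_surj)
  moreover have "\<sigma> (xs ! n) = ys ! n" if "n < length xs" for n using k[OF that] that by (simp add: \<sigma>_def)
  ultimately show ?thesis using that[of \<sigma>] out1 by blast
qed

section \<open>Isometric lattices and codes that contain a copy of one another\<close>

lemma code_eq_span:
  assumes "is_code C" "A \<subseteq> C" "\<And>c. c \<in> C \<Longrightarrow> c \<in> vec.span A"
  shows "C = vec.span A"
  using assms vec.span_minimal[of A C] by (auto simp: is_code_def)

lemma lattice_isomorphic_sym: "lattice_isomorphic L M \<Longrightarrow> lattice_isomorphic M L"
  if add: "\<And>x y. x \<in> L \<Longrightarrow> y \<in> L \<Longrightarrow> x + y \<in> L" for L :: "'v::euclidean_space set" and M :: "'w::euclidean_space set"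
proof -
  assume "lattice_isomorphic L M"
  then obtain f where f: "bij_betw f L M" "\<forall>x\<in>L. \<forall>y\<in>L. f (x + y) = f x + f y" "\<forall>x\<in>L. \<forall>y\<in>L. f x \<bullet> f y = x \<bullet> y"
    unfolding lattice_isomorphic_def by blast
  let ?g = "inv_into L f"
  have g: "bij_betw ?g M L" by (rule bij_betw_inv_into[OF f(1)])
  have gL: "?g y \<in> L" "f (?g y) = y" if "y \<in> M" for y
    using that f(1) bij_betwE[OF g] by (auto simp: bij_betw_inv_into_right)
  have gf: "?g (f x) = x" if "x \<in> L" for x using that f(1) by (simp add: bij_betw_inv_into_left)
  have "?g (y + z) = ?g y + ?g z" if y: "y \<in> M" "z \<in> M" for y z
  proof -
    have "f (?g y + ?g z) = y + z" using f(2) gL[OF y(1)] gL[OF y(2)] by simp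
    then show ?thesis using gf[OF add[OF gL(1)[OF y(1)] gL(1)[OF y(2)]]] by simp
  qed
  moreover have "?g y \<bullet> ?g z = y \<bullet> z" if "y \<in> M" "z \<in> M" for y z
    using f(3) gL[OF that(1)] gL[OF that(2)] by metis
  ultimately show ?thesis using g unfolding lattice_isomorphic_def by blast
qed

lemma lattice_isomorphic_trans:
  assumes "lattice_isomorphic L M" "lattice_isomorphic M N"
  shows "lattice_isomorphic L N"
proof -
  obtain f where f: "bij_betw f L M" "\<forall>x\<in>L. \<forall>y\<in>L. f (x + y) = f x + f y" "\<forall>x\<in>L. \<forall>y\<in>L. f x \<bullet> f y = x \<bullet> y"
    using assms(1) unfolding lattice_isomorphic_def by blast
  obtain g where g: "bij_betw g M N" "\<forall>x\<in>M. \<forall>y\<in>M. g (x + y) = g x + g y" "\<forall>x\<in>M. \<forall>y\<in>M. g x \<bullet> g y = x \<bullet> y"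
    using assms(2) unfolding lattice_isomorphic_def by blast
  have "f x \<in> M" if "x \<in> L" for x using that bij_betwE[OF f(1)] by blast
  then show ?thesis unfolding lattice_isomorphic_def
    using bij_betw_trans[OF f(1) g(1)] f g by (intro exI[of _ "g \<circ> f"]) auto
qed

lemma L_B_add: "is_code C \<Longrightarrow> x \<in> L_B C \<Longrightarrow> y \<in> L_B C \<Longrightarrow> x + y \<in> L_B C"
  using code_closed(2)[of C] by (auto simp: L_B_eq A_dual_add word_add phi_add add_divide_distrib)

lemma proper_subcode_contradiction:
  fixes C D :: "('p::{prime_card,linorder} mod_ring ^ 'k) set"
  assumes odd: "odd CARD('p)" and C: "is_code C" and iso: "lattice_isomorphic (L_B C) (L_B D)"
    and CC: "code_isomorphic C C'" "C' \<subset> D"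
  shows False
proof -
  have "lattice_isomorphic (L_B C') (L_B C)"
    by (rule code_isomorphic_imp_lattice_isomorphic[OF code_isomorphic_sym[OF CC(1)]])
  then have "lattice_isomorphic (L_B C') (L_B D)" using iso by (rule lattice_isomorphic_trans)
  then show False using proper_subcode_not_isomorphic[OF odd CC(2)] by blast
qed

text \<open>The word z spans a copy of C inside D. Were the copy proper, counting short vectors
  would contradict the isometry; so the dimension of D need not be determined beforehand.\<close>

lemma line_or_proper:
  fixes C D :: "('p::{prime_card,linorder} mod_ring ^ 'k) set"
  assumes odd: "odd CARD('p)" and C: "is_code C" and D: "is_code D" and iso: "lattice_isomorphic (L_B C) (L_B D)"
    and w: "C = vec.span {w}" and z: "z \<in> D"
    and eq: "\<And>x. card {i. w $ i * w $ i = x} = card {i. z $ i * z $ i = x}"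
  shows "code_isomorphic C D"
proof -
  have i: "code_isomorphic C (vec.span {z})" unfolding w by (rule iso_span_single[OF eq])
  have "vec.span {z} \<subseteq> D" using z D by (intro vec.span_minimal) (auto simp: is_code_def)
  then have "vec.span {z} = D" using proper_subcode_contradiction[OF odd C iso i] by blast
  then show ?thesis using i by simp
qed

lemma frame_pair_exists:
  fixes C D :: "('p::{prime_card,linorder} mod_ring ^ 'k) set"
  assumes odd: "odd CARD('p)" and C: "is_code C" "self_orthogonal C" and D: "is_code D" "self_orthogonal D"
    and iso: "lattice_isomorphic (L_B D) (L_B C)"
  obtains W W' where "frame_pair C D W W'"
proof -
  obtain f where f: "bij_betw f (L_B D) (L_B C)" "\<forall>x\<in>L_B D. \<forall>y\<in>L_B D. f x \<bullet> f y = x \<bullet> y"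
    using iso unfolding lattice_isomorphic_def by blast
  let ?g = "inv_into (L_B D) f"
  have fD: "f x \<in> L_B C" if "x \<in> L_B D" for x using that bij_betwE[OF f(1)] by blast
  have g: "?g y \<in> L_B D" "f (?g y) = y" if "y \<in> L_B C" for y
    using that bij_betwE[OF bij_betw_inv_into[OF f(1)]] f(1) by (auto simp: bij_betw_inv_into_right)
  have gf: "?g (f x) = x" if "x \<in> L_B D" for x using that f(1) by (simp add: bij_betw_inv_into_left)
  have gi: "?g x \<bullet> ?g y = x \<bullet> y" if "x \<in> L_B C" "y \<in> L_B C" for x y
    using f(2) g[OF that(1)] g[OF that(2)] by metis
  have spC: "span (L_B C) = V0" and spD: "span (L_B D) = V0"
    using span_L_B code_closed(1) C D by blast+
  obtain W where W: "linear W" "\<And>x. x \<in> L_B D \<Longrightarrow> W x = f x"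
    "\<And>x y. x \<in> span (L_B D) \<Longrightarrow> y \<in> span (L_B D) \<Longrightarrow> W x \<bullet> W y = x \<bullet> y"
    using isometry_extends[of "L_B D" f] f(2) by metis
  obtain W' where W': "linear W'" "\<And>x. x \<in> L_B C \<Longrightarrow> W' x = ?g x"
    "\<And>x y. x \<in> span (L_B C) \<Longrightarrow> y \<in> span (L_B C) \<Longrightarrow> W' x \<bullet> W' y = x \<bullet> y"
    using isometry_extends[of "L_B C" ?g] gi by metis
  have WV: "W x \<in> V0" if x: "x \<in> V0" for x
  proof -
    have "W x \<in> W ` span (L_B D)" using x spD by blast
    also have "W ` span (L_B D) = span (W ` L_B D)" by (rule linear_span_image[OF W(1), symmetric])
    also have "\<dots> \<subseteq> span (L_B C)" by (rule span_mono) (use W(2) fD in auto)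
    finally show ?thesis using spC by simp
  qed
  have W'V: "W' x \<in> V0" if x: "x \<in> V0" for x
  proof -
    have "W' x \<in> W' ` span (L_B C)" using x spC by blast
    also have "W' ` span (L_B C) = span (W' ` L_B C)" by (rule linear_span_image[OF W'(1), symmetric])
    also have "\<dots> \<subseteq> span (L_B D)" by (rule span_mono) (use W'(2) g in auto)
    finally show ?thesis using spD by simp
  qed
  have i1: "W' (W x) = x" if x: "x \<in> V0" for x
  proof -
    have "(W' \<circ> W) x = id x"
      by (rule linear_eq_on[OF linear_compose[OF W(1) W'(1)] linear_id, of x "L_B D"])
        (use x spD W(2) W'(2) fD gf in auto)
    then show ?thesis by simp
  qed
  have i2: "W (W' x) = x" if x: "x \<in> V0" for x
  proof -
    have "(W \<circ> W') x = id x"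
      by (rule linear_eq_on[OF linear_compose[OF W'(1) W(1)] linear_id, of x "L_B C"])
        (use x spC W(2) W'(2) g in auto)
    then show ?thesis by simp
  qed
  have "frame_pair C D W W'"
    by (rule frame_pair.intro) (use odd C D W(1) W'(1) WV W'V i1 i2 W(3) spD W(2) W'(2) fD g in auto)
  then show ?thesis by (rule that)
qed

subsection \<open>Frames with non-integral inner products\<close>

lemma sum_squares_sym: "3 * (\<Sum>z\<in>{- int h..int h}. z * z) = int h * (int h + 1) * (2 * int h + 1)"
proof (induction h)
  case (Suc h)
  have "{- int (Suc h)..int (Suc h)} = insert (int (Suc h)) (insert (- int (Suc h)) {- int h..int h})" by auto
  then have "(\<Sum>z\<in>{- int (Suc h)..int (Suc h)}. z * z) = 2 * (int h + 1) * (int h + 1) + (\<Sum>z\<in>{- int h..int h}. z * z)"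
    by (simp add: algebra_simps)
  then show ?case using Suc by (simp add: algebra_simps)
qed simp

text \<open>Exchanging an element outside the interval for one inside lowers the square by at least
  (h + 1)^2 - h^2 = 2h + 1, so the minimum is attained only by the interval itself.\<close>

lemma sum_squares_distinct:
  fixes Z :: "int set"
  assumes Z: "finite Z" "card Z = 2 * h + 1"
  shows "(\<Sum>z\<in>{- int h..int h}. z * z) \<le> (\<Sum>z\<in>Z. z * z)"
    and "(\<Sum>z\<in>Z. z * z) = (\<Sum>z\<in>{- int h..int h}. z * z) \<Longrightarrow> Z = {- int h..int h}"
proof -
  let ?I = "{- int h..int h}"
  have cI: "card ?I = 2 * h + 1" by simp
  have cd: "card (Z - ?I) = card (?I - Z)"
  proof -
    have "card (Z - ?I) + card (Z \<inter> ?I) = card Z" using Z(1) by (metis card_Int_Diff add.commute)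
    moreover have "card (?I - Z) + card (?I \<inter> Z) = card ?I" by (metis card_Int_Diff add.commute finite_atLeastAtMost_int)
    ultimately show ?thesis using Z(2) cI by (simp add: Int_commute)
  qed
  have sZ: "(\<Sum>z\<in>Z. z * z) = (\<Sum>z\<in>Z \<inter> ?I. z * z) + (\<Sum>z\<in>Z - ?I. z * z)" using Z(1) by (rule sum.Int_Diff)
  have sI: "(\<Sum>z\<in>?I. z * z) = (\<Sum>z\<in>Z \<inter> ?I. z * z) + (\<Sum>z\<in>?I - Z. z * z)"
    using sum.Int_Diff[of ?I "\<lambda>z. z * z" Z] by (simp add: Int_commute)
  have lo: "int (card (Z - ?I)) * ((int h + 1) * (int h + 1)) \<le> (\<Sum>z\<in>Z - ?I. z * z)"
  proof (rule sum_bounded_below)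
    fix z assume "z \<in> Z - ?I"
    then have "\<bar>z\<bar> \<ge> int h + 1" by auto
    then have "(int h + 1) * (int h + 1) \<le> \<bar>z\<bar> * \<bar>z\<bar>" by (intro mult_mono) auto
    then show "(int h + 1) * (int h + 1) \<le> z * z" by simp
  qed
  have hi: "(\<Sum>z\<in>?I - Z. z * z) \<le> int (card (?I - Z)) * (int h * int h)"
  proof (rule sum_bounded_above)
    fix z assume "z \<in> ?I - Z"
    then have "\<bar>z\<bar> \<le> int h" by auto
    then have "\<bar>z\<bar> * \<bar>z\<bar> \<le> int h * int h" by (intro mult_mono) auto
    then show "z * z \<le> int h * int h" by simp
  qed
  let ?n = "int (card (Z - ?I))"
  have ge: "(\<Sum>z\<in>?I. z * z) + ?n * (2 * int h + 1) \<le> (\<Sum>z\<in>Z. z * z)"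
  proof -
    have "?n * ((int h + 1) * (int h + 1)) = ?n * (int h * int h) + ?n * (2 * int h + 1)" by (simp add: algebra_simps)
    then show ?thesis using lo hi sZ sI cd by simp
  qed
  moreover have "0 \<le> ?n * (2 * int h + 1)" by simp
  ultimately show "(\<Sum>z\<in>?I. z * z) \<le> (\<Sum>z\<in>Z. z * z)" by linarith
  assume "(\<Sum>z\<in>Z. z * z) = (\<Sum>z\<in>?I. z * z)"
  then have "?n * (2 * int h + 1) \<le> 0" using ge by simp
  then have "?n = 0" by (simp add: mult_le_0_iff)
  then have "Z - ?I = {}" using Z(1) by simp
  then show "Z = ?I" using Z cI by (intro card_subset_eq) auto
qed

lemma sum_idx_h: "CARD('n::{finite,linorder}) = 2 * h + 1 \<Longrightarrow> (\<Sum>a\<in>UNIV. real (idx (a :: 'n))) = real CARD('n) * real h"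
  by (simp add: sum_idx_real)

lemma mod_ring_eq_neg_h:
  fixes u v :: int
  assumes "CARD('p::prime_card) = 2 * h + 1" "u \<in> {- int h..int h}" "v \<in> {- int h..int h}"
    and "(of_int u :: 'p mod_ring) = of_int v"
  shows "u = v"
proof (rule ccontr)
  assume ne: "u \<noteq> v"
  have "int CARD('p) dvd u - v" using assms(4) by (simp add: of_int_mod_ring_eq_iff)
  then have "\<bar>int CARD('p)\<bar> \<le> \<bar>u - v\<bar>" by (rule dvd_imp_le_int[rotated]) (use ne in simp)
  then show False using assms(1,2,3) by auto
qed

section \<open>Images of cyclic roots modulo p\<close>

context frame_pair
begin

lemma integral_if:
  assumes "W (rootv j0 a0 (nxt a0)) \<bullet> rootv i0 b0 (nxt b0) \<in> \<int>"
  shows "integral_frame_pair C D W W'"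
proof -
  have nn: "W (rootv j a (nxt a)) \<bullet> rootv i b (nxt b) \<in> \<int>" for j a i b
    using Ints_add[OF inner_root_const[of j a i b j0 a0 i0 b0] assms] by simp
  have dual: "W (rootv j a (nxt a)) \<in> A_dual" for j a
  proof -
    let ?y = "W (rootv j a (nxt a))"
    have yV: "?y \<in> V0" by (intro V0 root_V0)
    have "?y \<bullet> rootv i b c \<in> \<int>" for i b c
    proof (rule nxt_induct[of "\<lambda>c. ?y \<bullet> rootv i b c \<in> \<int>" b c])
      fix c assume c: "?y \<bullet> rootv i b c \<in> \<int>"
      have "?y \<bullet> rootv i b (nxt c) = ?y \<bullet> rootv i b c + ?y \<bullet> rootv i c (nxt c)" by (simp add: inner_diff_right)
      then show "?y \<bullet> rootv i b (nxt c) \<in> \<int>" using Ints_add[OF c nn] by simp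
    qed simp
    then show ?thesis unfolding A_dual_iff using yV by blast
  qed
  have "W (rootv j a b) \<in> A_dual" for j a b
  proof (rule nxt_induct[of "\<lambda>b. W (rootv j a b) \<in> A_dual" a b])
    show "W (rootv j a a) \<in> A_dual" by (simp add: linear_0[OF lin(1)] A_dual_0)
    fix b assume b: "W (rootv j a b) \<in> A_dual"
    have "W (rootv j a (nxt b)) = W (rootv j a b) + W (rootv j b (nxt b))"
      unfolding linear_add[OF lin(1), symmetric] by simp
    then show "W (rootv j a (nxt b)) \<in> A_dual" using A_dual_add[OF b dual] by simp
  qed
  then show ?thesis
    by (intro integral_frame_pair.intro frame_pair_axioms integral_frame_pair_axioms.intro)
qed

text \<open>The entries of p times the image of a cyclic root are integers, and modulo p each block
  is an arithmetic progression with step -m. The step is common to all blocks and all roots; only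
  the offset t depends on them.\<close>

definition residues :: "int \<Rightarrow> 'p \<Rightarrow> 'k \<Rightarrow> ('k \<Rightarrow> 'p \<Rightarrow> int) \<Rightarrow> 'p mod_ring ^ 'k \<Rightarrow> bool" where
  "residues m a j z t \<longleftrightarrow> (\<forall>i b. real CARD('p) * W (rootv j a (nxt a)) $ i $ b = of_int (z i b)) \<and>
    (\<forall>i b. of_int (z i b) = t $ i - of_int m * of_nat (idx b))"

text \<open>Let kappa be one of the products. Since p times a root lies in \<open>L_B C\<close>, m =
  p kappa is an integer, not divisible by p as kappa is not integral. Consecutive entries of a block
  differ by kappa modulo 1, which fixes the progression.\<close>

lemma exists_residues:
  assumes ni: "W (rootv j0 a0 (nxt a0)) \<bullet> rootv i0 b0 (nxt b0) \<notin> \<int>"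
  shows "\<exists>m. \<not> int CARD('p) dvd m \<and> (\<forall>j a. \<exists>z t. residues m a j z t)"
proof -
  let ?r0 = "rootv i0 b0 (nxt b0)" and ?p = "real CARD('p)"
  let ?\<kappa> = "W (rootv j0 a0 (nxt a0)) \<bullet> ?r0"
  obtain h where h: "CARD('p) = 2 * h + 1" using odd by (auto elim: oddE)
  have "?p *\<^sub>R ?r0 \<in> L_B C" by (rule root_in_L_B(1)[OF code_closed(1)[OF C(1)]])
  then have "W' (?p *\<^sub>R ?r0) \<in> A_dual" by (intro L_B_dual L_B)
  then have "W' (?p *\<^sub>R ?r0) \<bullet> rootv j0 a0 (nxt a0) \<in> \<int>" unfolding A_dual_iff by blast
  then have "W (rootv j0 a0 (nxt a0)) \<bullet> (?p *\<^sub>R ?r0) \<in> \<int>"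
    using adjoint[OF root_V0 subspace_scale[OF subspace_V0 root_V0], of j0 a0 "nxt a0" ?p i0 b0 "nxt b0"]
    by (simp only: inner_commute[of "W' (?p *\<^sub>R ?r0)"])
  then have "?p * ?\<kappa> \<in> \<int>" by (simp only: inner_scaleR_right)
  then obtain m where m: "?p * ?\<kappa> = of_int m" by (auto elim: Ints_cases)
  have ndvd: "\<not> int CARD('p) dvd m"
  proof
    assume "int CARD('p) dvd m"
    then obtain q where "m = int CARD('p) * q" by (auto elim: dvdE)
    then have "?\<kappa> = of_int q" using m by simp
    then show False using ni by simp
  qed
  have "\<exists>z t. residues m a j z t" for j a
  proof -
    let ?y = "W (rootv j a (nxt a))"
    have yV: "?y \<in> V0" by (intro V0 root_V0)
    obtain o0 :: 'p where o0: "idx o0 = 0" using ex_idx[of 0] by auto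
    have step: "?y $ i $ b - ?y $ i $ (nxt b) - ?\<kappa> \<in> \<int>" for i b
      using inner_root_const[of j a i b j0 a0 i0 b0] inner_ebar[OF yV] by (simp only: inner_diff_right[of ?y])
    have lin': "?y $ i $ b - ?y $ i $ o0 + real (idx b) * ?\<kappa> \<in> \<int>" for i b
    proof (rule nxt_induct[of "\<lambda>b. ?y $ i $ b - ?y $ i $ o0 + real (idx b) * ?\<kappa> \<in> \<int>" o0 b])
      fix b assume b: "?y $ i $ b - ?y $ i $ o0 + real (idx b) * ?\<kappa> \<in> \<int>"
      show "?y $ i $ (nxt b) - ?y $ i $ o0 + real (idx (nxt b)) * ?\<kappa> \<in> \<int>"
      proof (cases "idx b + 1 = CARD('p)")
        case True
        then have "idx (nxt b) = idx o0" using o0 by (simp add: idx_nxt)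
        then have e: "nxt b = o0" by (rule injD[OF inj_idx])
        show ?thesis unfolding e o0 by simp
      next
        case False
        then have "idx (nxt b) = idx b + 1" using idx_less[of b] by (simp add: idx_nxt)
        then have "?y $ i $ (nxt b) - ?y $ i $ o0 + real (idx (nxt b)) * ?\<kappa>
          = (?y $ i $ b - ?y $ i $ o0 + real (idx b) * ?\<kappa>) - (?y $ i $ b - ?y $ i $ (nxt b) - ?\<kappa>)"
          by (simp add: distrib_right)
        then show ?thesis using Ints_diff[OF b step[of i b]] by (simp only:)
      qed
    qed (simp add: o0)
    define n where "n i b = \<lfloor>?y $ i $ b - ?y $ i $ o0 + real (idx b) * ?\<kappa>\<rfloor>" for i b
    have fl: "x = of_int \<lfloor>x\<rfloor>" if "x \<in> \<int>" for x :: real using that by (auto elim: Ints_cases)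
    have n: "?y $ i $ b - ?y $ i $ o0 + real (idx b) * ?\<kappa> = of_int (n i b)" for i b
      unfolding n_def by (rule fl[OF lin'])
    \<comment> \<open>The block sum zero determines the entry at position 0. The positions sum to p
      h, which turns their contribution into the integer m h.\<close>
    have p0: "?p * ?y $ i $ o0 = of_int (m * int h - (\<Sum>b\<in>UNIV. n i b))" for i
    proof -
      have "(\<Sum>b\<in>UNIV. ?y $ i $ b) = (\<Sum>b\<in>UNIV. of_int (n i b) + ?y $ i $ o0 - real (idx b) * ?\<kappa>)"
        by (intro sum.cong refl) (use n[of i] in \<open>simp add: algebra_simps\<close>)
      also have "\<dots> = of_int (\<Sum>b\<in>UNIV. n i b) + ?p * ?y $ i $ o0 - (\<Sum>b\<in>UNIV. real (idx (b :: 'p))) * ?\<kappa>"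
        by (simp add: sum.distrib sum_subtractf sum_distrib_right)
      also have "(\<Sum>b\<in>UNIV. real (idx (b :: 'p))) * ?\<kappa> = real h * (?p * ?\<kappa>)" unfolding sum_idx_h[OF h] by (simp only: mult_ac)
      finally show ?thesis using yV unfolding m by (simp add: V0_def algebra_simps)
    qed
    define z where "z i b = m * int h - (\<Sum>b\<in>UNIV. n i b) - int (idx b) * m + int CARD('p) * n i b" for i b
    have "?p * ?y $ i $ b = of_int (z i b)" for i b
    proof -
      have "?y $ i $ b = of_int (n i b) + ?y $ i $ o0 - real (idx b) * ?\<kappa>" using n[of i b] by simp
      then have "?p * ?y $ i $ b = ?p * of_int (n i b) + ?p * ?y $ i $ o0 - real (idx b) * (?p * ?\<kappa>)"
        by (simp only:) (simp add: algebra_simps)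
      then show ?thesis unfolding p0 m z_def by simp
    qed
    moreover have "(of_int (z i b) :: 'p mod_ring) = of_int (m * int h - (\<Sum>b\<in>UNIV. n i b)) - of_int m * of_nat (idx b)" for i b
      by (simp add: z_def algebra_simps)
    ultimately have "residues m a j z (\<chi> i. of_int (m * int h - (\<Sum>b\<in>UNIV. n i b)))" by (simp add: residues_def)
    then show ?thesis by blast
  qed
  then show ?thesis using ndvd by blast
qed

lemma residues_inj:
  assumes r: "residues m a j z t" and m: "\<not> int CARD('p) dvd m"
  shows "inj (\<lambda>b. of_int (z i b) :: 'p mod_ring)" "inj (z i)"
proof -
  show i: "inj (\<lambda>b. of_int (z i b) :: 'p mod_ring)"
  proof (rule injI)
    fix b c assume "(of_int (z i b) :: 'p mod_ring) = of_int (z i c)"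
    moreover have "(of_int (z i b) :: 'p mod_ring) = t $ i - of_int m * of_nat (idx b)"
      "(of_int (z i c) :: 'p mod_ring) = t $ i - of_int m * of_nat (idx c)" using r unfolding residues_def by blast+
    ultimately have "(of_int m :: 'p mod_ring) * of_nat (idx b) = of_int m * of_nat (idx c)" by simp
    moreover have "(of_int m :: 'p mod_ring) \<noteq> 0" using m by (simp add: of_int_mod_ring_eq_0_iff)
    ultimately have "(of_int (int (idx b)) :: 'p mod_ring) = of_int (int (idx c))" by simp
    then have d: "int CARD('p) dvd int (idx b) - int (idx c)" by (simp only: of_int_mod_ring_eq_iff)
    have "idx b = idx c"
    proof (rule ccontr)
      assume "idx b \<noteq> idx c"
      then have "\<bar>int CARD('p)\<bar> \<le> \<bar>int (idx b) - int (idx c)\<bar>" by (intro dvd_imp_le_int d) simp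
      then show False using idx_less[of b] idx_less[of c] by simp
    qed
    then show "b = c" by (rule injD[OF inj_idx])
  qed
  show "inj (z i)" by (rule injI) (metis i injD)
qed

lemma residues_inner:
  assumes "residues m a j z t" "residues m a' j' z' t'"
  shows "(\<Sum>i\<in>UNIV. \<Sum>b\<in>UNIV. of_int (z i b * z' i b)) = (real CARD('p))\<^sup>2 * (rootv j a (nxt a) \<bullet> rootv j' a' (nxt a'))"
proof -
  have "(\<Sum>i\<in>UNIV. \<Sum>b\<in>UNIV. of_int (z i b * z' i b))
    = (\<Sum>i\<in>UNIV. \<Sum>b\<in>UNIV. (real CARD('p) * W (rootv j a (nxt a)) $ i $ b) * (real CARD('p) * W (rootv j' a' (nxt a')) $ i $ b))"
    using assms by (simp add: residues_def)
  also have "\<dots> = (real CARD('p))\<^sup>2 * (W (rootv j a (nxt a)) \<bullet> W (rootv j' a' (nxt a')))"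
    unfolding inner_blocks sum_distrib_left by (intro sum.cong refl) (simp only: power2_eq_square mult_ac)
  finally show ?thesis unfolding inner[OF root_V0 root_V0] .
qed

lemma root_nxt_norm: "rootv j a (nxt a) \<bullet> rootv j a (nxt a) = 2" for j :: 'k and a :: 'p
  by (rule root_norm[OF nxt_neq]) (rule prime_gt_1_nat[OF prime_card])

lemma residues_norm:
  assumes "residues m a j z t"
  shows "(\<Sum>i\<in>UNIV. \<Sum>b\<in>UNIV. z i b * z i b) = 2 * (int CARD('p))\<^sup>2"
proof -
  have "real_of_int (\<Sum>i\<in>UNIV. \<Sum>b\<in>UNIV. z i b * z i b) = of_int (2 * (int CARD('p))\<^sup>2)"
    using residues_inner[OF assms assms] unfolding root_nxt_norm by simp
  then show ?thesis by (simp only: of_int_eq_iff)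
qed

text \<open>The p entries of a block are distinct, so their squares sum to at least h (h + 1) (2h +
  1) / 3, and all blocks together have 2 p^2. Equality in total forces equality in every
  block.\<close>

lemma residues_bound:
  assumes r: "residues m a j z t" and m: "\<not> int CARD('p) dvd m" and h: "CARD('p) = 2 * h + 1"
  shows "CARD('k) * (h * (h + 1)) \<le> 6 * (2 * h + 1)"
    and "CARD('k) * (h * (h + 1)) = 6 * (2 * h + 1) \<Longrightarrow> range (z i) = {- int h..int h}"
proof -
  let ?S = "\<Sum>v\<in>{- int h..int h}. v * v"
  have card: "card (range (z i)) = 2 * h + 1" for i using card_image[OF residues_inj(2)[OF r m, of i]] h by simp
  have sum_eq: "(\<Sum>b\<in>UNIV. z i b * z i b) = (\<Sum>v\<in>range (z i). v * v)" for i
    using sum.reindex[OF residues_inj(2)[OF r m, of i], of "\<lambda>v. v * v"] by simp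
  have ge: "?S \<le> (\<Sum>b\<in>UNIV. z i b * z i b)" for i
    unfolding sum_eq by (rule sum_squares_distinct(1)[OF _ card]) simp
  have tot: "(\<Sum>i\<in>UNIV. \<Sum>b\<in>UNIV. z i b * z i b) = 2 * (int CARD('p))\<^sup>2" by (rule residues_norm[OF r])
  have le: "int CARD('k) * ?S \<le> 2 * (int CARD('p))\<^sup>2"
    using sum_bounded_below[of "UNIV :: 'k set" ?S "\<lambda>i. \<Sum>b\<in>UNIV. z i b * z i b"] ge tot by simp
  have S3: "3 * ?S = int h * (int h + 1) * int CARD('p)" using sum_squares_sym[of h] h by simp
  have "int CARD('p) * (int CARD('k) * (int h * (int h + 1))) = int CARD('k) * (3 * ?S)" unfolding S3 by (simp only: mult_ac)
  also have "\<dots> = 3 * (int CARD('k) * ?S)" by (simp only: mult_ac)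
  finally have e: "int CARD('p) * (int CARD('k) * (int h * (int h + 1))) = 3 * (int CARD('k) * ?S)" .
  also have "\<dots> \<le> 3 * (2 * (int CARD('p))\<^sup>2)" using le by (rule mult_left_mono) simp
  also have "\<dots> = int CARD('p) * (6 * int CARD('p))" by (simp add: power2_eq_square)
  finally have "int CARD('k) * (int h * (int h + 1)) \<le> 6 * int CARD('p)"
    by (subst (asm) mult_le_cancel_left_pos) simp_all
  then have "int (CARD('k) * (h * (h + 1))) \<le> int (6 * (2 * h + 1))" unfolding h by (simp add: algebra_simps)
  then show "CARD('k) * (h * (h + 1)) \<le> 6 * (2 * h + 1)" by (simp only: of_nat_le_iff)
  assume eq: "CARD('k) * (h * (h + 1)) = 6 * (2 * h + 1)"
  have "3 * (int CARD('k) * ?S) = int CARD('p) * int (CARD('k) * (h * (h + 1)))" unfolding e[symmetric] by (simp add: algebra_simps)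
  also have "\<dots> = 3 * (2 * (int CARD('p))\<^sup>2)" unfolding eq h by (simp add: power2_eq_square)
  finally have "int CARD('k) * ?S = 2 * (int CARD('p))\<^sup>2" by simp
  then have "(\<Sum>i\<in>UNIV. (\<Sum>b\<in>UNIV. z i b * z i b) - ?S) = 0" using tot by (simp add: sum_subtractf)
  then have "\<forall>i\<in>UNIV. (\<Sum>b\<in>UNIV. z i b * z i b) - ?S = 0"
    using sum_nonneg_eq_0_iff[of "UNIV :: 'k set" "\<lambda>i. (\<Sum>b\<in>UNIV. z i b * z i b) - ?S"] ge by simp
  then have "(\<Sum>v\<in>range (z i). v * v) = ?S" using sum_eq by simp
  then show "range (z i) = {- int h..int h}" by (rule sum_squares_distinct(2)[OF _ card, rotated]) simp
qed

text \<open>A difference of cyclic roots has its image in \<open>L_B C\<close>, and the word of that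
  image is minus the difference of the offsets. So all offsets lie in one coset of C.\<close>

lemma residues_diff:
  assumes "residues m a j z t" "residues m a' j' z' t'"
  shows "t - t' \<in> C"
proof -
  let ?r = "rootv j a (nxt a)" and ?r' = "rootv j' a' (nxt a')"
  have L: "W (?r - ?r') \<in> L_B C" by (intro L_B root_in_L_B code_closed D)
  have "word (W (?r - ?r')) $ i = - (t $ i - t' $ i)" for i
  proof -
    have "real CARD('p) * W (?r - ?r') $ i $ Min UNIV = of_int (z i (Min UNIV) - z' i (Min UNIV))"
      using assms unfolding linear_diff[OF lin(1), of ?r ?r'] by (simp add: residues_def right_diff_distrib)
    then have "word (W (?r - ?r')) $ i = - of_int (z i (Min UNIV) - z' i (Min UNIV))" by (simp only: word_def vec_lambda_beta floor_of_int)
    then show ?thesis using assms by (simp add: residues_def)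
  qed
  then have "word (W (?r - ?r')) = - (t - t')" by (simp add: vec_eq_iff)
  moreover have "word (W (?r - ?r')) \<in> C" using L by (simp add: L_B_eq)
  ultimately have "- (t - t') \<in> C" by simp
  then have "- (- (t - t')) \<in> C" by (rule code_closed(5)[OF C(1)])
  then show ?thesis by simp
qed

lemma root_nxt_inj:
  assumes "rootv j a (nxt a) = rootv j' a' (nxt a')"
  shows "j = (j' :: 'k) \<and> a = (a' :: 'p)"
proof -
  have n: "nxt a \<noteq> a" "nxt a' \<noteq> a'" using nxt_neq[of a] nxt_neq[of a'] prime_gt_1_nat[OF prime_card[where 'a='p]] by auto
  have "rootv j a (nxt a) $ j $ a = 1" unfolding root_nth using n by simp
  then have "rootv j' a' (nxt a') $ j $ a = 1" by (simp only: assms)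
  then show ?thesis unfolding root_nth by (auto split: if_splits)
qed

text \<open>When the entries are balanced residues, the offset t determines them and hence the root.
  The k p cyclic roots then have distinct offsets in one coset of C.\<close>

lemma card_ge_if_equality:
  assumes ni: "W (rootv j0 a0 (nxt a0)) \<bullet> rootv i0 b0 (nxt b0) \<notin> \<int>"
    and h: "CARD('p) = 2 * h + 1" and eq: "CARD('k) * (h * (h + 1)) = 6 * (2 * h + 1)"
  obtains m T Z where "\<not> int CARD('p) dvd m" "\<forall>j a. residues m a j (Z j a) (T j a)" "\<forall>j a i. range (Z j a i) = {- int h..int h}"
    "inj (\<lambda>q. T (fst q) (snd q))" "CARD('k) * CARD('p) \<le> card C"
proof -
  obtain m where m: "\<not> int CARD('p) dvd m" "\<forall>j a. \<exists>z t. residues m a j z t" using exists_residues[OF ni] by blast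
  obtain Z where "\<forall>j a. \<exists>t. residues m a j (Z j a) t" using m(2) by metis
  then obtain T where T: "\<forall>j a. residues m a j (Z j a) (T j a)" by metis
  then have R: "residues m a j (Z j a) (T j a)" for j a by blast
  have rg: "range (Z j a i) = {- int h..int h}" for j a i by (rule residues_bound(2)[OF R m(1) h eq])
  have inj: "inj (\<lambda>q. T (fst q) (snd q))"
  proof (rule injI)
    fix q q' :: "'k \<times> 'p" assume e: "T (fst q) (snd q) = T (fst q') (snd q')"
    let ?y = "W (rootv (fst q) (snd q) (nxt (snd q)))" and ?y' = "W (rootv (fst q') (snd q') (nxt (snd q')))"
    have "Z (fst q) (snd q) i b = Z (fst q') (snd q') i b" for i b
    proof (rule mod_ring_eq_neg_h[OF h])
      show "Z (fst q) (snd q) i b \<in> {- int h..int h}" "Z (fst q') (snd q') i b \<in> {- int h..int h}"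
        using rangeI[of "Z (fst q) (snd q) i" b] rangeI[of "Z (fst q') (snd q') i" b] unfolding rg by blast+
      show "(of_int (Z (fst q) (snd q) i b) :: 'p mod_ring) = of_int (Z (fst q') (snd q') i b)"
        using R[where j="fst q" and a="snd q"] R[where j="fst q'" and a="snd q'"] e by (simp add: residues_def)
    qed
    then have "real CARD('p) * ?y $ i $ b = real CARD('p) * ?y' $ i $ b" for i b
      using R[where j="fst q" and a="snd q"] R[where j="fst q'" and a="snd q'"] by (simp add: residues_def)
    then have "?y = ?y'" by (simp add: vec_eq_iff)
    then have "rootv (fst q) (snd q) (nxt (snd q)) = rootv (fst q') (snd q') (nxt (snd q'))"
      using inverse(1)[OF root_V0] by metis
    then show "q = q'" using root_nxt_inj by (metis prod_eqI)
  qed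
  have "CARD('k) * CARD('p) \<le> card C"
  proof -
    let ?f = "\<lambda>q :: 'k \<times> 'p. T (fst q) (snd q) - T j0 a0"
    have "inj ?f" by (rule injI) (rule injD[OF inj], simp)
    moreover have "range ?f \<subseteq> C" using residues_diff[OF R R] by blast
    ultimately have "card (UNIV :: ('k \<times> 'p) set) \<le> card C" by (intro card_inj_on_le[of ?f]) auto
    then show ?thesis by (simp add: card_prod)
  qed
  then show ?thesis by - (rule that[OF m(1) T _ inj], use rg in auto)
qed

end

section \<open>Lines, codes of length at most two, and length three for p = 7\<close>

lemma numeral_mod_ring_eq_0_iff: "(numeral n :: 'p::prime_card mod_ring) = 0 \<longleftrightarrow> CARD('p) dvd numeral n"
proof -
  have "(numeral n :: 'p mod_ring) = 0 \<longleftrightarrow> int CARD('p) dvd int (numeral n)"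
    using of_int_mod_ring_eq_0_iff[of "numeral n", where 'p='p] by simp
  then show ?thesis by (simp only: int_dvd_int_iff)
qed

lemma card_compl: "card (- A) = CARD('k::finite) - card (A :: 'k set)"
  by (simp add: Compl_eq_Diff_UNIV card_Diff_subset)

lemma code_self_dot: "self_orthogonal C \<Longrightarrow> c \<in> C \<Longrightarrow> (\<Sum>i\<in>UNIV. c $ i * c $ i) = 0"
  using self_orthogonalD by blast

lemma span1: "c = a *s w \<Longrightarrow> c \<in> vec.span {w}"
  by (auto intro: vec.span_scale vec.span_base)

lemma span2: "c = a *s w + b *s w' \<Longrightarrow> c \<in> vec.span {w, w'}"
  by (erule ssubst) (intro vec.span_add vec.span_scale vec.span_base, simp_all)

lemma line_span:
  assumes C: "is_code C" and c: "c \<in> C" "c $ i \<noteq> 0" and z: "\<And>x. x \<in> C \<Longrightarrow> x $ i = 0 \<Longrightarrow> x = 0"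
  shows "C = vec.span {c}"
proof (rule code_eq_span[OF C])
  fix x assume x: "x \<in> C"
  let ?a = "x $ i / c $ i"
  have "x - ?a *s c \<in> C" by (intro code_closed[OF C] x c)
  moreover have "(x - ?a *s c) $ i = 0" using c(2) by simp
  ultimately have "x - ?a *s c = 0" by (rule z)
  then have "x = ?a *s c" by simp
  then show "x \<in> vec.span {c}" by (rule span1)
qed (use c in simp)

lemma zero_code_iff:
  fixes C D :: "('p::{prime_card,linorder} mod_ring ^ 'k) set"
  assumes odd: "odd CARD('p)" and C: "is_code C" and D: "is_code D" and iso: "lattice_isomorphic (L_B C) (L_B D)"
  shows "C = {0} \<Longrightarrow> D = {0}"
proof (rule ccontr)
  assume "C = {0}" "D \<noteq> {0}"
  then have "C \<subset> D" using code_closed(1)[OF D] by auto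
  then show False using proper_subcode_not_isomorphic(1)[OF odd] iso by blast
qed

lemma code_isomorphic_refl: "code_isomorphic C C"
  unfolding code_isomorphic_def by (rule bexI[OF _ code_group.one]) simp

lemma nonzero_word: "is_code C \<Longrightarrow> C \<noteq> {0} \<Longrightarrow> \<exists>c\<in>C. c \<noteq> 0"
  using code_closed(1) by blast

lemma length_1_code:
  assumes "CARD('k::finite) = 1" "is_code C" "self_orthogonal C"
  shows "C = {0 :: 'a::field ^ 'k}"
proof -
  obtain i :: 'k where i: "UNIV = {i}" using assms(1) by (auto simp: card_1_singleton_iff)
  have "c = 0" if "c \<in> C" for c
  proof -
    have "c $ i * c $ i = 0" using code_self_dot[OF assms(3) that] by (simp add: i)
    then have "c $ t = 0" for t using i by (metis UNIV_I mult_eq_0_iff singletonD)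
    then show ?thesis by (simp add: vec_eq_iff)
  qed
  then show ?thesis using code_closed(1)[OF assms(2)] by blast
qed

lemma length_2_code:
  fixes C :: "('a::field ^ 'k::finite) set"
  assumes ij: "(UNIV :: 'k set) = {i, j}" "i \<noteq> j" and C: "is_code C" "self_orthogonal C" "C \<noteq> {0}"
  obtains w where "C = vec.span {w}" "w \<in> C" "w $ i * w $ i = 1" "w $ j * w $ j = -1"
proof -
  have dot: "c $ i * c $ i + c $ j * c $ j = 0" if "c \<in> C" for c
    using code_self_dot[OF C(2) that] unfolding ij(1) using ij(2) by simp
  have all: "P t" if "P i" "P j" for P and t :: 'k using ij(1) that by (metis UNIV_I empty_iff insert_iff)
  have z: "c = 0" if c: "c \<in> C" "c $ i = 0" for c
  proof -
    have "c $ j = 0" using dot[OF c(1)] c(2) by simp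
    then have "c $ t = 0" for t using c(2) all[of "\<lambda>t. c $ t = 0"] by blast
    then show ?thesis by (simp add: vec_eq_iff)
  qed
  obtain c where c: "c \<in> C" "c \<noteq> 0" using nonzero_word[OF C(1,3)] by blast
  then have ci: "c $ i \<noteq> 0" using z by blast
  define w where "w = inverse (c $ i) *s c"
  have w: "w \<in> C" unfolding w_def by (intro code_closed[OF C(1)] c)
  have wi: "w $ i = 1" using ci by (simp add: w_def)
  have "C = vec.span {w}" by (rule line_span[OF C(1) w _ z]) (simp_all add: wi)
  moreover have "w $ j * w $ j = -1" using dot[OF w] wi by (simp add: eq_neg_iff_add_eq_0 add.commute)
  ultimately show ?thesis using that[of w] w wi by simp
qed

text \<open>A nonzero self-orthogonal code of length two is a line spanned by a word with squares 1
  and -1, so both codes have the same squares.\<close>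

lemma iso_length_2:
  fixes C D :: "('p::{prime_card,linorder} mod_ring ^ 'k) set"
  assumes odd: "odd CARD('p)" and C: "is_code C" "self_orthogonal C" "C \<noteq> {0}" and D: "is_code D" "self_orthogonal D" "D \<noteq> {0}"
    and iso: "lattice_isomorphic (L_B C) (L_B D)" and k: "CARD('k) = 2"
  shows "code_isomorphic C D"
proof -
  obtain i j :: 'k where ij: "UNIV = {i, j}" "i \<noteq> j" using k by (auto simp: card_2_iff)
  obtain w where w: "C = vec.span {w}" "w \<in> C" "w $ i * w $ i = 1" "w $ j * w $ j = -1" by (rule length_2_code[OF ij C], rule that)
  obtain z where z: "D = vec.span {z}" "z \<in> D" "z $ i * z $ i = 1" "z $ j * z $ j = -1" by (rule length_2_code[OF ij D], rule that)
  have "w $ t * w $ t = z $ t * z $ t" for t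
  proof -
    have "t \<in> {i, j}" using ij(1) by auto
    then show ?thesis using w(3,4) z(3,4) by auto
  qed
  then show ?thesis by (intro line_or_proper[OF odd C(1) D(1) iso w(1) z(2)]) simp
qed

lemma mod_ring_cases_7:
  assumes "CARD('p::prime_card) = 7"
  shows "(c :: 'p mod_ring) * c \<in> {0, 1, 2, 4}" "c * c = 0 \<longleftrightarrow> c = 0"
proof -
  have "to_int_mod_ring c < 7" using to_int_mod_ring_bounds[of c] assms by simp
  then have "to_int_mod_ring c = 0 \<or> to_int_mod_ring c = 1 \<or> to_int_mod_ring c = 2 \<or>
    to_int_mod_ring c = 3 \<or> to_int_mod_ring c = 4 \<or> to_int_mod_ring c = 5 \<or> to_int_mod_ring c = 6"
    using to_int_mod_ring_bounds(1)[of c] by presburger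
  then have c: "c = of_int 0 \<or> c = of_int 1 \<or> c = of_int 2 \<or> c = of_int 3 \<or> c = of_int 4 \<or> c = of_int 5 \<or> c = of_int 6"
    using of_int_to_int_mod_ring[of c] by metis
  have sq: "(of_int n :: 'p mod_ring) * of_int n = of_int (n * n mod 7)" for n
    unfolding of_int_mult[symmetric] of_int_mod_ring_eq_iff assms by (simp add: mod_eq_dvd_iff[symmetric])
  have "c * c = of_int 0 \<or> c * c = of_int 1 \<or> c * c = of_int 2 \<or> c * c = of_int 4"
    using c by (elim disjE) (simp_all only: sq, simp_all)
  then show "c * c \<in> {0, 1, 2, 4}" by auto
  show "c * c = 0 \<longleftrightarrow> c = 0" by simp
qed

text \<open>The nonzero squares modulo 7 are 1, 2 and 4, and 1 + 2 + 4 is the only way for three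
  squares, not all zero, to cancel. So both codes are lines with these squares in some
  order.\<close>

lemma iso_7_3:
  fixes C D :: "('p::{prime_card,linorder} mod_ring ^ 'k) set"
  assumes p: "CARD('p) = 7" and C: "is_code C" "self_orthogonal C" "C \<noteq> {0}" and D: "is_code D" "self_orthogonal D" "D \<noteq> {0}"
    and iso: "lattice_isomorphic (L_B C) (L_B D)" and k: "CARD('k) = 3"
  shows "code_isomorphic C D"
proof -
  obtain i j l :: 'k where ijl: "UNIV = {i, j, l}" "i \<noteq> j" "i \<noteq> l" "j \<noteq> l" using k by (auto simp: card_3_iff)
  have odd: "odd CARD('p)" by (simp add: p)
  note num = numeral_mod_ring_eq_0_iff[where 'p='p, unfolded p]
  have form: "\<exists>w\<in>C. C = vec.span {w} \<and> w $ i * w $ i = 1 \<and>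
      (w $ j * w $ j = 2 \<and> w $ l * w $ l = 4 \<or> w $ j * w $ j = 4 \<and> w $ l * w $ l = 2)"
    if C: "is_code C" "self_orthogonal C" "C \<noteq> {0}" for C :: "('p mod_ring ^ 'k) set"
  proof -
    have dot: "c $ i * c $ i + c $ j * c $ j + c $ l * c $ l = 0" if "c \<in> C" for c
      using code_self_dot[OF C(2) that] unfolding ijl(1) using ijl(2-4) by (simp add: add.assoc)
    have z: "c = 0" if c: "c \<in> C" "c $ i = 0" for c
    proof -
      have "c $ j * c $ j + c $ l * c $ l = 0" using dot[OF c(1)] c(2) by simp
      then have "c $ j * c $ j = 0 \<and> c $ l * c $ l = 0"
        using mod_ring_cases_7(1)[OF p, of "c $ j"] mod_ring_cases_7(1)[OF p, of "c $ l"]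
        by (auto simp: num)
      then have "\<forall>t\<in>{i, j, l}. c $ t = 0" using c(2) by simp
      then have "c $ t = 0" for t using ijl(1) by blast
      then show ?thesis by (simp add: vec_eq_iff)
    qed
    obtain c where c: "c \<in> C" "c \<noteq> 0" using nonzero_word[OF C(1,3)] by blast
    then have ci: "c $ i \<noteq> 0" using z by blast
    define w where "w = inverse (c $ i) *s c"
    have w: "w \<in> C" unfolding w_def by (intro code_closed[OF C(1)] c)
    have wi: "w $ i = 1" using ci by (simp add: w_def)
    have sp: "C = vec.span {w}" by (rule line_span[OF C(1) w _ z]) (simp_all add: wi)
    have "1 + w $ j * w $ j + w $ l * w $ l = 0" using dot[OF w] wi by simp
    then have "w $ j * w $ j = 2 \<and> w $ l * w $ l = 4 \<or> w $ j * w $ j = 4 \<and> w $ l * w $ l = 2"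
      using mod_ring_cases_7(1)[OF p, of "w $ j"] mod_ring_cases_7(1)[OF p, of "w $ l"]
      by (auto simp: num)
    then show ?thesis using w sp wi by (intro bexI[of _ w] conjI) simp_all
  qed
  obtain w where w: "w \<in> C" "C = vec.span {w}" "w $ i * w $ i = 1"
    "w $ j * w $ j = 2 \<and> w $ l * w $ l = 4 \<or> w $ j * w $ j = 4 \<and> w $ l * w $ l = 2" using form[OF C] by (elim bexE conjE)
  obtain z where z: "z \<in> D" "z $ i * z $ i = 1"
    "z $ j * z $ j = 2 \<and> z $ l * z $ l = 4 \<or> z $ j * z $ j = 4 \<and> z $ l * z $ l = 2" using form[OF D] by (elim bexE conjE)
  define \<pi> where "\<pi> = (if w $ j * w $ j = z $ j * z $ j then id else Transposition.transpose j l)"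
  have bp: "bij \<pi>" by (simp add: \<pi>_def)
  have "\<forall>t\<in>{i, j, l}. z $ \<pi> t * z $ \<pi> t = w $ t * w $ t"
    using w(3,4) z(2,3) ijl(2-4) by (auto simp: \<pi>_def Transposition.transpose_def)
  then have zw: "z $ \<pi> t * z $ \<pi> t = w $ t * w $ t" for t using ijl(1) by blast
  have "card {t. w $ t * w $ t = x} = card {t. z $ t * z $ t = x}" for x
  proof (rule bij_betw_same_card[of \<pi>])
    have "\<pi> ` {t. w $ t * w $ t = x} = {t. z $ t * z $ t = x}"
    proof
      show "\<pi> ` {t. w $ t * w $ t = x} \<subseteq> {t. z $ t * z $ t = x}" using zw by auto
      show "{t. z $ t * z $ t = x} \<subseteq> \<pi> ` {t. w $ t * w $ t = x}"
      proof
        fix u assume u: "u \<in> {t. z $ t * z $ t = x}"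
        obtain t where t: "u = \<pi> t" using bp by (metis bij_pointE)
        then have "w $ t * w $ t = x" using u zw[of t] by simp
        then show "u \<in> \<pi> ` {t. w $ t * w $ t = x}" using t by blast
      qed
    qed
    then show "bij_betw \<pi> {t. w $ t * w $ t = x} {t. z $ t * z $ t = x}"
      using bp by (auto simp: bij_betw_def bij_def intro: inj_on_subset)
  qed
  then show ?thesis by (rule line_or_proper[OF odd C(1) D(1) iso w(2) z(1)])
qed

subsection \<open>Short codes over the field with five elements\<close>

text \<open>Since the supports are disjoint, each coordinate has to satisfy a sign condition for at
  most one of the two words.\<close>

lemma plane_iso:
  fixes w w' z z' :: "'a::field ^ 'k"
  assumes d: "supp w \<inter> supp w' = {}" "supp z \<inter> supp z' = {}" and \<sigma>: "bij \<sigma>"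
    and sq: "\<And>t. z $ \<sigma> t * z $ \<sigma> t = w $ t * w $ t" "\<And>t. z' $ \<sigma> t * z' $ \<sigma> t = w' $ t * w' $ t"
  shows "code_isomorphic (vec.span {w, w'}) (vec.span {z, z'})"
proof -
  define s :: "'k \<Rightarrow> 'a" where "s t = (if w $ t = z $ \<sigma> t \<and> w' $ t = z' $ \<sigma> t then 1 else -1)" for t
  have "w $ t = s t * z $ \<sigma> t \<and> w' $ t = s t * z' $ \<sigma> t" for t
  proof -
    have "w $ t = 0 \<or> w' $ t = 0" "z $ \<sigma> t = 0 \<or> z' $ \<sigma> t = 0" using d by (auto simp: supp_def)
    moreover have "w $ t = z $ \<sigma> t \<or> w $ t = - z $ \<sigma> t" "w' $ t = z' $ \<sigma> t \<or> w' $ t = - z' $ \<sigma> t"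
      using sq[of t] square_eq_iff[of "w $ t" "z $ \<sigma> t"] square_eq_iff[of "w' $ t" "z' $ \<sigma> t"] by auto
    ultimately show ?thesis by (auto simp: s_def)
  qed
  then have "(\<chi> t. s t * z $ \<sigma> t) = w" "(\<chi> t. s t * z' $ \<sigma> t) = w'" by (simp_all add: vec_eq_iff)
  then have "(\<lambda>x. \<chi> t. s t * x $ \<sigma> t) ` {z, z'} = {w, w'}" by simp
  then show ?thesis by (rule iso_span[OF \<sigma>, rotated]) (simp add: s_def)
qed

locale short_code_5 =
  fixes C :: "('p::{prime_card,linorder} mod_ring ^ 'k) set"
  assumes p: "CARD('p) = 5" and C: "is_code C" "self_orthogonal C" and k: "CARD('k) \<le> 5"
begin

lemma squares_5: "(c :: 'p mod_ring) * c = 0 \<or> c * c = 1 \<or> c * c = -1"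
proof -
  have "(4 :: 'p mod_ring) + 1 = 0" using five_eq_0[OF p] by simp
  then have four: "(4 :: 'p mod_ring) = -1" by (simp only: eq_neg_iff_add_eq_0)
  show ?thesis using mod_ring_cases_5[OF p, of c] four by (elim disjE) simp_all
qed

lemma one_neq_minus_one_5: "(1 :: 'p mod_ring) \<noteq> -1"
proof
  assume "(1 :: 'p mod_ring) = -1"
  then have "(1 :: 'p mod_ring) + 1 = 0" by (simp only: eq_neg_iff_add_eq_0)
  then have "(2 :: 'p mod_ring) = 0" by simp
  then show False using numeral_mod_ring_eq_0_iff[of "num.Bit0 num.One", where 'p='p] p by simp
qed

lemma counts_5:
  fixes c :: "'p mod_ring ^ 'k"
  shows "card {t. c $ t * c $ t = 0} + card {t. c $ t * c $ t = 1} + card {t. c $ t * c $ t = -1} = CARD('k)"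
    "(\<Sum>t\<in>UNIV. c $ t * c $ t) = of_nat (card {t. c $ t * c $ t = 1}) - of_nat (card {t. c $ t * c $ t = -1})"
proof -
  let ?A = "{t. c $ t * c $ t = 0}" and ?B = "{t. c $ t * c $ t = 1}" and ?E = "{t. c $ t * c $ t = -1}"
  have U: "(UNIV :: 'k set) = ?A \<union> (?B \<union> ?E)" using squares_5 by auto
  have dj: "?A \<inter> (?B \<union> ?E) = {}" "?B \<inter> ?E = {}" using one_neq_minus_one_5 by auto
  have "CARD('k) = card (?A \<union> (?B \<union> ?E))" using U by simp
  also have "\<dots> = card ?A + (card ?B + card ?E)"
    by (subst card_Un_disjoint, simp, simp, rule dj(1), subst card_Un_disjoint, simp, simp, rule dj(2), rule refl)
  finally show "card ?A + card ?B + card ?E = CARD('k)" by simp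
  have "(\<Sum>t\<in>UNIV. c $ t * c $ t) = (\<Sum>t\<in>?A \<union> (?B \<union> ?E). c $ t * c $ t)" using U by simp
  also have "\<dots> = (\<Sum>t\<in>?A. c $ t * c $ t) + ((\<Sum>t\<in>?B. c $ t * c $ t) + (\<Sum>t\<in>?E. c $ t * c $ t))"
    by (subst sum.union_disjoint, simp, simp, rule dj(1), subst sum.union_disjoint, simp, simp, rule dj(2), rule refl)
  also have "\<dots> = of_nat (card ?B) - of_nat (card ?E)" by simp
  finally show "(\<Sum>t\<in>UNIV. c $ t * c $ t) = of_nat (card ?B) - of_nat (card ?E)" .
qed

text \<open>The number of entries of square 1 minus the number of entries of square -1 is divisible
  by 5, and there are at most five coordinates.\<close>

lemma word_types_5:
  assumes "c \<in> C" "c \<noteq> 0"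
  shows "(card {t. c $ t * c $ t = 1}, card {t. c $ t * c $ t = -1}) \<in> {(1, 1), (2, 2), (5, 0), (0, 5)}"
proof -
  let ?b = "card {t. c $ t * c $ t = 1}" and ?e = "card {t. c $ t * c $ t = -1}" and ?a = "card {t. c $ t * c $ t = 0}"
  have "(of_int (int ?b - int ?e) :: 'p mod_ring) = 0" using counts_5(2)[of c] code_self_dot[OF C(2) assms(1)] by simp
  then have "int 5 dvd int ?b - int ?e" unfolding of_int_mod_ring_eq_0_iff p .
  then obtain q where q: "int ?b - int ?e = 5 * q" by (auto elim: dvdE)
  have le: "?b + ?e \<le> 5" using counts_5(1)[of c] k by linarith
  have "?b + ?e \<noteq> 0"
  proof
    assume "?b + ?e = 0"
    then have "\<forall>t. c $ t * c $ t \<noteq> 1 \<and> c $ t * c $ t \<noteq> -1" by simp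
    then have "c $ t = 0" for t using squares_5[of "c $ t"] by simp
    then show False using assms(2) by (simp add: vec_eq_iff)
  qed
  moreover have "q = 0 \<or> q = 1 \<or> q = -1" using q le by presburger
  ultimately have "?b = 1 \<and> ?e = 1 \<or> ?b = 2 \<and> ?e = 2 \<or> ?b = 5 \<and> ?e = 0 \<or> ?b = 0 \<and> ?e = 5" using q le by presburger
  then show ?thesis by auto
qed

lemma fibres_5:
  fixes c d :: "'p mod_ring ^ 'k"
  assumes "card {t. c $ t * c $ t = 1} = card {t. d $ t * d $ t = 1}" "card {t. c $ t * c $ t = -1} = card {t. d $ t * d $ t = -1}"
  shows "card {t. c $ t * c $ t = x} = card {t. d $ t * d $ t = x}"
proof -
  consider "x = 0" | "x = 1" | "x = -1" | "x \<noteq> 0 \<and> x \<noteq> 1 \<and> x \<noteq> -1" by blast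
  then show ?thesis
  proof cases
    case 1
    then show ?thesis using counts_5(1)[of c] counts_5(1)[of d] assms by simp
  next
    case 4
    then have "c $ t * c $ t \<noteq> x" for c :: "'p mod_ring ^ 'k" and t using squares_5[of "c $ t"] by metis
    then show ?thesis by simp
  qed (use assms in simp_all)
qed

lemma root_type_5:
  fixes w :: "'p mod_ring ^ 'k"
  shows "card {t. w $ t * w $ t = 1} = 1 \<and> card {t. w $ t * w $ t = -1} = 1 \<Longrightarrow> root_word w"
    "root_word w \<Longrightarrow> \<exists>a b. a \<noteq> b \<and> supp w = {a, b} \<and> w $ a * w $ a = 1 \<and> w $ b * w $ b = -1"
proof -
  have "(4 :: 'p mod_ring) + 1 = 0" using five_eq_0[OF p] by simp
  then have four: "(4 :: 'p mod_ring) = -1" by (simp only: eq_neg_iff_add_eq_0)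
  have odd: "odd CARD('p)" by (simp add: p)
  show "root_word w \<Longrightarrow> \<exists>a b. a \<noteq> b \<and> supp w = {a, b} \<and> w $ a * w $ a = 1 \<and> w $ b * w $ b = -1"
  proof -
    assume "root_word w"
    then obtain a b where "a \<noteq> b" "supp w = {a, b}" "w $ a = 1 \<or> w $ a = -1" "w $ b = 2 \<or> w $ b = -2"
      using root_word_shape[OF odd, of w] p by auto
    then show ?thesis using four by (intro exI[of _ a] exI[of _ b]) auto
  qed
  assume "card {t. w $ t * w $ t = 1} = 1 \<and> card {t. w $ t * w $ t = -1} = 1"
  then obtain a b where a: "{t. w $ t * w $ t = 1} = {a}" and b: "{t. w $ t * w $ t = -1} = {b}"
    by (auto simp: card_1_singleton_iff)
  have wa: "w $ a * w $ a = 1" and wb: "w $ b * w $ b = -1" using a b by auto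
  have ab: "a \<noteq> b" using wa wb one_neq_minus_one_5 by auto
  have sw: "supp w = {a, b}"
  proof
    show "supp w \<subseteq> {a, b}"
    proof
      fix t assume "t \<in> supp w"
      then have "w $ t * w $ t \<noteq> 0" by (simp add: supp_def)
      then have "t \<in> {t. w $ t * w $ t = 1} \<or> t \<in> {t. w $ t * w $ t = -1}" using squares_5[of "w $ t"] by simp
      then show "t \<in> {a, b}" unfolding a b by simp
    qed
    show "{a, b} \<subseteq> supp w" using wa wb by (auto simp: supp_def)
  qed
  have "w $ a = 1 \<or> w $ a = -1" using wa by (metis square_eq_1_iff)
  then have ga: "gap (w $ a) = 4" using gap_1[where 'p='p] p by auto
  have "w $ b = 2 \<or> w $ b = -2"
    using mod_ring_cases_5[OF p, of "w $ b"] wb one_neq_minus_one_5 by (elim disjE) simp_all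
  moreover have "gap (2 :: 'p mod_ring) = 6" using gap_numeral[of 2, where 'p='p] p by simp
  ultimately have gb: "gap (w $ b) = 6" using gap_uminus[of "2 :: 'p mod_ring"] by auto
  show "root_word w" unfolding root_word_def sum_gap_supp sw using ab ga gb p by simp
qed

lemma card_supp_5: "card (supp c) = card {t. c $ t * c $ t = 1} + card {t. c $ t * c $ t = -1}" for c :: "'p mod_ring ^ 'k"
proof -
  have "supp c = {t. c $ t * c $ t = 1} \<union> {t. c $ t * c $ t = -1}"
  proof (rule Set.set_eqI)
    fix t show "t \<in> supp c \<longleftrightarrow> t \<in> {t. c $ t * c $ t = 1} \<union> {t. c $ t * c $ t = -1}"
      using squares_5[of "c $ t"] by (auto simp: supp_def)
  qed
  moreover have "{t. c $ t * c $ t = 1} \<inter> {t. c $ t * c $ t = -1} = {}" using one_neq_minus_one_5 by auto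
  ultimately show ?thesis by (simp add: card_Un_disjoint)
qed

lemma small_supp_5:
  assumes "c \<in> C"
  shows "card (supp c) \<le> 1 \<Longrightarrow> c = 0" "card (supp c) \<le> 3 \<Longrightarrow> c \<noteq> 0 \<Longrightarrow> root_word c"
proof -
  show "c = 0" if "card (supp c) \<le> 1"
  proof (rule ccontr)
    assume "c \<noteq> 0"
    then show False using word_types_5[OF assms] that unfolding card_supp_5 by auto
  qed
  show "root_word c" if "card (supp c) \<le> 3" "c \<noteq> 0"
    by (rule root_type_5(1)) (use word_types_5[OF assms that(2)] that(1) card_supp_5[of c] in auto)
qed

lemma root_counts_5:
  fixes w :: "'p mod_ring ^ 'k"
  assumes "root_word w"
  shows "card {t. w $ t * w $ t = 1} = 1" "card {t. w $ t * w $ t = -1} = 1"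
proof -
  obtain a b where ab: "a \<noteq> b" "supp w = {a, b}" "w $ a * w $ a = 1" "w $ b * w $ b = -1"
    using root_type_5(2)[OF assms] by (elim exE conjE)
  have z: "w $ t = 0" if "t \<noteq> a" "t \<noteq> b" for t using that ab(2) by (auto simp: supp_def)
  have "{t. w $ t * w $ t = 1} = {a}"
  proof (rule Set.set_eqI)
    fix t show "t \<in> {t. w $ t * w $ t = 1} \<longleftrightarrow> t \<in> {a}"
      using ab(3,4) z[of t] one_neq_minus_one_5 by (cases "t = a"; cases "t = b") auto
  qed
  moreover have "{t. w $ t * w $ t = -1} = {b}"
  proof (rule Set.set_eqI)
    fix t show "t \<in> {t. w $ t * w $ t = -1} \<longleftrightarrow> t \<in> {b}"
      using ab(1,3,4) z[of t] one_neq_minus_one_5 by (cases "t = a"; cases "t = b") auto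
  qed
  ultimately show "card {t. w $ t * w $ t = 1} = 1" "card {t. w $ t * w $ t = -1} = 1" by simp_all
qed

lemma reduce_root_5:
  assumes w: "w \<in> C" "a \<noteq> b" "supp w = {a, b}" "w $ a * w $ a = 1" "w $ b * w $ b = -1" and c: "c \<in> C"
  shows "(c - (c $ a * w $ a) *s w) $ a = 0" "(c - (c $ a * w $ a) *s w) $ b = 0"
proof -
  show "(c - (c $ a * w $ a) *s w) $ a = 0" by (simp add: mult.assoc w(4))
  have "(\<Sum>t\<in>{a, b}. c $ t * w $ t) = 0"
    using self_orthogonalD[OF C(2) c w(1)] sum_dot_supp[of w "{a, b}" c] w(3) by simp
  then have "w $ a * c $ a + w $ b * c $ b = 0" using w(2) by (simp add: mult.commute)
  then have "w $ b * (w $ a * c $ a + w $ b * c $ b) = 0" by simp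
  then have "w $ b * w $ a * c $ a + (w $ b * w $ b) * c $ b = 0" by (simp only: distrib_left mult.assoc)
  then show "(c - (c $ a * w $ a) *s w) $ b = 0" unfolding w(5) by (simp add: mult_ac)
qed

text \<open>Subtracting a multiple of a root word clears one of its coordinates, and orthogonality
  clears the other. At most three coordinates remain, on which a nonzero word is again a root word;
  after two root words at most one coordinate remains and nothing survives.\<close>

lemma code_with_root_5:
  assumes w: "w \<in> C" "root_word w"
  shows "C = vec.span {w} \<or> (\<exists>w'\<in>C. root_word w' \<and> supp w \<inter> supp w' = {} \<and> C = vec.span {w, w'})"
proof (cases "\<forall>c\<in>C. supp w \<inter> supp c = {} \<longrightarrow> c = 0")
  case True
  obtain a b where ab: "a \<noteq> b" "supp w = {a, b}" "w $ a * w $ a = 1" "w $ b * w $ b = -1"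
    using root_type_5(2)[OF w(2)] by (elim exE conjE)
  have "C = vec.span {w}"
  proof (rule code_eq_span[OF C(1)])
    fix c assume c: "c \<in> C"
    let ?x = "c - (c $ a * w $ a) *s w"
    have "?x \<in> C" by (intro code_closed[OF C(1)] c w)
    moreover have "a \<notin> supp ?x" "b \<notin> supp ?x" using reduce_root_5[OF w(1) ab c] by (simp_all only: supp_def mem_Collect_eq not_not)
    then have "supp w \<inter> supp ?x = {}" unfolding ab(2) by blast
    ultimately have "?x = 0" using True by blast
    then have "c = (c $ a * w $ a) *s w" by simp
    then show "c \<in> vec.span {w}" by (rule span1)
  qed (use w in simp)
  then show ?thesis ..
next
  case False
  then obtain w' where w': "w' \<in> C" "supp w \<inter> supp w' = {}" "w' \<noteq> 0" by blast
  obtain a b where ab: "a \<noteq> b" "supp w = {a, b}" "w $ a * w $ a = 1" "w $ b * w $ b = -1"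
    using root_type_5(2)[OF w(2)] by (elim exE conjE)
  have rest: "card (- {a, b}) \<le> 3" using k ab(1) by (simp add: card_compl)
  have "supp w' \<subseteq> - {a, b}" using w'(2) ab(2) by blast
  then have "card (supp w') \<le> 3" using card_mono[of "- {a, b}" "supp w'"] rest by simp
  then have rw': "root_word w'" by (rule small_supp_5(2)[OF w'(1) _ w'(3)])
  obtain a' b' where ab': "a' \<noteq> b'" "supp w' = {a', b'}" "w' $ a' * w' $ a' = 1" "w' $ b' * w' $ b' = -1"
    using root_type_5(2)[OF rw'] by (elim exE conjE)
  have dist: "{a, b} \<inter> {a', b'} = {}" using w'(2) ab(2) ab'(2) by simp
  then have c4: "card {a, b, a', b'} = 4" using ab(1) ab'(1) by auto
  have "C = vec.span {w, w'}"
  proof (rule code_eq_span[OF C(1)])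
    fix c assume c: "c \<in> C"
    let ?x = "c - (c $ a * w $ a) *s w"
    have x: "?x \<in> C" by (intro code_closed[OF C(1)] c w)
    let ?y = "?x - (?x $ a' * w' $ a') *s w'"
    have y: "?y \<in> C" by (intro code_closed[OF C(1)] x w')
    have "a \<notin> supp w'" "b \<notin> supp w'" using dist ab'(2) by auto
    then have "w' $ a = 0" "w' $ b = 0" by (simp_all add: supp_def)
    then have "?y $ a = 0" "?y $ b = 0" using reduce_root_5[OF w(1) ab c] by simp_all
    moreover have "?y $ a' = 0" "?y $ b' = 0" by (rule reduce_root_5[OF w'(1) ab' x])+
    ultimately have "a \<notin> supp ?y" "b \<notin> supp ?y" "a' \<notin> supp ?y" "b' \<notin> supp ?y" by (simp_all only: supp_def mem_Collect_eq not_not)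
    then have "supp ?y \<subseteq> - {a, b, a', b'}" by blast
    then have "card (supp ?y) \<le> card (- {a, b, a', b'})" by (intro card_mono) simp_all
    also have "\<dots> \<le> 1" using k c4 by (simp only: card_compl)
    finally have "?y = 0" by (rule small_supp_5(1)[OF y])
    then have "c = (c $ a * w $ a) *s w + (?x $ a' * w' $ a') *s w'" by (simp add: algebra_simps)
    then show "c \<in> vec.span {w, w'}" by (rule span2)
  qed (use w w' in simp)
  then show ?thesis using w'(1,2) rw' by blast
qed

lemma rootless_5:
  assumes rl: "\<And>c. c \<in> C \<Longrightarrow> \<not> root_word c" and nz: "C \<noteq> {0}"
  shows "4 \<le> CARD('k)"
    and "CARD('k) = 4 \<Longrightarrow> w \<in> C \<Longrightarrow> w \<noteq> 0 \<Longrightarrow> C = vec.span {w} \<and> card {t. w $ t * w $ t = 1} = 2 \<and> card {t. w $ t * w $ t = -1} = 2"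
proof -
  have big: "4 \<le> card (supp c)" if "c \<in> C" "c \<noteq> 0" for c
    using small_supp_5(2)[OF that(1) _ that(2)] rl[OF that(1)] by fastforce
  obtain c where c: "c \<in> C" "c \<noteq> 0" using nonzero_word[OF C(1) nz] by blast
  show "4 \<le> CARD('k)" using big[OF c] card_mono[of UNIV "supp c"] by simp
  assume k4: "CARD('k) = 4" and w: "w \<in> C" "w \<noteq> 0"
  have full: "supp x = UNIV" if "x \<in> C" "x \<noteq> 0" for x
    by (rule card_seteq) (use big[OF that] k4 in simp_all)
  obtain i :: 'k where "i \<in> supp w" using full[OF w] by blast
  then have "C = vec.span {w}"
    by (intro line_span[OF C(1) w(1), of i]) (use full in \<open>auto simp: supp_def\<close>)
  moreover have "card {t. w $ t * w $ t = 1} = 2 \<and> card {t. w $ t * w $ t = -1} = 2"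
    using word_types_5[OF w] card_supp_5[of w] full[OF w] k4 by auto
  ultimately show "C = vec.span {w} \<and> card {t. w $ t * w $ t = 1} = 2 \<and> card {t. w $ t * w $ t = -1} = 2" ..
qed

text \<open>Without root words a word with two zeros vanishes. With 25 words this makes the code
  maximum distance separable, with parameters [5,2,4]. After scaling by a word \<open>w\<close> of
  full support it consists of the polynomials of degree at most 1 on the field, the labels of
  \<open>c\<close> naming the points.\<close>

lemma rootless_5_5:
  assumes rl: "\<And>c. c \<in> C \<Longrightarrow> \<not> root_word c" and k5: "CARD('k) = 5" and big: "25 \<le> card C"
  obtains w c where "\<forall>t. w $ t * w $ t = 1" "C = vec.span {w, c}" "bij (\<lambda>t. w $ t * c $ t)"
proof -
  have cF: "CARD('p mod_ring) = 5" by (simp add: p)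
  have two: "x = 0" if x: "x \<in> C" "x $ s = 0" "x $ t = 0" "s \<noteq> t" for x s t
  proof (rule ccontr)
    assume "x \<noteq> 0"
    have "supp x \<subseteq> - {s, t}" using x by (auto simp: supp_def)
    then have "card (supp x) \<le> card (- {s, t})" by (intro card_mono) simp_all
    also have "\<dots> = 3" using x(4) k5 by (simp add: card_compl)
    finally show False using small_supp_5(2)[OF x(1) _ \<open>x \<noteq> 0\<close>] rl[OF x(1)] by simp
  qed
  have ex: "\<exists>t :: 'k. t \<noteq> s" for s
  proof (rule ccontr)
    assume "\<nexists>t. t \<noteq> s"
    then have "(UNIV :: 'k set) = {s}" by auto
    then have "CARD('k) = card {s}" by (rule arg_cong)
    then show False using k5 by simp
  qed
  have le5: "card {c \<in> C. c $ s = 0} \<le> 5" for s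
  proof -
    obtain t where t: "t \<noteq> s" using ex by blast
    have "inj_on (\<lambda>c. c $ t) {c \<in> C. c $ s = 0}"
    proof (rule inj_onI)
      fix x y assume x: "x \<in> {c \<in> C. c $ s = 0}" and y: "y \<in> {c \<in> C. c $ s = 0}" and e: "x $ t = y $ t"
      have "x - y = 0" by (rule two[of _ s t]) (use x y e t in \<open>auto intro: code_closed[OF C(1)]\<close>)
      then show "x = y" by simp
    qed
    then have "card {c \<in> C. c $ s = 0} \<le> card (UNIV :: 'p mod_ring set)" by (rule card_inj_on_le) simp_all
    then show ?thesis by (simp only: cF)
  qed
  have "\<exists>w\<in>C. supp w = UNIV"
  proof (rule ccontr)
    assume "\<not> (\<exists>w\<in>C. supp w = UNIV)"
    then have "C \<subseteq> insert 0 (\<Union>s\<in>UNIV. {c \<in> C. c $ s = 0} - {0})" by (auto simp: supp_def)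
    then have "card C \<le> card (insert 0 (\<Union>s\<in>UNIV. {c \<in> C. c $ s = 0} - {0}))" by (intro card_mono) simp_all
    also have "\<dots> \<le> Suc (card (\<Union>s\<in>UNIV. {c \<in> C. c $ s = 0} - {0}))" by (rule card_insert_le_m1) simp_all
    also have "card (\<Union>s\<in>UNIV. {c \<in> C. c $ s = 0} - {0}) \<le> (\<Sum>s\<in>UNIV. card ({c \<in> C. c $ s = 0} - {0}))"
      by (rule card_UN_le) simp
    \<comment> \<open>At most four nonzero words vanish at a given coordinate, so at most 1 + 5 * 4
      = 21 words lack full support, fewer than 25.\<close>
    also have "\<dots> \<le> (\<Sum>s\<in>(UNIV :: 'k set). 4)"
    proof (rule sum_mono)
      fix s :: 'k
      have "0 \<in> {c \<in> C. c $ s = 0}" using code_closed(1)[OF C(1)] by simp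
      then show "card ({c \<in> C. c $ s = 0} - {0}) \<le> 4" using le5[of s] by (simp add: card_Diff_singleton)
    qed
    finally show False using big k5 by simp
  qed
  then obtain w0 where w0: "w0 \<in> C" "supp w0 = UNIV" by blast
  have sq0: "(\<forall>t. w0 $ t * w0 $ t = 1) \<or> (\<forall>t. w0 $ t * w0 $ t = -1)"
  proof -
    have "w0 \<noteq> 0" using w0(2) by (auto simp: supp_def)
    then have "card {t. w0 $ t * w0 $ t = 1} = 5 \<or> card {t. w0 $ t * w0 $ t = -1} = 5"
      using word_types_5[OF w0(1)] card_supp_5[of w0] w0(2) k5 by auto
    then have "{t. w0 $ t * w0 $ t = 1} = UNIV \<or> {t. w0 $ t * w0 $ t = -1} = UNIV"
      using k5 by (elim disjE) (rule disjI1, rule card_seteq, simp, simp, simp, rule disjI2, rule card_seteq, simp, simp, simp)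
    then show ?thesis by blast
  qed
  have "\<exists>w\<in>C. \<forall>t. w $ t * w $ t = 1"
  proof (cases "\<forall>t. w0 $ t * w0 $ t = 1")
    case False
    then have m: "\<forall>t. w0 $ t * w0 $ t = -1" using sq0 by blast
    have four: "- (4 :: 'p mod_ring) = 1" using five_eq_0[OF p] by (simp add: neg_eq_iff_add_eq_0)
    have "(2 *s w0) $ t * (2 *s w0) $ t = 4 * (w0 $ t * w0 $ t)" for t by (simp add: mult_ac)
    then have "(2 *s w0) $ t * (2 *s w0) $ t = 1" for t using m four by simp
    moreover have "2 *s w0 \<in> C" by (intro code_closed[OF C(1)] w0)
    ultimately show ?thesis by blast
  qed (use w0 in blast)
  then obtain w where w: "w \<in> C" "\<forall>t. w $ t * w $ t = 1" by blast
  obtain i :: 'k where True by blast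
  have "\<exists>c\<in>C. c \<noteq> 0 \<and> c $ i = 0"
  proof (rule ccontr)
    assume n: "\<not> (\<exists>c\<in>C. c \<noteq> 0 \<and> c $ i = 0)"
    have "inj_on (\<lambda>c. c $ i) C"
    proof (rule inj_onI)
      fix x y assume "x \<in> C" "y \<in> C" "x $ i = y $ i"
      then have "x - y \<in> C" "(x - y) $ i = 0" by (simp_all add: code_closed[OF C(1)])
      then have "x - y = 0" using n by blast
      then show "x = y" by simp
    qed
    then have "card C \<le> card (UNIV :: 'p mod_ring set)" by (rule card_inj_on_le) simp_all
    then show False using big by (simp only: cF)
  qed
  then obtain c where c: "c \<in> C" "c \<noteq> 0" "c $ i = 0" by blast
  have lab: "x $ t = w $ t * (w $ t * x $ t)" for x t using spec[OF w(2), of t] by (simp only: mult.assoc[symmetric]) simp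
  have inj: "inj (\<lambda>t. w $ t * c $ t)"
  proof (rule injI, rule ccontr)
    fix s t assume e: "w $ s * c $ s = w $ t * c $ t" and st: "s \<noteq> t"
    let ?v = "w $ s * c $ s"
    have "c - ?v *s w = 0"
    proof (rule two[OF _ _ _ st])
      show "c - ?v *s w \<in> C" by (intro code_closed[OF C(1)] c w)
      show "(c - ?v *s w) $ s = 0" using lab[of c s] by (simp add: mult_ac)
      show "(c - ?v *s w) $ t = 0" unfolding e using lab[of c t] by (simp add: mult_ac)
    qed
    then have cv: "c = ?v *s w" by simp
    then have "c $ i = ?v * w $ i" by (metis vector_smult_component)
    moreover have "w $ i \<noteq> 0" using spec[OF w(2), of i] by auto
    ultimately have v0: "?v = 0" using c(3) by simp
    note cv
    also have "?v *s w = 0" by (simp only: v0 vector_smult_lzero)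
    finally show False using c(2) by simp
  qed
  have "card (range (\<lambda>t. w $ t * c $ t)) = CARD('p mod_ring)" unfolding cF card_image[OF inj] k5 ..
  then have "range (\<lambda>t. w $ t * c $ t) = UNIV" by (intro card_seteq) simp_all
  then have bij: "bij (\<lambda>t. w $ t * c $ t)" using inj by (simp add: bij_def)
  have "C = vec.span {w, c}"
  proof (rule code_eq_span[OF C(1)])
    fix x assume x: "x \<in> C"
    obtain t where t: "t \<noteq> i" using ex by blast
    have ct: "c $ t \<noteq> 0" using two[OF c(1) c(3)] t c(2) by metis
    let ?\<alpha> = "w $ i * x $ i"
    let ?\<beta> = "(x $ t - ?\<alpha> * w $ t) / c $ t"
    have "x - ?\<alpha> *s w - ?\<beta> *s c = 0"
    proof (rule two[of _ i t])
      show "x - ?\<alpha> *s w - ?\<beta> *s c \<in> C" by (intro code_closed[OF C(1)] c w x)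
      show "(x - ?\<alpha> *s w - ?\<beta> *s c) $ i = 0" using lab[of x i] c(3) by (simp add: mult_ac)
      show "(x - ?\<alpha> *s w - ?\<beta> *s c) $ t = 0" using ct by simp
    qed (use t in simp)
    then have "x = ?\<alpha> *s w + ?\<beta> *s c" by (simp add: algebra_simps)
    then show "x \<in> vec.span {w, c}" by (rule span2)
  qed (use w c in simp)
  then show ?thesis using that w(2) bij by blast
qed

end

text \<open>Root words are detected by norm 2 vectors, which isometries preserve.\<close>

lemma root_word_transfer:
  fixes C D :: "('p::{prime_card,linorder} mod_ring ^ 'k) set"
  assumes odd: "odd CARD('p)" and iso: "lattice_isomorphic (L_B C) (L_B D)" and c: "\<exists>c\<in>C. root_word c"
  shows "\<exists>d\<in>D. root_word d"
proof -
  obtain f where f: "bij_betw f (L_B C) (L_B D)" "\<forall>x\<in>L_B C. \<forall>y\<in>L_B C. f x \<bullet> f y = x \<bullet> y"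
    using iso unfolding lattice_isomorphic_def by blast
  obtain x where x: "x \<in> L_B C" "x \<bullet> x = 2" using c unfolding L_B_has_root_iff[OF odd, symmetric] by blast
  have "f x \<in> L_B D" using bij_betwE[OF f(1)] x(1) by blast
  moreover have "f x \<bullet> f x = 2" using f(2) x by simp
  ultimately show ?thesis unfolding L_B_has_root_iff[OF odd, symmetric] by blast
qed

text \<open>The labels w_t x_t are unchanged when the sign of coordinate t is switched in both
  words. A bijection of coordinates that preserves labels therefore becomes a signed permutation
  with signs w_t z_(\<sigma> t).\<close>

lemma labelled_iso:
  fixes w z :: "'a::field ^ 'k"
  assumes w: "\<And>t. w $ t * w $ t = 1" and z: "\<And>t. z $ t * z $ t = 1" and \<sigma>: "bij \<sigma>"
    and P: "\<And>x y. (x, y) \<in> P \<Longrightarrow> \<forall>t. w $ t * x $ t = z $ \<sigma> t * y $ \<sigma> t"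
  shows "code_isomorphic (vec.span (fst ` P)) (vec.span (snd ` P))"
proof -
  define s :: "'k \<Rightarrow> 'a" where "s t = w $ t * z $ \<sigma> t" for t
  have "s t * s t = (w $ t * w $ t) * (z $ \<sigma> t * z $ \<sigma> t)" for t by (simp only: s_def mult_ac)
  then have "s t * s t = 1" for t by (simp only: w z mult_1_left)
  then have s: "s t = 1 \<or> s t = -1" for t by (simp only: square_eq_1_iff)
  have "(\<chi> t. s t * y $ \<sigma> t) = x" if "(x, y) \<in> P" for x y
  proof -
    have "s t * y $ \<sigma> t = w $ t * (w $ t * x $ t)" for t unfolding s_def spec[OF P[OF that], of t] by (simp only: mult.assoc)
    then have "s t * y $ \<sigma> t = x $ t" for t by (simp only: square_one_cancel(1)[OF w])
    then show ?thesis by (simp add: vec_eq_iff)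
  qed
  then have "(\<lambda>y. \<chi> t. s t * y $ \<sigma> t) ` snd ` P = fst ` P" by force
  then show ?thesis by (rule iso_span[OF \<sigma> s])
qed

lemma iso_5:
  fixes C D :: "('p::{prime_card,linorder} mod_ring ^ 'k) set"
  assumes p: "CARD('p) = 5" and C: "is_code C" "self_orthogonal C" "C \<noteq> {0}" and D: "is_code D" "self_orthogonal D" "D \<noteq> {0}"
    and iso: "lattice_isomorphic (L_B C) (L_B D)" and k: "CARD('k) \<le> 5"
    and big: "CARD('k) = 5 \<Longrightarrow> 25 \<le> card C" "CARD('k) = 5 \<Longrightarrow> 25 \<le> card D"
  shows "code_isomorphic C D"
proof -
  interpret C: short_code_5 C by unfold_locales (use p C k in auto)
  interpret D: short_code_5 D by unfold_locales (use p D k in auto)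
  have odd: "odd CARD('p)" by (simp add: p)
  have iso': "lattice_isomorphic (L_B D) (L_B C)" by (rule lattice_isomorphic_sym[OF L_B_add[OF C(1)] iso])
  show ?thesis
  proof (cases "\<exists>c\<in>C. root_word c")
    case True
    then obtain w where w: "w \<in> C" "root_word w" by blast
    obtain z where z: "z \<in> D" "root_word z" using root_word_transfer[OF odd iso True] by blast
    have fib: "card {t. w $ t * w $ t = x} = card {t. z $ t * z $ t = x}" for x
      by (rule C.fibres_5) (simp_all only: C.root_counts_5[OF w(2)] C.root_counts_5[OF z(2)])
    show ?thesis
    proof (cases "C = vec.span {w} \<or> D = vec.span {z}")
      case True
      then show ?thesis
      proof
        assume "C = vec.span {w}"
        then show ?thesis by (rule line_or_proper[OF odd C(1) D(1) iso _ z(1) fib])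
      next
        assume "D = vec.span {z}"
        then have "code_isomorphic D C" by (rule line_or_proper[OF odd D(1) C(1) iso' _ w(1) fib[symmetric]])
        then show ?thesis by (rule code_isomorphic_sym)
      qed
    next
      case False
      then obtain w' z' where w': "w' \<in> C" "root_word w'" "supp w \<inter> supp w' = {}" "C = vec.span {w, w'}"
        and z': "z' \<in> D" "root_word z'" "supp z \<inter> supp z' = {}" "D = vec.span {z, z'}"
        using C.code_with_root_5[OF w] D.code_with_root_5[OF z] by auto
      obtain a b where ab: "a \<noteq> b" "supp w = {a, b}" "w $ a * w $ a = 1" "w $ b * w $ b = -1"
        using C.root_type_5(2)[OF w(2)] by (elim exE conjE)
      obtain a' b' where ab': "a' \<noteq> b'" "supp w' = {a', b'}" "w' $ a' * w' $ a' = 1" "w' $ b' * w' $ b' = -1"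
        using C.root_type_5(2)[OF w'(2)] by (elim exE conjE)
      obtain c d where cd: "c \<noteq> d" "supp z = {c, d}" "z $ c * z $ c = 1" "z $ d * z $ d = -1"
        using D.root_type_5(2)[OF z(2)] by (elim exE conjE)
      obtain c' d' where cd': "c' \<noteq> d'" "supp z' = {c', d'}" "z' $ c' * z' $ c' = 1" "z' $ d' * z' $ d' = -1"
        using D.root_type_5(2)[OF z'(2)] by (elim exE conjE)
      have "distinct [a, b, a', b']" "distinct [c, d, c', d']" using w'(3) z'(3) ab(1,2) ab'(1,2) cd(1,2) cd'(1,2) by auto
      then obtain \<sigma> where \<sigma>: "bij \<sigma>" "\<forall>n<length [a, b, a', b']. \<sigma> ([a, b, a', b'] ! n) = [c, d, c', d'] ! n"
        "\<forall>i. i \<notin> set [a, b, a', b'] \<longrightarrow> \<sigma> i \<notin> set [c, d, c', d']"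
        by (rule list_permutation[of "[a, b, a', b']" "[c, d, c', d']"]) (simp, rule that)
      have m: "\<sigma> a = c" "\<sigma> b = d" "\<sigma> a' = c'" "\<sigma> b' = d'"
        using \<sigma>(2)[rule_format, of 0] \<sigma>(2)[rule_format, of 1] \<sigma>(2)[rule_format, of 2] \<sigma>(2)[rule_format, of 3] by simp_all
      have dj: "w' $ a = 0" "w' $ b = 0" "w $ a' = 0" "w $ b' = 0" "z' $ c = 0" "z' $ d = 0" "z $ c' = 0" "z $ d' = 0"
        using w'(3) z'(3) ab(2) ab'(2) cd(2) cd'(2) by (auto simp: supp_def)
      have out: "w $ t = 0 \<and> w' $ t = 0 \<and> z $ \<sigma> t = 0 \<and> z' $ \<sigma> t = 0" if t: "t \<notin> {a, b, a', b'}" for t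
      proof -
        have "\<sigma> t \<notin> {c, d, c', d'}" using spec[OF \<sigma>(3), of t] t by simp
        then have "t \<notin> supp w" "t \<notin> supp w'" "\<sigma> t \<notin> supp z" "\<sigma> t \<notin> supp z'" using t ab(2) ab'(2) cd(2) cd'(2) by auto
        then show ?thesis by (simp add: supp_def)
      qed
      have "z $ \<sigma> t * z $ \<sigma> t = w $ t * w $ t \<and> z' $ \<sigma> t * z' $ \<sigma> t = w' $ t * w' $ t" for t
      proof (cases "t \<in> {a, b, a', b'}")
        case True
        then consider "t = a" | "t = b" | "t = a'" | "t = b'" by blast
        then show ?thesis by cases (simp_all add: m dj ab(3,4) ab'(3,4) cd(3,4) cd'(3,4))
      qed (simp add: out)
      then show ?thesis unfolding w'(4) z'(4) by (intro plane_iso[OF w'(3) z'(3) \<sigma>(1)]) blast+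
    qed
  next
    case False
    then have rlC: "\<And>c. c \<in> C \<Longrightarrow> \<not> root_word c" by blast
    have rlD: "\<And>c. c \<in> D \<Longrightarrow> \<not> root_word c" using root_word_transfer[OF odd iso'] False by blast
    have "CARD('k) = 4 \<or> CARD('k) = 5" using C.rootless_5(1)[OF _ C(3)] rlC k by fastforce
    then show ?thesis
    proof
      assume k4: "CARD('k) = 4"
      obtain w where w: "w \<in> C" "w \<noteq> 0" using nonzero_word[OF C(1,3)] by blast
      obtain z where z: "z \<in> D" "z \<noteq> 0" using nonzero_word[OF D(1,3)] by blast
      have W: "C = vec.span {w} \<and> card {t. w $ t * w $ t = 1} = 2 \<and> card {t. w $ t * w $ t = -1} = 2"
        by (rule C.rootless_5(2)[OF _ C(3) k4 w]) (rule rlC)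
      have Z: "D = vec.span {z} \<and> card {t. z $ t * z $ t = 1} = 2 \<and> card {t. z $ t * z $ t = -1} = 2"
        by (rule D.rootless_5(2)[OF _ D(3) k4 z]) (rule rlD)
      have Cw: "C = vec.span {w}" using W by (elim conjE)
      have fib: "card {t. w $ t * w $ t = x} = card {t. z $ t * z $ t = x}" for x
        by (rule C.fibres_5) (simp_all only: W[THEN conjunct2, THEN conjunct1] W[THEN conjunct2, THEN conjunct2]
          Z[THEN conjunct2, THEN conjunct1] Z[THEN conjunct2, THEN conjunct2])
      show ?thesis by (rule line_or_proper[OF odd C(1) D(1) iso Cw z(1) fib])
    next
      assume k5: "CARD('k) = 5"
      obtain w c where w: "\<forall>t. w $ t * w $ t = 1" "C = vec.span {w, c}" "bij (\<lambda>t. w $ t * c $ t)"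
        by (rule C.rootless_5_5[OF _ k5 big(1)[OF k5]], rule rlC, assumption, rule that)
      obtain z d where z: "\<forall>t. z $ t * z $ t = 1" "D = vec.span {z, d}" "bij (\<lambda>t. z $ t * d $ t)"
        by (rule D.rootless_5_5[OF _ k5 big(2)[OF k5]], rule rlD, assumption, rule that)
      let ?l = "\<lambda>t. w $ t * c $ t" and ?m = "\<lambda>t. z $ t * d $ t"
      define \<sigma> where "\<sigma> = inv_into UNIV ?m \<circ> ?l"
      have b: "bij \<sigma>" unfolding \<sigma>_def by (intro bij_comp w(3) bij_imp_bij_inv z(3))
      have lab: "w $ t * c $ t = z $ \<sigma> t * d $ \<sigma> t" for t
        using surj_f_inv_f[OF bij_is_surj[OF z(3)], of "?l t"] by (simp add: \<sigma>_def)
      have "code_isomorphic (vec.span (fst ` {(w, z), (c, d)})) (vec.span (snd ` {(w, z), (c, d)}))"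
      proof (rule labelled_iso[OF _ _ b])
        fix x y assume "(x, y) \<in> {(w, z), (c, d)}"
        then have "x = w \<and> y = z \<or> x = c \<and> y = d" by auto
        then show "\<forall>t. w $ t * x $ t = z $ \<sigma> t * y $ \<sigma> t" using w(1) z(1) lab by (elim disjE conjE) simp_all
      qed (use w(1) z(1) in simp_all)
      then show ?thesis unfolding w(2) z(2) by simp
    qed
  qed
qed

subsection \<open>Ternary codes of length three and six\<close>

lemma sum_diff_eq_0:
  fixes x y :: "'p::prime_card mod_ring"
  assumes "odd CARD('p)" "x - y = 0" "x + y = 0"
  shows "x = 0 \<and> y = 0"
proof -
  have xy: "x = y" using assms(2) by (simp only: right_minus_eq)
  then have "2 * y = 0" using assms(3) by (simp only: mult_2)
  then have "y = 0" using two_neq_0[OF assms(1)] by simp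
  then show ?thesis using xy by (simp only:)
qed

locale code_3 =
  fixes C :: "('p::{prime_card,linorder} mod_ring ^ 'k) set"
  assumes p: "CARD('p) = 3" and C: "is_code C" "self_orthogonal C"
begin

lemma squares_3: "(c :: 'p mod_ring) * c = (if c = 0 then 0 else 1)"
  using mod_ring_cases_3[OF p, of c] by (elim disjE) simp_all

lemma minus_two_3: "- (2 :: 'p mod_ring) = 1"
proof -
  have "(3 :: 'p mod_ring) = 2 + 1" by simp
  then have "(2 :: 'p mod_ring) + 1 = 0" using three_eq_0[OF p] by simp
  then show ?thesis by (simp only: neg_eq_iff_add_eq_0)
qed

lemma weight_dvd: "c \<in> C \<Longrightarrow> 3 dvd card (supp c)"
proof -
  assume c: "c \<in> C"
  have "(\<Sum>t\<in>UNIV. c $ t * c $ t) = (\<Sum>t\<in>supp c. 1)"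
    unfolding squares_3 supp_def by (simp add: sum.If_cases Collect_neg_eq)
  then have "(of_int (int (card (supp c))) :: 'p mod_ring) = 0" using code_self_dot[OF C(2) c] by simp
  then have "int 3 dvd int (card (supp c))" unfolding of_int_mod_ring_eq_0_iff p .
  then show ?thesis by (simp only: int_dvd_int_iff)
qed

lemma weight_less: "c \<in> C \<Longrightarrow> card (supp c) < 3 \<Longrightarrow> c = 0"
proof -
  assume c: "c \<in> C" "card (supp c) < 3"
  then have "card (supp c) = 0" using weight_dvd[OF c(1)] by (auto elim: dvdE)
  then show "c = 0" by (simp add: supp_def vec_eq_iff)
qed

lemma weight_less_6: "c \<in> C \<Longrightarrow> card (supp c) < 6 \<Longrightarrow> c \<noteq> 0 \<Longrightarrow> card (supp c) = 3"
proof -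
  assume c: "c \<in> C" "card (supp c) < 6" "c \<noteq> 0"
  obtain n where n: "card (supp c) = 3 * n" using weight_dvd[OF c(1)] by (auto elim: dvdE)
  have "\<not> card (supp c) < 3" using weight_less[OF c(1)] c(3) by blast
  then show "card (supp c) = 3" using n c(2) by presburger
qed

lemma fibres_3:
  fixes c d :: "'p mod_ring ^ 'k"
  assumes "card (supp c) = card (supp d)"
  shows "card {t. c $ t * c $ t = x} = card {t. d $ t * d $ t = x}"
proof -
  have f: "{t. e $ t * e $ t = x} = (if x = 0 then - supp e else if x = 1 then supp e else {})" for e :: "'p mod_ring ^ 'k"
    unfolding squares_3 by (auto simp: supp_def)
  show ?thesis unfolding f using assms by (simp add: card_compl)
qed

lemma supp_compl_le: "(\<And>t. t \<in> A \<Longrightarrow> c $ t = 0) \<Longrightarrow> card (supp c) \<le> CARD('k) - card A" for c :: "'p mod_ring ^ 'k"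
  unfolding card_compl[symmetric] by (rule card_mono) (auto simp: supp_def)

lemma line_3:
  assumes w: "w \<in> C" "i \<in> supp w" and z: "\<And>x. x \<in> C \<Longrightarrow> x $ i = 0 \<Longrightarrow> x = 0"
  shows "C = vec.span {w}"
  by (rule line_span[OF C(1) w(1) _ z]) (use w(2) in \<open>simp_all add: supp_def\<close>)

text \<open>For length 6, the orthogonal sum of two lines of weight 3.\<close>

definition triple_pair :: "'p mod_ring ^ 'k \<Rightarrow> 'p mod_ring ^ 'k \<Rightarrow> bool" where
  "triple_pair u v \<longleftrightarrow> u \<in> C \<and> v \<in> C \<and> card (supp u) = 3 \<and> supp v = - supp u \<and> C = vec.span {u, v}"

text \<open>The tetracode on four coordinates, padded with zeros. The two products fix the relative
  signs of the basis words.\<close>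

definition tetrad_pair :: "'p mod_ring ^ 'k \<Rightarrow> 'p mod_ring ^ 'k \<Rightarrow> bool" where
  "tetrad_pair u v \<longleftrightarrow> u \<in> C \<and> v \<in> C \<and> C = vec.span {u, v} \<and> (\<exists>i a b j. distinct [i, a, b, j] \<and> supp u = {i, a, b} \<and> supp v = {a, b, j}
    \<and> u $ a * v $ a = 1 \<and> u $ b * v $ b = -1)"

text \<open>If some root word is disjoint from \<open>w\<close>, the two fill all coordinates.
  Otherwise either no nonzero word vanishes at a chosen coordinate of \<open>w\<close>, and the code
  is a line, or such a word has weight 3, meets \<open>w\<close> and generates a tetracode with
  it.\<close>

lemma length_6_root:
  assumes k: "CARD('k) = 6" and w: "w \<in> C" "card (supp w) = 3"
  shows "C = vec.span {w} \<or> (\<exists>v. triple_pair w v) \<or> (\<exists>v. tetrad_pair w v)"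
proof (cases "\<exists>v\<in>C. card (supp v) = 3 \<and> supp w \<inter> supp v = {}")
  case True
  then obtain v where v: "v \<in> C" "card (supp v) = 3" "supp w \<inter> supp v = {}" by blast
  have sv: "supp v = - supp w"
    by (rule card_subset_eq) (use v(2,3) w(2) k in \<open>auto simp: card_compl\<close>)
  obtain i where i: "i \<in> supp w" using w(2) by fastforce
  obtain j where j: "j \<in> supp v" using v(2) by fastforce
  have ij: "i \<noteq> j" "w $ j = 0" "v $ i = 0" using i j v(3) by (auto simp: supp_def)
  have nz: "w $ i \<noteq> 0" "v $ j \<noteq> 0" using i j by (simp_all add: supp_def)
  have "C = vec.span {w, v}"
  proof (rule code_eq_span[OF C(1)])
    fix x assume x: "x \<in> C"
    let ?y = "x - (x $ i / w $ i) *s w - (x $ j / v $ j) *s v"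
    have y: "?y \<in> C" by (intro code_closed[OF C(1)] x w v)
    have yi: "?y $ i = 0" "?y $ j = 0" using nz ij by simp_all
    have "?y = 0"
    proof (rule ccontr)
      assume "?y \<noteq> 0"
      have "card (supp ?y) \<le> CARD('k) - card {i, j}" by (rule supp_compl_le) (use yi in auto)
      then have "card (supp ?y) < 6" using k ij(1) by simp
      then have y3: "card (supp ?y) = 3" by (rule weight_less_6[OF y _ \<open>?y \<noteq> 0\<close>])
      have ne: "i \<notin> supp ?y" "j \<notin> supp ?y" using yi by (simp_all only: supp_def mem_Collect_eq not_not)
      \<comment> \<open>A parity argument: a triple different from both meets each of the two
        complementary triples in 0 or 2 coordinates, so its size would be even.\<close>
      have "card (supp w \<inter> supp ?y) = 0 \<or> card (supp w \<inter> supp ?y) = 2"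
      proof (cases "supp w \<inter> supp ?y = {}")
        case False
        then obtain l where l: "l \<in> supp w" "l \<in> supp ?y" by blast
        obtain m n where mn: "supp w = {i, l, m}" "supp ?y = {l, m, n}" "distinct [i, l, m, n]"
          by (rule overlap_3[OF p w(2) y3 self_orthogonalD[OF C(2) w(1) y] l i ne(1)], rule that)
        have "supp w \<inter> supp ?y = {l, m}" unfolding mn(1,2) using mn(3) by auto
        then show ?thesis using mn(3) by simp
      qed simp
      moreover have "card (supp v \<inter> supp ?y) = 0 \<or> card (supp v \<inter> supp ?y) = 2"
      proof (cases "supp v \<inter> supp ?y = {}")
        case False
        then obtain l where l: "l \<in> supp v" "l \<in> supp ?y" by blast
        obtain m n where mn: "supp v = {j, l, m}" "supp ?y = {l, m, n}" "distinct [j, l, m, n]"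
          by (rule overlap_3[OF p v(2) y3 self_orthogonalD[OF C(2) v(1) y] l j ne(2)], rule that)
        have "supp v \<inter> supp ?y = {l, m}" unfolding mn(1,2) using mn(3) by auto
        then show ?thesis using mn(3) by simp
      qed simp
      moreover have "card (supp ?y) = card (supp w \<inter> supp ?y) + card (supp v \<inter> supp ?y)"
      proof -
        have "supp ?y = (supp w \<inter> supp ?y) \<union> (supp v \<inter> supp ?y)" unfolding sv by blast
        then have "card (supp ?y) = card ((supp w \<inter> supp ?y) \<union> (supp v \<inter> supp ?y))" by (rule arg_cong)
        also have "\<dots> = card (supp w \<inter> supp ?y) + card (supp v \<inter> supp ?y)" by (rule card_Un_disjoint) (use v(3) in auto)
        finally show ?thesis .
      qed
      ultimately show False using y3 by linarith
    qed
    then have "x = (x $ i / w $ i) *s w + (x $ j / v $ j) *s v" by (simp add: algebra_simps)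
    then show "x \<in> vec.span {w, v}" by (rule span2)
  qed (use w v in simp)
  then show ?thesis using w v sv unfolding triple_pair_def by blast
next
  case False
  obtain i where i: "i \<in> supp w" using w(2) by fastforce
  show ?thesis
  proof (cases "\<forall>x\<in>C. x $ i = 0 \<longrightarrow> x = 0")
    case True
    then have "C = vec.span {w}" by (intro line_3[OF w(1) i]) blast
    then show ?thesis ..
  next
    case False
    then obtain x where x: "x \<in> C" "x $ i = 0" "x \<noteq> 0" by blast
    have "card (supp x) \<le> CARD('k) - card {i}" by (rule supp_compl_le) (use x in auto)
    then have x3: "card (supp x) = 3" using k by (intro weight_less_6[OF x(1) _ x(3)]) simp
    have ix: "i \<notin> supp x" using x(2) by (simp add: supp_def)
    obtain a where a: "a \<in> supp w" "a \<in> supp x" using \<open>\<not> (\<exists>v\<in>C. card (supp v) = 3 \<and> supp w \<inter> supp v = {})\<close> x(1) x3 by blast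
    obtain b j where bj: "supp w = {i, a, b}" "supp x = {a, b, j}" "distinct [i, a, b, j]" "w $ a * x $ a + w $ b * x $ b = 0"
      by (rule overlap_3[OF p w(2) x3 self_orthogonalD[OF C(2) w(1) x(1)] a i ix], rule that)
    let ?e = "w $ a * x $ a"
    have nz: "w $ i \<noteq> 0" "w $ a \<noteq> 0" "w $ b \<noteq> 0" "x $ a \<noteq> 0" "x $ b \<noteq> 0" "x $ j \<noteq> 0" and z: "w $ j = 0"
      using bj(1,2,3) by (auto simp: supp_def)
    have e: "?e * ?e = 1" using nz by (simp add: squares_3)
    have eb: "w $ b * x $ b = - ?e" using bj(4) by (simp add: eq_neg_iff_add_eq_0 add.commute)
    \<comment> \<open>The sign makes the products at \<open>a\<close> and \<open>b\<close> equal to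
      1 and -1, as in the definition of \<open>tetrad_pair\<close>.\<close>
    define v where "v = ?e *s x"
    have v: "v \<in> C" unfolding v_def by (intro code_closed[OF C(1)] x)
    have e0: "?e \<noteq> 0" using nz by simp
    have sv: "supp v = {a, b, j}" unfolding bj(2)[symmetric] using e0 by (simp add: v_def supp_def)
    have "w $ a * v $ a = ?e * ?e" by (simp add: v_def mult_ac)
    then have va: "w $ a * v $ a = 1" by (simp only: e)
    have "w $ b * v $ b = ?e * (w $ b * x $ b)" by (simp add: v_def mult_ac)
    then have "w $ b * v $ b = - (?e * ?e)" by (simp only: eb mult_minus_right)
    then have vb: "w $ b * v $ b = -1" by (simp only: e)
    have vj: "v $ j \<noteq> 0" "v $ i = 0" "v $ a \<noteq> 0" "v $ b \<noteq> 0" using sv bj(3) by (auto simp: supp_def)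
    have "C = vec.span {w, v}"
    proof (rule code_eq_span[OF C(1)])
      fix c assume c: "c \<in> C"
      let ?y = "c - (c $ i / w $ i) *s w - (c $ j / v $ j) *s v"
      have y: "?y \<in> C" by (intro code_closed[OF C(1)] c w v)
      have yi: "?y $ i = 0" "?y $ j = 0" using nz(1) z vj by simp_all
      have "(\<Sum>t\<in>{i, a, b}. ?y $ t * w $ t) = 0" using self_orthogonalD[OF C(2) y w(1)] sum_dot_supp[of w "{i, a, b}" ?y] bj(1) by simp
      then have d1: "?y $ a * w $ a + ?y $ b * w $ b = 0" using yi(1) bj(3) by simp
      have "(\<Sum>t\<in>{a, b, j}. ?y $ t * v $ t) = 0" using self_orthogonalD[OF C(2) y v] sum_dot_supp[of v "{a, b, j}" ?y] sv by simp
      then have d2: "?y $ a * v $ a + ?y $ b * v $ b = 0" using yi(2) bj(3) by simp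
      have wva: "v $ a = w $ a" "v $ b = - w $ b"
      proof -
        have "w $ a * v $ a = w $ a * w $ a" using va nz by (simp add: squares_3)
        then show "v $ a = w $ a" using nz by simp
        have "w $ b * v $ b = w $ b * (- w $ b)" using vb nz by (simp add: squares_3)
        then show "v $ b = - w $ b" using nz by (simp only: mult_cancel_left) simp
      qed
      have "?y $ a * w $ a - ?y $ b * w $ b = 0" using d2 unfolding wva by simp
      then have "?y $ a * w $ a = 0 \<and> ?y $ b * w $ b = 0" using d1 by (intro sum_diff_eq_0) (simp_all only: p, simp)
      then have ya: "?y $ a = 0" and yb: "?y $ b = 0" using nz(2,3) by (simp_all only: mult_eq_0_iff simp_thms)
      have "card (supp ?y) \<le> CARD('k) - card {i, a, b, j}"
        by (rule supp_compl_le) (use yi ya yb in \<open>elim insertE emptyE; simp only:\<close>)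
      then have "card (supp ?y) < 3" using k bj(3) by simp
      then have "?y = 0" by (rule weight_less[OF y])
      then have "c = (c $ i / w $ i) *s w + (c $ j / v $ j) *s v" by (simp add: algebra_simps)
      then show "c \<in> vec.span {w, v}" by (rule span2)
    qed (use w v in simp)
    then have "tetrad_pair w v" unfolding tetrad_pair_def using w(1) v sv bj(1,3) va vb by blast
    then show ?thesis by blast
  qed
qed

end

lemma triple_pair_iso:
  assumes "code_3 C" "code_3 D" and t: "code_3.triple_pair C u v" "code_3.triple_pair D u' v'" and k: "CARD('k) = 6"
  shows "code_isomorphic C (D :: ('p::{prime_card,linorder} mod_ring ^ 'k) set)"
proof -
  interpret C: code_3 C by fact
  interpret D: code_3 D by fact
  note u = t(1)[unfolded C.triple_pair_def] and u' = t(2)[unfolded D.triple_pair_def]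
  have c3: "card (supp u) = 3" "card (supp u') = 3" "card (- supp u) = 3" "card (- supp u') = 3" using u u' k by (auto simp: card_compl)
  have sv: "supp v = - supp u" "supp v' = - supp u'" using u u' by auto
  obtain \<sigma> where \<sigma>: "bij \<sigma>" "\<forall>t. (\<sigma> t \<in> supp u') = (t \<in> supp u)"
  proof (rule fibre_bijection[of "\<lambda>t. t \<in> supp u" "\<lambda>t. t \<in> supp u'"])
    fix x show "card {t. (t \<in> supp u) = x} = card {t. (t \<in> supp u') = x}"
      using c3 by (cases x) (simp_all add: Collect_neg_eq)
  qed (rule that)
  have sq: "c $ t * c $ t = (if t \<in> supp c then 1 else 0)" for c :: "'p mod_ring ^ 'k" and t
    using C.squares_3[of "c $ t"] by (simp add: supp_def)
  have "code_isomorphic (vec.span {u, v}) (vec.span {u', v'})"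
    by (rule plane_iso[OF _ _ \<sigma>(1)]) (use \<sigma>(2) in \<open>simp_all add: sv sq\<close>)
  then show ?thesis using u u' by simp
qed

lemma tetrad_pair_iso:
  assumes "code_3 C" "code_3 D" and t: "code_3.tetrad_pair C u v" "code_3.tetrad_pair D u' v'"
  shows "code_isomorphic C (D :: ('p::{prime_card,linorder} mod_ring ^ 'k) set)"
proof -
  interpret C: code_3 C by fact
  interpret D: code_3 D by fact
  note u = t(1)[unfolded C.tetrad_pair_def] and u' = t(2)[unfolded D.tetrad_pair_def]
  have Cs: "C = vec.span {u, v}" using u by (elim conjE)
  have Ds: "D = vec.span {u', v'}" using u' by (elim conjE)
  obtain i a b j where i: "distinct [i, a, b, j]" "supp u = {i, a, b}" "supp v = {a, b, j}" "u $ a * v $ a = 1" "u $ b * v $ b = -1"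
    using u by (elim conjE exE)
  obtain i' a' b' j' where i': "distinct [i', a', b', j']" "supp u' = {i', a', b'}" "supp v' = {a', b', j'}"
    "u' $ a' * v' $ a' = 1" "u' $ b' * v' $ b' = -1"
    using u' by (elim conjE exE)
  obtain \<sigma> where \<sigma>: "bij \<sigma>" "\<forall>n<length [i, a, b, j]. \<sigma> ([i, a, b, j] ! n) = [i', a', b', j'] ! n"
    "\<forall>t. t \<notin> set [i, a, b, j] \<longrightarrow> \<sigma> t \<notin> set [i', a', b', j']"
    by (rule list_permutation[OF i(1) i'(1)]) (simp, rule that)
  have m: "\<sigma> i = i'" "\<sigma> a = a'" "\<sigma> b = b'" "\<sigma> j = j'"
    using \<sigma>(2)[rule_format, of 0] \<sigma>(2)[rule_format, of 1] \<sigma>(2)[rule_format, of 2] \<sigma>(2)[rule_format, of 3] by simp_all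
  \<comment> \<open>An auxiliary vector with nonzero entries everywhere, in general not a code word,
    which serves to normalise the labels: those of the first word become 1 on its support.\<close>
  define n where "n u v = (\<chi> t. if u $ t \<noteq> 0 then u $ t else if v $ t \<noteq> 0 then v $ t else 1)" for u v :: "'p mod_ring ^ 'k"
  have n: "n u v $ t * n u v $ t = 1" for u v t by (simp add: n_def C.squares_3)
  have nu: "n u v $ t * u $ t = (if u $ t \<noteq> 0 then 1 else 0)" for u v t by (simp add: n_def C.squares_3)
  have nv: "n u v $ t * v $ t = (if u $ t \<noteq> 0 then u $ t * v $ t else if v $ t \<noteq> 0 then 1 else 0)" for u v t by (simp add: n_def C.squares_3)
  have nz: "u $ i \<noteq> 0" "u $ a \<noteq> 0" "u $ b \<noteq> 0" "v $ j \<noteq> 0" "u $ j = 0" "v $ i = 0"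
    using i(1,2,3) by (auto simp: supp_def)
  have nz': "u' $ i' \<noteq> 0" "u' $ a' \<noteq> 0" "u' $ b' \<noteq> 0" "v' $ j' \<noteq> 0" "u' $ j' = 0" "v' $ i' = 0" using i'(1,2,3) by (auto simp: supp_def)
  have out: "u $ t = 0 \<and> v $ t = 0 \<and> u' $ \<sigma> t = 0 \<and> v' $ \<sigma> t = 0" if t: "t \<notin> {i, a, b, j}" for t
  proof -
    have "\<sigma> t \<notin> {i', a', b', j'}" using spec[OF \<sigma>(3), of t] t by simp
    then have "t \<notin> supp u" "t \<notin> supp v" "\<sigma> t \<notin> supp u'" "\<sigma> t \<notin> supp v'" using t i(2,3) i'(2,3) by auto
    then show ?thesis by (simp add: supp_def)
  qed
  have lab: "n u v $ t * u $ t = n u' v' $ \<sigma> t * u' $ \<sigma> t \<and> n u v $ t * v $ t = n u' v' $ \<sigma> t * v' $ \<sigma> t" for t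
  proof (cases "t \<in> {i, a, b, j}")
    case True
    then consider "t = i" | "t = a" | "t = b" | "t = j" by blast
    then show ?thesis unfolding nu nv by cases (simp_all add: m nz nz' i(4,5) i'(4,5))
  next
    case False
    then show ?thesis unfolding nu nv by (simp add: out)
  qed
  have "code_isomorphic (vec.span (fst ` {(u, u'), (v, v')})) (vec.span (snd ` {(u, u'), (v, v')}))"
  proof (rule labelled_iso[of "n u v" "n u' v'", OF n n \<sigma>(1)])
    fix x y assume "(x, y) \<in> {(u, u'), (v, v')}"
    then have "x = u \<and> y = u' \<or> x = v \<and> y = v'" by auto
    then show "\<forall>t. n u v $ t * x $ t = n u' v' $ \<sigma> t * y $ \<sigma> t" using lab by (elim disjE conjE) simp_all
  qed
  then show ?thesis unfolding Cs Ds by simp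
qed

section \<open>Counting vectors of norm 2\<close>

definition root_vectors :: "('p::{prime_card,linorder} mod_ring ^ 'k) set \<Rightarrow> ('p, 'k) blocks set" where
  "root_vectors C = {x \<in> L_B C. x \<bullet> x = 2}"

lemma finite_root_vectors: "finite (root_vectors C)"
  by (rule finite_subset[OF _ finite_A_dual_bounded[of 2]]) (auto simp: root_vectors_def L_B_eq)

lemma card_root_vectors:
  assumes "lattice_isomorphic (L_B C) (L_B D)"
  shows "card (root_vectors C) = card (root_vectors D)"
proof -
  obtain f where f: "bij_betw f (L_B C) (L_B D)" "\<forall>x\<in>L_B C. \<forall>y\<in>L_B C. f x \<bullet> f y = x \<bullet> y"
    using assms unfolding lattice_isomorphic_def by blast
  have "bij_betw f (root_vectors C) (root_vectors D)"
  proof (rule bij_betw_imageI)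
    show "inj_on f (root_vectors C)" by (rule inj_on_subset[OF bij_betw_imp_inj_on[OF f(1)]]) (auto simp: root_vectors_def)
    show "f ` root_vectors C = root_vectors D"
    proof
      show "f ` root_vectors C \<subseteq> root_vectors D"
        using bij_betwE[OF f(1)] f(2) unfolding root_vectors_def by auto
      show "root_vectors D \<subseteq> f ` root_vectors C"
      proof
        fix y assume y: "y \<in> root_vectors D"
        then have "y \<in> f ` L_B C" unfolding bij_betw_imp_surj_on[OF f(1)] root_vectors_def by simp
        then obtain x where x: "x \<in> L_B C" "y = f x" by (elim imageE)
        have "x \<bullet> x = 2" using y x f(2) unfolding root_vectors_def by simp
        then show "y \<in> f ` root_vectors C" using x unfolding root_vectors_def by simp
      qed
    qed
  qed
  then show ?thesis by (rule bij_betw_same_card)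
qed

lemma root_vector_word:
  assumes odd: "odd CARD('p)" and x: "x \<in> root_vectors (C :: ('p::{prime_card,linorder} mod_ring ^ 'k) set)"
  shows "word x \<in> C" "root_word (word x)" "word x \<noteq> 0" "word x \<in> C' \<Longrightarrow> x \<in> root_vectors C'"
proof -
  show w: "word x \<in> C" and sub: "word x \<in> C' \<Longrightarrow> x \<in> root_vectors C'" for C' using x by (auto simp: root_vectors_def L_B_eq)
  show nz: "word x \<noteq> 0"
  proof
    assume "word x = 0"
    then have "x \<in> root_vectors {0}" by (intro sub) simp
    then have "\<exists>x\<in>L_B {0 :: 'p mod_ring ^ 'k}. x \<bullet> x = 2" by (auto simp: root_vectors_def)
    then have "root_word (0 :: 'p mod_ring ^ 'k)" unfolding L_B_has_root_iff[OF odd] by simp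
    then show False by (simp add: root_word_def gap_def)
  qed
  show "root_word (word x)" by (rule norm2_word[OF _ _ nz]) (use x in \<open>auto simp: root_vectors_def L_B_eq\<close>)
qed

lemma span1_iff: "c \<in> vec.span {w} \<longleftrightarrow> (\<exists>a. c = a *s w)" for w :: "'a::field ^ 'k"
  by (auto simp: vec.span_singleton)

text \<open>All lines of weight 3 contribute the same positive number M of norm 2 vectors. In a sum
  of two disjoint triples the root words lie on two lines, giving at most 2M. The tetracode has at
  least the lines of u', v' and u' + v', giving 3M.\<close>

lemma triple_tetrad_contradiction:
  fixes C D :: "('p::{prime_card,linorder} mod_ring ^ 'k) set"
  assumes "code_3 C" "code_3 D" and t: "code_3.triple_pair C u v" "code_3.tetrad_pair D u' v'" and k: "CARD('k) = 6"
    and iso: "lattice_isomorphic (L_B C) (L_B D)"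
  shows False
proof -
  interpret C: code_3 C by fact
  interpret D: code_3 D by fact
  have odd: "odd CARD('p)" by (simp add: C.p)
  note u = t(1)[unfolded C.triple_pair_def] and u' = t(2)[unfolded D.tetrad_pair_def]
  obtain i a b j where i: "distinct [i, a, b, j]" "supp u' = {i, a, b}" "supp v' = {a, b, j}" "u' $ a * v' $ a = 1" "u' $ b * v' $ b = -1"
    using u' by (elim conjE exE)
  have w3: "card (supp u) = 3" "card (supp v) = 3" "card (supp u') = 3" "card (supp v') = 3" using u i(1,2,3) k by (auto simp: card_compl)
  have uv': "u' + v' \<in> D" "u' \<in> D" "v' \<in> D" using u' code_closed(2)[OF D.C(1)] by auto
  have s3: "card (supp (u' + v')) = 3"
    using tetrad_combination(1)[OF D.C D.p uv'(2) w3(3) uv'(3) w3(4), of 1] i(1,2,3) by auto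
  let ?M = "card (root_vectors (vec.span {u}))"
  have M: "card (root_vectors (vec.span {z})) = ?M" if "card (supp z) = 3" for z :: "'p mod_ring ^ 'k"
    by (rule card_root_vectors, rule code_isomorphic_imp_lattice_isomorphic, rule iso_span_single, rule C.fibres_3) (simp add: that w3)
  have pos: "?M > 0"
  proof -
    have "\<exists>c\<in>vec.span {u}. root_word c" by (rule bexI[of _ u]) (simp_all add: root_word_3[OF C.p] w3 vec.span_base)
    then have "root_vectors (vec.span {u}) \<noteq> {}" unfolding L_B_has_root_iff[OF odd, symmetric] by (auto simp: root_vectors_def)
    then show ?thesis using finite_root_vectors by (simp add: card_gt_0_iff)
  qed
  have "root_vectors C \<subseteq> root_vectors (vec.span {u}) \<union> root_vectors (vec.span {v})"
  proof
    fix x assume x: "x \<in> root_vectors C"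
    have w: "word x \<in> C" "card (supp (word x)) = 3" using root_vector_word[OF odd x] root_word_3[OF C.p] by auto
    have "word x \<in> vec.span {u, v}" using w(1) u by simp
    then obtain q where q: "word x - q *s u \<in> vec.span {v}" by (auto simp: vec.span_breakdown_eq[of _ u])
    then obtain r where r: "word x - q *s u = r *s v" by (auto simp: span1_iff)
    then have wx: "word x = q *s u + r *s v" by (simp add: algebra_simps)
    have "q = 0 \<or> r = 0"
    proof (rule ccontr)
      assume "\<not> (q = 0 \<or> r = 0)"
      then have "word x $ t \<noteq> 0" for t
      proof (cases "t \<in> supp u")
        case True
        then have "v $ t = 0" "u $ t \<noteq> 0" using u by (auto simp: supp_def)
        then show ?thesis using \<open>\<not> (q = 0 \<or> r = 0)\<close> by (simp add: wx)
      next
        case False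
        then have "t \<in> supp v" using u by simp
        then have "u $ t = 0" "v $ t \<noteq> 0" using False by (auto simp: supp_def)
        then show ?thesis using \<open>\<not> (q = 0 \<or> r = 0)\<close> by (simp add: wx)
      qed
      then have "supp (word x) = UNIV" by (auto simp: supp_def)
      then show False using w(2) k by simp
    qed
    then have "word x \<in> vec.span {u} \<or> word x \<in> vec.span {v}"
    proof
      assume "q = 0"
      then have "word x = r *s v" using wx by simp
      then show ?thesis by (intro disjI2) (rule span1)
    next
      assume "r = 0"
      then have "word x = q *s u" using wx by simp
      then show ?thesis by (intro disjI1) (rule span1)
    qed
    then show "x \<in> root_vectors (vec.span {u}) \<union> root_vectors (vec.span {v})" using root_vector_word(4)[OF odd x] by blast
  qed
  then have "card (root_vectors C) \<le> card (root_vectors (vec.span {u}) \<union> root_vectors (vec.span {v}))"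
    by (intro card_mono finite_UnI finite_root_vectors)
  also have "\<dots> \<le> ?M + card (root_vectors (vec.span {v}))" by (rule card_Un_le)
  finally have le: "card (root_vectors C) \<le> 2 * ?M" unfolding M[OF w3(2)] by simp
  have dj: "root_vectors (vec.span {y}) \<inter> root_vectors (vec.span {z}) = {}" if "\<And>q r. q *s y = r *s z \<Longrightarrow> q = 0" for y z :: "'p mod_ring ^ 'k"
  proof -
    have False if x: "x \<in> root_vectors (vec.span {y})" "x \<in> root_vectors (vec.span {z})" for x
    proof -
      obtain q where q: "word x = q *s y" using root_vector_word(1)[OF odd x(1)] unfolding span1_iff ..
      obtain r where r: "word x = r *s z" using root_vector_word(1)[OF odd x(2)] unfolding span1_iff ..
      have "q = 0" using q r \<open>\<And>q r. q *s y = r *s z \<Longrightarrow> q = 0\<close> by metis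
      then show False using q root_vector_word(3)[OF odd x(1)] by simp
    qed
    then show ?thesis by blast
  qed
  have nz: "u' $ i \<noteq> 0" "v' $ i = 0" "v' $ j \<noteq> 0" "u' $ j = 0" using i(1,2,3) by (auto simp: supp_def)
  have at: "q * y $ l = r * z $ l" if "q *s y = r *s z" for q r l and y z :: "'p mod_ring ^ 'k" using that by (metis vector_smult_component)
  have d1: "root_vectors (vec.span {u'}) \<inter> root_vectors (vec.span {v'}) = {}"
    by (rule dj) (drule at[where l=i], simp add: nz)
  have d2: "root_vectors (vec.span {u'}) \<inter> root_vectors (vec.span {u' + v'}) = {}"
  proof (rule dj)
    fix q r assume e: "q *s u' = r *s (u' + v')"
    have "r = 0" using at[OF e, of j] nz by simp
    then show "q = 0" using at[OF e, of i] nz by simp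
  qed
  have d3: "root_vectors (vec.span {v'}) \<inter> root_vectors (vec.span {u' + v'}) = {}"
  proof (rule dj)
    fix q r assume e: "q *s v' = r *s (u' + v')"
    have "r = 0" using at[OF e, of i] nz by simp
    then show "q = 0" using at[OF e, of j] nz by simp
  qed
  have sub: "root_vectors (vec.span {z}) \<subseteq> root_vectors D" if "z \<in> D" for z :: "'p mod_ring ^ 'k"
  proof
    fix x assume x: "x \<in> root_vectors (vec.span {z})"
    have "vec.span {z} \<subseteq> D" using that D.C(1) by (intro vec.span_minimal) (auto simp: is_code_def)
    then show "x \<in> root_vectors D" using root_vector_word(1)[OF odd x] by (intro root_vector_word(4)[OF odd x]) blast
  qed
  have "card ((root_vectors (vec.span {u'}) \<union> root_vectors (vec.span {v'})) \<union> root_vectors (vec.span {u' + v'})) = ?M + ?M + ?M"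
    by (subst card_Un_disjoint, (intro finite_UnI finite_root_vectors)+, use d2 d3 in blast,
      subst card_Un_disjoint[OF finite_root_vectors finite_root_vectors d1]) (simp only: M[OF w3(3)] M[OF w3(4)] M[OF s3])
  moreover have "\<dots> \<le> card (root_vectors D)" if "?M + ?M + ?M = card ((root_vectors (vec.span {u'}) \<union> root_vectors (vec.span {v'})) \<union> root_vectors (vec.span {u' + v'}))"
    unfolding that by (intro card_mono finite_root_vectors Un_least sub uv')
  ultimately have "3 * ?M \<le> card (root_vectors D)" by simp
  then show False using le pos card_root_vectors[OF iso] by simp
qed

lemma iso_3_small:
  fixes C D :: "('p::{prime_card,linorder} mod_ring ^ 'k) set"
  assumes p: "CARD('p) = 3" and C: "is_code C" "self_orthogonal C" "C \<noteq> {0}" and D: "is_code D" "self_orthogonal D" "D \<noteq> {0}"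
    and iso: "lattice_isomorphic (L_B C) (L_B D)" and k: "CARD('k) = 3 \<or> CARD('k) = 6"
  shows "code_isomorphic C D"
proof -
  interpret C: code_3 C by unfold_locales (use p C in auto)
  interpret D: code_3 D by unfold_locales (use p D in auto)
  have odd: "odd CARD('p)" by (simp add: p)
  have iso': "lattice_isomorphic (L_B D) (L_B C)" by (rule lattice_isomorphic_sym[OF L_B_add[OF C(1)] iso])
  show ?thesis
  proof (cases "CARD('k) = 6 \<and> (\<exists>c\<in>C. root_word c)")
    case True
    then obtain w where w: "w \<in> C" "card (supp w) = 3" using root_word_3[OF p] by blast
    obtain z where z: "z \<in> D" "card (supp z) = 3" using root_word_transfer[OF odd iso] True root_word_3[OF p] by blast
    have fib: "card {t. w $ t * w $ t = x} = card {t. z $ t * z $ t = x}" for x by (rule C.fibres_3) (simp only: w z)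
    have line: ?thesis if "C = vec.span {w}" by (rule line_or_proper[OF odd C(1) D(1) iso that z(1) fib])
    have line': ?thesis if "D = vec.span {z}"
      by (rule code_isomorphic_sym) (rule line_or_proper[OF odd D(1) C(1) iso' that w(1) fib[symmetric]])
    have k6: "CARD('k) = 6" using True ..
    have l: "code_3 C" "code_3 D" by unfold_locales
    consider "C = vec.span {w}" | "D = vec.span {z}"
      | v v' where "C.triple_pair w v" "D.triple_pair z v'" | v v' where "C.tetrad_pair w v" "D.tetrad_pair z v'"
      | v v' where "C.triple_pair w v" "D.tetrad_pair z v'" | v v' where "C.tetrad_pair w v" "D.triple_pair z v'"
      using C.length_6_root[OF k6 w] D.length_6_root[OF k6 z] by (elim disjE exE) simp_all
    then show ?thesis
    proof cases
      case (3 v v')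
      then show ?thesis by (rule triple_pair_iso[OF l _ _ k6])
    next
      case (4 v v')
      then show ?thesis by (rule tetrad_pair_iso[OF l])
    next
      case (5 v v')
      then have False by (rule triple_tetrad_contradiction[OF l _ _ k6 iso])
      then show ?thesis ..
    next
      case (6 v v')
      then have False by (intro triple_tetrad_contradiction[OF l(2,1) _ _ k6 iso'])
      then show ?thesis ..
    qed (rule line, assumption, rule line', assumption)
  next
    case False
    \<comment> \<open>For length 3, and for length 6 without root words, divisibility of weights by
      3 leaves only full support for nonzero words. The codes are then lines of equal
      weight.\<close>
    have full: "supp c = UNIV" if c: "c \<in> E" "c \<noteq> 0" and E: "code_3 E" "\<not> (CARD('k) = 6 \<and> (\<exists>c\<in>E. root_word c))"
      for c and E :: "('p mod_ring ^ 'k) set"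
    proof -
      interpret E: code_3 E by fact
      have ge: "3 \<le> card (supp c)" using E.weight_less[OF c(1)] c(2) by fastforce
      have "CARD('k) \<le> card (supp c)"
      proof (cases "CARD('k) = 6")
        case True
        then have "card (supp c) \<noteq> 3" using E(2) c(1) root_word_3[OF p, of c] by blast
        then have "\<not> card (supp c) < 6" using E.weight_less_6[OF c(1) _ c(2)] by blast
        then show ?thesis using True by simp
      qed (use k ge in simp)
      then show ?thesis by (intro card_seteq) simp_all
    qed
    have False': "\<not> (CARD('k) = 6 \<and> (\<exists>c\<in>D. root_word c))" using False root_word_transfer[OF odd iso'] by blast
    have l: "code_3 C" "code_3 D" by unfold_locales
    obtain w where w: "w \<in> C" "w \<noteq> 0" using nonzero_word[OF C(1,3)] by blast
    obtain z where z: "z \<in> D" "z \<noteq> 0" using nonzero_word[OF D(1,3)] by blast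
    obtain i :: 'k where "i \<in> UNIV" by blast
    have "C = vec.span {w}"
    proof (rule C.line_3[OF w(1), of i])
      show "i \<in> supp w" by (simp add: full[OF w l(1) False])
      show "x = 0" if "x \<in> C" "x $ i = 0" for x
      proof (rule ccontr)
        assume "x \<noteq> 0"
        then have "i \<in> supp x" by (simp add: full[OF that(1) _ l(1) False])
        then show False using that(2) by (simp add: supp_def)
      qed
    qed
    then show ?thesis
      by (rule line_or_proper[OF odd C(1) D(1) iso _ z(1)])
        (rule C.fibres_3, simp only: full[OF w l(1) False] full[OF z l(2) False'])
  qed
qed

subsection \<open>Ternary codes of length nine\<close>

lemma UNIV_mod_ring_3: "CARD('p::prime_card) = 3 \<Longrightarrow> (UNIV :: 'p mod_ring set) = {0, 1, -1}"
  using mod_ring_cases_3 by auto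

lemma one_neq_minus_one_3: "CARD('p::prime_card) = 3 \<Longrightarrow> (1 :: 'p mod_ring) \<noteq> -1"
proof
  assume p: "CARD('p) = 3" and "(1 :: 'p mod_ring) = -1"
  then have "(1 :: 'p mod_ring) + 1 = 0" by (simp only: eq_neg_iff_add_eq_0)
  then have "(2 :: 'p mod_ring) = 0" by simp
  moreover have "odd CARD('p)" by (simp add: p)
  ultimately show False using two_neq_0 by blast
qed

lemma arith_3:
  assumes "CARD('p::prime_card) = 3"
  shows "(1 :: 'p mod_ring) + 1 = -1" "(-1 :: 'p mod_ring) - 1 = 1"
proof -
  have "(1 + 1 + 1 :: 'p mod_ring) = 0" using three_eq_0[OF assms] by simp
  then show "(1 :: 'p mod_ring) + 1 = -1" by (simp only: eq_neg_iff_add_eq_0)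
  then show "(-1 :: 'p mod_ring) - 1 = 1" by (metis add_diff_cancel_right')
qed

text \<open>Modulo 3 the second block is the first shifted by d. The balanced residues multiply with
  themselves to 2 and with either cyclic shift to -1.\<close>

lemma block_product:
  fixes f g :: "'p::{prime_card,linorder} \<Rightarrow> int"
  assumes p: "CARD('p) = 3" and f: "inj f" "range f = {-1..1}" and g: "range g = {-1..1}"
    and d: "\<And>b. (of_int (g b) :: 'p mod_ring) = of_int (f b) + d"
  shows "(\<Sum>b\<in>UNIV. f b * g b) = (if d = 0 then 2 else -1)"
proof -
  define s :: "int \<Rightarrow> int" where "s v = (if d = 0 then v else if d = 1 then (if v = 1 then -1 else v + 1) else (if v = -1 then 1 else v - 1))" for v
  have rg: "f b \<in> {-1..1}" "g b \<in> {-1..1}" for b using f(2) g by blast+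
  have "g b = s (f b)" for b
  proof (rule mod_ring_eq_neg_h[of 1])
    have v: "f b = -1 \<or> f b = 0 \<or> f b = 1" using rg(1)[of b] by auto
    then show "s (f b) \<in> {- int 1..int 1}" by (elim disjE) (simp_all add: s_def)
    have "d = 0 \<or> d = 1 \<or> d = -1" by (rule mod_ring_cases_3[OF p])
    then show "(of_int (g b) :: 'p mod_ring) = of_int (s (f b))"
      using v arith_3[OF p] one_neq_minus_one_3[OF p] unfolding d s_def by (elim disjE) simp_all
  qed (use rg p in simp_all)
  then have "(\<Sum>b\<in>UNIV. f b * g b) = (\<Sum>b\<in>UNIV. f b * s (f b))" by simp
  also have "\<dots> = (\<Sum>v\<in>range f. v * s v)" by (subst sum.reindex[OF f(1)]) simp
  also have "\<dots> = (\<Sum>v\<in>{-1, 0, 1}. v * s v)" unfolding f(2) by (intro sum.cong) auto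
  also have "\<dots> = (if d = 0 then 2 else -1)" by (simp add: s_def)
  finally show ?thesis .
qed

lemma add_diff_eq_cases:
  fixes x e V :: "'a::ab_group_add"
  shows "e = V \<or> x + e = V \<or> x - e = V \<Longrightarrow> e = V \<or> e = V - x \<or> e = x - V"
  by auto

lemma even_small: "even n \<Longrightarrow> n \<le> 4 \<Longrightarrow> 3 dvd n \<Longrightarrow> n < (3 :: nat)"
  by presburger

lemma sum_if_mem: "(\<Sum>u\<in>UNIV. if u \<in> S then 4 else 1 :: nat) = 4 * card S + card (- S)" for S :: "'k::finite set"
  by (simp add: sum.If_cases)

lemma sum_fibres: "(\<Sum>v\<in>UNIV. card {t. f t = v}) = CARD('k)" for f :: "'k::finite \<Rightarrow> 'l::finite"
proof -
  have "(\<Sum>v\<in>UNIV. \<Sum>t\<in>{t\<in>UNIV. f t = v}. 1 :: nat) = (\<Sum>t\<in>(UNIV :: 'k set). 1)" by (rule sum.group) simp_all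
  then show ?thesis by simp
qed

section \<open>Images of cyclic roots for p = 3\<close>

context frame_pair
begin

text \<open>Each block runs through all residues modulo 3, with sum of squares 2, and the total norm
  2 * 3^2 is divisible by 3; so 3 divides 2k.\<close>

lemma length_dvd_3:
  assumes ni: "W (rootv j0 a0 (nxt a0)) \<bullet> rootv i0 b0 (nxt b0) \<notin> \<int>" and p: "CARD('p) = 3"
  shows "3 dvd CARD('k)"
proof -
  obtain m where m: "\<not> int CARD('p) dvd m" "\<forall>j a. \<exists>z t. residues m a j z t" using exists_residues[OF ni] by blast
  then obtain z t where r: "residues m a0 j0 z t" by blast
  have bl: "(\<Sum>b\<in>UNIV. of_int (z i b * z i b) :: 'p mod_ring) = 2" for i
  proof -
    let ?f = "\<lambda>b. of_int (z i b) :: 'p mod_ring"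
    have inj: "inj ?f" by (rule residues_inj(1)[OF r m(1)])
    have "card (range ?f) = CARD('p mod_ring)" using card_image[OF inj] by simp
    then have rg: "range ?f = UNIV" by (intro card_seteq) simp_all
    have "(\<Sum>b\<in>UNIV. of_int (z i b * z i b) :: 'p mod_ring) = (\<Sum>b\<in>UNIV. ?f b * ?f b)" by simp
    also have "\<dots> = (\<Sum>v\<in>range ?f. v * v)" by (subst sum.reindex[OF inj]) simp
    also have "\<dots> = (\<Sum>v\<in>{0, 1, -1 :: 'p mod_ring}. v * v)" unfolding rg UNIV_mod_ring_3[OF p] ..
    also have "\<dots> = 2" using one_neq_minus_one_3[OF p] by simp
    finally show ?thesis .
  qed
  have "(of_int (\<Sum>i\<in>UNIV. \<Sum>b\<in>UNIV. z i b * z i b) :: 'p mod_ring) = (\<Sum>i\<in>(UNIV :: 'k set). 2)"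
    unfolding of_int_sum bl ..
  then have "of_int (2 * (int CARD('p))\<^sup>2) = (of_int (int CARD('k) * 2) :: 'p mod_ring)" unfolding residues_norm[OF r] by simp
  then have "int CARD('p) dvd 2 * (int CARD('p))\<^sup>2 - int CARD('k) * 2" by (simp only: of_int_mod_ring_eq_iff)
  then have "(3 :: int) dvd 18 - int CARD('k) * 2" unfolding p by simp
  then have "(3 :: int) dvd int CARD('k)" by presburger
  then have "int 3 dvd int CARD('k)" by simp
  then show ?thesis by (simp only: int_dvd_int_iff)
qed

text \<open>Blocks where the offsets agree contribute 2 and the others -1, by
  \<open>block_product\<close>. The total 18 - 3 wt equals 9 times the product of the roots.\<close>

lemma inner_weight:
  assumes p: "CARD('p) = 3" and k: "CARD('k) = 9" and m: "\<not> int CARD('p) dvd m"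
    and r: "residues m a j z t" "residues m a' j' z' t'"
    and rg: "\<And>i. range (z i) = {- int 1..int 1}" "\<And>i. range (z' i) = {- int 1..int 1}"
  shows "3 * (rootv j a (nxt a) \<bullet> rootv j' a' (nxt a')) = 6 - real (card (supp (t - t')))"
proof -
  have "(\<Sum>b\<in>UNIV. z i b * z' i b) = (if t' $ i - t $ i = 0 then 2 else -1)" for i
  proof (rule block_product[OF p residues_inj(2)[OF r(1) m]])
    show "(of_int (z' i b) :: 'p mod_ring) = of_int (z i b) + (t' $ i - t $ i)" for b using r by (simp add: residues_def)
  qed (use rg in simp_all)
  then have "(\<Sum>i\<in>UNIV. \<Sum>b\<in>UNIV. z i b * z' i b) = (\<Sum>i\<in>UNIV. 2 - (if i \<in> supp (t - t') then 3 else 0))"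
    by (intro sum.cong refl) (auto simp: supp_def)
  also have "\<dots> = 18 - 3 * int (card (supp (t - t')))" by (simp add: sum_subtractf k sum.If_cases)
  finally have "real_of_int (\<Sum>i\<in>UNIV. \<Sum>b\<in>UNIV. z i b * z' i b) = real_of_int (18 - 3 * int (card (supp (t - t'))))" by (rule arg_cong)
  then show ?thesis using residues_inner[OF r] by (simp add: p)
qed

lemma root_nxt_inner:
  "rootv j a (nxt a) \<bullet> rootv j' a' (nxt a') = (if j = j' then 2 * (if a = a' then 1 else 0) - (if a' = nxt a then 1 else 0) - (if nxt a' = a then 1 else 0) else 0)"
  for j j' :: 'k and a a' :: 'p
proof -
  have "rootv j a (nxt a) \<bullet> rootv j' a' (nxt a') = rootv j a (nxt a) $ j' $ a' - rootv j a (nxt a) $ j' $ nxt a'"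
    unfolding inner_diff_right[of "rootv j a (nxt a)"] inner_ebar[OF root_V0] ..
  moreover have "nxt a' = nxt a \<longleftrightarrow> a = a'" using inj_eq[OF inj_nxt, of a' a] by auto
  ultimately show ?thesis unfolding root_nth by auto
qed

text \<open>Cyclic neighbours have product -1, so their offsets differ in all nine coordinates.
  Weight 3 corresponds to product 1, which never occurs: two cyclic roots have product 2, -1 or 0.
  If C had only 27 words, differences of offsets would exhaust it and exclude weight 3.\<close>

lemma length_9_geometry:
  assumes ni: "W (rootv j0 a0 (nxt a0)) \<bullet> rootv i0 b0 (nxt b0) \<notin> \<int>" and p: "CARD('p) = 3" and k: "CARD('k) = 9"
  shows "27 \<le> card C" "\<exists>w\<in>C. supp w = UNIV" "c \<in> C \<Longrightarrow> card (supp c) = 3 \<Longrightarrow> 27 < card C"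
proof -
  have h: "CARD('p) = 2 * 1 + 1" "CARD('k) * (1 * (1 + 1)) = 6 * (2 * 1 + 1)" using p k by simp_all
  obtain m T Z where mTZ: "\<not> int CARD('p) dvd m" "\<forall>j a. residues m a j (Z j a) (T j a)" "\<forall>j a i. range (Z j a i) = {- int 1..int 1}"
    "inj (\<lambda>q. T (fst q) (snd q))" "CARD('k) * CARD('p) \<le> card C"
    by (rule card_ge_if_equality[OF ni h], rule that)
  have R: "residues m a j (Z j a) (T j a)" for j a using mTZ(2) by blast
  have rg: "range (Z j a i) = {- int 1..int 1}" for j a i using mTZ(3) by blast
  have iw: "3 * (rootv j a (nxt a) \<bullet> rootv j' a' (nxt a')) = 6 - real (card (supp (T j a - T j' a')))" for j a j' a'
    by (rule inner_weight[OF p k mTZ(1) R R rg rg])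
  show "27 \<le> card C" using mTZ(5) p k by simp
  let ?w = "T j0 a0 - T j0 (nxt a0)"
  have "rootv j0 a0 (nxt a0) \<bullet> rootv j0 (nxt a0) (nxt (nxt a0)) \<le> -1"
    unfolding root_nxt_inner using nxt_neq[of a0] p by auto
  then have "9 \<le> real (card (supp ?w))" using iw[of j0 a0 j0 "nxt a0"] by linarith
  then have "supp ?w = UNIV" using k by (intro card_seteq) simp_all
  then show "\<exists>w\<in>C. supp w = UNIV" using residues_diff[OF R R] by blast
  assume c: "c \<in> C" "card (supp c) = 3"
  show "27 < card C"
  proof (rule ccontr)
    assume "\<not> 27 < card C"
    let ?f = "\<lambda>q :: 'k \<times> 'p. T (fst q) (snd q) - T j0 a0"
    have inj: "inj ?f" by (rule injI) (rule injD[OF mTZ(4)], simp)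
    have "range ?f = C"
    proof (rule card_seteq)
      show "range ?f \<subseteq> C" using residues_diff[OF R R] by blast
      have "card (range ?f) = card (UNIV :: ('k \<times> 'p) set)" by (rule card_image[OF inj])
      then show "card C \<le> card (range ?f)" using \<open>\<not> 27 < card C\<close> p k by (simp add: card_prod)
    qed simp
    then obtain q where q: "c = T (fst q) (snd q) - T j0 a0" using c(1) by blast
    have "3 * (rootv (fst q) (snd q) (nxt (snd q)) \<bullet> rootv j0 a0 (nxt a0)) = 3" unfolding iw q[symmetric] c(2) by simp
    then show False unfolding root_nxt_inner by (auto split: if_splits)
  qed
qed

end

text \<open>The word \<open>w\<close> of full support turns entries into labels w_t x_t: multiples
  of \<open>w\<close> become constant functions, and words become functions on the nine coordinates
  up to signs.\<close>

locale code_39 = code_3 C for C :: "('p::{prime_card,linorder} mod_ring ^ 'k) set" +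
  fixes w assumes k: "CARD('k) = 9" and w: "w \<in> C" "supp w = UNIV"
begin

lemma w_square: "w $ t * w $ t = 1"
  using w(2) by (auto simp: squares_3 supp_def)

lemmas w_cancel = square_one_cancel(1)[OF w_square]

lemma label_eq_iff: "w $ t * x $ t = v \<longleftrightarrow> (x - v *s w) $ t = 0"
proof -
  have "x $ t = v * w $ t" if "w $ t * x $ t = v" using w_cancel[of t "x $ t"] unfolding that by (simp only: mult.commute)
  moreover have "w $ t * x $ t = v" if "x $ t = v * w $ t"
    unfolding that using w_cancel[of t v] by (simp only: mult.commute[of v])
  ultimately show ?thesis by auto
qed

text \<open>Pigeonhole principle for the restriction to S; the difference of two words with equal
  restriction vanishes there.\<close>

lemma vanishing_word:
  assumes "3 ^ card S < card C"
  shows "\<exists>c\<in>C. c \<noteq> 0 \<and> (\<forall>t\<in>S. c $ t = 0)"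
proof -
  let ?f = "\<lambda>c. restrict (\<lambda>t. c $ t) S"
  have "?f ` C \<subseteq> S \<rightarrow>\<^sub>E (UNIV :: 'p mod_ring set)" by auto
  then have "card (?f ` C) \<le> card (S \<rightarrow>\<^sub>E (UNIV :: 'p mod_ring set))" by (intro card_mono finite_PiE) simp_all
  also have "\<dots> = 3 ^ card S" by (simp add: card_PiE p)
  finally have "\<not> inj_on ?f C" using assms card_image[of ?f C] by linarith
  then obtain x y where xy: "x \<in> C" "y \<in> C" "?f x = ?f y" "x \<noteq> y" unfolding inj_on_def by blast
  have "(x - y) $ t = 0" if "t \<in> S" for t using fun_cong[OF xy(3), of t] that by simp
  then show ?thesis using xy code_closed(3)[OF C(1)] by (intro bexI[of _ "x - y"] conjI) auto
qed

text \<open>Without root words x - v w has weight 6 or 9, so each label occurs 3 times or not at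
  all; three labels have to fill nine coordinates.\<close>

lemma equidistributed:
  assumes rl: "\<forall>c\<in>C. card (supp c) \<noteq> 3" and x: "x \<in> C" "\<forall>v. x \<noteq> v *s w"
  shows "card {t. w $ t * x $ t = v} = 3"
proof -
  have c: "card {t. w $ t * x $ t = v} = 0 \<or> card {t. w $ t * x $ t = v} = 3" for v
  proof -
    let ?y = "x - v *s w"
    have y: "?y \<in> C" by (intro code_closed[OF C(1)] x w)
    have "?y \<noteq> 0" using x(2) by simp
    then have "\<not> card (supp ?y) < 6" using weight_less_6[OF y] rl y by blast
    moreover have "{t. w $ t * x $ t = v} = - supp ?y" unfolding label_eq_iff supp_def by blast
    moreover obtain n where "card (supp ?y) = 3 * n" using weight_dvd[OF y] by (auto elim: dvdE)
    moreover have "card (supp ?y) \<le> 9" using card_mono[of UNIV "supp ?y"] k by simp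
    ultimately show ?thesis using k by (simp only: card_compl) presburger
  qed
  have "(\<Sum>v\<in>UNIV. card {t. w $ t * x $ t = v}) = 9" using sum_fibres[of "\<lambda>t. w $ t * x $ t"] k by simp
  then have "card {t. w $ t * x $ t = 0} + (card {t. w $ t * x $ t = 1} + card {t. w $ t * x $ t = -1}) = 9"
    unfolding UNIV_mod_ring_3[OF p] using one_neq_minus_one_3[OF p] by simp
  then have "card {t. w $ t * x $ t = 0} = 3" "card {t. w $ t * x $ t = 1} = 3" "card {t. w $ t * x $ t = -1} = 3"
    using c[of 0] c[of 1] c[of "-1"] by presburger+
  then show ?thesis using mod_ring_cases_3[OF p, of v] by (elim disjE) simp_all
qed

text \<open>Each nonzero pair over the field with three elements satisfies exactly one of the four linear
  equations used here, so counting zeros gives \<open>12 = 9 + 3 n\<close>, where \<open>n\<close> is the number of common zeros.\<close>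

lemma labels_collide:
  assumes rl: "\<forall>c\<in>C. card (supp c) \<noteq> 3" and x: "x \<in> C" "\<forall>v. x \<noteq> v *s w" and y: "y \<in> C"
    and st: "s \<noteq> t" "w $ s * x $ s = w $ t * x $ t" "w $ s * y $ s = w $ t * y $ t"
  shows "\<exists>v. y = v *s w \<or> x + y = v *s w \<or> x - y = v *s w"
proof (rule ccontr)
  assume n: "\<not> ?thesis"
  let ?a = "w $ s * x $ s" and ?b = "w $ s * y $ s"
  let ?A = "{t. w $ t * x $ t = ?a}" and ?B = "{t. w $ t * y $ t = ?b}"
    and ?E = "{t. w $ t * (x + y) $ t = ?a + ?b}" and ?F = "{t. w $ t * (x - y) $ t = ?a - ?b}"
  have c: "card ?A = 3" "card ?B = 3" "card ?E = 3" "card ?F = 3"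
    by (rule equidistributed[OF rl], (intro code_closed[OF C(1)] x(1) y)?, use x n in blast)+
  have le: "(if u \<in> {s, t} then 4 else 1) \<le> (of_bool (u \<in> ?A) + of_bool (u \<in> ?B) + of_bool (u \<in> ?E) + of_bool (u \<in> ?F) :: nat)" for u
  proof (cases "u \<in> {s, t}")
    case True
    then have "u \<in> ?A" "u \<in> ?B" using st(2,3) by auto
    then have "w $ u * x $ u = ?a" "w $ u * y $ u = ?b" by simp_all
    moreover from this have "u \<in> ?E" "u \<in> ?F" by (simp_all add: distrib_left right_diff_distrib)
    ultimately show ?thesis using True by simp
  next
    case False
    let ?p = "w $ u * x $ u - ?a" and ?q = "w $ u * y $ u - ?b"
    have "?p = 0 \<or> ?q = 0 \<or> ?p + ?q = 0 \<or> ?p - ?q = 0"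
      using mod_ring_cases_3[OF p, of ?p] mod_ring_cases_3[OF p, of ?q] by (elim disjE) simp_all
    then have "u \<in> ?A \<or> u \<in> ?B \<or> u \<in> ?E \<or> u \<in> ?F"
      by (elim disjE) (simp_all add: algebra_simps)
    then show ?thesis using False by (elim disjE) simp_all
  qed
  have "(\<Sum>u\<in>(UNIV :: 'k set). if u \<in> {s, t} then 4 else 1 :: nat)
    \<le> (\<Sum>u\<in>UNIV. of_bool (u \<in> ?A) + of_bool (u \<in> ?B) + of_bool (u \<in> ?E) + of_bool (u \<in> ?F))"
    by (rule sum_mono) (rule le)
  also have "\<dots> = card ?A + card ?B + card ?E + card ?F"
    unfolding sum.distrib sum_of_bool_eq[OF finite] by simp
  also have "\<dots> = 12" unfolding c by simp
  finally have "(\<Sum>u\<in>(UNIV :: 'k set). if u \<in> {s, t} then 4 else 1 :: nat) \<le> 12" .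
  moreover have "(\<Sum>u\<in>(UNIV :: 'k set). if u \<in> {s, t} then 4 else 1 :: nat) = 4 * card {s, t} + card (- {s, t})"
    by (rule sum_if_mem)
  ultimately show False using st(1) k by (simp add: card_compl)
qed

text \<open>The labels of \<open>x\<close> and \<open>y\<close> identify the coordinates with the
  affine plane over the field with three elements, and the code with its affine functions, a
  generalised first order Reed-Muller code. This determines it up to signed permutations.\<close>

lemma rootless_39:
  assumes rl: "\<forall>c\<in>C. card (supp c) \<noteq> 3" and big: "27 \<le> card C"
  obtains x y where "C = vec.span {w, x, y}" "bij (\<lambda>t. (w $ t * x $ t, w $ t * y $ t))"
proof -
  have w0: "w $ t \<noteq> 0" for t using w_square[of t] by auto
  obtain t0 :: 'k where "t0 \<in> UNIV" by blast
  have "\<exists>c\<in>C. c \<noteq> 0 \<and> (\<forall>t\<in>{t0}. c $ t = 0)" by (rule vanishing_word) (use big in simp)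
  then obtain x where x: "x \<in> C" "x \<noteq> 0" "x $ t0 = 0" by auto
  have xw: "\<forall>v. x \<noteq> v *s w"
  proof (intro allI notI)
    fix v assume e: "x = v *s w"
    then have "v = 0" using x(3) w0[of t0] by simp
    then show False using e x(2) by simp
  qed
  obtain t1 where t1: "x $ t1 \<noteq> 0" using x(2) by (auto simp: vec_eq_iff)
  have "card {t0, t1} = 2" using t1 x(3) by (cases "t0 = t1") auto
  then have "\<exists>c\<in>C. c \<noteq> 0 \<and> (\<forall>t\<in>{t0, t1}. c $ t = 0)" by (intro vanishing_word) (use big in simp)
  then obtain y where y: "y \<in> C" "y \<noteq> 0" "y $ t0 = 0" "y $ t1 = 0" by auto
  have zv: "v = 0" if "u = v *s w" "u $ t0 = 0" for u v using that w0[of t0] by simp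
  have noc: "\<not> (y = v *s w \<or> x + y = v *s w \<or> x - y = v *s w)" for v
  proof
    assume d: "y = v *s w \<or> x + y = v *s w \<or> x - y = v *s w"
    have z: "y $ t0 = 0" "(x + y) $ t0 = 0" "(x - y) $ t0 = 0" by (simp_all add: x(3) y(3))
    have "v = 0" using d by (elim disjE) (erule zv, rule z(1), erule zv, rule z(2), erule zv, rule z(3))
    then have "y = 0 \<or> x + y = 0 \<or> x - y = 0" using d by simp
    then have "(x + y) $ t1 = 0 \<or> (x - y) $ t1 = 0" using y(2) by (metis zero_index)
    then show False using t1 y(4) by simp
  qed
  have inj: "inj (\<lambda>t. (w $ t * x $ t, w $ t * y $ t))"
    using labels_collide[OF rl x(1) xw y(1)] noc by (intro injI) blast
  have "card (range (\<lambda>t. (w $ t * x $ t, w $ t * y $ t))) = card (UNIV :: ('p mod_ring \<times> 'p mod_ring) set)"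
    unfolding card_image[OF inj] k by (simp add: card_prod p)
  then have "range (\<lambda>t. (w $ t * x $ t, w $ t * y $ t)) = UNIV" by (intro card_seteq) simp_all
  then have bij: "bij (\<lambda>t. (w $ t * x $ t, w $ t * y $ t))" using inj by (simp add: bij_def)
  have "C = vec.span {w, x, y}"
  proof (rule code_eq_span[OF C(1)])
    fix c assume c: "c \<in> C"
    have "card {t. w $ t * x $ t = 0} = 3" by (rule equidistributed[OF rl x(1) xw])
    then obtain s t where "s \<in> {t. w $ t * x $ t = 0}" "t \<in> {t. w $ t * x $ t = 0}" and st: "s \<noteq> t" by (auto simp: card_3_iff)
    then have xst: "w $ s * x $ s = w $ t * x $ t" by (simp only: mem_Collect_eq)
    let ?d = "w $ s * y $ s - w $ t * y $ t"
    have d: "?d \<noteq> 0" using injD[OF inj, of s t] st xst by auto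
    \<comment> \<open>Two coordinates with equal \<open>x\<close> labels have different
      \<open>y\<close> labels. Subtracting this multiple of \<open>y\<close> makes the labels of
      \<open>c\<close> agree there, and \<open>labels_collide\<close> applies.\<close>
    let ?\<beta> = "(w $ s * c $ s - w $ t * c $ t) / ?d"
    let ?e = "c - ?\<beta> *s y"
    have e: "?e \<in> C" by (intro code_closed[OF C(1)] c y)
    have "?\<beta> * ?d = w $ s * c $ s - w $ t * c $ t" using d by simp
    moreover have "w $ s * ?e $ s - w $ t * ?e $ t = (w $ s * c $ s - w $ t * c $ t) - ?\<beta> * ?d"
      unfolding vector_minus_component vector_smult_component by (simp only: right_diff_distrib mult.left_commute) simp
    ultimately have "w $ s * ?e $ s = w $ t * ?e $ t" by (simp only: diff_self right_minus_eq)
    then obtain v where "?e = v *s w \<or> x + ?e = v *s w \<or> x - ?e = v *s w"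
      using labels_collide[OF rl x(1) xw e st xst] by blast
    then have "?e = v *s w \<or> ?e = v *s w - x \<or> ?e = x - v *s w" by (rule add_diff_eq_cases)
    moreover have b: "w \<in> vec.span {w, x, y}" "x \<in> vec.span {w, x, y}" "y \<in> vec.span {w, x, y}" by (simp_all add: vec.span_base)
    ultimately have "?e \<in> vec.span {w, x, y}" by (elim disjE) (erule ssubst, intro vec.span_scale vec.span_diff b)+
    then have "?e + ?\<beta> *s y \<in> vec.span {w, x, y}" by (rule vec.span_add[OF _ vec.span_scale[OF b(3)]])
    then show "c \<in> vec.span {w, x, y}" by (simp only: diff_add_cancel)
  qed (use w x y in simp)
  then show ?thesis using that bij by blast
qed

text \<open>The restriction of \<open>w\<close> to T; in labels it is the indicator function of
  T.\<close>

definition part :: "'k set \<Rightarrow> 'p mod_ring ^ 'k" where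
  "part T = (\<chi> t. if t \<in> T then w $ t else 0)"

lemma part_label: "w $ t * part T $ t = (if t \<in> T then 1 else 0)"
  by (simp add: part_def w_square)

lemma part_sum:
  assumes "part T \<in> C" "x \<in> C"
  shows "(\<Sum>t\<in>T. w $ t * x $ t) = 0"
proof -
  have "(\<Sum>t\<in>UNIV. part T $ t * x $ t) = (\<Sum>t\<in>UNIV. if t \<in> T then w $ t * x $ t else 0)"
    by (intro sum.cong) (auto simp: part_def)
  also have "\<dots> = (\<Sum>t\<in>T. w $ t * x $ t)" by (simp add: sum.If_cases)
  finally show ?thesis using self_orthogonalD[OF C(2) assms] by simp
qed

text \<open>The labels on such a triple sum to zero, and -2 = 1: two equal labels force the third to
  be the same.\<close>

lemma triple_const:
  assumes T: "part T \<in> C" "card T = 3" and x: "x \<in> C" and st: "s \<in> T" "t \<in> T" "s \<noteq> t" "w $ s * x $ s = w $ t * x $ t"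
    and u: "u \<in> T"
  shows "w $ u * x $ u = w $ s * x $ s"
proof (cases "u = s \<or> u = t")
  case False
  have "{s, t, u} = T" by (rule card_subset_eq) (use st u T(2) False in auto)
  then have "(\<Sum>t\<in>{s, t, u}. w $ t * x $ t) = 0" using part_sum[OF T(1) x] by simp
  moreover have "s \<noteq> u" "t \<noteq> u" using False by auto
  ultimately have "w $ s * x $ s + (w $ t * x $ t + w $ u * x $ u) = 0" using st(3) by simp
  then have "w $ s * x $ s + (w $ s * x $ s + w $ u * x $ u) = 0" by (simp only: st(4))
  then have "w $ u * x $ u = - 2 * (w $ s * x $ s)" by (simp add: eq_neg_iff_add_eq_0 algebra_simps)
  then show ?thesis unfolding minus_two_3 by simp
qed (use st in auto)

text \<open>Orthogonality to \<open>w\<close> makes the three labels of a root word sum to zero.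
  Being 1 or -1, they are all equal, so the root word is \<open>w\<close> on its support up to
  sign.\<close>

lemma root_part:
  assumes u: "u \<in> C" "card (supp u) = 3"
  shows "part (supp u) \<in> C"
proof -
  obtain a b c where abc: "supp u = {a, b, c}" "a \<noteq> b" "a \<noteq> c" "b \<noteq> c" using u(2) by (auto simp: card_3_iff)
  let ?l = "\<lambda>t. w $ t * u $ t"
  have nz: "?l t = 1 \<or> ?l t = -1" if "t \<in> supp u" for t
  proof -
    have "?l t \<noteq> 0" using that w_square[of t] by (auto simp: supp_def)
    then show ?thesis using mod_ring_cases_3[OF p, of "?l t"] by blast
  qed
  have "(\<Sum>t\<in>{a, b, c}. w $ t * u $ t) = 0" using self_orthogonalD[OF C(2) w(1) u(1)] sum_dot_supp[of u "{a, b, c}" w] abc(1) by simp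
  then have s: "?l a + (?l b + ?l c) = 0" using abc by simp
  have eq: "?l b = ?l a \<and> ?l c = ?l a"
  proof -
    have "?l a = 1 \<or> ?l a = -1" "?l b = 1 \<or> ?l b = -1" "?l c = 1 \<or> ?l c = -1" by (rule nz, simp add: abc(1))+
    then show ?thesis using s by (elim disjE) simp_all
  qed
  have "part (supp u) $ t = (?l a *s u) $ t" for t
  proof (cases "t \<in> supp u")
    case True
    then have la: "?l t = ?l a" using eq abc(1) by auto
    have "?l t * ?l t = 1" using nz[OF True] by (elim disjE) simp_all
    have "u $ t * u $ t = 1" using True by (simp add: squares_3 supp_def)
    have "?l t * u $ t = w $ t * (u $ t * u $ t)" by (simp only: mult.assoc)
    also have "\<dots> = w $ t" by (simp only: \<open>u $ t * u $ t = 1\<close> mult_1_right)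
    finally have "?l a * u $ t = w $ t" unfolding la .
    then show ?thesis using True by (simp add: part_def)
  qed (simp add: part_def supp_def)
  then have "part (supp u) = ?l a *s u" unfolding vec_eq_iff by blast
  moreover have "?l a *s u \<in> C" by (intro code_closed[OF C(1)] u)
  ultimately show ?thesis by simp
qed

lemma triple_supp:
  assumes T: "part T \<in> C" "card T = 3" and y: "y \<in> C" and a: "a \<in> T" "y $ a = 0"
  shows "card (supp y \<inter> T) = 0 \<or> card (supp y \<inter> T) = 2"
proof -
  have "card (T - {a}) = 2" using T(2) a(1) by simp
  then obtain b c where bc: "T - {a} = {b, c}" "b \<noteq> c" by (auto simp: card_2_iff)
  have Tabc: "T = {a, b, c}" "a \<noteq> b" "a \<noteq> c" using bc a(1) by auto
  have cst: "y $ v = 0" if "u \<in> T" "u \<noteq> a" "y $ u = 0" "v \<in> T" for u v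
  proof -
    have "w $ v * y $ v = w $ a * y $ a" by (rule triple_const[OF T y a(1) that(1) _ _ that(4)]) (use that a in auto)
    then have "w $ v * (w $ v * y $ v) = 0" using a(2) by simp
    then show ?thesis by (simp only: w_cancel)
  qed
  show ?thesis
  proof (cases "y $ b = 0 \<or> y $ c = 0")
    case True
    then have "\<exists>u\<in>{b, c}. y $ u = 0" by simp
    then obtain u where u: "u \<in> {b, c}" "y $ u = 0" by (elim bexE)
    have "u \<in> T" "u \<noteq> a" using u(1) Tabc by auto
    then have "v \<notin> supp y" if "v \<in> T" for v using cst[of u v] u(2) that by (simp add: supp_def)
    then have "supp y \<inter> T = {}" by blast
    then show ?thesis by simp
  next
    case False
    then have "b \<in> supp y" "c \<in> supp y" "a \<notin> supp y" using a(2) by (simp_all add: supp_def)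
    then have "supp y \<inter> T = {b, c}" unfolding Tabc(1) by blast
    then show ?thesis using bc(2) by simp
  qed
qed

text \<open>Subtract multiples of the three parts so that the rest \<open>y\<close> vanishes at one
  point of each triple. On the triple with two equal labels it vanishes entirely, and on each other
  triple its support has 0 or 2 elements. So its weight is even, at most 4 and divisible by 3, hence
  zero.\<close>

lemma parts_combination:
  assumes \<tau>: "\<And>t. \<tau> t < (3 :: nat)" and T: "\<And>n. n < 3 \<Longrightarrow> part {t. \<tau> t = n} \<in> C" "\<And>n. n < 3 \<Longrightarrow> card {t. \<tau> t = n} = 3"
    and x: "x \<in> C" and st: "\<tau> s = \<tau> t" "s \<noteq> t" "w $ s * x $ s = w $ t * x $ t" and a: "\<And>n. n < 3 \<Longrightarrow> \<tau> (a n) = n"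
  shows "x = (w $ a 0 * x $ a 0) *s part {t. \<tau> t = 0} + (w $ a 1 * x $ a 1) *s part {t. \<tau> t = 1} + (w $ a 2 * x $ a 2) *s part {t. \<tau> t = 2}"
proof -
  let ?l = "\<lambda>n. w $ a n * x $ a n" and ?T = "\<lambda>n. {t. \<tau> t = n}"
  define y where "y = x - ?l 0 *s part (?T 0) - ?l 1 *s part (?T 1) - ?l 2 *s part (?T 2)"
  have y: "y \<in> C" unfolding y_def by (intro code_closed[OF C(1)] x T) simp_all
  have lab: "w $ u * y $ u = w $ u * x $ u - ?l (\<tau> u)" for u
  proof -
    have "w $ u * y $ u = w $ u * x $ u - ?l 0 * (w $ u * part (?T 0) $ u) - ?l 1 * (w $ u * part (?T 1) $ u) - ?l 2 * (w $ u * part (?T 2) $ u)"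
      unfolding y_def vector_minus_component vector_smult_component right_diff_distrib by (simp only: mult.left_commute)
    moreover have "\<tau> u = 0 \<or> \<tau> u = 1 \<or> \<tau> u = 2" using \<tau>[of u] by linarith
    ultimately show ?thesis unfolding part_label by (elim disjE) simp_all
  qed
  have zero: "y $ u = 0" if "w $ u * y $ u = 0" for u using w_cancel[of u "y $ u"] unfolding that by simp
  have ya: "y $ a n = 0" if "n < 3" for n by (rule zero) (simp add: lab a[OF that])
  have c: "card (supp y \<inter> ?T n) = 0 \<or> card (supp y \<inter> ?T n) = 2" if "n < 3" for n
    by (rule triple_supp[OF T(1)[OF that] T(2)[OF that] y _ ya[OF that]]) (simp add: a[OF that])
  have c0: "card (supp y \<inter> ?T (\<tau> s)) = 0"
  proof -
    have e: "w $ s * y $ s = w $ t * y $ t" unfolding lab st(1) st(3) ..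
    have cst: "w $ u * y $ u = w $ s * y $ s" if "\<tau> u = \<tau> s" for u
      by (rule triple_const[OF T(1)[OF \<tau>] T(2)[OF \<tau>] y _ _ st(2) e]) (simp_all add: that st(1))
    have "\<tau> (a (\<tau> s)) = \<tau> s" by (rule a[OF \<tau>])
    then have "w $ s * y $ s = w $ a (\<tau> s) * y $ a (\<tau> s)" using cst[of "a (\<tau> s)"] by (simp only:)
    also have "\<dots> = 0" unfolding ya[OF \<tau>] by simp
    finally have "w $ u * y $ u = 0" if "\<tau> u = \<tau> s" for u using cst[OF that] by (simp only:)
    then have "u \<notin> supp y" if "\<tau> u = \<tau> s" for u using zero[of u] that by (simp add: supp_def)
    then have "supp y \<inter> ?T (\<tau> s) = {}" by blast
    then show ?thesis by simp
  qed
  have "supp y = (supp y \<inter> ?T 0) \<union> ((supp y \<inter> ?T 1) \<union> (supp y \<inter> ?T 2))"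
  proof -
    have "u \<in> ?T 0 \<or> u \<in> ?T 1 \<or> u \<in> ?T 2" for u using \<tau>[of u] by auto
    then show ?thesis by blast
  qed
  then have "card (supp y) = card ((supp y \<inter> ?T 0) \<union> ((supp y \<inter> ?T 1) \<union> (supp y \<inter> ?T 2)))" by (rule arg_cong)
  also have "\<dots> = card (supp y \<inter> ?T 0) + card ((supp y \<inter> ?T 1) \<union> (supp y \<inter> ?T 2))" by (rule card_Un_disjoint) auto
  also have "card ((supp y \<inter> ?T 1) \<union> (supp y \<inter> ?T 2)) = card (supp y \<inter> ?T 1) + card (supp y \<inter> ?T 2)" by (rule card_Un_disjoint) auto
  finally have "card (supp y) = card (supp y \<inter> ?T 0) + (card (supp y \<inter> ?T 1) + card (supp y \<inter> ?T 2))" .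
  moreover have "\<tau> s = 0 \<or> \<tau> s = 1 \<or> \<tau> s = 2" using \<tau>[of s] by linarith
  then have "card (supp y \<inter> ?T 0) = 0 \<or> card (supp y \<inter> ?T 1) = 0 \<or> card (supp y \<inter> ?T 2) = 0"
    using c0 by (elim disjE) simp_all
  moreover have "card (supp y \<inter> ?T 0) = 0 \<or> card (supp y \<inter> ?T 0) = 2" "card (supp y \<inter> ?T 1) = 0 \<or> card (supp y \<inter> ?T 1) = 2"
    "card (supp y \<inter> ?T 2) = 0 \<or> card (supp y \<inter> ?T 2) = 2" by (rule c, simp)+
  ultimately have "even (card (supp y)) \<and> card (supp y) \<le> 4" by (elim disjE) (simp_all only:, simp_all)
  then have "card (supp y) < 3" using even_small[OF _ _ weight_dvd[OF y]] by blast
  then have "y = 0" by (rule weight_less[OF y])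
  then show ?thesis unfolding y_def by (simp only: diff_diff_add right_minus_eq add.assoc)
qed

text \<open>A word vanishing on two points of one triple and on a point outside it vanishes on the
  whole triple and has weight at most 5, so it is a second root word; \<open>w\<close> supplies the
  third triple. A word \<open>c\<close> vanishing at one point of each triple has distinct labels on
  every triple, by \<open>parts_combination\<close>. The partition and the labels of
  \<open>c\<close> then describe the code.\<close>

lemma rooted_39:
  assumes u: "u \<in> C" "card (supp u) = 3" and big: "27 < card C"
  obtains \<tau> :: "'k \<Rightarrow> nat" and c where "\<forall>t. \<tau> t < 3" "C = vec.span {part {t. \<tau> t = 0}, part {t. \<tau> t = 1}, part {t. \<tau> t = 2}, c}"
    "\<forall>n<3. bij_betw (\<lambda>t. w $ t * c $ t) {t. \<tau> t = n} UNIV"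
proof -
  let ?U = "supp u"
  have pU: "part ?U \<in> C" by (rule root_part[OF u])
  obtain a b where ab: "a \<in> ?U" "b \<in> ?U" "a \<noteq> b" using u(2) by (auto simp: card_3_iff)
  have "?U \<noteq> UNIV" using u(2) k by auto
  then obtain t where t: "t \<notin> ?U" by blast
  have "a \<noteq> t" "b \<noteq> t" using ab t by blast+
  then have "card {a, b, t} = 3" using ab(3) by simp
  then have "\<exists>c\<in>C. c \<noteq> 0 \<and> (\<forall>t\<in>{a, b, t}. c $ t = 0)" by (intro vanishing_word) (use big in simp)
  then obtain v where v: "v \<in> C" "v \<noteq> 0" "v $ a = 0" "v $ b = 0" "v $ t = 0" by auto
  have vU: "v $ s = 0" if "s \<in> ?U" for s
  proof -
    have "w $ s * v $ s = w $ a * v $ a" by (rule triple_const[OF pU u(2) v(1) ab(1,2,3) _ that]) (simp add: v(3,4))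
    then have "w $ s * (w $ s * v $ s) = 0" by (simp add: v(3))
    then show ?thesis by (simp only: w_cancel)
  qed
  have "card (supp v) \<le> CARD('k) - card (insert t ?U)" by (rule supp_compl_le) (use vU v(5) in auto)
  then have "card (supp v) < 6" using t u(2) k by simp
  then have v3: "card (supp v) = 3" by (rule weight_less_6[OF v(1) _ v(2)])
  have pV: "part (supp v) \<in> C" by (rule root_part[OF v(1) v3])
  have dj: "?U \<inter> supp v = {}" using vU by (auto simp: supp_def)
  define \<tau> :: "'k \<Rightarrow> nat" where "\<tau> t = (if t \<in> ?U then 0 else if t \<in> supp v then 1 else 2)" for t
  have \<tau>3: "\<tau> t < 3" for t by (simp add: \<tau>_def)
  have T0: "{t. \<tau> t = 0} = ?U" by (auto simp: \<tau>_def)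
  have T1: "{t. \<tau> t = 1} = supp v" using dj by (auto simp: \<tau>_def split: if_splits)
  have T2: "{t. \<tau> t = 2} = - (?U \<union> supp v)" by (auto simp: \<tau>_def)
  have cUV: "card (?U \<union> supp v) = 6" using card_Un_disjoint[OF _ _ dj] u(2) v3 by simp
  have p2: "part (- (?U \<union> supp v)) = w - part ?U - part (supp v)" using dj by (auto simp: part_def vec_eq_iff)
  have P2: "part (- (?U \<union> supp v)) \<in> C" unfolding p2 by (intro code_closed[OF C(1)] w pU pV)
  have PT: "part {t. \<tau> t = n} \<in> C" "card {t. \<tau> t = n} = 3" if "n < 3" for n
  proof -
    have "n = 0 \<or> n = 1 \<or> n = 2" using that by linarith
    then have "part {t. \<tau> t = n} \<in> C \<and> card {t. \<tau> t = n} = 3"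
      by (elim disjE) (simp_all only: T0 T1 T2 pU pV P2 u(2) v3 card_compl cUV k, simp_all)
    then show "part {t. \<tau> t = n} \<in> C" "card {t. \<tau> t = n} = 3" by auto
  qed
  define e where "e n = (SOME t. \<tau> t = n)" for n
  have e: "\<tau> (e n) = n" if "n < 3" for n
  proof -
    have "{t. \<tau> t = n} \<noteq> {}" using PT(2)[OF that] by fastforce
    then have "\<exists>t. \<tau> t = n" by blast
    then show ?thesis unfolding e_def by (rule someI_ex)
  qed
  have "card {e 0, e 1, e 2} = 3"
  proof -
    have ne: "e m \<noteq> e n" if "m < 3" "n < 3" "m \<noteq> n" for m n using e[OF that(1)] e[OF that(2)] that(3) by auto
    have "e 0 \<noteq> e 1" "e 0 \<noteq> e 2" "e 1 \<noteq> e 2" by (rule ne; simp)+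
    then show ?thesis by simp
  qed
  then have "\<exists>c\<in>C. c \<noteq> 0 \<and> (\<forall>t\<in>{e 0, e 1, e 2}. c $ t = 0)" by (intro vanishing_word) (use big in simp)
  then obtain c where c: "c \<in> C" "c \<noteq> 0" "c $ e 0 = 0" "c $ e 1 = 0" "c $ e 2 = 0" by auto
  have inj: "s = t" if st: "\<tau> s = \<tau> t" "w $ s * c $ s = w $ t * c $ t" for s t
  proof (rule ccontr)
    assume "s \<noteq> t"
    then have "c = (w $ e 0 * c $ e 0) *s part {t. \<tau> t = 0} + (w $ e 1 * c $ e 1) *s part {t. \<tau> t = 1} + (w $ e 2 * c $ e 2) *s part {t. \<tau> t = 2}"
      by (intro parts_combination[OF \<tau>3 PT c(1) st(1) _ st(2) e])
    also have "\<dots> = 0" unfolding c(3,4,5) by simp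
    finally show False using c(2) by simp
  qed
  have bij: "bij_betw (\<lambda>t. w $ t * c $ t) {t. \<tau> t = n} UNIV" if "n < 3" for n
  proof -
    have i: "inj_on (\<lambda>t. w $ t * c $ t) {t. \<tau> t = n}" by (rule inj_onI) (rule inj, simp_all)
    have "card ((\<lambda>t. w $ t * c $ t) ` {t. \<tau> t = n}) = CARD('p mod_ring)" unfolding card_image[OF i] PT(2)[OF that] by (simp add: p)
    then have "(\<lambda>t. w $ t * c $ t) ` {t. \<tau> t = n} = UNIV" by (intro card_seteq) simp_all
    then show ?thesis using i by (simp add: bij_betw_def)
  qed
  let ?S = "vec.span {part {t. \<tau> t = 0}, part {t. \<tau> t = 1}, part {t. \<tau> t = 2}, c}"
  have base: "part {t. \<tau> t = 0} \<in> ?S" "part {t. \<tau> t = 1} \<in> ?S" "part {t. \<tau> t = 2} \<in> ?S" "c \<in> ?S"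
    by (rule vec.span_base, simp)+
  have "C = ?S"
  proof (rule code_eq_span[OF C(1)])
    fix x assume x: "x \<in> C"
    have \<tau>ab: "\<tau> a = \<tau> b" using ab by (simp add: \<tau>_def)
    let ?d = "w $ a * c $ a - w $ b * c $ b"
    have d: "?d \<noteq> 0" using inj[OF \<tau>ab] ab(3) by auto
    let ?\<beta> = "(w $ a * x $ a - w $ b * x $ b) / ?d"
    define y where "y = x - ?\<beta> *s c"
    have y: "y \<in> C" unfolding y_def by (intro code_closed[OF C(1)] c x)
    have "?\<beta> * ?d = w $ a * x $ a - w $ b * x $ b" using d by simp
    moreover have "w $ a * y $ a - w $ b * y $ b = (w $ a * x $ a - w $ b * x $ b) - ?\<beta> * ?d"
      unfolding y_def vector_minus_component vector_smult_component by (simp only: right_diff_distrib mult.left_commute) simp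
    ultimately have yab: "w $ a * y $ a = w $ b * y $ b" by (simp only: diff_self right_minus_eq)
    have "y = (w $ e 0 * y $ e 0) *s part {t. \<tau> t = 0} + (w $ e 1 * y $ e 1) *s part {t. \<tau> t = 1} + (w $ e 2 * y $ e 2) *s part {t. \<tau> t = 2}"
      by (rule parts_combination[OF \<tau>3 PT y \<tau>ab ab(3) yab e])
    then have "y \<in> ?S" by (rule ssubst) (intro vec.span_add vec.span_scale base)
    then have "y + ?\<beta> *s c \<in> ?S" by (intro vec.span_add vec.span_scale base(4))
    then show "x \<in> ?S" unfolding y_def by (simp only: diff_add_cancel)
  qed (use PT(1)[of 0] PT(1)[of 1] PT(1)[of 2] c(1) in simp)
  moreover have "\<forall>t. \<tau> t < 3" using \<tau>3 by blast
  moreover have "\<forall>n<3. bij_betw (\<lambda>t. w $ t * c $ t) {t. \<tau> t = n} UNIV" using bij by blast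
  ultimately show ?thesis by (intro that[of \<tau> c])
qed

end

lemma iso_3_9:
  fixes C D :: "('p::{prime_card,linorder} mod_ring ^ 'k) set"
  assumes p: "CARD('p) = 3" and k: "CARD('k) = 9" and C: "is_code C" "self_orthogonal C" and D: "is_code D" "self_orthogonal D"
    and iso: "lattice_isomorphic (L_B C) (L_B D)"
    and gC: "27 \<le> card C" "w \<in> C" "supp w = UNIV" "\<And>c. c \<in> C \<Longrightarrow> card (supp c) = 3 \<Longrightarrow> 27 < card C"
    and gD: "27 \<le> card D" "z \<in> D" "supp z = UNIV" "\<And>c. c \<in> D \<Longrightarrow> card (supp c) = 3 \<Longrightarrow> 27 < card D"
  shows "code_isomorphic C D"
proof -
  interpret C: code_39 C w by unfold_locales (use p C k gC in auto)
  interpret D: code_39 D z by unfold_locales (use p D k gD in auto)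
  have odd: "odd CARD('p)" by (simp add: p)
  have iso': "lattice_isomorphic (L_B D) (L_B C)" by (rule lattice_isomorphic_sym[OF L_B_add[OF C(1)] iso])
  have tr: "(\<exists>c\<in>C. card (supp c) = 3) \<longleftrightarrow> (\<exists>c\<in>D. card (supp c) = 3)"
    using root_word_transfer[OF odd iso] root_word_transfer[OF odd iso'] unfolding root_word_3[OF p] by blast
  show ?thesis
  proof (cases "\<exists>c\<in>C. card (supp c) = 3")
    case False
    then have rl: "\<forall>c\<in>C. card (supp c) \<noteq> 3" "\<forall>c\<in>D. card (supp c) \<noteq> 3" using tr by auto
    obtain x y where xy: "C = vec.span {w, x, y}" "bij (\<lambda>t. (w $ t * x $ t, w $ t * y $ t))"
      by (rule C.rootless_39[OF rl(1) gC(1)], rule that)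
    obtain x' y' where xy': "D = vec.span {z, x', y'}" "bij (\<lambda>t. (z $ t * x' $ t, z $ t * y' $ t))"
      by (rule D.rootless_39[OF rl(2) gD(1)], rule that)
    let ?l = "\<lambda>t. (w $ t * x $ t, w $ t * y $ t)" and ?m = "\<lambda>t. (z $ t * x' $ t, z $ t * y' $ t)"
    define \<sigma> where "\<sigma> = inv_into UNIV ?m \<circ> ?l"
    have b: "bij \<sigma>" unfolding \<sigma>_def by (intro bij_comp xy(2) bij_imp_bij_inv xy'(2))
    have "?m (\<sigma> t) = ?l t" for t
      using surj_f_inv_f[OF bij_is_surj[OF xy'(2)], of "?l t"] by (simp add: \<sigma>_def)
    then have lab: "w $ t * x $ t = z $ \<sigma> t * x' $ \<sigma> t" "w $ t * y $ t = z $ \<sigma> t * y' $ \<sigma> t" for t by (simp_all only: prod.inject)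
    have "code_isomorphic (vec.span (fst ` {(w, z), (x, x'), (y, y')})) (vec.span (snd ` {(w, z), (x, x'), (y, y')}))"
    proof (rule labelled_iso[OF C.w_square D.w_square b])
      fix c d assume "(c, d) \<in> {(w, z), (x, x'), (y, y')}"
      then have "c = w \<and> d = z \<or> c = x \<and> d = x' \<or> c = y \<and> d = y'" by auto
      then show "\<forall>t. w $ t * c $ t = z $ \<sigma> t * d $ \<sigma> t"
        using C.w_square D.w_square lab by (elim disjE conjE) (simp_all only:, simp_all)
    qed
    then show ?thesis unfolding xy(1) xy'(1) by simp
  next
    case True
    obtain u where u: "u \<in> C" "card (supp u) = 3" using True by blast
    obtain u' where u': "u' \<in> D" "card (supp u') = 3" using True tr by blast
    obtain \<tau> :: "'k \<Rightarrow> nat" and c where c: "\<forall>t. \<tau> t < 3" "C = vec.span {C.part {t. \<tau> t = 0}, C.part {t. \<tau> t = 1}, C.part {t. \<tau> t = 2}, c}"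
      "\<forall>n<3. bij_betw (\<lambda>t. w $ t * c $ t) {t. \<tau> t = n} UNIV"
      by (rule C.rooted_39[OF u gC(4)[OF u]], rule that)
    obtain \<tau>' :: "'k \<Rightarrow> nat" and d where d: "\<forall>t. \<tau>' t < 3" "D = vec.span {D.part {t. \<tau>' t = 0}, D.part {t. \<tau>' t = 1}, D.part {t. \<tau>' t = 2}, d}"
      "\<forall>n<3. bij_betw (\<lambda>t. z $ t * d $ t) {t. \<tau>' t = n} UNIV"
      by (rule D.rooted_39[OF u' gD(4)[OF u']], rule that)
    have fib: "card {t. (T t, f t) = q} = (if fst q < 3 then 1 else 0)"
      if T: "\<forall>t. T t < 3" and f: "\<forall>n<3. bij_betw f {t. T t = n} UNIV" for T :: "'k \<Rightarrow> nat" and f :: "'k \<Rightarrow> 'p mod_ring" and q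
    proof (cases "fst q < 3")
      case True
      then have b: "bij_betw f {t. T t = fst q} UNIV" using f by blast
      have "snd q \<in> f ` {t. T t = fst q}" unfolding bij_betw_imp_surj_on[OF b] by simp
      then obtain s where s: "T s = fst q" "snd q = f s" by auto
      have "{t. (T t, f t) = q} = {s}"
      proof
        show "{s} \<subseteq> {t. (T t, f t) = q}" using s by (simp add: prod_eq_iff)
        show "{t. (T t, f t) = q} \<subseteq> {s}"
        proof
          fix t assume "t \<in> {t. (T t, f t) = q}"
          then have "T t = fst q" "f t = snd q" by auto
          then have "t = s" using s by (intro inj_onD[OF bij_betw_imp_inj_on[OF b]]) simp_all
          then show "t \<in> {s}" by simp
        qed
      qed
      then show ?thesis using True by simp
    next
      case False
      then have "{t. (T t, f t) = q} = {}" using T by auto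
      then show ?thesis using False by simp
    qed
    obtain \<sigma> where \<sigma>: "bij \<sigma>" "\<forall>t. (\<tau>' (\<sigma> t), z $ \<sigma> t * d $ \<sigma> t) = (\<tau> t, w $ t * c $ t)"
    proof (rule fibre_bijection[of "\<lambda>t. (\<tau> t, w $ t * c $ t)" "\<lambda>t. (\<tau>' t, z $ t * d $ t)"])
      fix q show "card {t. (\<tau> t, w $ t * c $ t) = q} = card {t. (\<tau>' t, z $ t * d $ t) = q}"
        unfolding fib[OF c(1,3)] fib[OF d(1,3)] ..
    qed (rule that)
    have lab: "\<tau>' (\<sigma> t) = \<tau> t" "w $ t * c $ t = z $ \<sigma> t * d $ \<sigma> t" for t using spec[OF \<sigma>(2), of t] by simp_all
    let ?C = "\<lambda>n. C.part {t. \<tau> t = n}" and ?D = "\<lambda>n. D.part {t. \<tau>' t = n}"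
    let ?P = "{(?C 0, ?D 0), (?C 1, ?D 1), (?C 2, ?D 2), (c, d)}"
    have "code_isomorphic (vec.span (fst ` ?P)) (vec.span (snd ` ?P))"
    proof (rule labelled_iso[OF C.w_square D.w_square \<sigma>(1)])
      fix x y assume "(x, y) \<in> ?P"
      then consider n where "x = ?C n" "y = ?D n" | "x = c" "y = d" by blast
      then show "\<forall>t. w $ t * x $ t = z $ \<sigma> t * y $ \<sigma> t"
      proof cases
        case (1 n)
        show ?thesis unfolding 1 C.part_label D.part_label by (simp add: lab(1))
      next
        case 2
        show ?thesis unfolding 2 using lab(2) by blast
      qed
    qed
    then show ?thesis unfolding c(2) d(2) by simp
  qed
qed

subsection \<open>The theorem\<close>

text \<open>Signed permutations embed D into C and C into D; the codes are finite, so the first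
  embedding is onto.\<close>

lemma integral_frame_pair_iso:
  assumes "integral_frame_pair C D W W'"
  shows "code_isomorphic C (D :: ('p::{prime_card,linorder} mod_ring ^ 'k) set)"
proof -
  interpret integral_frame_pair C D W W' by fact
  have inj: "inj_on (\<lambda>d. \<chi> t. s t * d $ \<sigma> t) E" if \<sigma>: "bij \<sigma>" and s: "\<forall>t. s t = 1 \<or> s t = -1"
    for s \<sigma> and E :: "('p mod_ring ^ 'k) set"
  proof (rule inj_onI)
    fix x y assume e: "(\<chi> t. s t * x $ \<sigma> t) = (\<chi> t. s t * y $ \<sigma> t)"
    have "x $ \<sigma> t = y $ \<sigma> t" for t
    proof -
      have "s t * x $ \<sigma> t = s t * y $ \<sigma> t" using arg_cong[OF e, of "\<lambda>v. v $ t"] by simp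
      then show ?thesis using spec[OF s, of t] by (elim disjE) simp_all
    qed
    then have "x $ u = y $ u" for u using surj_f_inv_f[OF bij_is_surj[OF \<sigma>], of u] by metis
    then show "x = y" by (simp add: vec_eq_iff)
  qed
  obtain \<sigma> s where s: "bij \<sigma>" "\<forall>t. s t = 1 \<or> s t = -1" "\<forall>d\<in>D. (\<chi> t. s t * d $ \<sigma> t) \<in> C"
    using signed_permutation_into_C by (elim exE conjE)
  obtain \<sigma>' s' where s': "bij \<sigma>'" "\<forall>t. s' t = 1 \<or> s' t = -1" "\<forall>d\<in>C. (\<chi> t. s' t * d $ \<sigma>' t) \<in> D"
    using integral_frame_pair.signed_permutation_into_C[OF swap_integral] by (elim exE conjE)
  let ?f = "\<lambda>d. \<chi> t. s t * d $ \<sigma> t"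
  have "card C \<le> card D" by (rule card_inj_on_le[OF inj[OF s'(1,2)]]) (use s'(3) in auto)
  moreover have "card (?f ` D) = card D" by (rule card_image[OF inj[OF s(1,2)]])
  moreover have sub: "?f ` D \<subseteq> C" using s(3) by auto
  ultimately have "?f ` D = C" by (intro card_seteq) simp_all
  then have "code_isomorphic D C" unfolding code_isomorphic_def
    by (rule bexI[OF _ code_group_signed_permutation[OF s(1)]]) (use s(2) in blast)
  then show ?thesis by (rule code_isomorphic_sym)
qed

lemma length_bounds:
  fixes h k :: nat
  assumes "k * (h * (h + 1)) \<le> 6 * (2 * h + 1)"
  shows "h = 1 \<Longrightarrow> k \<le> 9" "h = 2 \<Longrightarrow> k \<le> 5" "h = 3 \<Longrightarrow> k \<le> 3" "4 \<le> h \<Longrightarrow> k \<le> 2"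
proof -
  show "k \<le> 2" if h: "4 \<le> h"
  proof (rule ccontr)
    assume "\<not> k \<le> 2"
    then have "3 * (h * (h + 1)) \<le> k * (h * (h + 1))" by (intro mult_right_mono) simp_all
    then have "3 * (h * (h + 1)) \<le> 12 * h + 6" using assms by simp
    moreover have "4 * (h + 1) \<le> h * (h + 1)" using h by (intro mult_right_mono) simp_all
    moreover have "4 * h \<le> h * h" using h by simp
    ultimately show False using h by simp
  qed
qed (use assms in simp_all)

lemma lattice_isomorphic_imp_code_isomorphic:
  fixes C D :: "('p::{prime_card,linorder} mod_ring ^ 'k) set"
  assumes odd: "odd CARD('p)" and C: "is_code C" "self_orthogonal C" and D: "is_code D" "self_orthogonal D"
    and iso: "lattice_isomorphic (L_B C) (L_B D)"
  shows "code_isomorphic C D"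
proof -
  have iso': "lattice_isomorphic (L_B D) (L_B C)" by (rule lattice_isomorphic_sym[OF L_B_add[OF C(1)] iso])
  obtain W W' where fp: "frame_pair C D W W'" by (rule frame_pair_exists[OF odd C D iso'])
  interpret frame_pair C D W W' by (rule fp)
  obtain j0 :: 'k and a0 :: 'p where "j0 \<in> UNIV" "a0 \<in> UNIV" by blast
  let ?r = "rootv j0 a0 (nxt a0)"
  show ?thesis
  proof (cases "W ?r \<bullet> ?r \<in> \<int> \<or> C = {0} \<or> D = {0}")
    case True
    then show ?thesis
    proof (elim disjE)
      assume "W ?r \<bullet> ?r \<in> \<int>"
      then show ?thesis by (rule integral_frame_pair_iso[OF integral_if])
    next
      assume c: "C = {0}"
      have "D = {0}" by (rule zero_code_iff[OF odd C(1) D(1) iso c])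
      then show ?thesis using c code_isomorphic_refl by simp
    next
      assume d: "D = {0}"
      have "C = {0}" by (rule zero_code_iff[OF odd D(1) C(1) iso' d])
      then show ?thesis using d code_isomorphic_refl by simp
    qed
  next
    case False
    then have ni: "W ?r \<bullet> ?r \<notin> \<int>" and nz: "C \<noteq> {0}" "D \<noteq> {0}" by auto
    interpret S: frame_pair D C W' W by (rule swap)
    \<comment> \<open>With the same root on both sides the product is unchanged by passing to the
      adjoint. So the exchanged pair is nonintegral too, and the bounds on the size of the code hold
      for D as well.\<close>
    have "W' ?r \<bullet> ?r = W ?r \<bullet> ?r" using adjoint[OF root_V0 root_V0, of j0 a0 "nxt a0" j0 a0 "nxt a0"] by (simp only: inner_commute)
    then have ni': "W' ?r \<bullet> ?r \<notin> \<int>" using ni by simp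
    obtain h where h: "CARD('p) = 2 * h + 1" using odd by (auto elim: oddE)
    obtain m where m: "\<not> int CARD('p) dvd m" "\<forall>j a. \<exists>z t. residues m a j z t" using exists_residues[OF ni] by blast
    obtain z t where r: "residues m a0 j0 z t" using m(2) by blast
    note b = length_bounds[OF residues_bound(1)[OF r m(1) h]]
    have k1: "CARD('k) \<noteq> 1" using length_1_code[OF _ C] nz by blast
    have k2: ?thesis if "CARD('k) = 2" by (rule iso_length_2[OF odd C nz(1) D nz(2) iso that])
    have pos: "0 < CARD('k)" by simp
    have "h \<noteq> 0" using h prime_gt_1_nat[OF prime_card[where 'a='p]] by auto
    then consider "h = 1" | "h = 2" | "h = 3" | "4 \<le> h" by linarith
    then show ?thesis
    proof cases
      case 1
      then have p: "CARD('p) = 3" using h by simp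
      obtain q where q: "CARD('k) = 3 * q" using length_dvd_3[OF ni p] by (auto elim: dvdE)
      then have "CARD('k) = 3 \<or> CARD('k) = 6 \<or> CARD('k) = 9" using b(1)[OF 1] pos by presburger
      then consider "CARD('k) = 3 \<or> CARD('k) = 6" | "CARD('k) = 9" by blast
      then show ?thesis
      proof cases
        case 1
        then show ?thesis by (rule iso_3_small[OF p C nz(1) D nz(2) iso])
      next
        case 2
        obtain w where w: "w \<in> C" "supp w = UNIV" using length_9_geometry(2)[OF ni p 2] by blast
        obtain z where z: "z \<in> D" "supp z = UNIV" using S.length_9_geometry(2)[OF ni' p 2] by blast
        show ?thesis
          by (rule iso_3_9[OF p 2 C D iso length_9_geometry(1)[OF ni p 2] w _ S.length_9_geometry(1)[OF ni' p 2] z])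
            (rule length_9_geometry(3)[OF ni p 2], assumption+, rule S.length_9_geometry(3)[OF ni' p 2], assumption+)
      qed
    next
      case 2
      then have p: "CARD('p) = 5" using h by simp
      have eq: "CARD('k) * (h * (h + 1)) = 6 * (2 * h + 1)" if "CARD('k) = 5" using that 2 by simp
      have "25 \<le> card C" if k: "CARD('k) = 5"
        by (rule card_ge_if_equality[OF ni h eq[OF k]]) (simp add: p k)
      moreover have "25 \<le> card D" if k: "CARD('k) = 5"
        by (rule S.card_ge_if_equality[OF ni' h eq[OF k]]) (simp add: p k)
      ultimately show ?thesis by (rule iso_5[OF p C nz(1) D nz(2) iso b(2)[OF 2]])
    next
      case 3
      then have p: "CARD('p) = 7" using h by simp
      have "CARD('k) = 2 \<or> CARD('k) = 3" using b(3)[OF 3] k1 pos by linarith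
      then show ?thesis using k2 iso_7_3[OF p C nz(1) D nz(2) iso] by blast
    next
      case 4
      then have "CARD('k) = 2" using b(4) k1 pos by linarith
      then show ?thesis by (rule k2)
    qed
  qed
qed

theorem theorem4p1:
  fixes C D :: "(('p::{prime_card,linorder}) mod_ring ^ 'k) set"
  assumes "odd CARD('p)"
    and "is_code C" and "self_orthogonal C"
    and "is_code D" and "self_orthogonal D"
  shows "lattice_isomorphic (L_B C) (L_B D) \<longleftrightarrow> code_isomorphic C D"
  using lattice_isomorphic_imp_code_isomorphic[OF assms] code_isomorphic_imp_lattice_isomorphic by blast

end
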